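(* Let $K$ be an infinite field, let $R$ be a commutative $K$-algebra that is finitely generated over $K$ and has Krull dimension $d$, let $n>1$ be an integer, and let $(B,\tau)$ be a degree-$n$ Azumaya algebra with a unitary involution over $R$. Then \[\mathrm{gen}_R(B,\tau)\leq \left\lfloor \frac{d}{2n-2}+\frac{3}{2}\right\rfloor .\]
   Context: Rings are commutative and unital; algebras are associative and unital. An $R$-algebra with an $R$-involution $(B,\tau)$ (that is, $\tau:B\to B$ is an $R$-linear anti-automorphism with $\tau\circ\tau=\mathrm{id}$) is called Azumaya with unitary involution over $R$ if $B$ is an Azumaya algebra over its center $S$, $S$ is a quadratic étale $R$-algebra, and $\tau|_S$ is the standard $R$-involution of $S$, i.e. $\tau(s)=\mathrm{Tr}_{S/R}(s)-s$ for all $s\in S$. It has degree $n$ if $B$ has rank $n^2$ as an $S$-module. $\mathrm{gen}_R(B,\tau)$ denotes the smallest cardinality of a subset of $B$ generating $B$ as a unital $R$-algebra with involution (i.e. the smallest unital $\tau$-stable $R$-subalgebra containing the subset is $B$). *)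

theory Defs
  imports Complex_Main "HOL-Library.Extended_Nat" "HOL-Algebra.Module" "HOL-Algebra.QuotRing" "HOL-Algebra.Subrings"
begin

section \<open>Algebras and linear maps\<close>

text \<open>The locale \<^locale>\<open>algebra\<close> of the library is about commutative algebras; the following
  one drops commutativity. An algebra is stored as a \<^type>\<open>module\<close> record over its base ring.\<close>

locale assoc_algebra = module R A + ring A for R (structure) and A (structure) +
  assumes smult_mult_left:
      "\<lbrakk>r \<in> carrier R; x \<in> carrier A; y \<in> carrier A\<rbrakk>
        \<Longrightarrow> (r \<odot>\<^bsub>A\<^esub> x) \<otimes>\<^bsub>A\<^esub> y = r \<odot>\<^bsub>A\<^esub> (x \<otimes>\<^bsub>A\<^esub> y)"
    and smult_mult_right:
      "\<lbrakk>r \<in> carrier R; x \<in> carrier A; y \<in> carrier A\<rbrakk>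
        \<Longrightarrow> x \<otimes>\<^bsub>A\<^esub> (r \<odot>\<^bsub>A\<^esub> y) = r \<odot>\<^bsub>A\<^esub> (x \<otimes>\<^bsub>A\<^esub> y)"

definition regular :: "('a, 'm) ring_scheme \<Rightarrow> ('a, 'a) module" where
  "regular A = \<lparr>carrier = carrier A, mult = mult A, one = \<one>\<^bsub>A\<^esub>,
     zero = \<zero>\<^bsub>A\<^esub>, add = add A,
     smult = mult A\<rparr>"

definition opposite :: "('r, 'a, 'm) module_scheme \<Rightarrow> ('r, 'a, 'm) module_scheme" where
  "opposite A = A\<lparr>mult := \<lambda>x y. y \<otimes>\<^bsub>A\<^esub> x\<rparr>"

definition ring_center :: "('a, 'm) ring_scheme \<Rightarrow> 'a set" where
  "ring_center A = {z \<in> carrier A. \<forall>x \<in> carrier A. z \<otimes>\<^bsub>A\<^esub> x = x \<otimes>\<^bsub>A\<^esub> z}"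

text \<open>Linear maps are taken extensional, so that equality of maps is equality on the carrier.\<close>

definition linear_maps ::
  "('r, 'c) ring_scheme \<Rightarrow> ('r, 'a, 'm) module_scheme \<Rightarrow> ('r, 'b, 'n) module_scheme \<Rightarrow> ('a \<Rightarrow> 'b) set" where
  "linear_maps R M N = {f \<in> carrier M \<rightarrow>\<^sub>E carrier N.
     (\<forall>x \<in> carrier M. \<forall>y \<in> carrier M. f (x \<oplus>\<^bsub>M\<^esub> y) = f x \<oplus>\<^bsub>N\<^esub> f y) \<and>
     (\<forall>r \<in> carrier R. \<forall>x \<in> carrier M. f (r \<odot>\<^bsub>M\<^esub> x) = r \<odot>\<^bsub>N\<^esub> f x)}"

definition endo_ring :: "('r, 'c) ring_scheme \<Rightarrow> ('r, 'a, 'm) module_scheme \<Rightarrow> ('a \<Rightarrow> 'a) ring" where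
  "endo_ring R M = \<lparr>carrier = linear_maps R M M,
     mult = (\<lambda>f g. compose (carrier M) f g),
     one = (\<lambda>x \<in> carrier M. x),
     zero = (\<lambda>x \<in> carrier M. \<zero>\<^bsub>M\<^esub>),
     add = (\<lambda>f g. \<lambda>x \<in> carrier M. f x \<oplus>\<^bsub>M\<^esub> g x)\<rparr>"

section \<open>Finitely generated projective modules and their rank\<close>

text \<open>The free module \<open>R\<^sup>k\<close>. The fields \<^const>\<open>mult\<close> and \<^const>\<open>one\<close> of a module
  record are irrelevant for its module structure.\<close>

definition free_module :: "('r, 'c) ring_scheme \<Rightarrow> nat \<Rightarrow> ('r, nat \<Rightarrow> 'r) module" where
  "free_module R k = \<lparr>carrier = {..<k} \<rightarrow>\<^sub>E carrier R,
     mult = undefined, one = undefined,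
     zero = (\<lambda>i \<in> {..<k}. \<zero>\<^bsub>R\<^esub>),
     add = (\<lambda>v w. \<lambda>i \<in> {..<k}. v i \<oplus>\<^bsub>R\<^esub> w i),
     smult = (\<lambda>r v. \<lambda>i \<in> {..<k}. r \<otimes>\<^bsub>R\<^esub> v i)\<rparr>"

text \<open>\<open>M\<close> is a direct summand of \<open>R\<^sup>k\<close>, with inclusion \<open>\<iota>\<close> and projection \<open>\<pi>\<close>.\<close>

definition summand_of_free ::
  "('r, 'c) ring_scheme \<Rightarrow> ('r, 'a, 'm) module_scheme \<Rightarrow> nat
    \<Rightarrow> ('a \<Rightarrow> nat \<Rightarrow> 'r) \<Rightarrow> ((nat \<Rightarrow> 'r) \<Rightarrow> 'a) \<Rightarrow> bool" where
  "summand_of_free R M k \<iota> \<pi> \<longleftrightarrow>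
     \<iota> \<in> linear_maps R M (free_module R k) \<and>
     \<pi> \<in> linear_maps R (free_module R k) M \<and>
     (\<forall>x \<in> carrier M. \<pi> (\<iota> x) = x)"

definition fg_projective :: "('r, 'c) ring_scheme \<Rightarrow> ('r, 'a, 'm) module_scheme \<Rightarrow> bool" where
  "fg_projective R M \<longleftrightarrow> (\<exists>k \<iota> \<pi>. summand_of_free R M k \<iota> \<pi>)"

text \<open>Localization at a prime \<open>P\<close>: the fraction \<open>x/s\<close> is the class of all \<open>(y, t)\<close> such that
  \<open>u t x = u s y\<close> for some \<open>u \<notin> P\<close>. The localization of an algebra is an algebra over the
  localized base ring, which is itself the localization of \<open>regular R\<close>; for a mere module the
  multiplicative fields are irrelevant.\<close>

definition fraction ::
  "('r, 'c) ring_scheme \<Rightarrow> ('r, 'a, 'm) module_scheme \<Rightarrow> 'r set \<Rightarrow> 'a \<Rightarrow> 'r \<Rightarrow> ('a \<times> 'r) set" where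
  "fraction R M P x s = {(y, t). y \<in> carrier M \<and> t \<in> carrier R - P \<and>
     (\<exists>u \<in> carrier R - P. u \<odot>\<^bsub>M\<^esub> (t \<odot>\<^bsub>M\<^esub> x) = u \<odot>\<^bsub>M\<^esub> (s \<odot>\<^bsub>M\<^esub> y))}"

definition localize ::
  "('r, 'c) ring_scheme \<Rightarrow> ('r, 'a, 'm) module_scheme \<Rightarrow> 'r set
    \<Rightarrow> (('r \<times> 'r) set, ('a \<times> 'r) set) module" where
  "localize R M P = \<lparr>carrier = {fraction R M P x s | x s. x \<in> carrier M \<and> s \<in> carrier R - P},
     mult = (\<lambda>X Y. \<Union>(x, s) \<in> X. \<Union>(y, t) \<in> Y. fraction R M P (x \<otimes>\<^bsub>M\<^esub> y) (s \<otimes>\<^bsub>R\<^esub> t)),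
     one = fraction R M P \<one>\<^bsub>M\<^esub> \<one>\<^bsub>R\<^esub>,
     zero = fraction R M P \<zero>\<^bsub>M\<^esub> \<one>\<^bsub>R\<^esub>,
     add = (\<lambda>X Y. \<Union>(x, s) \<in> X. \<Union>(y, t) \<in> Y.
       fraction R M P (t \<odot>\<^bsub>M\<^esub> x \<oplus>\<^bsub>M\<^esub> s \<odot>\<^bsub>M\<^esub> y) (s \<otimes>\<^bsub>R\<^esub> t)),
     smult = (\<lambda>Q X. \<Union>(r, s) \<in> Q. \<Union>(x, t) \<in> X. fraction R M P (r \<odot>\<^bsub>M\<^esub> x) (s \<otimes>\<^bsub>R\<^esub> t))\<rparr>"

text \<open>\<open>M\<close> has constant rank \<open>k\<close>: every localization \<open>M\<^sub>P\<close> is free of rank \<open>k\<close> over \<open>R\<^sub>P\<close>.\<close>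

definition has_rank :: "('r, 'c) ring_scheme \<Rightarrow> ('r, 'a, 'm) module_scheme \<Rightarrow> nat \<Rightarrow> bool" where
  "has_rank R M k \<longleftrightarrow> (\<forall>P. primeideal P R \<longrightarrow>
     (let R\<^sub>P = localize R (regular R) P; M\<^sub>P = localize R M P in
       \<exists>f \<in> linear_maps R\<^sub>P (free_module R\<^sub>P k) M\<^sub>P.
         bij_betw f (carrier (free_module R\<^sub>P k)) (carrier M\<^sub>P)))"

text \<open>Trace of an endomorphism \<open>\<phi>\<close> of a finitely generated projective module: the trace of the
  matrix of \<open>\<iota> \<circ> \<phi> \<circ> \<pi>\<close>, for any presentation of the module as a summand of \<open>R\<^sup>k\<close>
  (the value does not depend on the presentation).\<close>

definition module_trace ::
  "('r, 'c) ring_scheme \<Rightarrow> ('r, 'a, 'm) module_scheme \<Rightarrow> ('a \<Rightarrow> 'a) \<Rightarrow> 'r" where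
  "module_trace R M \<phi> = (THE t. \<exists>k \<iota> \<pi>. summand_of_free R M k \<iota> \<pi> \<and>
     t = (\<Oplus>\<^bsub>R\<^esub>j\<in>{..<k}. \<iota> (\<phi> (\<pi> (\<lambda>i \<in> {..<k}. if i = j then \<one>\<^bsub>R\<^esub> else \<zero>\<^bsub>R\<^esub>))) j))"

definition algebra_trace :: "('r, 'c) ring_scheme \<Rightarrow> ('r, 'a, 'm) module_scheme \<Rightarrow> 'a \<Rightarrow> 'r" where
  "algebra_trace R S s = module_trace R S (\<lambda>x. s \<otimes>\<^bsub>S\<^esub> x)"

section \<open>Tensor products of algebras\<close>

text \<open>An element of \<open>A \<otimes>\<^sub>R C\<close> is a class of formal sums \<open>\<Sum> a\<^sub>i \<otimes> c\<^sub>i\<close>, represented by lists of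
  pairs, modulo the congruence generated by commutativity of addition and bilinearity. The rule
  \<open>zero\<close> is needed because formal sums of this kind a priori form only a commutative monoid.\<close>

inductive tensor_eq ::
  "('r, 'c) ring_scheme \<Rightarrow> ('r, 'a, 'm) module_scheme \<Rightarrow> ('r, 'b, 'n) module_scheme
    \<Rightarrow> ('a \<times> 'b) list \<Rightarrow> ('a \<times> 'b) list \<Rightarrow> bool"
  for R A C where
    refl: "set ps \<subseteq> carrier A \<times> carrier C \<Longrightarrow> tensor_eq R A C ps ps"
  | sym: "tensor_eq R A C ps qs \<Longrightarrow> tensor_eq R A C qs ps"
  | trans: "\<lbrakk>tensor_eq R A C ps qs; tensor_eq R A C qs us\<rbrakk> \<Longrightarrow> tensor_eq R A C ps us"
  | append: "\<lbrakk>tensor_eq R A C ps ps'; tensor_eq R A C qs qs'\<rbrakk>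
      \<Longrightarrow> tensor_eq R A C (ps @ qs) (ps' @ qs')"
  | commute: "\<lbrakk>set ps \<subseteq> carrier A \<times> carrier C; set qs \<subseteq> carrier A \<times> carrier C\<rbrakk>
      \<Longrightarrow> tensor_eq R A C (ps @ qs) (qs @ ps)"
  | zero: "c \<in> carrier C \<Longrightarrow> tensor_eq R A C [(\<zero>\<^bsub>A\<^esub>, c)] []"
  | add_left: "\<lbrakk>a \<in> carrier A; a' \<in> carrier A; c \<in> carrier C\<rbrakk>
      \<Longrightarrow> tensor_eq R A C [(a \<oplus>\<^bsub>A\<^esub> a', c)] [(a, c), (a', c)]"
  | add_right: "\<lbrakk>a \<in> carrier A; c \<in> carrier C; c' \<in> carrier C\<rbrakk>
      \<Longrightarrow> tensor_eq R A C [(a, c \<oplus>\<^bsub>C\<^esub> c')] [(a, c), (a, c')]"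
  | balance: "\<lbrakk>r \<in> carrier R; a \<in> carrier A; c \<in> carrier C\<rbrakk>
      \<Longrightarrow> tensor_eq R A C [(r \<odot>\<^bsub>A\<^esub> a, c)] [(a, r \<odot>\<^bsub>C\<^esub> c)]"

definition tensor_class ::
  "('r, 'c) ring_scheme \<Rightarrow> ('r, 'a, 'm) module_scheme \<Rightarrow> ('r, 'b, 'n) module_scheme
    \<Rightarrow> ('a \<times> 'b) list \<Rightarrow> ('a \<times> 'b) list set" where
  "tensor_class R A C ps = {qs. tensor_eq R A C ps qs}"

definition tensor_algebra ::
  "('r, 'c) ring_scheme \<Rightarrow> ('r, 'a, 'm) module_scheme \<Rightarrow> ('r, 'b, 'n) module_scheme
    \<Rightarrow> ('r, ('a \<times> 'b) list set) module" where
  "tensor_algebra R A C = \<lparr>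
     carrier = {tensor_class R A C ps | ps. set ps \<subseteq> carrier A \<times> carrier C},
     mult = (\<lambda>X Y. \<Union>ps \<in> X. \<Union>qs \<in> Y.
       tensor_class R A C [(a \<otimes>\<^bsub>A\<^esub> a', c \<otimes>\<^bsub>C\<^esub> c'). (a, c) \<leftarrow> ps, (a', c') \<leftarrow> qs]),
     one = tensor_class R A C [(\<one>\<^bsub>A\<^esub>, \<one>\<^bsub>C\<^esub>)],
     zero = tensor_class R A C [],
     add = (\<lambda>X Y. \<Union>ps \<in> X. \<Union>qs \<in> Y. tensor_class R A C (ps @ qs)),
     smult = (\<lambda>r X. \<Union>ps \<in> X. tensor_class R A C [(r \<odot>\<^bsub>A\<^esub> a, c). (a, c) \<leftarrow> ps])\<rparr>"

definition enveloping :: "('r, 'c) ring_scheme \<Rightarrow> ('r, 'a, 'm) module_scheme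
    \<Rightarrow> ('r, ('a \<times> 'a) list set) module" where
  "enveloping R A = tensor_algebra R A (opposite A)"

text \<open>The action \<open>(\<Sum> a\<^sub>i \<otimes> b\<^sub>i) x = \<Sum> a\<^sub>i x b\<^sub>i\<close> of the enveloping algebra on \<open>A\<close>, first for
  representing lists and then for classes.\<close>

definition sandwich :: "('a, 'm) ring_scheme \<Rightarrow> ('a \<times> 'a) list \<Rightarrow> 'a \<Rightarrow> 'a" where
  "sandwich A ps x = foldr (\<lambda>(a, b) y. (a \<otimes>\<^bsub>A\<^esub> x \<otimes>\<^bsub>A\<^esub> b) \<oplus>\<^bsub>A\<^esub> y) ps \<zero>\<^bsub>A\<^esub>"

definition env_action :: "('a, 'm) ring_scheme \<Rightarrow> ('a \<times> 'a) list set \<Rightarrow> 'a \<Rightarrow> 'a" where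
  "env_action A T x = the_elem ((\<lambda>ps. sandwich A ps x) ` T)"

definition env_module :: "('r, 'a, 'm) module_scheme \<Rightarrow> (('a \<times> 'a) list set, 'a) module" where
  "env_module A = \<lparr>carrier = carrier A, mult = mult A, one = \<one>\<^bsub>A\<^esub>,
     zero = \<zero>\<^bsub>A\<^esub>, add = add A,
     smult = env_action A\<rparr>"

section \<open>Azumaya and quadratic etale algebras, unitary involutions\<close>

text \<open>\<open>A\<close> is a faithful finitely generated projective \<open>R\<close>-module and the canonical map
  \<open>A \<otimes>\<^sub>R A\<^sup>o\<^sup>p \<rightarrow> End\<^sub>R(A)\<close> is an isomorphism.\<close>

locale azumaya_algebra = assoc_algebra +
  assumes fg_projective: "fg_projective R A"
    and faithful: "\<lbrakk>r \<in> carrier R; \<forall>x \<in> carrier A. r \<odot>\<^bsub>A\<^esub> x = \<zero>\<^bsub>A\<^esub>\<rbrakk> \<Longrightarrow> r = \<zero>\<^bsub>R\<^esub>"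
    and canonical_iso:
      "(\<lambda>T. \<lambda>x \<in> carrier A. env_action A T x) \<in> ring_iso (enveloping R A) (endo_ring R A)"

text \<open>A finite etale algebra is a commutative algebra that is finitely generated projective as a
  module and separable, i.e. projective over its enveloping algebra. Being cyclic over the latter,
  it is projective there iff it is finitely generated projective.\<close>

locale quadratic_etale_algebra = algebra R S for R (structure) and S (structure) +
  assumes fg_projective: "fg_projective R S"
    and rank_two: "has_rank R S 2"
    and separable: "fg_projective (enveloping R S) (env_module S)"

text \<open>\<open>B\<lparr>carrier := ring_center B\<rparr>\<close> is the center \<open>S\<close> of \<open>B\<close>, as an \<open>R\<close>-algebra, and
  \<open>regular B\<close> is \<open>B\<close> viewed as an \<open>S\<close>-algebra.\<close>

locale azumaya_unitary = assoc_algebra R B for R (structure) and B (structure) +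
  fixes \<tau> :: "'c \<Rightarrow> 'c"
  assumes inv_closed: "x \<in> carrier B \<Longrightarrow> \<tau> x \<in> carrier B"
    and inv_add: "\<lbrakk>x \<in> carrier B; y \<in> carrier B\<rbrakk> \<Longrightarrow> \<tau> (x \<oplus>\<^bsub>B\<^esub> y) = \<tau> x \<oplus>\<^bsub>B\<^esub> \<tau> y"
    and inv_smult: "\<lbrakk>r \<in> carrier R; x \<in> carrier B\<rbrakk> \<Longrightarrow> \<tau> (r \<odot>\<^bsub>B\<^esub> x) = r \<odot>\<^bsub>B\<^esub> \<tau> x"
    and inv_mult: "\<lbrakk>x \<in> carrier B; y \<in> carrier B\<rbrakk> \<Longrightarrow> \<tau> (x \<otimes>\<^bsub>B\<^esub> y) = \<tau> y \<otimes>\<^bsub>B\<^esub> \<tau> x"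
    and inv_inv: "x \<in> carrier B \<Longrightarrow> \<tau> (\<tau> x) = x"
    and azumaya_over_center: "azumaya_algebra (B\<lparr>carrier := ring_center B\<rparr>) (regular B)"
    and quadratic_etale_center: "quadratic_etale_algebra R (B\<lparr>carrier := ring_center B\<rparr>)"
    and standard_on_center: "s \<in> ring_center B \<Longrightarrow>
      \<tau> s = algebra_trace R (B\<lparr>carrier := ring_center B\<rparr>) s \<odot>\<^bsub>B\<^esub> \<one>\<^bsub>B\<^esub> \<ominus>\<^bsub>B\<^esub> s"

definition has_degree :: "('r, 'b, 'm) module_scheme \<Rightarrow> nat \<Rightarrow> bool" where
  "has_degree B n \<longleftrightarrow> has_rank (B\<lparr>carrier := ring_center B\<rparr>) (regular B) (n\<^sup>2)"

section \<open>Generation and Krull dimension\<close>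

definition unital_subalgebra ::
  "('r, 'c) ring_scheme \<Rightarrow> ('r, 'a, 'm) module_scheme \<Rightarrow> 'a set \<Rightarrow> bool" where
  "unital_subalgebra R A T \<longleftrightarrow>
     subring T A \<and> (\<forall>r \<in> carrier R. \<forall>x \<in> T. r \<odot>\<^bsub>A\<^esub> x \<in> T)"

definition fg_algebra :: "('r, 'c) ring_scheme \<Rightarrow> ('r, 'a, 'm) module_scheme \<Rightarrow> bool" where
  "fg_algebra R A \<longleftrightarrow> (\<exists>X. finite X \<and> X \<subseteq> carrier A \<and>
     \<Inter>{T. unital_subalgebra R A T \<and> X \<subseteq> T} = carrier A)"

definition generates_with_involution ::
  "('r, 'c) ring_scheme \<Rightarrow> ('r, 'a, 'm) module_scheme \<Rightarrow> ('a \<Rightarrow> 'a) \<Rightarrow> 'a set \<Rightarrow> bool" where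
  "generates_with_involution R B \<tau> X \<longleftrightarrow> X \<subseteq> carrier B \<and>
     \<Inter>{T. unital_subalgebra R B T \<and> \<tau> ` T \<subseteq> T \<and> X \<subseteq> T} = carrier B"

text \<open>The value is \<open>\<infinity>\<close> if there is no finite generating set.\<close>

definition gen ::
  "('r, 'c) ring_scheme \<Rightarrow> ('r, 'a, 'm) module_scheme \<Rightarrow> ('a \<Rightarrow> 'a) \<Rightarrow> enat" where
  "gen R B \<tau> = Inf {enat (card X) | X. finite X \<and> generates_with_involution R B \<tau> X}"

text \<open>\<open>d\<close> is the largest length of a strict chain of prime ideals. As \<open>d\<close> is a natural number,
  this excludes the zero ring.\<close>

definition has_krull_dim :: "('r, 'c) ring_scheme \<Rightarrow> nat \<Rightarrow> bool" where
  "has_krull_dim R d \<longleftrightarrow>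
     (let chain = (\<lambda>k P. (\<forall>i\<le>k. primeideal (P i) R) \<and> (\<forall>i<k. P i \<subset> P (Suc i)))
      in (\<exists>P. chain d P) \<and> (\<forall>k P. chain k P \<longrightarrow> k \<le> d))"

end

theory Submission
  imports Defs "HOL-Algebra.Algebraic_Closure" "HOL-Algebra.Generated_Rings"
begin

text \<open>Put \<open>c = (2r - 1)(n - 1) > d\<close> and consider the \<open>r\<close> elements \<open>b\<^sub>i = \<Sum>\<^sub>e t\<^sub>i\<^sub>e e\<close>, where \<open>e\<close> runs
through module generators of \<open>B\<close> and the \<open>t\<^sub>i\<^sub>e\<close> are parameters in \<open>K\<close>. If they never generate \<open>B\<close>, then every
parameter \<open>t\<close> has a maximal ideal \<open>m\<^sub>t\<close> and a nonzero functional \<open>B \<rightarrow> R/m\<^sub>t\<close> that kills the subalgebra generated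
by the \<open>b\<^sub>i\<close>. A suitable quotient of the product of all \<open>R/m\<^sub>t\<close> embeds in an algebraically closed field \<open>F\<close> in
which the coordinates \<open>t\<^sub>i\<^sub>e\<close> are algebraically independent over \<open>K\<close>, whereas the image of \<open>R\<close> has transcendence
degree at most \<open>d\<close>. Over the algebraic closure of that image, all functionals on \<open>B\<close> are combinations of
the entries of two irreducible representations of size at least \<open>n\<close>, exchanged by \<open>\<tau>\<close> and transposition. If the
words in the \<open>b\<^sub>i\<close> and \<open>\<tau> b\<^sub>i\<close> had an invariant subspace, or an operator intertwining the two representations, then the
parameters would satisfy at least \<open>c\<close> independent algebraic relations over a field of transcendence
degree \<open>d < c\<close>. So by Frobenius and Schur the entries of the two representations are independent on words,
and a functional that kills all words is zero.\<close>

\<comment> \<open>The constant comes from the worst obstruction. A \<open>k\<close>-dimensional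
  subspace of an \<open>m\<close>-dimensional representation depends on \<open>k (m - k)\<close>
  parameters, and its invariance under the matrices of \<open>b\<^sub>i\<close> and
  \<open>\<tau> b\<^sub>i\<close> imposes \<open>2 k (m - k)\<close> linear conditions on the
  parameters of each \<open>b\<^sub>i\<close>. The surplus \<open>(2 r - 1) k (m - k)\<close> is
  smallest for a line or a hyperplane. An intertwiner costs \<open>m^2\<close> conditions for each
  \<open>b\<^sub>i\<close> and may be taken symmetric or antisymmetric, so it is never the
  bottleneck. A larger \<open>m\<close> only helps, hence the inequality \<open>m >= n\<close> is
  all that enters. The obstacle is that the maximal ideal at which generation fails varies with
  \<open>t\<close>. The product of all \<open>R/m\<^sub>t\<close> treats all failures at once, and
  the resulting functional stays nonzero because the elements on which the single functionals take
  the value one are combinations of one finite set of module generators. The image of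
  \<open>R\<close> in \<open>F\<close> may be a proper quotient; chains of primes above the kernel
  still bound its transcendence degree. Functionals into \<open>F\<close> take the place of base
  changes of \<open>B\<close>.\<close>
text \<open>Below \<open>x **.F y\<close> is the product in the structure \<open>F\<close>, and \<open>x <: F\<close> is membership in its carrier.\<close>

syntax
  "_index" :: "logic \<Rightarrow> index"  ("(00._)" [1000])
  "_finsum" :: "index \<Rightarrow> idt \<Rightarrow> 'a set \<Rightarrow> 'b \<Rightarrow> 'b"  ("(3\<Oplus>__:_. _)" [1000, 0, 51, 10] 10)

notation monoid.mult  (infixl "**\<index>" 70)

abbreviation (input) in_carrier  (infix "<:" 50) where "x <: R \<equiv> x \<in> carrier R"

section \<open>Linear algebra over a field\<close>

context ring
begin

lemma finsum_all_zero: "(!!i. i : I ==> f i = \<zero>) ==> (\<Oplus>i:I. f i) = \<zero>"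
 by (metis (no_types, lifting) add.finprod_one_eqI)

lemma finsum_swap:
 assumes "finite I" "finite J" "!!i j. i : I ==> j : J ==> f i j <: R"
 shows "(\<Oplus>i:I. \<Oplus>j:J. f i j) = (\<Oplus>j:J. \<Oplus>i:I. f i j)"
 using assms(1,3)
proof (induction I rule: finite_induct)
 case empty
 thus ?case by (simp add: finsum_all_zero)
next
 case (insert i I)
 have cl: "(%j. \<Oplus>i:I. f i j) : J \<rightarrow> carrier R" "f i : J \<rightarrow> carrier R"
  "(%i. \<Oplus>j:J. f i j) : I \<rightarrow> carrier R" "(\<Oplus>j:J. f i j) <: R"
  using insert.prems by (auto intro!: finsum_closed)
 have "(\<Oplus>j:J. \<Oplus>i:insert i I. f i j) = (\<Oplus>j:J. f i j \<oplus> (\<Oplus>i:I. f i j))"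
  using insert by (intro finsum_cong') (auto intro!: finsum_closed finsum_insert)
 thus ?case
  using insert cl by (simp add: finsum_addf)
qed

lemma finsum_delta:
 assumes "finite I" "i : I" "a <: R"
 shows "(\<Oplus>j:I. if j = i then a else \<zero>) = a" "(\<Oplus>j:I. if i = j then a else \<zero>) = a"
 using finsum_singleton[of i I "%_. a"] add.finprod_singleton_swap[of i I "%_. a"] assms by simp_all

lemma finsum_delta_mult:
 assumes "finite I" "i : I" "!!j. j : I ==> f j <: R"
 shows "(\<Oplus>j:I. (if j = i then \<one> else \<zero>) ** f j) = f i"
  and "(\<Oplus>j:I. (if i = j then \<one> else \<zero>) ** f j) = f i"
  and "(\<Oplus>j:I. f j ** (if j = i then \<one> else \<zero>)) = f i"
  and "(\<Oplus>j:I. f j ** (if i = j then \<one> else \<zero>)) = f i"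
proof -
 have *: "(\<Oplus>j:I. if j = i then f j else \<zero>) = f i"
  using finsum_delta(1)[of I i "f i"] assms by (simp cong: if_cong)
 show "(\<Oplus>j:I. (if j = i then \<one> else \<zero>) ** f j) = f i"
  by (subst *[symmetric], intro finsum_cong') (use assms in auto)
 show "(\<Oplus>j:I. (if i = j then \<one> else \<zero>) ** f j) = f i"
  by (subst *[symmetric], intro finsum_cong') (use assms in auto)
 show "(\<Oplus>j:I. f j ** (if j = i then \<one> else \<zero>)) = f i"
  by (subst *[symmetric], intro finsum_cong') (use assms in auto)
 show "(\<Oplus>j:I. f j ** (if i = j then \<one> else \<zero>)) = f i"
  by (subst *[symmetric], intro finsum_cong') (use assms in auto)
qed

lemma finsum_remove:
 assumes "finite I" "i : I" "!!j. j : I ==> f j <: R"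
 shows "(\<Oplus>j:I. f j) = f i \<oplus> (\<Oplus>j:I - {i}. f j)"
 using finsum_insert[of "I - {i}" i f] assms by (simp add: insert_absorb Pi_iff)

lemma finsum_ominus:
 assumes "!!j. j : I ==> f j <: R"
 shows "(\<Oplus>j:I. \<ominus> f j) = \<ominus> (\<Oplus>j:I. f j)"
proof (cases "finite I")
 case True
 have "(\<Oplus>j:I. f j) \<oplus> (\<Oplus>j:I. \<ominus> f j) = (\<Oplus>j:I. f j \<oplus> \<ominus> f j)"
  using assms by (intro finsum_addf[symmetric]) auto
 also have "... = \<zero>" using assms by (intro finsum_all_zero) (simp add: r_neg)
 finally show ?thesis
  using assms by (metis (no_types, lifting) Pi_I a_inv_closed add.finprod_closed minus_equality a_comm)
qed simp

lemma finsum_neutral_subset: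
 assumes "finite J" "I <= J" "!!i. i : I ==> f i <: R" "!!i. i : J - I ==> f i = \<zero>"
 shows "(\<Oplus>i:J. f i) = (\<Oplus>i:I. f i)"
proof -
 have "i : J ==> f i <: R" for i using assms(3,4) by (cases "i : I") auto
 thus ?thesis using assms by (intro add.finprod_mono_neutral_cong_right) auto
qed

text \<open>Vector spaces occur only as spaces of functions into the field, so that evaluation at
  points supplies the coordinates. No finiteness is built in; it enters through a finite set of
  points that determines the functions.\<close>

definition fun_subspace :: "('x => 'a) set => bool" where
 "fun_subspace U \<longleftrightarrow> U <= UNIV \<rightarrow> carrier R & (%x. \<zero>) : U &
   (ALL u:U. ALL v:U. (%x. u x \<oplus> v x) : U) & (ALL c:carrier R. ALL u:U. (%x. c ** u x) : U)"

lemma fun_subspace_closed: "fun_subspace U ==> u : U ==> u x <: R"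
 unfolding fun_subspace_def by blast

lemma fun_subspace_add: "fun_subspace U ==> u : U ==> v : U ==> (%x. u x \<oplus> v x) : U"
 and fun_subspace_smult: "fun_subspace U ==> c <: R ==> u : U ==> (%x. c ** u x) : U"
 and fun_subspace_zero: "fun_subspace U ==> (%x. \<zero>) : U"
 unfolding fun_subspace_def by simp_all

lemma fun_subspace_sum:
 assumes "fun_subspace U" "finite I" "!!i. i : I ==> c i <: R" "!!i. i : I ==> u i : U"
 shows "(%x. \<Oplus>i:I. c i ** u i x) : U"
 using assms(2-)
proof (induction I rule: finite_induct)
 case empty
 thus ?case using assms(1) by (simp add: fun_subspace_def)
next
 case (insert i I)
 have "(%x. c i ** u i x \<oplus> (\<Oplus>i:I. c i ** u i x)) : U"
  using insert by (intro fun_subspace_add[OF assms(1)] fun_subspace_smult[OF assms(1)]) auto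
 moreover have "(%x. \<Oplus>i:insert i I. c i ** u i x) = (%x. c i ** u i x \<oplus> (\<Oplus>i:I. c i ** u i x))"
  using insert fun_subspace_closed[OF assms(1)] by (intro ext finsum_insert) auto
 ultimately show ?case by simp
qed

lemma fun_subspace_minus:
 assumes "fun_subspace U" "u : U" "v : U"
 shows "(%x. u x \<ominus> v x) : U"
proof -
 have "(%x. u x \<oplus> (\<ominus> \<one> ** v x)) : U"
  using assms by (intro fun_subspace_add fun_subspace_smult) auto
 thus ?thesis using fun_subspace_closed[OF assms(1,3)] by (simp add: minus_eq l_minus)
qed

end

context field
begin

lemma inv_closed: "a <: R ==> a ~= \<zero> ==> inv a <: R"
 and inv_right: "a <: R ==> a ~= \<zero> ==> a ** inv a = \<one>"
 and inv_left: "a <: R ==> a ~= \<zero> ==> inv a ** a = \<one>"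
 and inv_nonzero: "a <: R ==> a ~= \<zero> ==> inv a ~= \<zero>"
 using field_Units by auto

lemma minus_eq_zeroD: "a <: R ==> b <: R ==> a \<ominus> b = \<zero> ==> a = b"
 by (simp add: r_right_minus_eq)

text \<open>A finite-dimensional space of functions has a basis that is dual to the evaluations at
  suitable points; this makes coordinates explicit throughout.\<close>

lemma dual_basis_of_evaluations:
 assumes U: "fun_subspace U" and E: "finite E"
  and det: "ALL u:U. (ALL y:E. u y = \<zero>) --> u = (%_. \<zero>)"
 obtains I e where "I <= E" "!!i. i : I ==> e i : U"
  "!!i j. i : I ==> j : I ==> e i j = (if i = j then \<one> else \<zero>)"
  "!!u. u : U ==> u = (%x. \<Oplus>i:I. u i ** e i x)"
proof -
 \<comment> \<open>\<open>D I\<close> says that the values on \<open>I\<close> determine the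
   functions of \<open>U\<close>. A smallest such \<open>I\<close> has independent
   evaluations.\<close>
 define D where "D I \<longleftrightarrow> I <= E & (ALL u:U. (ALL y:I. u y = \<zero>) --> (ALL x. u x = \<zero>))" for I
 have "D E" using det by (auto simp: D_def)
 then obtain I where I: "D I" and min: "!!J. D J ==> card I <= card J"
  using ex_has_least_nat[of D E card] by auto
 have fI: "finite I" using I E finite_subset by (auto simp: D_def)
 have "EX v:U. ALL j:I. v j = (if i = j then \<one> else \<zero>)" if i: "i : I" for i
 proof -
  \<comment> \<open>Dropping \<open>i\<close> loses determinacy, so some nonzero \<open>v\<close>
    vanishes on the rest of \<open>I\<close>. It cannot vanish at \<open>i\<close> as well and can
    be normalized there.\<close>
  have "~ D (I - {i})" using min[of "I - {i}"] fI i card_Diff1_less[of I i] by force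
  then obtain v x where v: "v : U" "ALL y:I - {i}. v y = \<zero>" "v x ~= \<zero>"
   using I by (auto simp: D_def)
  have vc: "v y <: R" for y using v(1) fun_subspace_closed[OF U] by blast
  have vi: "v i ~= \<zero>"
  proof
   assume "v i = \<zero>"
   hence "ALL y:I. v y = \<zero>" using v(2) by auto
   thus False using I v(1,3) by (auto simp: D_def)
  qed
  have "(%x. inv (v i) ** v x) : U"
   by (rule fun_subspace_smult[OF U inv_closed[OF vc vi] v(1)])
  moreover have "ALL j:I. inv (v i) ** v j = (if i = j then \<one> else \<zero>)"
   using v(2) vi inv_left[OF vc vi] inv_closed[OF vc vi] by auto
  ultimately show ?thesis by (intro bexI[of _ "%x. inv (v i) ** v x"])
 qed
 then obtain e where e: "!!i. i : I ==> e i : U"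
  "!!i j. i : I ==> j : I ==> e i j = (if i = j then \<one> else \<zero>)" by metis
 have "u = (%x. \<Oplus>i:I. u i ** e i x)" if u: "u : U" for u
 proof
  fix x
  let ?s = "%x. \<Oplus>i:I. u i ** e i x"
  have uc: "!!y. u y <: R" using u fun_subspace_closed[OF U] by blast
  have s: "?s : U" by (rule fun_subspace_sum[OF U fI uc e(1)])
  have d: "(%x. u x \<ominus> ?s x) : U" by (rule fun_subspace_minus[OF U u s])
  have "u y \<ominus> ?s y = \<zero>" if y: "y : I" for y
  proof -
   have "?s y = (\<Oplus>i:I. u i ** (if i = y then \<one> else \<zero>))"
    using e(2) y uc by (intro finsum_cong') auto
   also have "... = u y" by (rule finsum_delta_mult(3)[OF fI y uc])
   finally show ?thesis using uc by (simp add: minus_eq r_neg)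
  qed
  hence "u x \<ominus> ?s x = \<zero>" using I d by (auto simp: D_def)
  thus "u x = ?s x" using uc fun_subspace_closed[OF U s] minus_eq_zeroD by blast
 qed
 thus thesis using that[of I e] I e by (auto simp: D_def)
qed

text \<open>Gaussian elimination by induction on the number of equations: an unknown with a nonzero
  coefficient is solved for and removed, which keeps the surplus of unknowns over equations.\<close>

lemma nontrivial_solution:
 assumes "finite I" "finite J" "card I < card J" "!!i j. A i j <: R"
 obtains c where "!!j. c j <: R" "EX j:J. c j ~= \<zero>" "!!i. i : I ==> (\<Oplus>j:J. c j ** A i j) = \<zero>"
proof -
 have "EX c. (ALL j. c j <: R) & (EX j:J. c j ~= \<zero>) & (ALL i:I. (\<Oplus>j:J. c j ** A i j) = \<zero>)"
  using assms
 proof (induction I arbitrary: J A rule: finite_induct)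
  case empty
  hence "J ~= {}" by auto
  thus ?case by (intro exI[of _ "%_. \<one>"]) auto
 next
  case (insert i0 I)
  note A[simp] = insert.prems(3)
  show ?case
  proof (cases "ALL j:J. A i0 j = \<zero>")
   case True
   have "card I < card J" using insert by simp
   then obtain c where c: "ALL j. c j <: R" "EX j:J. c j ~= \<zero>" "ALL i:I. (\<Oplus>j:J. c j ** A i j) = \<zero>"
    using insert.IH[of J A] insert.prems by blast
   moreover have "(\<Oplus>j:J. c j ** A i0 j) = \<zero>"
    using True c(1) by (intro finsum_all_zero) simp
   ultimately show ?thesis by auto
  next
   case False
   then obtain j0 where j0: "j0 : J" "A i0 j0 ~= \<zero>" by auto
   define t where "t = inv (A i0 j0)"
   have t[simp]: "t <: R" "t ** A i0 j0 = \<one>"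
    using inv_closed inv_left j0 A unfolding t_def by auto
   \<comment> \<open>Subtracting multiples of the pivot column \<open>j0\<close> clears row
     \<open>i0\<close>.\<close>
   define A' where "A' i j = A i j \<ominus> (A i0 j ** t) ** A i j0" for i j
   have A'[simp]: "A' i j <: R" for i j by (simp add: A'_def)
   have "card I < card (J - {j0})" using insert j0 by simp
   then obtain c' where c': "!!j. c' j <: R" "EX j:J - {j0}. c' j ~= \<zero>"
    "!!i. i : I ==> (\<Oplus>j:J - {j0}. c' j ** A' i j) = \<zero>"
    using insert.IH[of "J - {j0}" A'] insert.prems by auto
   note [simp] = c'(1)
   \<comment> \<open>The value at \<open>j0\<close> is forced by row \<open>i0\<close>; the reduced
     system supplies the other unknowns.\<close>
   define s where "s = (\<Oplus>j:J - {j0}. c' j ** (A i0 j ** t))"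
   have [simp]: "s <: R" by (simp add: s_def finsum_closed)
   define c where "c j = (if j = j0 then \<ominus> s else c' j)" for j
   have c[simp]: "c j <: R" for j by (simp add: c_def)
   have fJ: "finite (J - {j0})" using insert.prems(1) by simp
   have split: "(\<Oplus>j:J. c j ** A i j) = \<ominus> s ** A i j0 \<oplus> (\<Oplus>j:J - {j0}. c' j ** A i j)" for i
   proof -
    have "(\<Oplus>j:J. c j ** A i j) = c j0 ** A i j0 \<oplus> (\<Oplus>j:J - {j0}. c j ** A i j)"
     by (rule finsum_remove) (use j0 insert.prems(1) in auto)
    moreover have "(\<Oplus>j:J - {j0}. c j ** A i j) = (\<Oplus>j:J - {j0}. c' j ** A i j)"
     by (rule finsum_cong') (auto simp: c_def)
    ultimately show ?thesis by (simp add: c_def)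
   qed
   have "(\<Oplus>j:J - {j0}. c' j ** A i j) = s ** A i j0" if i: "i : insert i0 I" for i
   proof (cases "i = i0")
    case True
    have "s ** A i0 j0 = (\<Oplus>j:J - {j0}. (c' j ** (A i0 j ** t)) ** A i0 j0)"
     unfolding s_def by (rule finsum_ldistr) (use fJ in auto)
    also have "... = (\<Oplus>j:J - {j0}. c' j ** A i0 j)"
     by (rule finsum_cong') (auto simp: m_assoc)
    finally show ?thesis using True by simp
   next
    case False
    hence "(\<Oplus>j:J - {j0}. c' j ** A' i j) = \<zero>" using c'(3) i by simp
    moreover have "(\<Oplus>j:J - {j0}. c' j ** A' i j) =
     (\<Oplus>j:J - {j0}. c' j ** A i j \<oplus> \<ominus> ((c' j ** (A i0 j ** t)) ** A i j0))"
     by (rule finsum_cong') (auto simp: A'_def minus_eq r_distr r_minus m_assoc)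
    moreover have "... = (\<Oplus>j:J - {j0}. c' j ** A i j) \<oplus> (\<Oplus>j:J - {j0}. \<ominus> ((c' j ** (A i0 j ** t)) ** A i j0))"
     by (rule finsum_addf) auto
    moreover have "(\<Oplus>j:J - {j0}. \<ominus> ((c' j ** (A i0 j ** t)) ** A i j0)) =
     \<ominus> (\<Oplus>j:J - {j0}. (c' j ** (A i0 j ** t)) ** A i j0)"
     by (rule finsum_ominus) auto
    moreover have "(\<Oplus>j:J - {j0}. (c' j ** (A i0 j ** t)) ** A i j0) = s ** A i j0"
     unfolding s_def by (rule finsum_ldistr[symmetric]) (use fJ in auto)
    ultimately have "(\<Oplus>j:J - {j0}. c' j ** A i j) \<ominus> s ** A i j0 = \<zero>" by (simp add: minus_eq)
    thus ?thesis by (rule minus_eq_zeroD[rotated 2]) (auto intro!: finsum_closed)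
   qed
   hence "ALL i:insert i0 I. (\<Oplus>j:J. c j ** A i j) = \<zero>"
    unfolding split by (simp add: l_minus l_neg)
   moreover have "EX j:J. c j ~= \<zero>" using c'(2) by (auto simp: c_def)
   ultimately show ?thesis using c by blast
  qed
 qed
 thus thesis using that by blast
qed

end

subsection \<open>Matrices\<close>

context ring
begin

text \<open>Vectors are total functions that vanish off \<open>I\<close>, so that equality of
  vectors is equality of functions and \<open>fun_subspace\<close> applies to sets of
  vectors.\<close>

definition vecs :: "'i set => ('i => 'a) set" where
 "vecs I = {v. (ALL i. v i <: R) & (ALL i. i ~: I --> v i = \<zero>)}"

definition mat_app :: "'i set => ('i => 'i => 'a) => ('i => 'a) => 'i => 'a" where
 "mat_app I M v i = (if i : I then \<Oplus>j:I. M i j ** v j else \<zero>)"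

lemma vecsD: "v : vecs I ==> v i <: R" "v : vecs I ==> i ~: I ==> v i = \<zero>"
 unfolding vecs_def by auto

lemma vecs_nonzeroD: "v : vecs I ==> v ~= (%_. \<zero>) ==> EX i:I. v i ~= \<zero>"
 unfolding vecs_def by (auto simp: fun_eq_iff)

lemma mat_app_vecs:
 assumes "!!i j. M i j <: R" "v : vecs I"
 shows "mat_app I M v : vecs I"
 using assms unfolding vecs_def mat_app_def by (auto intro!: finsum_closed)

lemma unit_vec_in_vecs: "i : I ==> (%j. if j = i then \<one> else \<zero>) : vecs I"
 unfolding vecs_def by auto

lemma fun_subspace_image:
 assumes "fun_subspace Y"
 shows "fun_subspace ((%x i. x (h i)) ` Y)"
 unfolding fun_subspace_def
proof (intro conjI ballI)
 show "(%x i. x (h i)) ` Y <= UNIV \<rightarrow> carrier R"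
  using fun_subspace_closed[OF assms] by auto
 show "(%i. \<zero>) : (%x i. x (h i)) ` Y"
  using fun_subspace_zero[OF assms] by (rule rev_image_eqI) simp
next
 fix u v assume "u : (%x i. x (h i)) ` Y" "v : (%x i. x (h i)) ` Y"
 then obtain x y where xy: "x : Y" "y : Y" "u = (%i. x (h i))" "v = (%i. y (h i))" by blast
 show "(%i. u i \<oplus> v i) : (%x i. x (h i)) ` Y"
  by (rule rev_image_eqI[OF fun_subspace_add[OF assms xy(1,2)]]) (simp add: xy)
next
 fix c u assume c: "c <: R" and "u : (%x i. x (h i)) ` Y"
 then obtain x where x: "x : Y" "u = (%i. x (h i))" by blast
 show "(%i. c ** u i) : (%x i. x (h i)) ` Y"
  by (rule rev_image_eqI[OF fun_subspace_smult[OF assms c x(1)]]) (simp add: x)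
qed

text \<open>Algebraic closedness in terms of coefficient sequences, of which only the terms up to
  \<open>Suc n\<close> matter. In this form it can be stated for a subfield by restricting the
  carrier.\<close>

definition has_roots :: bool where
 "has_roots \<longleftrightarrow> (ALL n c. (ALL i. c i <: R) & c (Suc n) ~= \<zero> -->
   (EX x:carrier R. (\<Oplus>i:{..Suc n}. c i ** x [^] i) = \<zero>))"

text \<open>\<open>W\<close> is a bare index set without multiplication, so the notion applies to a
  set of letters as well as to all words in them.\<close>

definition irred_rep :: "'i set => ('w => 'i => 'i => 'a) => 'w set => bool" where
 "irred_rep I rho W \<longleftrightarrow> (ALL U. fun_subspace U & U <= vecs I & (ALL w:W. ALL u:U. mat_app I (rho w) u : U) &
   (EX u:U. u ~= (%_. \<zero>)) --> vecs I <= U)"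

end

context cring
begin

lemma mat_app_comp:
 assumes "finite I" "!!i j. A i j <: R" "!!i j. M i j <: R" "v : vecs I" "i : I"
 shows "mat_app I A (mat_app I M v) i = (\<Oplus>j:I. (\<Oplus>k:I. A i k ** M k j) ** v j)"
proof -
 note [simp] = assms(2,3) vecsD[OF assms(4)]
 have "mat_app I A (mat_app I M v) i = (\<Oplus>k:I. A i k ** (\<Oplus>j:I. M k j ** v j))"
  using assms(5) by (auto simp: mat_app_def intro!: finsum_cong' finsum_closed)
 also have "... = (\<Oplus>k:I. \<Oplus>j:I. A i k ** M k j ** v j)"
  by (intro finsum_cong') (auto simp: finsum_rdistr assms(1) m_assoc intro!: finsum_closed)
 also have "... = (\<Oplus>j:I. \<Oplus>k:I. A i k ** M k j ** v j)"
  by (rule finsum_swap) (use assms(1) in auto)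
 also have "... = (\<Oplus>j:I. (\<Oplus>k:I. A i k ** M k j) ** v j)"
  by (intro finsum_cong') (auto simp: finsum_ldistr assms(1) intro!: finsum_closed)
 finally show ?thesis .
qed

lemma mat_app_combination:
 assumes "!!i j. M i j <: R" "u : vecs I" "v : vecs I" "c <: R" "finite I"
 shows "mat_app I M (%i. u i \<ominus> c ** v i) = (%i. mat_app I M u i \<ominus> c ** mat_app I M v i)"
proof
 fix i
 note [simp] = assms(1,4) vecsD[OF assms(2)] vecsD[OF assms(3)]
 show "mat_app I M (%i. u i \<ominus> c ** v i) i = mat_app I M u i \<ominus> c ** mat_app I M v i"
 proof (cases "i : I")
  case True
  have "(\<Oplus>j:I. M i j ** (u j \<ominus> c ** v j)) = (\<Oplus>j:I. M i j ** u j \<oplus> \<ominus> (c ** (M i j ** v j)))"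
   by (intro finsum_cong') (auto simp: minus_eq r_distr r_minus m_ac)
  also have "... = (\<Oplus>j:I. M i j ** u j) \<oplus> (\<Oplus>j:I. \<ominus> (c ** (M i j ** v j)))"
   by (rule finsum_addf) auto
  also have "(\<Oplus>j:I. \<ominus> (c ** (M i j ** v j))) = \<ominus> (\<Oplus>j:I. c ** (M i j ** v j))"
   by (rule finsum_ominus) auto
  also have "(\<Oplus>j:I. c ** (M i j ** v j)) = c ** (\<Oplus>j:I. M i j ** v j)"
   by (rule finsum_rdistr[symmetric]) (use assms(5) in auto)
  finally show ?thesis using True by (simp add: mat_app_def minus_eq)
 next
  case False
  thus ?thesis by (simp add: mat_app_def minus_eq)
 qed
qed

text \<open>Division of a polynomial by \<open>X - l\<close> is linear in the powers of
  \<open>X\<close>, so the powers may be replaced by an arbitrary sequence \<open>y\<close>. The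
  iterates of a matrix on a vector are one such sequence, the powers of a scalar another.\<close>

lemma synthetic_division:
 assumes "!!i. c i <: R" "l <: R" "(\<Oplus>i:{..Suc n}. c i ** l [^] i) = \<zero>"
 shows "EX q. (ALL i. q i <: R) & q n = c (Suc n) & (ALL y. (ALL i. y i <: R) -->
  (\<Oplus>i:{..Suc n}. c i ** y i) = (\<Oplus>k:{..n}. q k ** (y (Suc k) \<ominus> l ** y k)))"
 using assms
proof (induction n arbitrary: c)
 case 0
 note [simp] = "0.prems"(1,2)
 have "c 1 ** l \<oplus> c 0 = \<zero>" using "0.prems"(3) by simp
 hence *: "c 0 = \<ominus> (c 1 ** l)" by (simp add: add.inv_equality a_comm minus_equality)
 have "c (Suc 0) ** y (Suc 0) \<oplus> c 0 ** y 0 = c (Suc 0) ** (y (Suc 0) \<ominus> l ** y 0)"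
  if "ALL i. y i <: R" for y
  using that by (simp add: * minus_eq r_distr r_minus l_minus m_assoc)
 thus ?case by (intro exI[of _ "%_. c 1"]) simp
next
 case (Suc n)
 note [simp] = Suc.prems(1,2)
 \<comment> \<open>One step of the Horner scheme: the top coefficient is carried over to the next
   one.\<close>
 define c' where "c' = c(Suc n := c (Suc n) \<oplus> l ** c (Suc (Suc n)))"
 have c'[simp]: "c' i <: R" for i by (simp add: c'_def)
 have eq: "(\<Oplus>i:{..Suc (Suc n)}. c i ** z i) =
   c (Suc (Suc n)) ** (z (Suc (Suc n)) \<ominus> l ** z (Suc n)) \<oplus> (\<Oplus>i:{..Suc n}. c' i ** z i)"
  if z[simp]: "!!i. z i <: R" for z
 proof -
  have s: "(\<Oplus>i:{..n}. c' i ** z i) = (\<Oplus>i:{..n}. c i ** z i)"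
   by (intro finsum_cong') (auto simp: c'_def)
  have cl: "(\<Oplus>i:{..n}. c i ** z i) <: R" by (rule finsum_closed) auto
  have l: "(\<Oplus>i:{..Suc n}. c' i ** z i) = c' (Suc n) ** z (Suc n) \<oplus> (\<Oplus>i:{..n}. c i ** z i)"
   using finsum_Suc[of "%i. c' i ** z i" n] by (simp add: s)
  have r: "(\<Oplus>i:{..Suc (Suc n)}. c i ** z i) = c (Suc (Suc n)) ** z (Suc (Suc n)) \<oplus> (c (Suc n) ** z (Suc n) \<oplus> (\<Oplus>i:{..n}. c i ** z i))"
   by (simp del: finsum_closed)
  have *: "a ** x \<oplus> (b ** y \<oplus> w) = a ** (x \<ominus> l ** y) \<oplus> ((b \<oplus> l ** a) ** y \<oplus> w)"
   if "a <: R" "b <: R" "x <: R" "y <: R" "w <: R" for a b x y w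
   using that Suc.prems(2) by algebra
  show ?thesis unfolding l r using *[OF _ _ _ _ cl] by (simp add: c'_def)
 qed
 have "c (Suc (Suc n)) ** (l [^] Suc (Suc n) \<ominus> l ** l [^] Suc n) = \<zero>"
  by (simp add: minus_eq r_neg m_ac)
 hence "(\<Oplus>i:{..Suc n}. c' i ** l [^] i) = \<zero>"
  using eq[of "%i. l [^] i"] Suc.prems(3) by (simp add: finsum_closed)
 then obtain q where q: "ALL i. q i <: R" "q n = c' (Suc n)"
  "ALL y. (ALL i. y i <: R) --> (\<Oplus>i:{..Suc n}. c' i ** y i) = (\<Oplus>k:{..n}. q k ** (y (Suc k) \<ominus> l ** y k))"
  using Suc.IH[of c'] c' Suc.prems(2) by blast
 define q' where "q' = q(Suc n := c (Suc (Suc n)))"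
 have "(\<Oplus>i:{..Suc (Suc n)}. c i ** y i) = (\<Oplus>k:{..Suc n}. q' k ** (y (Suc k) \<ominus> l ** y k))"
  if y: "ALL i. y i <: R" for y
 proof -
  have "(\<Oplus>k:{..n}. q' k ** (y (Suc k) \<ominus> l ** y k)) = (\<Oplus>k:{..n}. q k ** (y (Suc k) \<ominus> l ** y k))"
   using y q by (intro finsum_cong') (auto simp: q'_def)
  thus ?thesis
   using eq[of y] q y finsum_Suc[of "%k. q' k ** (y (Suc k) \<ominus> l ** y k)" n] by (auto simp: q'_def)
 qed
 moreover have "ALL i. q' i <: R" using q by (simp add: q'_def)
 ultimately show ?case by (intro exI[of _ q']) (simp add: q'_def)
qed

end

context field
begin

text \<open>No determinants are involved. The iterates of a vector \<open>w\<close> under the matrix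
  satisfy a polynomial relation; splitting off a root \<open>l\<close> either shows that
  \<open>w\<close> is an eigenvector or passes to a vector with a relation of smaller
  degree.\<close>

lemma eigenvector:
 assumes roots: "has_roots" and I: "finite I" "I ~= {}" and M: "!!i j. M i j <: R"
 obtains l v where "l <: R" "v : vecs I" "v ~= (%_. \<zero>)" "mat_app I M v = (%i. l ** v i)"
proof -
 let ?T = "mat_app I M"
 have T: "(?T ^^ k) v : vecs I" if "v : vecs I" for k v
  using that by (induction k) (simp_all add: mat_app_vecs M)
 have lin: "(?T ^^ k) (%i. u i \<ominus> c ** v i) = (%i. (?T ^^ k) u i \<ominus> c ** (?T ^^ k) v i)"
  if "u : vecs I" "v : vecs I" "c <: R" for k u v c
  using that mat_app_combination[OF M T T _ I(1)] by (induction k) simp_all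
 have P: "EX l:carrier R. EX v:vecs I. v ~= (%_. \<zero>) & ?T v = (%i. l ** v i)"
  if "w : vecs I" "w ~= (%_. \<zero>)" "!!k. c k <: R" "c n ~= \<zero>"
   "!!i. i : I ==> (\<Oplus>k:{..n}. c k ** (?T ^^ k) w i) = \<zero>" for n c w
  using that
 proof (induction n arbitrary: c w)
  case 0
  obtain i where i: "i : I" "w i ~= \<zero>" using vecs_nonzeroD[OF "0.prems"(1,2)] by blast
  have "w i <: R" by (rule vecsD(1)[OF "0.prems"(1)])
  moreover have "c 0 ** w i = \<zero>" using "0.prems"(5)[OF i(1)] "0.prems"(3) calculation by simp
  ultimately show ?case using "0.prems"(3,4) i(2) integral by blast
 next
  case (Suc n)
  obtain l where l: "l <: R" "(\<Oplus>i:{..Suc n}. c i ** l [^] i) = \<zero>"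
   using roots Suc.prems(3,4) unfolding has_roots_def by blast
  obtain q where q: "!!i. q i <: R" "q n = c (Suc n)" "!!y. (ALL i. y i <: R) ==>
   (\<Oplus>i:{..Suc n}. c i ** y i) = (\<Oplus>k:{..n}. q k ** (y (Suc k) \<ominus> l ** y k))"
   using synthetic_division[of c, OF Suc.prems(3) l] by blast
  \<comment> \<open>If this vector is not zero, the quotient of the relation by \<open>X - l\<close>
    is a relation for it, with the same leading coefficient.\<close>
  define w' where "w' = (%i. ?T w i \<ominus> l ** w i)"
  show ?case
  proof (cases "w' = (%_. \<zero>)")
   case True
   have "?T w i = l ** w i" for i
   proof (rule minus_eq_zeroD)
    show "?T w i \<ominus> l ** w i = \<zero>" using fun_cong[OF True, of i] by (simp add: w'_def)
   qed (use vecsD(1)[OF mat_app_vecs[OF M Suc.prems(1)]] vecsD(1)[OF Suc.prems(1)] l in auto)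
   hence "?T w = (%i. l ** w i)" by blast
   thus ?thesis using l(1) Suc.prems(1,2) by blast
  next
   case False
   have w'v: "w' : vecs I"
    using vecsD[OF mat_app_vecs[OF M Suc.prems(1)]] vecsD[OF Suc.prems(1)] l
    unfolding vecs_def w'_def by (auto simp: minus_eq)
   have "(\<Oplus>k:{..n}. q k ** (?T ^^ k) w' i) = \<zero>" if i: "i : I" for i
   proof -
    have "(?T ^^ k) w' = (%i. (?T ^^ Suc k) w i \<ominus> l ** (?T ^^ k) w i)" for k
     using lin[OF mat_app_vecs[OF M Suc.prems(1)] Suc.prems(1) l(1), of k]
     by (simp add: w'_def funpow_swap1)
    hence "(\<Oplus>k:{..n}. q k ** (?T ^^ k) w' i) =
      (\<Oplus>k:{..n}. q k ** ((?T ^^ Suc k) w i \<ominus> l ** (?T ^^ k) w i))" by simp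
    also have "... = (\<Oplus>k:{..Suc n}. c k ** (?T ^^ k) w i)"
     using vecsD(1)[OF T[OF Suc.prems(1)]] by (intro q(3)[symmetric]) blast
    finally show ?thesis using Suc.prems(5)[OF i] by simp
   qed
   thus ?thesis using Suc.IH[of w' q] w'v False q(1,2) Suc.prems(4) by auto
  qed
 qed
 obtain i0 where i0: "i0 : I" using I by auto
 define w where "w = (%j. if j = i0 then \<one> else \<zero>)"
 have w: "w : vecs I" "w ~= (%_. \<zero>)"
  using unit_vec_in_vecs[OF i0] by (auto simp: w_def dest!: fun_cong[where x = i0])
 have "card I < card {..card I}" by simp
 then obtain c where c: "!!j. c j <: R" "EX j:{..card I}. c j ~= \<zero>"
  "!!i. i : I ==> (\<Oplus>j:{..card I}. c j ** (?T ^^ j) w i) = \<zero>"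
  using nontrivial_solution[OF I(1), of "{..card I}" "%i j. (?T ^^ j) w i"] vecsD(1)[OF T[OF w(1)]] by blast
 \<comment> \<open>The last nonzero coefficient becomes the leading one, as the root extraction
   demands.\<close>
 define n where "n = Max {j : {..card I}. c j ~= \<zero>}"
 have n: "n : {j : {..card I}. c j ~= \<zero>}" unfolding n_def by (rule Max_in) (use c(2) in auto)
 have "c j = \<zero>" if "j : {..card I} - {..n}" for j
  using Max_ge[of "{j : {..card I}. c j ~= \<zero>}" j] that unfolding n_def by fastforce
 hence "(\<Oplus>k:{..n}. c k ** (?T ^^ k) w i) = \<zero>" if "i : I" for i
  using c(1) c(3)[OF that] n vecsD(1)[OF T[OF w(1)]]
   finsum_neutral_subset[of "{..card I}" "{..n}" "%k. c k ** (?T ^^ k) w i"] by auto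
 thus thesis using P[OF w, of c n] c(1) n that by blast
qed

text \<open>An eigenspace of \<open>M\<close> is stable under every matrix commuting with
  \<open>M\<close>; being nonzero, it is the whole space by irreducibility.\<close>

lemma schur:
 assumes roots: "has_roots" and I: "finite I" "I ~= {}" and irr: "irred_rep I rho W"
  and rho: "!!w i j. rho w i j <: R" and M: "!!i j. M i j <: R"
  and comm: "!!w i j. w : W ==> i : I ==> j : I ==>
   (\<Oplus>k:I. M i k ** rho w k j) = (\<Oplus>k:I. rho w i k ** M k j)"
 obtains l where "l <: R" "!!i j. i : I ==> j : I ==> M i j = (if i = j then l else \<zero>)"
proof -
 obtain l v where l: "l <: R" "v : vecs I" "v ~= (%_. \<zero>)" "mat_app I M v = (%i. l ** v i)"
  using eigenvector[OF roots I M] .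
 define U where "U = {u : vecs I. mat_app I M u = (%i. l ** u i)}"
 have sum_app: "mat_app I M (%i. u i \<oplus> v i) i = mat_app I M u i \<oplus> mat_app I M v i"
  if "u : vecs I" "v : vecs I" for u v i
 proof -
  note [simp] = vecsD(1)[OF that(1)] vecsD(1)[OF that(2)]
  have "(\<Oplus>j:I. M i j ** (u j \<oplus> v j)) = (\<Oplus>j:I. M i j ** u j \<oplus> M i j ** v j)"
   using M by (intro finsum_cong') (auto simp: r_distr)
  also have "... = (\<Oplus>j:I. M i j ** u j) \<oplus> (\<Oplus>j:I. M i j ** v j)"
   using M by (intro finsum_addf) auto
  finally show ?thesis by (simp add: mat_app_def)
 qed
 have smult_app: "mat_app I M (%i. c ** u i) i = c ** mat_app I M u i"
  if "u : vecs I" "c <: R" for u c i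
 proof -
  note [simp] = vecsD(1)[OF that(1)] that(2)
  have "(\<Oplus>j:I. M i j ** (c ** u j)) = (\<Oplus>j:I. c ** (M i j ** u j))"
   using M by (intro finsum_cong') (auto simp: m_lcomm)
  also have "... = c ** (\<Oplus>j:I. M i j ** u j)"
   using M I by (intro finsum_rdistr[symmetric]) auto
  finally show ?thesis using that by (simp add: mat_app_def)
 qed
 have "fun_subspace U"
  unfolding fun_subspace_def U_def
 proof (intro conjI ballI CollectI; (elim CollectE conjE)?)
  show "{u : vecs I. mat_app I M u = (%i. l ** u i)} <= UNIV \<rightarrow> carrier R" by (auto dest: vecsD)
  show "(%x. \<zero>) : vecs I" by (simp add: vecs_def)
  show "mat_app I M (%x. \<zero>) = (%i. l ** \<zero>)"
   using l M by (auto simp: mat_app_def fun_eq_iff intro!: finsum_all_zero)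
 next
  fix u v assume *: "u : vecs I" "mat_app I M u = (%i. l ** u i)" "v : vecs I" "mat_app I M v = (%i. l ** v i)"
  show "(%x. u x \<oplus> v x) : vecs I" using * by (simp add: vecs_def)
  show "mat_app I M (%x. u x \<oplus> v x) = (%i. l ** (u i \<oplus> v i))"
   using * l(1) vecsD(1)[of u I] vecsD(1)[of v I] by (intro ext) (simp add: sum_app r_distr)
 next
  fix c u assume *: "c <: R" "u : vecs I" "mat_app I M u = (%i. l ** u i)"
  show "(%x. c ** u x) : vecs I" using * by (simp add: vecs_def)
  show "mat_app I M (%x. c ** u x) = (%i. l ** (c ** u i))"
   using * l(1) vecsD(1)[of u I] by (intro ext) (simp add: smult_app m_lcomm)
 qed
 moreover have "mat_app I (rho w) u : U" if w: "w : W" and u: "u : U" for w u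
 proof -
  have uv: "u : vecs I" "mat_app I M u = (%i. l ** u i)" using u by (auto simp: U_def)
  have "mat_app I M (mat_app I (rho w) u) i = l ** mat_app I (rho w) u i" for i
  proof (cases "i : I")
   case True
   have "mat_app I M (mat_app I (rho w) u) i = (\<Oplus>j:I. (\<Oplus>k:I. M i k ** rho w k j) ** u j)"
    by (rule mat_app_comp[OF I(1) M rho uv(1) True])
   also have "... = (\<Oplus>j:I. (\<Oplus>k:I. rho w i k ** M k j) ** u j)"
    using comm[OF w True] rho M vecsD(1)[OF uv(1)] by (intro finsum_cong') (auto intro!: finsum_closed)
   also have "... = mat_app I (rho w) (mat_app I M u) i"
    by (rule mat_app_comp[OF I(1) rho M uv(1) True, symmetric])
   also have "... = (\<Oplus>j:I. l ** (rho w i j ** u j))"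
    using True l(1) rho vecsD(1)[OF uv(1)] unfolding uv(2) mat_app_def
    by (auto intro!: finsum_cong' simp: m_lcomm)
   also have "... = l ** (\<Oplus>j:I. rho w i j ** u j)"
    using rho l(1) vecsD(1)[OF uv(1)] I by (intro finsum_rdistr[symmetric]) auto
   finally show ?thesis using True by (simp add: mat_app_def)
  next
   case False
   thus ?thesis using l by (simp add: mat_app_def)
  qed
  thus ?thesis using mat_app_vecs[of "rho w", OF rho uv(1)] by (simp add: U_def fun_eq_iff)
 qed
 moreover have "v : U" using l by (simp add: U_def)
 ultimately have all: "vecs I <= U" using irr l(3) unfolding irred_rep_def U_def by blast
 have "M i j = (if i = j then l else \<zero>)" if ij: "i : I" "j : I" for i j
 proof -
  let ?e = "%k. if k = j then \<one> else \<zero>"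
  have "mat_app I M ?e = (%i. l ** ?e i)" using all unit_vec_in_vecs[OF ij(2)] unfolding U_def by blast
  hence "mat_app I M ?e i = l ** ?e i" by (rule fun_cong)
  hence "(\<Oplus>k:I. M i k ** ?e k) = l ** ?e i" using ij by (simp add: mat_app_def)
  moreover have "(\<Oplus>k:I. M i k ** ?e k) = M i j"
   by (rule finsum_delta_mult(3)) (use I ij M in auto)
  ultimately show ?thesis using l(1) by simp
 qed
 thus thesis using that l(1) by blast
qed

end

subsection \<open>Linear independence of matrix coefficients\<close>

lemma (in ring) irred_repD:
 assumes "irred_rep I rho W" "fun_subspace U" "U <= vecs I"
  "!!w u. w : W ==> u : U ==> mat_app I (rho w) u : U" "EX u:U. u ~= (%_. \<zero>)"
 shows "vecs I <= U"
 using assms unfolding irred_rep_def by simp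

context field
begin

text \<open>The Frobenius--Schur argument: among the relations take one with the fewest nonzero rows.
  By irreducibility the relations supported on these rows form a copy of the representation
  space, whose rows are related by intertwiners, hence by scalars.\<close>

lemma frobenius_schur:
 assumes roots: "has_roots" and I: "finite I" and L: "finite L"
  and closed: "!!a b. a : W ==> b : W ==> mul a b : W" and one: "e : W"
  and rho[simp]: "!!k w p q. rho k w p q <: R"
  and mult: "!!k a b p q. k : L ==> a : W ==> b : W ==> p : I ==> q : I ==>
   rho k (mul a b) p q = (\<Oplus>j:I. rho k a p j ** rho k b j q)"
  and unit: "!!k p q. k : L ==> p : I ==> q : I ==> rho k e p q = (if p = q then \<one> else \<zero>)"
  and irr: "!!k. k : L ==> irred_rep I (rho k) W"
  and inter: "!!k k' g p q. k : L ==> k' : L ==> k ~= k' ==> (!!p q. g p q <: R) ==>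
   (!!w p q. w : W ==> p : I ==> q : I ==>
    (\<Oplus>j:I. g p j ** rho k w j q) = (\<Oplus>j:I. rho k' w p j ** g j q)) ==>
   p : I ==> q : I ==> g p q = \<zero>"
  and C: "!!s q. C s q <: R"
  and rel: "!!w. w : W ==> (\<Oplus>s:L \<times> I. \<Oplus>q:I. C s q ** rho (fst s) w (snd s) q) = \<zero>"
 shows "s : L \<times> I ==> q : I ==> C s q = \<zero>"
proof -
 define S where "S = L \<times> I"
 have S: "finite S" using I L by (simp add: S_def)
 \<comment> \<open>A candidate relation \<open>x\<close> has a row for each pair of a representation
   and a row index of its matrices; \<open>V x w\<close> is its value at \<open>w\<close>, and
   \<open>Y\<close> is the space of relations that hold on all of \<open>W\<close>.\<close>
 define V where "V x w = (\<Oplus>s:S. \<Oplus>q:I. x (s, q) ** rho (fst s) w (snd s) q)" for x w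
 define Y where "Y = {x : vecs (S \<times> I). ALL w:W. V x w = \<zero>}"
 have V_add: "V (%t. x t \<oplus> y t) w = V x w \<oplus> V y w" if "x : vecs (S \<times> I)" "y : vecs (S \<times> I)" for x y w
 proof -
  note [simp] = vecsD(1)[OF that(1)] vecsD(1)[OF that(2)]
  have "V (%t. x t \<oplus> y t) w = (\<Oplus>s:S. (\<Oplus>q:I. x (s, q) ** rho (fst s) w (snd s) q) \<oplus> (\<Oplus>q:I. y (s, q) ** rho (fst s) w (snd s) q))"
   unfolding V_def
  proof (rule finsum_cong')
   fix s assume "s : S"
   have "(\<Oplus>q:I. (x (s, q) \<oplus> y (s, q)) ** rho (fst s) w (snd s) q) =
    (\<Oplus>q:I. x (s, q) ** rho (fst s) w (snd s) q \<oplus> y (s, q) ** rho (fst s) w (snd s) q)"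
    by (rule finsum_cong') (auto simp: l_distr)
   thus "(\<Oplus>q:I. (x (s, q) \<oplus> y (s, q)) ** rho (fst s) w (snd s) q) = (\<Oplus>q:I. x (s, q) ** rho (fst s) w (snd s) q) \<oplus> (\<Oplus>q:I. y (s, q) ** rho (fst s) w (snd s) q)"
    by (simp add: finsum_addf)
  qed (auto intro!: finsum_closed)
  thus ?thesis unfolding V_def by (simp add: finsum_addf finsum_closed)
 qed
 have V_smult: "V (%t. c ** x t) w = c ** V x w" if "x : vecs (S \<times> I)" "c <: R" for x c w
 proof -
  note [simp] = vecsD(1)[OF that(1)] that(2)
  have "V (%t. c ** x t) w = (\<Oplus>s:S. c ** (\<Oplus>q:I. x (s, q) ** rho (fst s) w (snd s) q))"
   unfolding V_def
  proof (rule finsum_cong')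
   fix s assume "s : S"
   have "(\<Oplus>q:I. c ** x (s, q) ** rho (fst s) w (snd s) q) = (\<Oplus>q:I. c ** (x (s, q) ** rho (fst s) w (snd s) q))"
    by (rule finsum_cong') (auto simp: m_assoc)
   thus "(\<Oplus>q:I. c ** x (s, q) ** rho (fst s) w (snd s) q) = c ** (\<Oplus>q:I. x (s, q) ** rho (fst s) w (snd s) q)"
    using I by (simp add: finsum_rdistr)
  qed (auto intro!: finsum_closed)
  thus ?thesis unfolding V_def using S by (simp add: finsum_rdistr finsum_closed)
 qed
 have Ysub: "fun_subspace Y"
  unfolding fun_subspace_def Y_def
 proof (intro conjI ballI CollectI; (elim CollectE conjE)?)
  show "{x : vecs (S \<times> I). ALL w:W. V x w = \<zero>} <= UNIV \<rightarrow> carrier R" by (auto dest: vecsD)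
  show "(%x. \<zero>) : vecs (S \<times> I)" by (simp add: vecs_def)
  show "V (%x. \<zero>) w = \<zero>" for w unfolding V_def by (auto intro!: finsum_all_zero)
 next
  fix u v assume *: "u : vecs (S \<times> I)" "v : vecs (S \<times> I)"
  thus "(%x. u x \<oplus> v x) : vecs (S \<times> I)" by (simp add: vecs_def)
  fix w assume "w : W" "ALL w:W. V u w = \<zero>" "ALL w:W. V v w = \<zero>"
  thus "V (%x. u x \<oplus> v x) w = \<zero>" using V_add[OF *] by simp
 next
  fix c u assume *: "u : vecs (S \<times> I)" "c <: R"
  thus "(%x. c ** u x) : vecs (S \<times> I)" by (simp add: vecs_def)
  fix w assume "w : W" "ALL w:W. V u w = \<zero>"
  thus "V (%x. c ** u x) w = \<zero>" using V_smult[OF *] *(2) by simp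
 qed
 \<comment> \<open>Applying \<open>rho a\<close> to each row of a relation amounts to evaluating the
   relation at \<open>mul w a\<close> instead of \<open>w\<close>, so relations go to
   relations.\<close>
 define act where "act a x = (%(s, q). if s : S & q : I then \<Oplus>j:I. rho (fst s) a q j ** x (s, j) else \<zero>)" for a x
 have act_vecs: "act a x : vecs (S \<times> I)" if "x : vecs (S \<times> I)" for a x
  using vecsD(1)[OF that] unfolding vecs_def act_def by (auto intro!: finsum_closed)
 have actY: "act a x : Y" if x: "x : Y" and a: "a : W" for a x
 proof -
  have xv: "x : vecs (S \<times> I)" using x by (simp add: Y_def)
  note [simp] = vecsD(1)[OF xv]
  have "V (act a x) w = \<zero>" if w: "w : W" for w
  proof -
   have "V (act a x) w = V x (mul w a)"
    unfolding V_def
   proof (rule finsum_cong')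
    fix s assume s: "s : S"
    have sL: "fst s : L" "snd s : I" using s by (auto simp: S_def)
    have "(\<Oplus>q:I. act a x (s, q) ** rho (fst s) w (snd s) q) = (\<Oplus>q:I. \<Oplus>j:I. x (s, j) ** (rho (fst s) w (snd s) q ** rho (fst s) a q j))"
    proof (rule finsum_cong')
     fix q assume q: "q : I"
     have "act a x (s, q) ** rho (fst s) w (snd s) q = (\<Oplus>j:I. rho (fst s) a q j ** x (s, j) ** rho (fst s) w (snd s) q)"
      using s q I by (simp add: act_def finsum_ldistr)
     also have "... = (\<Oplus>j:I. x (s, j) ** (rho (fst s) w (snd s) q ** rho (fst s) a q j))"
      by (rule finsum_cong') (auto simp: m_ac)
     finally show "act a x (s, q) ** rho (fst s) w (snd s) q = (\<Oplus>j:I. x (s, j) ** (rho (fst s) w (snd s) q ** rho (fst s) a q j))" .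
    qed (auto intro!: finsum_closed)
    also have "... = (\<Oplus>j:I. \<Oplus>q:I. x (s, j) ** (rho (fst s) w (snd s) q ** rho (fst s) a q j))"
     by (rule finsum_swap) (use I in auto)
    also have "... = (\<Oplus>j:I. x (s, j) ** rho (fst s) (mul w a) (snd s) j)"
     using mult[OF sL(1) w a sL(2)] I
     by (intro finsum_cong') (auto simp: finsum_rdistr intro!: finsum_closed)
    finally show "(\<Oplus>q:I. act a x (s, q) ** rho (fst s) w (snd s) q) = (\<Oplus>q:I. x (s, q) ** rho (fst s) (mul w a) (snd s) q)" .
   qed (auto intro!: finsum_closed)
   thus ?thesis using x closed[OF w a] by (simp add: Y_def)
  qed
  thus ?thesis using act_vecs[OF xv] by (simp add: Y_def)
 qed
 \<comment> \<open>The number of nonzero rows is the quantity that is minimized.\<close>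
 define rows where "rows x = {s : S. EX q:I. x (s, q) ~= \<zero>}" for x :: "('d \<times> 'c) \<times> 'c => 'a"
 have Y_trivial: "~ (EX x:Y. x ~= (%_. \<zero>))"
 proof
  assume "EX x:Y. x ~= (%_. \<zero>)"
  then obtain z where "z : Y & z ~= (%_. \<zero>)" by blast
  from ex_has_least_nat[of "%x. x : Y & x ~= (%_. \<zero>)", OF this, of "%x. card (rows x)"]
  obtain x0 where x0: "x0 : Y" "x0 ~= (%_. \<zero>)"
   and min: "!!x. x : Y ==> x ~= (%_. \<zero>) ==> card (rows x0) <= card (rows x)" by blast
  define D where "D = rows x0"
  have x0v: "x0 : vecs (S \<times> I)" using x0 by (simp add: Y_def)
  obtain s0 i0 where s0: "s0 : S" "i0 : I" "x0 (s0, i0) ~= \<zero>"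
   using vecs_nonzeroD[OF x0v x0(2)] by auto
  have s0D: "s0 : D" using s0 by (auto simp: D_def rows_def)
  have fD: "finite D" using S by (simp add: D_def rows_def)
  define Z where "Z = {x : Y. rows x <= D}"
  have zero_off: "x (s, q) = \<zero>" if "x : Z" "s : S - D" "q : I" for x s q
   using that by (auto simp: Z_def rows_def)
  have Z_vecs: "x : vecs (S \<times> I)" if "x : Z" for x using that by (simp add: Z_def Y_def)
  \<comment> \<open>A relation supported on \<open>D\<close> that also vanishes on row
    \<open>s0\<close> has fewer nonzero rows than the minimum, so row \<open>s0\<close> determines
    all the others.\<close>
  have det: "x = (%_. \<zero>)" if x: "x : Z" and 0: "!!q. q : I ==> x (s0, q) = \<zero>" for x
  proof (rule ccontr)
   assume "x ~= (%_. \<zero>)"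
   hence "card D <= card (rows x)" using min x by (auto simp: Z_def D_def)
   moreover have "rows x <= D - {s0}" using x 0 by (auto simp: Z_def rows_def)
   ultimately show False using card_mono[of "D - {s0}" "rows x"] fD s0D card_Diff1_less[of D s0] by simp
  qed
  have Zsub: "fun_subspace Z"
   unfolding fun_subspace_def
  proof (intro conjI ballI)
   show "Z <= UNIV \<rightarrow> carrier R" using fun_subspace_closed[OF Ysub] by (auto simp: Z_def)
   show "(%x. \<zero>) : Z" using fun_subspace_zero[OF Ysub] by (simp add: Z_def rows_def)
  next
   fix u v assume uv: "u : Z" "v : Z"
   hence "(%x. u x \<oplus> v x) : Y" by (intro fun_subspace_add[OF Ysub]) (auto simp: Z_def)
   moreover have "u (s, q) \<oplus> v (s, q) = \<zero>" if "s : S - D" "q : I" for s q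
    using zero_off[OF uv(1) that] zero_off[OF uv(2) that] by simp
   ultimately show "(%x. u x \<oplus> v x) : Z" unfolding Z_def rows_def by blast
  next
   fix c u assume uv: "c <: R" "u : Z"
   hence "(%x. c ** u x) : Y" by (intro fun_subspace_smult[OF Ysub]) (auto simp: Z_def)
   moreover have "c ** u (s, q) = \<zero>" if "s : S - D" "q : I" for s q
    using zero_off[OF uv(2) that] uv(1) by simp
   ultimately show "(%x. c ** u x) : Z" unfolding Z_def rows_def by blast
  qed
  have actZ: "act a x : Z" if x: "x : Z" and a: "a : W" for a x
  proof -
   have "act a x (s, q) = \<zero>" if "s : S - D" for s q
    using zero_off[OF x that] by (auto simp: act_def intro!: finsum_all_zero)
   hence "rows (act a x) <= D" by (auto simp: rows_def)
   moreover have "act a x : Y" using actY x a by (auto simp: Z_def)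
   ultimately show ?thesis by (simp add: Z_def)
  qed
  define k0 where "k0 = fst s0"
  have k0: "k0 : L" using s0 by (auto simp: k0_def S_def)
  \<comment> \<open>The rows \<open>s0\<close> of the relations in \<open>Z\<close> form a nonzero
    stable subspace, hence all of \<open>vecs I\<close>.\<close>
  let ?U = "(%x i. x (s0, i)) ` Z"
  have "fun_subspace ?U" by (rule fun_subspace_image[OF Zsub])
  moreover have "?U <= vecs I"
  proof
   fix u assume "u : ?U"
   then obtain x where x: "x : Z" "u = (%i. x (s0, i))" by blast
   thus "u : vecs I" using vecsD[OF Z_vecs[OF x(1)]] by (simp add: vecs_def)
  qed
  moreover have "mat_app I (rho k0 w) u : ?U" if w: "w : W" and u: "u : ?U" for w u
  proof -
   obtain x where x: "x : Z" "u = (%i. x (s0, i))" using u by blast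
   have "mat_app I (rho k0 w) u = (%i. act w x (s0, i))"
    using s0 by (auto simp: fun_eq_iff mat_app_def act_def x k0_def)
   thus ?thesis using actZ[OF x(1) w] by blast
  qed
  moreover have "EX u:?U. u ~= (%_. \<zero>)"
  proof (rule bexI)
   show "(%i. x0 (s0, i)) ~= (%_. \<zero>)" using s0(3) by (auto dest: fun_cong[where x = i0])
   show "(%i. x0 (s0, i)) : ?U" using x0 by (auto simp: Z_def D_def)
  qed
  ultimately have full: "vecs I <= ?U" by (rule irred_repD[OF irr[OF k0]])
  have "EX x:Z. (%j. x (s0, j)) = (%j. if j = i then \<one> else \<zero>)" if "i : I" for i
   using full unit_vec_in_vecs[OF that] by force
  \<comment> \<open>\<open>y i\<close> is the relation whose row \<open>s0\<close> is the unit
    vector at \<open>i\<close>.\<close>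
  then obtain y where y: "!!i. i : I ==> y i : Z" "!!i. i : I ==> (%j. y i (s0, j)) = (%j. if j = i then \<one> else \<zero>)"
   by metis
  have y0: "y i (s0, j) = (if j = i then \<one> else \<zero>)" if "i : I" for i j
   using fun_cong[OF y(2)[OF that], of j] by simp
  have yc[simp]: "y i t <: R" if "i : I" for i t using fun_subspace_closed[OF Zsub y(1)[OF that]] .
  have expand: "x t = (\<Oplus>i:I. x (s0, i) ** y i t)" if x: "x : Z" for x t
  proof -
   have xc[simp]: "x t <: R" for t using fun_subspace_closed[OF Zsub x] .
   let ?s = "%t. \<Oplus>i:I. x (s0, i) ** y i t"
   have s: "?s : Z" by (rule fun_subspace_sum[OF Zsub I]) (use y(1) in auto)
   have "(%t. x t \<ominus> ?s t) = (%_. \<zero>)"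
   proof (rule det)
    show "(%t. x t \<ominus> ?s t) : Z" by (rule fun_subspace_minus[OF Zsub x s])
    fix q assume q: "q : I"
    have "?s (s0, q) = (\<Oplus>i:I. x (s0, i) ** (if q = i then \<one> else \<zero>))"
     by (rule finsum_cong') (auto simp: y0)
    also have "... = x (s0, q)" by (rule finsum_delta_mult(4)[OF I q]) simp
    finally show "x (s0, q) \<ominus> ?s (s0, q) = \<zero>" by (simp add: minus_eq r_neg)
   qed
   hence "x t \<ominus> ?s t = \<zero>" by (rule fun_cong)
   thus ?thesis by (intro minus_eq_zeroD[OF xc fun_subspace_closed[OF Zsub s]])
  qed
  \<comment> \<open>The matrix that computes row \<open>s\<close> of a relation in \<open>Z\<close>
    from its row \<open>s0\<close>. It commutes with the action.\<close>
  define g where "g s p q = (if q : I then y q (s, p) else \<zero>)" for s p q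
  have gc[simp]: "g s p q <: R" for s p q by (simp add: g_def)
  have intertwine: "(\<Oplus>j:I. g s p j ** rho k0 w j q) = (\<Oplus>j:I. rho (fst s) w p j ** g s j q)"
   if s: "s : S" and w: "w : W" and pq: "p : I" "q : I" for s w p q
  proof -
   have *: "act w (y q) : Z" using actZ y(1) pq w by blast
   have "act w (y q) (s0, i) = rho k0 w i q" if "i : I" for i
   proof -
    have "act w (y q) (s0, i) = (\<Oplus>j:I. rho k0 w i j ** (if j = q then \<one> else \<zero>))"
     using that s0 pq by (auto simp: act_def k0_def y0 intro!: finsum_cong')
    also have "... = rho k0 w i q" by (rule finsum_delta_mult(3)) (use I pq in auto)
    finally show ?thesis .
   qed
   hence "act w (y q) (s, p) = (\<Oplus>i:I. rho k0 w i q ** y i (s, p))"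
    unfolding expand[OF *, of "(s, p)"] by (intro finsum_cong') auto
   also have "... = (\<Oplus>j:I. g s p j ** rho k0 w j q)"
    by (intro finsum_cong') (auto simp: g_def m_comm)
   finally have "act w (y q) (s, p) = (\<Oplus>j:I. g s p j ** rho k0 w j q)" .
   moreover have "act w (y q) (s, p) = (\<Oplus>j:I. rho (fst s) w p j ** g s j q)"
    using s pq by (simp add: act_def g_def)
   ultimately show ?thesis by simp
  qed
  have scalar: "EX l:carrier R. ALL i:I. ALL j:I. g (k0, p) i j = (if i = j then l else \<zero>)" if p: "p : I" for p
  proof -
   have *: "(k0, p) : S" using k0 p by (simp add: S_def)
   have "!!w i j. w : W ==> i : I ==> j : I ==>
     (\<Oplus>k:I. g (k0, p) i k ** rho k0 w k j) = (\<Oplus>k:I. rho k0 w i k ** g (k0, p) k j)"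
    using intertwine[OF *] by simp
   from schur[where M = "g (k0, p)" and rho = "rho k0", OF roots I _ irr[OF k0] rho gc this] p
   obtain l where "l <: R" "!!i j. i : I ==> j : I ==> g (k0, p) i j = (if i = j then l else \<zero>)"
    by auto
   thus ?thesis by blast
  qed
  define p0 where "p0 = snd s0"
  have p0: "p0 : I" "s0 = (k0, p0)" using s0 by (auto simp: p0_def k0_def S_def)
  \<comment> \<open>Evaluating at the neutral element reads off one diagonal entry per row. The
    absence of intertwiners and the scalar form of \<open>g\<close> leave only the entry
    \<open>1\<close> in row \<open>s0\<close>, so the relation would say
    \<open>1 = 0\<close>.\<close>
  have "V (y p0) e = \<zero>" using y(1)[OF p0(1)] one by (simp add: Z_def Y_def)
  moreover have "V (y p0) e = (\<Oplus>s:S. y p0 (s, snd s))"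
   unfolding V_def
  proof (rule finsum_cong')
   fix s assume s: "s : S"
   hence sL: "fst s : L" "snd s : I" by (auto simp: S_def)
   have "(\<Oplus>q:I. y p0 (s, q) ** rho (fst s) e (snd s) q) = (\<Oplus>q:I. y p0 (s, q) ** (if snd s = q then \<one> else \<zero>))"
    using p0 unit[OF sL] by (intro finsum_cong') auto
   also have "... = y p0 (s, snd s)" by (rule finsum_delta_mult(4)) (use I sL p0 in auto)
   finally show "(\<Oplus>q:I. y p0 (s, q) ** rho (fst s) e (snd s) q) = y p0 (s, snd s)" .
  qed (use p0 in auto)
  moreover have "(\<Oplus>s:S. y p0 (s, snd s)) = (\<Oplus>s:S. if s = s0 then \<one> else \<zero>)"
  proof (rule finsum_cong')
   fix s assume s: "s : S"
   then obtain k p where kp: "s = (k, p)" "k : L" "p : I" by (auto simp: S_def)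
   show "y p0 (s, snd s) = (if s = s0 then \<one> else \<zero>)"
   proof (cases "k = k0")
    case False
    have "g s p p0 = \<zero>"
    proof (rule inter[OF k0 kp(2)])
     show "k0 ~= k" using False by simp
     show "(\<Oplus>j:I. g s p j ** rho k0 w j q) = (\<Oplus>j:I. rho k w p j ** g s j q)" if "w : W" "p : I" "q : I" for w p q
      using intertwine[OF s that] kp by simp
    qed (use kp p0 in auto)
    thus ?thesis using False kp p0 by (auto simp: g_def)
   next
    case True
    show ?thesis
    proof (cases "p = p0")
     case True
     thus ?thesis using \<open>k = k0\<close> kp p0 y0[OF p0(1)] by simp
    next
     case False
     obtain l where "ALL i:I. ALL j:I. g (k0, p) i j = (if i = j then l else \<zero>)" using scalar[OF kp(3)] by blast
     hence "g (k0, p) p p0 = \<zero>" using False kp(3) p0(1) by simp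
     thus ?thesis using False True kp p0 by (simp add: g_def)
    qed
   qed
  qed auto
  moreover have "(\<Oplus>s:S. if s = s0 then \<one> else \<zero>) = \<one>" by (rule finsum_delta(1)[OF S s0(1)]) simp
  ultimately show False by simp
 qed
 define x where "x = (%(s, q). if s : S & q : I then C s q else \<zero>)"
 have xv: "x : vecs (S \<times> I)" using C by (auto simp: x_def vecs_def)
 have "V x w = (\<Oplus>s:L \<times> I. \<Oplus>q:I. C s q ** rho (fst s) w (snd s) q)" for w
  unfolding V_def S_def[symmetric]
  using C by (auto simp: x_def intro!: finsum_cong' finsum_closed)
 hence "x : Y" using xv rel by (simp add: Y_def)
 hence "x = (%_. \<zero>)" using Y_trivial by blast
 hence *: "x (s, q) = \<zero>" for s q by simp
 show "C s q = \<zero>" if "s : L \<times> I" "q : I" for s q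
  using *[of s q] that by (simp add: x_def S_def)
qed

end

section \<open>Irreducible constituents of function spaces on monoids\<close>

context field
begin

lemma finsum_finsum_cong:
 assumes "!!p q. p : I ==> q : J ==> f p q = g p q" "!!p q. p : I ==> q : J ==> g p q <: R"
 shows "(\<Oplus>p:I. \<Oplus>q:J. f p q) = (\<Oplus>p:I. \<Oplus>q:J. g p q)"
 using assms by (intro finsum_cong' refl) (auto intro!: finsum_closed)

text \<open>A translation-stable function space of finite dimension contains a minimal stable
  subspace, on which \<open>W\<close> acts irreducibly. In a basis dual to evaluations at points of
  \<open>W\<close> the matrix entries are values \<open>u (mul p a)\<close> of functions in
  \<open>V\<close>, so they inherit properties of \<open>V\<close>; independence is the
  Frobenius--Schur argument for a single representation.\<close>

lemma burnside:
 assumes roots: "has_roots"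
  and closed: "!!a b. a : W ==> b : W ==> mul a b : W" and one: "e : W"
  and assoc: "!!a b c. a : W ==> b : W ==> c : W ==> mul (mul a b) c = mul a (mul b c)"
  and neutral: "!!a. a : W ==> mul a e = a"
  and V: "fun_subspace V"
  and translate: "!!a u. a : W ==> u : V ==> (%x. if x : W then u (mul x a) else \<zero>) : V"
  and E: "finite E" "E <= W" and det: "ALL u:V. (ALL y:E. u y = \<zero>) --> u = (%_. \<zero>)"
  and nonzero: "EX u:V. u ~= (%_. \<zero>)"
 obtains I rho where "finite I" "I ~= {}" "I <= W" "!!a p q. rho a p q <: R"
  "!!a b p q. a : W ==> b : W ==> p : I ==> q : I ==> rho (mul a b) p q = (\<Oplus>j:I. rho a p j ** rho b j q)"
  "!!p q. p : I ==> q : I ==> rho e p q = (if p = q then \<one> else \<zero>)"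
  "!!q. q : I ==> EX u:V. ALL p:I. ALL a:W. rho a p q = u (mul p a)"
  "!!C p q. (!!p q. C p q <: R) ==> (!!a. a : W ==> (\<Oplus>p:I. \<Oplus>q:I. C p q ** rho a p q) = \<zero>) ==>
   p : I ==> q : I ==> C p q = \<zero>"
proof -
 define tr where "tr a u = (%x. if x : W then u (mul x a) else \<zero>)" for a and u :: "'c => 'a"
 define stable where "stable U \<longleftrightarrow> fun_subspace U & U <= V & (ALL a:W. ALL u:U. tr a u : U) & (EX u:U. u ~= (%_. \<zero>))" for U
 define basis where "basis U I b \<longleftrightarrow> I <= E & (ALL i:I. b i : U) & (ALL i:I. ALL j:I. b i j = (if i = j then \<one> else \<zero>)) &
  (ALL u:U. u = (%x. \<Oplus>i:I. u i ** b i x))" for U I and b :: "'c => 'c => 'a"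
 have ex_basis: "EX I b. I <= E' & basis U I b"
  if sub: "fun_subspace U" and E': "E' <= E" and d: "ALL u:U. (ALL y:E'. u y = \<zero>) --> u = (%_. \<zero>)" for U E'
 proof -
  obtain I b where "I <= E'" "!!i. i : I ==> b i : U"
   "!!i j. i : I ==> j : I ==> b i j = (if i = j then \<one> else \<zero>)"
   "!!u. u : U ==> u = (%x. \<Oplus>i:I. u i ** b i x)"
   using dual_basis_of_evaluations[OF sub finite_subset[OF E' E(1)] d] by blast
  thus ?thesis using E' unfolding basis_def by (intro exI[of _ I] exI[of _ b] conjI ballI) auto
 qed
 have stV: "stable V" using V translate nonzero by (simp add: stable_def tr_def)
 obtain I1 b1 where "basis V I1 b1" using ex_basis[OF V order_refl det] by blast
 hence "stable (fst (V, I1)) & (EX b. basis (fst (V, I1)) (snd (V, I1)) b)" using stV by auto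
 \<comment> \<open>A stable space and its set of evaluation points are minimized together, so
   \<open>card I\<close> is the least dimension of a stable space.\<close>
 from ex_has_least_nat[of "%z. stable (fst z) & (EX b. basis (fst z) (snd z) b)", OF this, of "%z. card (snd z)"]
 obtain U I b where st: "stable U" and bs: "basis U I b"
  and min: "!!U' I' b'. stable U' ==> basis U' I' b' ==> card I <= card I'" by fastforce
 have I: "finite I" using bs E(1) finite_subset by (auto simp: basis_def)
 have IW: "I <= W" using bs E(2) by (auto simp: basis_def)
 have Usub: "fun_subspace U" using st by (simp add: stable_def)
 have bU: "b i : U" if "i : I" for i using bs that by (simp add: basis_def)
 have bd: "b i j = (if i = j then \<one> else \<zero>)" if "i : I" "j : I" for i j using bs that by (simp add: basis_def)
 have expand: "u x = (\<Oplus>i:I. u i ** b i x)" if "u : U" for u x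
 proof -
  have "u = (%x. \<Oplus>i:I. u i ** b i x)" using bs that unfolding basis_def by blast
  thus ?thesis by (rule fun_cong)
 qed
 have bc[simp]: "b i x <: R" if "i : I" for i x using fun_subspace_closed[OF Usub bU[OF that]] .
 have trU: "tr a u : U" if "a : W" "u : U" for a u using st that by (simp add: stable_def)
 \<comment> \<open>The coordinate at \<open>p\<close> of the translate of the basis function
   \<open>b q\<close> by \<open>a\<close>.\<close>
 define rho where "rho a p q = (if p : I & q : I then b q (mul p a) else \<zero>)" for a p q
 have rhoc[simp]: "rho a p q <: R" for a p q by (simp add: rho_def)
 have tr_b: "tr a (b q) x = (\<Oplus>p:I. rho a p q ** b p x)" if "a : W" "q : I" for a q x
  unfolding expand[OF trU[OF that(1) bU[OF that(2)]], of x]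
  by (rule finsum_cong') (use that IW in "auto simp: tr_def rho_def")
 have mult: "rho (mul a c) p q = (\<Oplus>j:I. rho a p j ** rho c j q)" if "a : W" "c : W" "p : I" "q : I" for a c p q
 proof -
  have pW: "p : W" "mul p a : W" using that IW closed by auto
  have "rho (mul a c) p q = tr c (b q) (mul p a)"
   using that pW by (simp add: rho_def tr_def assoc)
  also have "... = (\<Oplus>j:I. rho c j q ** b j (mul p a))" by (rule tr_b) (use that in auto)
  also have "... = (\<Oplus>j:I. rho a p j ** rho c j q)"
   by (rule finsum_cong') (use that in "auto simp: rho_def m_comm")
  finally show ?thesis .
 qed
 have unit: "rho e p q = (if p = q then \<one> else \<zero>)" if "p : I" "q : I" for p q
  using that IW bd[OF that(2,1)] by (auto simp: rho_def neutral subset_iff)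
 \<comment> \<open>\<open>lc\<close> turns coordinate vectors into functions in \<open>U\<close>. It
   carries a stable space of vectors to a stable space of functions, to which minimality
   applies.\<close>
 define lc where "lc w = (%x. \<Oplus>i:I. w i ** b i x)" for w
 have lc_at: "lc w p = w p" if "p : I" "!!i. w i <: R" for w p
 proof -
  have "lc w p = (\<Oplus>i:I. w i ** (if i = p then \<one> else \<zero>))"
   unfolding lc_def by (rule finsum_cong') (use that bd in auto)
  also have "... = w p" by (rule finsum_delta_mult(3)) (use I that in auto)
  finally show ?thesis .
 qed
 have irr: "irred_rep I rho W"
  unfolding irred_rep_def
 proof (intro allI impI, elim conjE)
  fix U' assume U': "fun_subspace U'" "U' <= vecs I" "ALL w:W. ALL u:U'. mat_app I (rho w) u : U'" "EX u:U'. u ~= (%_. \<zero>)"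
  have wc[simp]: "w i <: R" if "w : U'" for w i using fun_subspace_closed[OF U'(1) that] .
  have lcU: "lc w : U" if "w : U'" for w
   unfolding lc_def by (rule fun_subspace_sum[OF Usub I]) (use that bU in auto)
  have sub: "fun_subspace (lc ` U')"
   unfolding fun_subspace_def
  proof (intro conjI ballI)
   show "lc ` U' <= UNIV \<rightarrow> carrier R" using fun_subspace_closed[OF Usub lcU] by auto
   show "(%x. \<zero>) : lc ` U'"
    by (rule rev_image_eqI[OF fun_subspace_zero[OF U'(1)]]) (auto simp: lc_def intro!: finsum_all_zero[symmetric])
  next
   fix u v assume "u : lc ` U'" "v : lc ` U'"
   then obtain x y where xy: "x : U'" "y : U'" "u = lc x" "v = lc y" by blast
   have "lc (%i. x i \<oplus> y i) z = lc x z \<oplus> lc y z" for z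
   proof -
    have "lc (%i. x i \<oplus> y i) z = (\<Oplus>i:I. x i ** b i z \<oplus> y i ** b i z)"
     unfolding lc_def by (rule finsum_cong') (use xy in "auto simp: l_distr")
    thus ?thesis unfolding lc_def using xy by (simp add: finsum_addf)
   qed
   thus "(%i. u i \<oplus> v i) : lc ` U'"
    by (intro rev_image_eqI[OF fun_subspace_add[OF U'(1) xy(1,2)]]) (auto simp: xy)
  next
   fix c u assume c: "c <: R" and "u : lc ` U'"
   then obtain x where x: "x : U'" "u = lc x" by blast
   have "lc (%i. c ** x i) z = c ** lc x z" for z
   proof -
    have "lc (%i. c ** x i) z = (\<Oplus>i:I. c ** (x i ** b i z))"
     unfolding lc_def by (rule finsum_cong') (use x c in "auto simp: m_assoc")
    thus ?thesis unfolding lc_def using x c I by (simp add: finsum_rdistr)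
   qed
   thus "(%i. c ** u i) : lc ` U'"
    by (intro rev_image_eqI[OF fun_subspace_smult[OF U'(1) c x(1)]]) (auto simp: x)
  qed
  have "tr a u : lc ` U'" if a: "a : W" and u: "u : lc ` U'" for a u
  proof -
   obtain w where w: "w : U'" "u = lc w" using u by blast
   have "tr a u x = lc (mat_app I (rho a) w) x" for x
   proof (cases "x : W")
    case True
    have "tr a u x = (\<Oplus>q:I. w q ** tr a (b q) x)" using True by (simp add: w tr_def lc_def)
    also have "... = (\<Oplus>q:I. w q ** (\<Oplus>p:I. rho a p q ** b p x))"
     by (rule finsum_cong') (use a w tr_b in "auto intro!: finsum_closed")
    also have "... = (\<Oplus>q:I. \<Oplus>p:I. rho a p q ** w q ** b p x)"
     by (rule finsum_cong') (use w I in "auto simp: finsum_rdistr m_ac intro!: finsum_closed finsum_cong'")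
    also have "... = (\<Oplus>p:I. \<Oplus>q:I. rho a p q ** w q ** b p x)"
     by (rule finsum_swap) (use I w in auto)
    also have "... = (\<Oplus>p:I. mat_app I (rho a) w p ** b p x)"
     by (rule finsum_cong') (use I w in "auto simp: mat_app_def finsum_ldistr intro!: finsum_closed")
    finally show ?thesis by (simp add: lc_def)
   next
    case False
    \<comment> \<open>The translation by the neutral element is the identity on \<open>U\<close> but
      cuts functions off outside \<open>W\<close>, so the basis functions vanish there.\<close>
    have "b p x = \<zero>" if p: "p : I" for p
    proof -
     have "tr e (b p) = b p"
     proof -
      have "tr e (b p) z = (\<Oplus>i:I. rho e i p ** b i z)" for z by (rule tr_b[OF one p])
      also have "(\<Oplus>i:I. rho e i p ** b i z) = (\<Oplus>i:I. (if i = p then \<one> else \<zero>) ** b i z)" for z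
       by (rule finsum_cong') (use unit p in auto)
      also have "(\<Oplus>i:I. (if i = p then \<one> else \<zero>) ** b i z) = b p z" for z
       by (rule finsum_delta_mult(1)) (use I p in auto)
      finally show ?thesis by blast
     qed
     thus ?thesis using False by (metis tr_def)
    qed
    moreover have "mat_app I (rho a) w : vecs I" using mat_app_vecs[of "rho a" w I] w U'(2) by auto
    ultimately show ?thesis using False vecsD(1)[of "mat_app I (rho a) w" I]
     by (auto simp: tr_def lc_def intro!: finsum_all_zero[symmetric])
   qed
   hence "tr a u = lc (mat_app I (rho a) w)" by blast
   thus ?thesis using U'(3) a w by blast
  qed
  moreover have "EX u:lc ` U'. u ~= (%_. \<zero>)"
  proof -
   obtain w where w: "w : U'" "w ~= (%_. \<zero>)" using U'(4) by blast
   then obtain p where "p : I" "w p ~= \<zero>" using U'(2) vecs_nonzeroD[of w I] by blast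
   hence "lc w p ~= \<zero>" using lc_at w by simp
   hence "lc w ~= (%_. \<zero>)" by (metis (full_types))
   thus ?thesis using w by blast
  qed
  moreover have "lc ` U' <= V" using lcU st by (auto simp: stable_def)
  ultimately have st': "stable (lc ` U')" using sub by (simp add: stable_def)
  have IE: "I <= E" using bs by (simp add: basis_def)
  have det': "u x = \<zero>" if "u : lc ` U'" "ALL y:I. u y = \<zero>" for u x
  proof -
   have "u x = (\<Oplus>i:I. u i ** b i x)" using that lcU by (intro expand) auto
   thus ?thesis using that by (simp add: finsum_all_zero)
  qed
  obtain I' b' where b': "I' <= I" "basis (lc ` U') I' b'"
   using ex_basis[OF sub IE] det' by (metis (no_types, lifting) ext)
  \<comment> \<open>The image has a dual basis at points among \<open>I\<close>, and by minimality
    it cannot have fewer points than \<open>U\<close>.\<close>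
  have I': "I' = I" using b'(1) min[OF st' b'(2)] I by (simp add: card_seteq)
  show "vecs I <= U'"
  proof
   fix v assume v: "v : vecs I"
   note [simp] = vecsD(1)[OF v]
   have b'U: "b' i : lc ` U'" "!!j. j : I ==> b' i j = (if i = j then \<one> else \<zero>)" if "i : I" for i
    using b' that unfolding basis_def I' by simp_all
   have "(%x. \<Oplus>i:I. v i ** b' i x) : lc ` U'"
    by (rule fun_subspace_sum[OF sub I]) (use b'U in auto)
   then obtain w where w: "w : U'" "(%x. \<Oplus>i:I. v i ** b' i x) = lc w" by blast
   have "v p = w p" for p
   proof (cases "p : I")
    case True
    have "(\<Oplus>i:I. v i ** b' i p) = (\<Oplus>i:I. v i ** (if i = p then \<one> else \<zero>))"
     by (rule finsum_cong') (use True b'U in auto)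
    also have "... = v p" by (rule finsum_delta_mult(3)) (use I True in auto)
    finally show ?thesis using fun_cong[OF w(2), of p] lc_at[OF True] w(1) by simp
   next
    case False
    thus ?thesis using vecsD(2)[OF v False] vecsD(2)[of w I p] w(1) U'(2) by auto
   qed
   hence "v = w" by blast
   thus "v : U'" using w by simp
  qed
 qed
 show thesis
 proof (rule that[of I rho])
  show "finite I" "I <= W" by (rule I, rule IW)
  show "I ~= {}"
  proof
   assume "I = {}"
   hence "u x = \<zero>" if "u : U" for u x using expand[OF that, of x] by simp
   thus False using st by (auto simp: stable_def fun_eq_iff)
  qed
  show "EX u:V. ALL p:I. ALL a:W. rho a p q = u (mul p a)" if "q : I" for q
   using that bU[OF that] st by (intro bexI[of _ "b q"]) (auto simp: rho_def stable_def)
 next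
  fix C p q assume C: "!!p q. C p q <: R" "p : I" "q : I"
   and rel: "!!a. a : W ==> (\<Oplus>p:I. \<Oplus>q:I. C p q ** rho a p q) = \<zero>"
  define C' :: "unit \<times> 'c => 'c => 'a" where "C' s q = C (snd s) q" for s q
  have "(\<Oplus>s:{()} \<times> I. \<Oplus>q:I. C' s q ** rho w (snd s) q) = \<zero>" if "w : W" for w
  proof -
   have "{()} \<times> I = Pair () ` I" by auto
   moreover have "finsum R (%s. \<Oplus>q:I. C' s q ** rho w (snd s) q) (Pair () ` I) = (\<Oplus>p:I. \<Oplus>q:I. C' (Pair () p) q ** rho w p q)"
    using C by (subst finsum_reindex) (auto simp: C'_def inj_on_def intro!: finsum_closed)
   ultimately show ?thesis using rel[OF that] by (simp add: C'_def)
  qed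
  hence "C' ((), p) q = \<zero>"
   using C frobenius_schur[OF roots I, of "{()}" W mul e "%_. rho" C' "((), p)" q] closed one mult unit irr
   by (simp add: C'_def)
  thus "C p q = \<zero>" by (simp add: C'_def)
 qed (use mult unit in auto)
qed

text \<open>For commutative \<open>W\<close> the constituent is one-dimensional: equality of two
  products gives linear relations between the matrix entries, and these entries are
  independent.\<close>

lemma burnside_commutative:
 assumes roots: "has_roots"
  and closed: "!!a b. a : W ==> b : W ==> mul a b : W" and one: "e : W"
  and assoc: "!!a b c. a : W ==> b : W ==> c : W ==> mul (mul a b) c = mul a (mul b c)"
  and neutral: "!!a. a : W ==> mul a e = a"
  and comm: "!!a b. a : W ==> b : W ==> mul a b = mul b a"
  and V: "fun_subspace V"
  and translate: "!!a u. a : W ==> u : V ==> (%x. if x : W then u (mul x a) else \<zero>) : V"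
  and E: "finite E" "E <= W" and det: "ALL u:V. (ALL y:E. u y = \<zero>) --> u = (%_. \<zero>)"
  and nonzero: "EX u:V. u ~= (%_. \<zero>)"
 obtains chi u p where "u : V" "p : W" "!!a. a : W ==> chi a = u (mul p a)" "!!a. chi a <: R" "chi e = \<one>"
  "!!a b. a : W ==> b : W ==> chi (mul a b) = chi a ** chi b"
proof (rule burnside[where W = W and mul = mul and e = e and V = V and E = E, OF roots closed one assoc neutral V translate E det nonzero])
 fix I rho assume I: "finite I" "I ~= {}" "I <= W" and rho[simp]: "!!a p q. rho a p q <: R"
  and mult: "!!a b p q. a : W ==> b : W ==> p : I ==> q : I ==> rho (mul a b) p q = (\<Oplus>j:I. rho a p j ** rho b j q)"
  and unit: "!!p q. p : I ==> q : I ==> rho e p q = (if p = q then \<one> else \<zero>)"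
  and coeff: "!!q. q : I ==> EX u:V. ALL p:I. ALL a:W. rho a p q = u (mul p a)"
  and indep: "!!C p q. (!!p q. C p q <: R) ==> (!!a. a : W ==> (\<Oplus>p:I. \<Oplus>q:I. C p q ** rho a p q) = \<zero>) ==>
   p : I ==> q : I ==> C p q = \<zero>"
 obtain p where p: "p : I" using I by blast
 have "k = p" if k: "k : I" for k
 proof (rule ccontr)
  assume kp: "k ~= p"
  have z: "rho b k p = \<zero>" if b: "b : W" for b
  proof -
   \<comment> \<open>With \<open>b\<close> fixed, these are the coefficients of the difference of
     the entries at \<open>(p, p)\<close> of \<open>rho (mul a b)\<close> and
     \<open>rho (mul b a)\<close>, as a linear form in the entries of \<open>rho a\<close>.\<close>
   define C where "C x y = (if x = p then rho b y p else \<zero>) \<oplus> \<ominus> (if y = p then rho b p x else \<zero>)" for x y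
   have "(\<Oplus>x:I. \<Oplus>y:I. C x y ** rho a x y) = \<zero>" if a: "a : W" for a
   proof -
    have "(\<Oplus>x:I. \<Oplus>y:I. C x y ** rho a x y) =
     (\<Oplus>x:I. (\<Oplus>y:I. (if x = p then rho b y p else \<zero>) ** rho a x y) \<oplus> \<ominus> (\<Oplus>y:I. (if y = p then \<one> else \<zero>) ** (rho b p x ** rho a x y)))"
    proof (rule finsum_cong')
     fix x assume "x : I"
     have "(\<Oplus>y:I. C x y ** rho a x y) = (\<Oplus>y:I. (if x = p then rho b y p else \<zero>) ** rho a x y \<oplus> \<ominus> ((if y = p then \<one> else \<zero>) ** (rho b p x ** rho a x y)))"
      by (rule finsum_cong') (auto simp: C_def l_distr l_minus)
     also have "... = (\<Oplus>y:I. (if x = p then rho b y p else \<zero>) ** rho a x y) \<oplus> (\<Oplus>y:I. \<ominus> ((if y = p then \<one> else \<zero>) ** (rho b p x ** rho a x y)))"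
      by (rule finsum_addf) auto
     also have "(\<Oplus>y:I. \<ominus> ((if y = p then \<one> else \<zero>) ** (rho b p x ** rho a x y))) = \<ominus> (\<Oplus>y:I. (if y = p then \<one> else \<zero>) ** (rho b p x ** rho a x y))"
      by (rule finsum_ominus) auto
     finally show "(\<Oplus>y:I. C x y ** rho a x y) = (\<Oplus>y:I. (if x = p then rho b y p else \<zero>) ** rho a x y) \<oplus> \<ominus> (\<Oplus>y:I. (if y = p then \<one> else \<zero>) ** (rho b p x ** rho a x y))" .
    qed (auto intro!: finsum_closed)
    also have "... = (\<Oplus>x:I. (if x = p then \<one> else \<zero>) ** (\<Oplus>y:I. rho b y p ** rho a x y) \<oplus> \<ominus> (rho b p x ** rho a x p))"
    proof (rule finsum_cong')
     fix x assume x: "x : I"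
     have 1: "(\<Oplus>y:I. (if x = p then rho b y p else \<zero>) ** rho a x y) = (if x = p then \<one> else \<zero>) ** (\<Oplus>y:I. rho b y p ** rho a x y)"
      by (auto simp: finsum_closed intro!: finsum_all_zero)
     have 2: "(\<Oplus>y:I. (if y = p then \<one> else \<zero>) ** (rho b p x ** rho a x y)) = rho b p x ** rho a x p"
      by (rule finsum_delta_mult(1)) (use I p in auto)
     show "(\<Oplus>y:I. (if x = p then rho b y p else \<zero>) ** rho a x y) \<oplus> \<ominus> (\<Oplus>y:I. (if y = p then \<one> else \<zero>) ** (rho b p x ** rho a x y)) =
      (if x = p then \<one> else \<zero>) ** (\<Oplus>y:I. rho b y p ** rho a x y) \<oplus> \<ominus> (rho b p x ** rho a x p)"
      unfolding 1 2 ..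
    qed (auto intro!: finsum_closed)
    also have "... = (\<Oplus>x:I. (if x = p then \<one> else \<zero>) ** (\<Oplus>y:I. rho b y p ** rho a x y)) \<oplus> (\<Oplus>x:I. \<ominus> (rho b p x ** rho a x p))"
     by (rule finsum_addf) (auto intro!: finsum_closed)
    also have "(\<Oplus>x:I. \<ominus> (rho b p x ** rho a x p)) = \<ominus> (\<Oplus>x:I. rho b p x ** rho a x p)"
     by (rule finsum_ominus) auto
    also have "(\<Oplus>x:I. rho b p x ** rho a x p) = rho (mul b a) p p" by (rule mult[symmetric]) (use a b p in auto)
    also have "(\<Oplus>x:I. (if x = p then \<one> else \<zero>) ** (\<Oplus>y:I. rho b y p ** rho a x y)) = (\<Oplus>y:I. rho b y p ** rho a p y)"
     by (rule finsum_delta_mult(1)) (use I p in "auto intro!: finsum_closed")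
    also have "... = (\<Oplus>y:I. rho a p y ** rho b y p)" by (rule finsum_cong') (auto simp: m_comm)
    also have "... = rho (mul a b) p p" by (rule mult[symmetric]) (use a b p in auto)
    finally show ?thesis by (simp add: comm[OF a b] r_neg)
   qed
   hence "C p k = \<zero>" using indep[of C p k] p k by (simp add: C_def)
   thus ?thesis using kp by (simp add: C_def)
  qed
  \<comment> \<open>The vanishing of the entry \<open>(k, p)\<close> for all \<open>b\<close> is
    itself a relation, with coefficient one.\<close>
  define C where "C x y = (if x = k & y = p then \<one> else \<zero>)" for x y
  have "(\<Oplus>x:I. \<Oplus>y:I. C x y ** rho a x y) = \<zero>" if "a : W" for a
   using z[OF that] by (auto simp: C_def intro!: finsum_all_zero)
  moreover have "C x y <: R" for x y by (simp add: C_def)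
  ultimately have "C k p = \<zero>" using indep[of C k p] p k by blast
  thus False by (simp add: C_def)
 qed
 hence Ip: "I = {p}" using p by blast
 obtain u where u: "u : V" "!!a. a : W ==> rho a p p = u (mul p a)" using coeff[OF p] p by blast
 have "rho (mul a b) p p = rho a p p ** rho b p p" if "a : W" "b : W" for a b
  using mult[OF that p p] by (simp add: Ip)
 thus thesis
  by (intro that[of u p "%a. rho a p p"]) (use u p I unit in auto)
qed

end

section \<open>Algebraic dependence\<close>

text \<open>The exchange argument for an abstract closure operator: members of \<open>ts\<close>
  replace members of \<open>Y\<close> one by one. Independence is tested along a list, each member
  against the earlier ones only.\<close>

lemma steinitz:
 fixes cl :: "'a set => 'a set"
 assumes mono: "!!V Y. V <= Y ==> Y <= S ==> cl V <= cl Y"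
  and ext: "!!V. V <= S ==> V <= cl V"
  and idem: "!!V Y. V <= S ==> Y <= cl V ==> cl Y <= cl V"
  and exchange: "!!V x y. V <= S ==> x : S ==> y : cl (insert x V) ==> y ~: cl V ==> x : cl (insert y V)"
  and S: "set ts <= S" "Y <= S" and Y: "finite Y" and gen: "set ts <= cl Y"
  and indep: "!!i. i < length ts ==> ts ! i ~: cl (set (take i ts))"
 shows "length ts <= card Y"
proof -
 have "EX Z<=Y. card Z + k = card Y & Y <= cl (set (take k ts) Un Z)" if "k <= length ts" for k
  using that
 proof (induction k)
  case 0
  thus ?case using ext[OF S(2)] by (intro exI[of _ Y]) auto
 next
  case (Suc k)
  then obtain Z where Z: "Z <= Y" "card Z + k = card Y" "Y <= cl (set (take k ts) Un Z)" by auto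
  let ?T = "set (take k ts)" and ?t = "ts ! k"
  have T: "?T <= S" using S(1) set_take_subset by fast
  have tS: "?t : S" and tset: "?t : set ts" using Suc.prems S(1) by auto
  have fZ: "finite Z" using Z(1) Y finite_subset by blast
  have TZ: "?T Un Z <= S" using T Z(1) S(2) by auto
  have tZ: "?t : cl (?T Un Z)" using idem[OF TZ Z(3)] gen tset by auto
  have "?t ~: cl (?T Un {})" using indep[of k] Suc.prems by simp
  \<comment> \<open>A largest subset \<open>Z'\<close> of \<open>Z\<close> that does not yet capture
    the new element captures it as soon as any further \<open>z\<close> is added. Exchange then lets
    the new element replace \<open>z\<close>.\<close>
  hence "EX Z'. Z' <= Z & ?t ~: cl (?T Un Z')" by blast
  then obtain Z' where Z': "Z' <= Z" "?t ~: cl (?T Un Z')"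
   and max: "!!W. W <= Z ==> ?t ~: cl (?T Un W) ==> card W <= card Z'"
   using ex_has_greatest_nat[of "%W. W <= Z & ?t ~: cl (?T Un W)" _ card "card Z + 1"] fZ card_mono
   by (metis (no_types, lifting) le_imp_less_Suc Suc_eq_plus1 less_imp_le)
  have "Z' ~= Z" using Z' tZ by auto
  then obtain z where z: "z : Z" "z ~: Z'" using Z' by auto
  have fZ': "finite Z'" using Z'(1) fZ finite_subset by blast
  have "?t : cl (?T Un insert z Z')"
   using max[of "insert z Z'"] z Z' fZ' by fastforce
  hence "?t : cl (insert z (?T Un Z'))" by simp
  moreover have "?T Un Z' <= S" "z : S" using TZ Z' z by auto
  ultimately have "z : cl (insert ?t (?T Un Z'))" using exchange Z'(2) by blast
  moreover have tk: "set (take (Suc k) ts) = insert ?t ?T"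
   using Suc.prems by (simp add: take_Suc_conv_app_nth)
  moreover have big: "set (take (Suc k) ts) Un (Z - {z}) <= S" using tk tS TZ by auto
  ultimately have zc: "z : cl (set (take (Suc k) ts) Un (Z - {z}))"
   using mono[OF _ big, of "insert ?t (?T Un Z')"] Z' z by auto
  have "?T Un Z <= cl (set (take (Suc k) ts) Un (Z - {z}))"
   using zc ext[OF big] tk by auto
  hence "Y <= cl (set (take (Suc k) ts) Un (Z - {z}))" using idem[OF big] Z(3) by blast
  moreover have "card (Z - {z}) + Suc k = card Y" using Z(2) z fZ by (metis card_Suc_Diff1 add_Suc_right add_Suc)
  ultimately show ?case using Z(1) by (intro exI[of _ "Z - {z}"]) auto
 qed
 from this[of "length ts"] show ?thesis by auto
qed

section \<open>Algebraic elements over subrings\<close>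

context ring
begin

lemma eval_eq_finsum:
 assumes "set p <= carrier R" "x <: R"
 shows "eval p x = (\<Oplus>i:{..<length p}. coeff p i ** x [^] i)"
 using assms(1)
proof (induction p)
 case (Cons a p)
 note [simp] = assms(2)
 have "(\<Oplus>i:{..<length (a # p)}. coeff (a # p) i ** x [^] i) =
  coeff (a # p) (length p) ** x [^] length p \<oplus> (\<Oplus>i:{..<length p}. coeff (a # p) i ** x [^] i)"
  unfolding length_Cons lessThan_Suc
  by (rule finsum_insert) (use Cons.prems coeff_in_carrier[of "a # p"] in "auto simp del: coeff.simps")
 also have "(\<Oplus>i:{..<length p}. coeff (a # p) i ** x [^] i) = (\<Oplus>i:{..<length p}. coeff p i ** x [^] i)"
  by (rule finsum_cong') (use Cons.prems in auto)
 finally show ?case using Cons by simp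
qed simp

lemma eval_map_rev:
 assumes "!!i. c i <: R" "x <: R"
 shows "eval (map c (rev [0..<n])) x = (\<Oplus>i:{..<n}. c i ** x [^] i)"
proof (induction n)
 case (Suc n)
 have "(\<Oplus>i:{..<Suc n}. c i ** x [^] i) = c n ** x [^] n \<oplus> (\<Oplus>i:{..<n}. c i ** x [^] i)"
  unfolding lessThan_Suc by (rule finsum_insert) (use assms in auto)
 thus ?case using Suc by simp
qed simp

text \<open>The base may be a subring, so that generated rings serve as base without forming their
  fractions.\<close>

definition alg_over :: "'a set => 'a set" where
 "alg_over A = {u : carrier R. (algebraic over A) u}"

end

context domain
begin

lemma coeff_in_set: "set p <= A ==> \<zero> : A ==> coeff p i : A"
 by (induction p) auto

text \<open>Polynomials are traded for coefficient sequences without a condition on the leading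
  term, which makes it easy to rearrange relations as sums.\<close>

lemma algebraic_iff:
 assumes A: "subring A R" and u: "u <: R"
 shows "(algebraic over A) u \<longleftrightarrow>
  (EX (n::nat) c. (ALL i. c i : A) & (EX i<n. c i ~= \<zero>) & (\<Oplus>i:{..<n}. c i ** u [^] i) = \<zero>)"
proof
 assume "(algebraic over A) u"
 then obtain p where p: "p : carrier (A[X])" "p ~= []" "eval p u = \<zero>" using algebraicE[OF A u] by blast
 hence pp: "polynomial A p" by (simp add: univ_poly_def)
 have "set p <= A" using polynomial_incl[OF pp] .
 moreover have "coeff p (length p - 1) ~= \<zero>"
  using pp p(2) by (cases p) (auto simp: polynomial_def)
 moreover have "length p - 1 < length p" using p(2) by simp
 moreover have "(\<Oplus>i:{..<length p}. coeff p i ** u [^] i) = \<zero>"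
  using eval_eq_finsum[of p u] p(3) u subringE(1)[OF A] \<open>set p <= A\<close> by auto
 moreover have "ALL i. coeff p i : A" using coeff_in_set[OF \<open>set p <= A\<close>] subringE(2)[OF A] by blast
 ultimately show "EX (n::nat) c. (ALL i. c i : A) & (EX i<n. c i ~= \<zero>) & (\<Oplus>i:{..<n}. c i ** u [^] i) = \<zero>"
  by blast
next
 assume "EX (n::nat) c. (ALL i. c i : A) & (EX i<n. c i ~= \<zero>) & (\<Oplus>i:{..<n}. c i ** u [^] i) = \<zero>"
 then obtain n :: nat and c i where c: "!!i. c i : A" "i < n" "c i ~= \<zero>" "(\<Oplus>i:{..<n}. c i ** u [^] i) = \<zero>" by blast
 let ?p = "map c (rev [0..<n])"
 have cc: "c i <: R" for i using c(1) subringE(1)[OF A] by auto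
 have "eval (normalize ?p) u = \<zero>"
  using eval_normalize[of ?p u] eval_map_rev[of c u n] cc c(4) u by auto
 moreover have "normalize ?p : carrier (A[X])"
  using normalize_gives_polynomial[of ?p A] c(1) by (auto simp: univ_poly_def)
 moreover have "normalize p ~= []" if "EX a:set p. a ~= \<zero>" for p using that by (induction p) auto
 hence "normalize ?p ~= []" using c(2,3) by (metis atLeastLessThan_iff imageI le0 set_map set_rev set_upt)
 ultimately show "(algebraic over A) u" using algebraicI by blast
qed

lemma simple_extension_elem:
 assumes A: "subring A R" and x: "x <: R"
 shows "y : simple_extension A x \<longleftrightarrow> (EX (n::nat) c. (ALL i. c i : A) & y = (\<Oplus>i:{..<n}. c i ** x [^] i))"
proof
 assume "y : simple_extension A x"
 then obtain p where p: "p : carrier (A[X])" "y = eval p x"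
  using simple_extension_as_eval_img[OF subringE(1)[OF A] x] by auto
 have "set p <= A" using polynomial_incl p(1) by (auto simp: univ_poly_def)
 hence "ALL i. coeff p i : A" "y = (\<Oplus>i:{..<length p}. coeff p i ** x [^] i)"
  using coeff_in_set[of p A] subringE(1,2)[OF A] eval_eq_finsum[of p x] p(2) x by auto
 thus "EX (n::nat) c. (ALL i. c i : A) & y = (\<Oplus>i:{..<n}. c i ** x [^] i)" by blast
next
 assume "EX (n::nat) c. (ALL i. c i : A) & y = (\<Oplus>i:{..<n}. c i ** x [^] i)"
 then obtain n :: nat and c where c: "!!i. c i : A" "y = (\<Oplus>i:{..<n}. c i ** x [^] i)" by blast
 let ?p = "map c (rev [0..<n])"
 have cc: "c i <: R" for i using c(1) subringE(1)[OF A] by auto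
 have "set ?p <= carrier R" using cc by auto
 hence "y = eval (normalize ?p) x"
  using eval_normalize[of ?p x] eval_map_rev[of c x n] cc c(2) x by simp
 moreover have "normalize ?p : carrier (A[X])"
  using normalize_gives_polynomial[of ?p A] c(1) by (auto simp: univ_poly_def)
 ultimately show "y : simple_extension A x"
  using simple_extension_as_eval_img[OF subringE(1)[OF A] x] by auto
qed

lemma subring_finsum:
 assumes "subring A R" "!!i. i : I ==> f i : A"
 shows "(\<Oplus>i:I. f i) : A"
proof (cases "finite I")
 case True
 thus ?thesis using assms(2)
 proof (induction I rule: finite_induct)
  case (insert i I)
  hence "(\<Oplus>j:insert i I. f j) = f i \<oplus> (\<Oplus>j:I. f j)"
   using subringE(1)[OF assms(1)] by (intro finsum_insert) auto
  thus ?case using insert subringE(7)[OF assms(1)] by simp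
 qed (simp add: subringE(2)[OF assms(1)])
qed (simp add: subringE(2)[OF assms(1)])

end

context field
begin

text \<open>Clearing denominators shows that the fraction field of \<open>A\<close> has the same
  algebraic elements, so results about extensions of subfields carry over to subrings.\<close>

lemma subring_fractions:
 assumes A: "subring A R"
 defines "Q == {a ** inv b | a b. a : A & b : A & b ~= \<zero>}"
 shows "subfield Q R" "A <= Q" "alg_over A = alg_over Q"
proof -
 note Ac = subsetD[OF subringE(1)[OF A]]
 have ic: "inv b <: R" "b ** inv b = \<one>" "inv b ~= \<zero>" if "b : A" "b ~= \<zero>" for b
  using that Ac inv_closed inv_right inv_nonzero by auto
 have QI: "a ** inv b : Q" if "a : A" "b : A" "b ~= \<zero>" for a b using that by (auto simp: Q_def)
 have Qeq: "x : Q" if "x <: R" "b : A" "b ~= \<zero>" "x ** b : A" for x b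
 proof -
  have "x = (x ** b) ** inv b" using that ic[of b] Ac by (simp add: m_assoc)
  thus ?thesis using QI that by metis
 qed
 show AQ: "A <= Q"
 proof
  fix a assume "a : A"
  thus "a : Q" using Qeq[of a \<one>] Ac subringE(3)[OF A] by auto
 qed
 have Qc: "Q <= carrier R" using Ac ic by (auto simp: Q_def)
 have QE: "EX b:A. b ~= \<zero> & x ** b : A" if "x : Q" for x
 proof -
  obtain a b where ab: "a : A" "b : A" "b ~= \<zero>" "x = a ** inv b" using \<open>x : Q\<close> by (auto simp: Q_def)
  have "x ** b = a" using ab ic[of b] inv_left[of b] Ac by (simp add: m_assoc)
  thus ?thesis using ab by blast
 qed
 show Q: "subfield Q R"
 proof (rule subfieldI'[OF subringI])
  show "Q <= carrier R" "\<one> : Q" using Qc AQ subringE(3)[OF A] by auto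
 next
  fix x assume x: "x : Q"
  then obtain b where b: "b : A" "b ~= \<zero>" "x ** b : A" using QE by blast
  thus "\<ominus> x : Q" using x Qc Ac Qeq[of "\<ominus> x" b] subringE(5)[OF A] by (auto simp: l_minus)
 next
  fix x y assume x: "x : Q" and y: "y : Q"
  obtain b where b: "b : A" "b ~= \<zero>" "x ** b : A" using QE x by blast
  obtain c where c: "c : A" "c ~= \<zero>" "y ** c : A" using QE y by blast
  have cl: "x <: R" "y <: R" "b <: R" "c <: R" using x y Qc b c Ac by auto
  have bc: "b ** c : A" "b ** c ~= \<zero>" using b c cl subringE(6)[OF A] integral by auto
  have "(x \<oplus> y) ** (b ** c) = (x ** b) ** c \<oplus> (y ** c) ** b" using cl by algebra
  hence "(x \<oplus> y) ** (b ** c) : A" using b c subringE(6,7)[OF A] by simp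
  thus "x \<oplus> y : Q" using Qeq bc cl by blast
  have "(x ** y) ** (b ** c) = (x ** b) ** (y ** c)" using cl by algebra
  hence "(x ** y) ** (b ** c) : A" using b c subringE(6)[OF A] by simp
  thus "x ** y : Q" using Qeq bc cl by blast
 next
  fix x assume x: "x : Q - {\<zero>}"
  then obtain b where b: "b : A" "b ~= \<zero>" "x ** b : A" using QE by blast
  have cl: "x <: R" "x ~= \<zero>" "b <: R" using x Qc b Ac by auto
  have "inv x ** (x ** b) = b" using cl inv_left[of x] inv_closed[of x] by (simp add: m_assoc[symmetric])
  moreover have "x ** b ~= \<zero>" using cl b integral by auto
  ultimately show "inv x : Q" using Qeq[of "inv x" "x ** b"] b cl inv_closed[of x] by simp
 qed
 have Qr: "subring Q R" using subfieldE(1)[OF Q] .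
 show "alg_over A = alg_over Q"
 proof
  show "alg_over A <= alg_over Q" using algebraic_mono[OF AQ] by (auto simp: alg_over_def)
  show "alg_over Q <= alg_over A"
  proof
   fix u assume "u : alg_over Q"
   hence u: "u <: R" "(algebraic over Q) u" by (auto simp: alg_over_def)
   then obtain n :: nat and c i where c: "!!i. c i : Q" "i < n" "c i ~= \<zero>" "(\<Oplus>i:{..<n}. c i ** u [^] i) = \<zero>"
    using algebraic_iff[OF Qr u(1)] by blast
   have cc[simp]: "c i <: R" for i using c(1) Qc by blast
   \<comment> \<open>A common denominator for the first \<open>k\<close> coefficients.\<close>
   have "EX b:A. b ~= \<zero> & (ALL i<k. c i ** b : A)" for k
   proof (induction k)
    case 0
    thus ?case using subringE(3)[OF A] by (intro bexI[of _ \<one>]) auto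
   next
    case (Suc k)
    then obtain b where b: "b : A" "b ~= \<zero>" "ALL i<k. c i ** b : A" by blast
    obtain b' where b': "b' : A" "b' ~= \<zero>" "c k ** b' : A" using QE c(1) by blast
    have "c i ** (b ** b') : A" if "i < Suc k" for i
    proof (cases "i = k")
     case True
     have "c k ** (b ** b') = c k ** b' ** b" using Ac[OF b(1)] Ac[OF b'(1)] by (simp add: m_ac)
     thus ?thesis using True b b' subringE(6)[OF A] by simp
    next
     case False
     have "c i ** (b ** b') = c i ** b ** b'" using Ac[OF b(1)] Ac[OF b'(1)] by (simp add: m_assoc)
     thus ?thesis using False that b b' subringE(6)[OF A] by simp
    qed
    moreover have "b ** b' : A" "b ** b' ~= \<zero>"
     using b b' Ac[OF b(1)] Ac[OF b'(1)] subringE(6)[OF A] integral[of b b'] by auto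
    ultimately show ?case by blast
   qed
   then obtain b where b: "b : A" "b ~= \<zero>" "ALL i<n. c i ** b : A" by blast
   define d where "d i = (if i < n then c i ** b else \<zero>)" for i
   have dA: "ALL i. d i : A" using b subringE(2)[OF A] by (simp add: d_def)
   have "(\<Oplus>i:{..<n}. d i ** u [^] i) = (\<Oplus>i:{..<n}. b ** (c i ** u [^] i))"
    using Ac[OF b(1)] u(1) by (intro finsum_cong') (auto simp: d_def m_ac)
   also have "... = b ** (\<Oplus>i:{..<n}. c i ** u [^] i)"
    using Ac[OF b(1)] u(1) by (intro finsum_rdistr[symmetric]) auto
   also have "... = \<zero>" using c(4) b(1) Ac by simp
   finally have "(\<Oplus>i:{..<n}. d i ** u [^] i) = \<zero>" .
   moreover have "d i ~= \<zero>" using c(1)[of i] c(2,3) b Ac Qc integral[of "c i" b] by (auto simp: d_def)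
   ultimately show "u : alg_over A"
    using algebraic_iff[OF A u(1)] dA c(2) u(1) by (auto simp: alg_over_def)
  qed
 qed
qed

lemma alg_over_subfield: "subring A R ==> subfield (alg_over A) R"
 using subfield_of_algebraics[OF subring_fractions(1)] subring_fractions(3) by (auto simp: alg_over_def)

lemma alg_over_mono: "A <= A' ==> alg_over A <= alg_over A'"
 using algebraic_mono by (auto simp: alg_over_def)

lemma alg_over_incl: "subring A R ==> A <= alg_over A"
 using algebraic_self subringE(1) by (fastforce simp: alg_over_def)

text \<open>Transitivity of algebraicity: the coefficients of an equation for \<open>u\<close>
  generate a finite extension of the fraction field, over which \<open>u\<close> is again
  finite.\<close>

lemma alg_over_idem:
 assumes A: "subring A R"
 shows "alg_over (alg_over A) = alg_over A"
proof
 define Q where "Q = {a ** inv b | a b. a : A & b : A & b ~= \<zero>}"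
 have Q: "subfield Q R" "alg_over A = alg_over Q" using subring_fractions[OF A] by (auto simp: Q_def)
 have F: "subfield (alg_over A) R" by (rule alg_over_subfield[OF A])
 show "alg_over (alg_over A) <= alg_over A"
 proof
  fix u assume "u : alg_over (alg_over A)"
  hence u: "u <: R" "(algebraic over (alg_over A)) u" by (auto simp: alg_over_def)
  obtain p where p: "p : carrier ((alg_over A)[X])" "p ~= []" "eval p u = \<zero>"
   using algebraicE[OF subfieldE(1)[OF F] u] by blast
  have pa: "set p <= alg_over Q" using polynomial_incl p(1) Q(2) by (auto simp: univ_poly_def)
  hence pc: "set p <= carrier R" and palg: "!!x. x : set p ==> (algebraic over Q) x"
   by (auto simp: alg_over_def)
  define L where "L = finite_extension Q p"
  have L: "subfield L R" "finite_dimension Q L" "set p <= L"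
   using finite_extension_is_subfield[OF Q(1) pc palg] finite_extension_finite_dimension(1)[OF Q(1) pc palg]
    finite_extension_mem[OF subfieldE(1)[OF Q(1)] pc] by (auto simp: L_def)
  have "p : carrier (L[X])" using p(1) L(3) by (auto simp: univ_poly_def polynomial_def)
  hence "(algebraic over L) u" using algebraicI p(2,3) by blast
  hence "finite_dimension L (simple_extension L u)"
   using finite_dimension_simple_extension[OF L(1) u(1)] by simp
  hence "finite_dimension Q (simple_extension L u)"
   using telescopic_base_dim(1)[OF Q(1) L(1,2)] by blast
  hence "(algebraic over Q) u"
   using finite_dimension_imp_algebraic[OF Q(1) simple_extension_is_subring[OF subfieldE(1)[OF L(1)] u(1)]]
    simple_extension_mem[OF subfieldE(1)[OF L(1)] u(1)] by blast
  thus "u : alg_over A" using u(1) Q(2) by (simp add: alg_over_def)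
 qed
 show "alg_over A <= alg_over (alg_over A)" by (rule alg_over_incl[OF subfieldE(1)[OF F]])
qed

text \<open>A relation for \<open>y\<close> with coefficients in \<open>A[x]\<close> is a polynomial
  in both elements; sorted by powers of \<open>x\<close> it becomes a relation for \<open>x\<close>
  with coefficients in \<open>A[y]\<close>.\<close>

lemma alg_over_exchange:
 assumes A: "subring A R" and x: "x <: R"
  and y: "y : alg_over (simple_extension A x)" "y ~: alg_over A"
 shows "x : alg_over (simple_extension A y)"
proof -
 note Ac = subsetD[OF subringE(1)[OF A]]
 have yc: "y <: R" using y(1) by (simp add: alg_over_def)
 note [simp] = x yc
 have Ax: "subring (simple_extension A x) R" by (rule simple_extension_is_subring[OF A x])
 obtain n :: nat and c i0 where c: "!!i. c i : simple_extension A x" "i0 < n" "c i0 ~= \<zero>" "(\<Oplus>i:{..<n}. c i ** y [^] i) = \<zero>"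
  using y(1) algebraic_iff[OF Ax yc] by (auto simp: alg_over_def)
 have "ALL i. EX (m::nat) a. (ALL j. a j : A) & c i = (\<Oplus>j:{..<m}. a j ** x [^] j)"
  using c(1) simple_extension_elem[OF A x] by blast
 then obtain m :: "nat => nat" and a where a: "!!i j. a i j : A" "!!i. c i = (\<Oplus>j:{..<m i}. a i j ** x [^] j)" by metis
 \<comment> \<open>A common bound for the degrees in \<open>x\<close>; shorter coefficients are
   padded with zeros.\<close>
 define M where "M = Max (m ` {..<n})"
 have mM: "m i <= M" if "i < n" for i using that unfolding M_def by (intro Max_ge) auto
 define b where "b i j = (if j < m i then a i j else \<zero>)" for i j
 have bA: "b i j : A" for i j using a(1) subringE(2)[OF A] by (simp add: b_def)
 note [simp] = Ac[OF bA] Ac[OF a(1)]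
 have cb: "c i = (\<Oplus>j:{..<M}. b i j ** x [^] j)" if "i < n" for i
 proof -
  have "(\<Oplus>j:{..<M}. b i j ** x [^] j) = (\<Oplus>j:{..<m i}. b i j ** x [^] j)"
   by (rule finsum_neutral_subset) (use mM[OF that] in "auto simp: b_def")
  also have "... = (\<Oplus>j:{..<m i}. a i j ** x [^] j)" by (rule finsum_cong') (auto simp: b_def)
  finally show ?thesis using a(2) by simp
 qed
 define d where "d j = (\<Oplus>i:{..<n}. b i j ** y [^] i)" for j
 have dc[simp]: "d j <: R" for j by (simp add: d_def finsum_closed)
 have "(\<Oplus>j:{..<M}. d j ** x [^] j) = (\<Oplus>j:{..<M}. \<Oplus>i:{..<n}. b i j ** y [^] i ** x [^] j)"
  by (intro finsum_cong') (auto simp: d_def finsum_ldistr intro!: finsum_closed)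
 also have "... = (\<Oplus>i:{..<n}. \<Oplus>j:{..<M}. b i j ** y [^] i ** x [^] j)" by (rule finsum_swap) auto
 also have "... = (\<Oplus>i:{..<n}. (\<Oplus>j:{..<M}. b i j ** x [^] j) ** y [^] i)"
 proof (intro finsum_cong' refl)
  fix i
  have "(\<Oplus>j:{..<M}. b i j ** y [^] i ** x [^] j) = (\<Oplus>j:{..<M}. b i j ** x [^] j ** y [^] i)"
   by (intro finsum_cong') (auto simp: m_ac)
  also have "... = (\<Oplus>j:{..<M}. b i j ** x [^] j) ** y [^] i" by (rule finsum_ldistr[symmetric]) auto
  finally show "(\<Oplus>j:{..<M}. b i j ** y [^] i ** x [^] j) = (\<Oplus>j:{..<M}. b i j ** x [^] j) ** y [^] i" .
 qed (auto intro!: finsum_closed)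
 also have "... = (\<Oplus>i:{..<n}. c i ** y [^] i)"
  by (intro finsum_cong') (auto simp: cb intro!: finsum_closed)
 finally have rel: "(\<Oplus>j:{..<M}. d j ** x [^] j) = \<zero>" using c(4) by simp
 have dAy: "d j : simple_extension A y" for j
  unfolding simple_extension_elem[OF A yc] d_def using bA by (intro exI[of _ n] exI[of _ "%i. b i j"]) auto
 \<comment> \<open>If all sorted coefficients vanished, each would be a relation for
   \<open>y\<close> over \<open>A\<close>, hence trivial, and then \<open>c i0\<close> would vanish
   too.\<close>
 have "EX j<M. d j ~= \<zero>"
 proof (rule ccontr)
  assume *: "~ (EX j<M. d j ~= \<zero>)"
  have "b i j = \<zero>" if "i < n" "j < M" for i j
  proof (rule ccontr)
   assume "b i j ~= \<zero>"
   hence "(algebraic over A) y"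
    unfolding algebraic_iff[OF A yc] using * that bA
    by (intro exI[of _ n] exI[of _ "%i. b i j"]) (auto simp: d_def)
   thus False using y(2) by (simp add: alg_over_def)
  qed
  hence "c i0 = \<zero>" unfolding cb[OF c(2)] using c(2) by (intro finsum_all_zero) auto
  thus False using c(3) by simp
 qed
 thus ?thesis
  using algebraic_iff[OF simple_extension_is_subring[OF A yc] x] dAy rel by (auto simp: alg_over_def)
qed

end

section \<open>Relative algebraic closure as a closure operator with exchange\<close>

context field
begin

text \<open>The algebraic closure of \<open>k(Y)\<close> inside the field.\<close>

definition acl :: "'a set => 'a set => 'a set" where
 "acl k Y = alg_over (generate_ring R (k Un Y))"

lemma gen_subring: "k <= carrier R ==> Y <= carrier R ==> subring (generate_ring R (k Un Y)) R"
 by (rule generate_ring_is_subring) auto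

lemma acl_subfield: "k <= carrier R ==> Y <= carrier R ==> subfield (acl k Y) R"
 unfolding acl_def by (rule alg_over_subfield[OF gen_subring])

lemma acl_incl: "k <= carrier R ==> Y <= carrier R ==> k Un Y <= acl k Y"
 unfolding acl_def using alg_over_incl[OF gen_subring[of k Y]] generate_ring.incl[of _ "k Un Y" R] by blast

lemma acl_idem: "k <= carrier R ==> Y <= carrier R ==> alg_over (acl k Y) = acl k Y"
 unfolding acl_def by (rule alg_over_idem[OF gen_subring])

lemma acl_mono: "k <= carrier R ==> Y <= Z ==> Z <= carrier R ==> acl k Y <= acl k Z"
 unfolding acl_def by (intro alg_over_mono mono_generate_ring) auto

lemma acl_min: "k <= carrier R ==> Y <= carrier R ==> Z <= acl k Y ==> acl k Z <= acl k Y"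
proof -
 assume *: "k <= carrier R" "Y <= carrier R" "Z <= acl k Y"
 have sf: "subfield (acl k Y) R" by (rule acl_subfield[OF *(1,2)])
 have "generate_ring R (k Un Z) <= acl k Y"
 proof (rule generate_ring_min_subring1[OF _ subfieldE(1)[OF sf]])
  show "k Un Z <= carrier R" "k Un Z <= acl k Y"
   using * acl_incl[OF *(1,2)] subfieldE(3)[OF sf] by auto
 qed
 hence "alg_over (generate_ring R (k Un Z)) <= alg_over (acl k Y)" by (rule alg_over_mono)
 thus ?thesis using acl_idem[OF *(1,2)] by (simp add: acl_def)
qed

lemma generate_ring_insert:
 assumes "k <= carrier R" "Y <= carrier R" "x <: R"
 shows "generate_ring R (k Un insert x Y) = simple_extension (generate_ring R (k Un Y)) x"
proof
 have A: "subring (generate_ring R (k Un Y)) R" by (rule gen_subring[OF assms(1,2)])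
 show "generate_ring R (k Un insert x Y) <= simple_extension (generate_ring R (k Un Y)) x"
 proof (rule generate_ring_min_subring1)
  show "subring (simple_extension (generate_ring R (k Un Y)) x) R"
   by (rule simple_extension_is_subring[OF A assms(3)])
  show "k Un insert x Y <= simple_extension (generate_ring R (k Un Y)) x"
   using simple_extension_incl[OF subringE(1)[OF A] assms(3)] simple_extension_mem[OF A assms(3)]
    generate_ring.incl[of _ "k Un Y" R] by blast
 qed (use assms in auto)
 show "simple_extension (generate_ring R (k Un Y)) x <= generate_ring R (k Un insert x Y)"
  by (rule simple_extension_subring_incl[OF gen_subring])
   (use assms mono_generate_ring[of "k Un Y" "k Un insert x Y"] generate_ring.incl[of x "k Un insert x Y" R] in auto)
qed

lemma acl_exchange:
 assumes "k <= carrier R" "Y <= carrier R" "x <: R" "y : acl k (insert x Y)" "y ~: acl k Y"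
 shows "x : acl k (insert y Y)"
proof -
 have "y <: R" using assms(4) by (simp add: acl_def alg_over_def)
 thus ?thesis
  using alg_over_exchange[OF gen_subring[OF assms(1,2)] assms(3)] assms(4,5)
  unfolding acl_def generate_ring_insert[OF assms(1,2) \<open>y <: R\<close>] generate_ring_insert[OF assms(1-3)]
  by blast
qed

lemma acl_independent_bound:
 assumes k: "k <= carrier R" and Y: "Y <= carrier R" "finite Y" and ts: "set ts <= acl k Y"
  and indep: "!!i. i < length ts ==> ts ! i ~: acl k (set (take i ts))"
 shows "length ts <= card Y"
proof (rule steinitz[where cl = "acl k" and S = "carrier R"])
 show "set ts <= carrier R" using ts by (auto simp: acl_def alg_over_def)
 show "V <= acl k V" if "V <= carrier R" for V using acl_incl[OF k that] by blast
qed (use acl_mono acl_min acl_exchange k Y ts indep in auto)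

text \<open>A smallest subset of \<open>G\<close> over which \<open>G\<close> is algebraic is a
  transcendence basis; choosing it among given generators is what later allows it to be lifted to
  the ring.\<close>

lemma acl_basis:
 assumes k: "k <= carrier R" and G: "G <= carrier R" "finite G"
 obtains Bs where "Bs <= G" "G <= acl k Bs" "ALL b:Bs. b ~: acl k (Bs - {b})"
proof -
 have "G <= G & G <= acl k G" using acl_incl[OF k G(1)] by auto
 from ex_has_least_nat[of "%Bs. Bs <= G & G <= acl k Bs", OF this, of card]
 obtain Bs where "(Bs <= G & G <= acl k Bs) & (ALL C. C <= G & G <= acl k C --> card Bs <= card C)" ..
 hence Bs: "Bs <= G" "G <= acl k Bs" and min: "!!C. C <= G ==> G <= acl k C ==> card Bs <= card C"
  by simp_all
 have "b ~: acl k (Bs - {b})" if b: "b : Bs" for b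
 proof
  assume "b : acl k (Bs - {b})"
  moreover have "Bs - {b} <= carrier R" using Bs G by auto
  ultimately have "Bs <= acl k (Bs - {b})" using acl_incl[OF k] by blast
  hence "acl k Bs <= acl k (Bs - {b})" by (rule acl_min[OF k \<open>Bs - {b} <= carrier R\<close>])
  hence "card Bs <= card (Bs - {b})" using min[of "Bs - {b}"] Bs by blast
  thus False using b Bs G(2) card_Diff1_less[of Bs b] finite_subset by fastforce
 qed
 thus thesis using that Bs by blast
qed

lemma algebraically_closed_has_roots:
 assumes "algebraically_closed R"
 shows "has_roots"
 unfolding has_roots_def
proof (intro allI impI, elim conjE)
 fix n c assume c: "ALL i. c i <: R" "c (Suc n) ~= \<zero>"
 let ?p = "map c (rev [0..<Suc (Suc n)])"
 have p: "?p : carrier (poly_ring R)" using c by (auto simp: univ_poly_def polynomial_def)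
 hence "size (roots ?p) = Suc n"
  using algebraically_closed.roots_over_carrier[OF assms p] by (simp add: splitted_def)
 then obtain x where "x :# roots ?p" by fastforce
 hence "is_root ?p x" using roots_mem_iff_is_root[OF p] by simp
 hence "x <: R" "eval ?p x = \<zero>" by (auto simp: is_root_def)
 thus "EX x:carrier R. (\<Oplus>i:{..Suc n}. c i ** x [^] i) = \<zero>"
  using eval_map_rev[of c x "Suc (Suc n)"] c by (auto simp: lessThan_Suc_atMost)
qed

end

section \<open>Ideals and residue fields\<close>

context cring
begin

lemma ideal_by_closure:
 assumes "I <= carrier R" "\<zero> : I" "!!a b. a : I ==> b : I ==> a \<oplus> b : I"
  "!!r a. r <: R ==> a : I ==> r ** a : I"
 shows "ideal I R"
proof (rule idealI[OF ring_axioms])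
 have "\<ominus> a : I" if "a : I" for a
 proof -
  have "\<ominus> \<one> ** a : I" using assms(4) that by simp
  thus ?thesis using that assms(1) by (auto simp: l_minus)
 qed
 thus "subgroup I (add_monoid R)"
  using assms by (intro add.subgroupI) (auto simp: a_inv_def)
 fix a x assume "a : I" "x <: R"
 thus "x ** a : I" "a ** x : I" using assms(1,4) m_comm[of a x] by auto
qed

lemma ideal_sum_principal:
 assumes "ideal I R" "a <: R"
 shows "ideal {x \<oplus> a ** r | x r. x : I & r <: R} R"
  and "I <= {x \<oplus> a ** r | x r. x : I & r <: R}"
  and "a : {x \<oplus> a ** r | x r. x : I & r <: R}"
proof -
 interpret ideal I R by fact
 have Ic[simp]: "x : I ==> x <: R" for x using a_subset by auto
 show sub: "I <= {x \<oplus> a ** r | x r. x : I & r <: R}"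
 proof
  fix x assume "x : I"
  hence "x = x \<oplus> a ** \<zero>" using assms(2) by simp
  thus "x : {x \<oplus> a ** r | x r. x : I & r <: R}" using \<open>x : I\<close> by blast
 qed
 have "a = \<zero> \<oplus> a ** \<one>" using assms(2) by simp
 thus "a : {x \<oplus> a ** r | x r. x : I & r <: R}" using zero_closed by blast
 show "ideal {x \<oplus> a ** r | x r. x : I & r <: R} R"
 proof (rule ideal_by_closure)
  show "{x \<oplus> a ** r | x r. x : I & r <: R} <= carrier R" using assms(2) by auto
  show "\<zero> : {x \<oplus> a ** r | x r. x : I & r <: R}" using sub zero_closed by blast
 next
  fix u v assume "u : {x \<oplus> a ** r | x r. x : I & r <: R}" "v : {x \<oplus> a ** r | x r. x : I & r <: R}"
  then obtain x r y s where *: "u = x \<oplus> a ** r" "v = y \<oplus> a ** s" "x : I" "y : I" "r <: R" "s <: R" by blast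
  have "x <: R" "y <: R" using * by auto
  hence "u \<oplus> v = (x \<oplus> y) \<oplus> a ** (r \<oplus> s)" using * assms(2) by algebra
  thus "u \<oplus> v : {x \<oplus> a ** r | x r. x : I & r <: R}" using * a_closed by blast
 next
  fix t u assume t: "t <: R" and "u : {x \<oplus> a ** r | x r. x : I & r <: R}"
  then obtain x r where *: "u = x \<oplus> a ** r" "x : I" "r <: R" by blast
  have "x <: R" using * by auto
  hence "t ** u = t ** x \<oplus> a ** (t ** r)" using * assms(2) t by algebra
  thus "t ** u : {x \<oplus> a ** r | x r. x : I & r <: R}" using * t I_l_closed by blast
 qed
qed

text \<open>One application of Zorn serves twice: \<open>S\<close> consisting of \<open>1\<close>
  alone gives maximal ideals, a multiplicative \<open>S\<close> gives primes.\<close>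

lemma ideal_maximal_disjoint:
 assumes I: "ideal I R" and disj: "I Int S = {}" and S: "S ~= {}"
 obtains P where "ideal P R" "I <= P" "P Int S = {}"
  "!!J. ideal J R ==> P <= J ==> J Int S = {} ==> J = P"
proof -
 define F where "F = {J. ideal J R & I <= J & J Int S = {}}"
 have "EX M:F. ALL J:F. M <= J --> J = M"
 proof (rule subset_Zorn)
  fix C assume C: "subset.chain F C"
  show "EX U:F. ALL J:C. J <= U"
  proof (cases "C = {}")
   case True
   thus ?thesis using I disj by (intro bexI[of _ I]) (auto simp: F_def)
  next
   case False
   have sub: "C <= F" using C by (auto simp: pred_on.chain_def)
   have "subset.chain {I. ideal I R} C" using C by (auto simp: pred_on.chain_def F_def)
   from chain_Union_is_ideal[OF this] have "ideal (\<Union>C) R" using False by simp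
   moreover have "I <= \<Union>C" using False sub by (auto simp: F_def)
   moreover have "\<Union>C Int S = {}" using sub by (auto simp: F_def)
   ultimately show ?thesis by (intro bexI[of _ "\<Union>C"]) (auto simp: F_def)
  qed
 qed
 then obtain P where "P : F" "ALL J:F. P <= J --> J = P" ..
 thus thesis using that[of P] by (auto simp: F_def)
qed

lemma prime_avoiding:
 assumes I: "ideal I R" and disj: "I Int S = {}" and one: "\<one> : S" and mult: "!!a b. a : S ==> b : S ==> a ** b : S"
 obtains P where "primeideal P R" "I <= P" "P Int S = {}"
proof -
 obtain P where P: "ideal P R" "I <= P" "P Int S = {}"
  and max: "!!J. ideal J R ==> P <= J ==> J Int S = {} ==> J = P"
  using ideal_maximal_disjoint[OF I disj] one by (metis empty_iff)
 interpret P: ideal P R by (rule P(1))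
 have Pc[simp]: "x : P ==> x <: R" for x using P.a_subset by auto
 \<comment> \<open>By maximality, enlarging \<open>P\<close> by an element outside makes it meet
   \<open>S\<close>. Two such meetings, multiplied, show that \<open>P\<close> is prime.\<close>
 have meet: "EX x:P. EX r:carrier R. x \<oplus> a ** r : S" if a: "a <: R" "a ~: P" for a
 proof (rule ccontr)
  assume "~ ?thesis"
  hence "{x \<oplus> a ** r | x r. x : P & r <: R} Int S = {}" by blast
  thus False using max ideal_sum_principal[OF P(1) a(1)] a(2) by blast
 qed
 have "primeideal P R"
 proof (rule primeidealI[OF P(1) cring_axioms])
  show "carrier R ~= P" using P(3) one by auto
  fix a b assume ab: "a <: R" "b <: R" "a ** b : P"
  show "a : P \<or> b : P"
  proof (rule ccontr)
   assume "~ (a : P \<or> b : P)"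
   then obtain x r y s where *: "x : P" "r <: R" "x \<oplus> a ** r : S" "y : P" "s <: R" "y \<oplus> b ** s : S"
    using meet[OF ab(1)] meet[OF ab(2)] by blast
   have "(x \<oplus> a ** r) ** (y \<oplus> b ** s) = ((y \<oplus> b ** s) ** x \<oplus> (a ** r) ** y) \<oplus> (r ** s) ** (a ** b)"
    using Pc[OF *(1)] Pc[OF *(4)] * ab by algebra
   moreover have "((y \<oplus> b ** s) ** x \<oplus> (a ** r) ** y) \<oplus> (r ** s) ** (a ** b) : P"
    using * ab by (intro P.a_closed P.I_l_closed[OF ab(3)] P.I_l_closed[OF *(1)] P.I_l_closed[OF *(4)]) auto
   ultimately show False using mult[OF *(3,6)] P(3) by auto
  qed
 qed
 thus thesis using that P by blast
qed

lemma maximal_containing: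
 assumes I: "ideal I R" and "\<one> ~: I"
 obtains M where "maximalideal M R" "I <= M"
proof -
 obtain P where P: "ideal P R" "I <= P" "P Int {\<one>} = {}"
  and max: "!!J. ideal J R ==> P <= J ==> J Int {\<one>} = {} ==> J = P"
  using ideal_maximal_disjoint[OF I, of "{\<one>}"] assms(2) by blast
 have "maximalideal P R"
 proof (rule maximalidealI[OF P(1)])
  show "carrier R ~= P" using P(3) by auto
  fix J assume J: "ideal J R" "P <= J" "J <= carrier R"
  show "J = P \<or> J = carrier R" using max[OF J(1,2)] ideal.one_imp_carrier[OF J(1)] by blast
 qed
 thus thesis using that P by blast
qed

end

text \<open>The residue field of a prime \<open>p\<close>: fractions \<open>a/s\<close> with \<open>s \<notin> p\<close>, where
  \<open>a/s = b/t\<close> iff \<open>a t - b s \<in> p\<close>.\<close>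

definition residue_fraction :: "('a, 'm) ring_scheme => 'a set => 'a => 'a => ('a \<times> 'a) set" where
 "residue_fraction R p a s = {(b, t). b <: R & t : carrier R - p &
   (a **.R t) \<ominus>.R (b **.R s) : p}"

text \<open>Representatives are picked by \<open>SOME\<close>, so the result is a class by
  construction; \<open>fr_mult\<close> shows that the choice does not matter.\<close>

definition residue_mult :: "('a, 'm) ring_scheme => 'a set => ('a \<times> 'a) set => ('a \<times> 'a) set => ('a \<times> 'a) set" where
 "residue_mult R p x y = (case (SOME z. z : x, SOME z. z : y) of ((a, s), (b, t)) =>
   residue_fraction R p (a **.R b) (s **.R t))"

definition residue_add :: "('a, 'm) ring_scheme => 'a set => ('a \<times> 'a) set => ('a \<times> 'a) set => ('a \<times> 'a) set" where
 "residue_add R p x y = (case (SOME z. z : x, SOME z. z : y) of ((a, s), (b, t)) =>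
   residue_fraction R p ((a **.R t) \<oplus>.R (b **.R s)) (s **.R t))"

definition residue_field :: "('a, 'm) ring_scheme => 'a set => ('a \<times> 'a) set ring" where
 "residue_field R p = \<lparr>carrier = {residue_fraction R p a s | a s. a <: R & s : carrier R - p},
   monoid.mult = residue_mult R p, one = residue_fraction R p \<one>.R \<one>.R,
   zero = residue_fraction R p \<zero>.R \<one>.R, add = residue_add R p\<rparr>"

context primeideal
begin

abbreviation (input) fr where "fr == residue_fraction R I"

lemma I_add: "x : I ==> y : I ==> x \<oplus> y : I"
 by (rule additive_subgroup.a_closed[OF is_additive_subgroup])

lemma p_mult: "s : carrier R - I ==> t : carrier R - I ==> s ** t : carrier R - I"
 using I_prime by auto

lemma one_notin: "\<one> : carrier R - I"
 using I_notcarr one_imp_carrier by auto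

lemma fr_eq_iff:
 assumes "a <: R" "s : carrier R - I" "b <: R" "t : carrier R - I"
 shows "fr a s = fr b t \<longleftrightarrow> (a ** t) \<ominus> (b ** s) : I"
proof
 assume eq: "fr a s = fr b t"
 have "(b, t) : fr b t" using assms zero_closed by (simp add: residue_fraction_def minus_eq r_neg)
 hence "(b, t) : fr a s" using eq by simp
 thus "(a ** t) \<ominus> (b ** s) : I" by (simp add: residue_fraction_def)
next
 have *: "fr a s <= fr b t" if "a <: R" "s : carrier R - I" "b <: R" "t : carrier R - I"
  "(a ** t) \<ominus> (b ** s) : I" for a s b t
 proof
  fix z assume "z : fr a s"
  then obtain c u where z: "z = (c, u)" "c <: R" "u : carrier R - I" "(a ** u) \<ominus> (c ** s) : I"
   by (auto simp: residue_fraction_def)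
  have cl: "s <: R" "t <: R" "u <: R" using that z by auto
  \<comment> \<open>The difference lies in the prime after multiplication by \<open>s\<close>, and
    \<open>s\<close> is outside the prime.\<close>
  have "s ** ((b ** u) \<ominus> (c ** t)) = t ** ((a ** u) \<ominus> (c ** s)) \<oplus> (\<ominus> u) ** ((a ** t) \<ominus> (b ** s))"
   using that(1,3) cl z(2) by algebra
  also have "... : I" using that z cl by (intro I_add I_l_closed) auto
  finally have "s ** ((b ** u) \<ominus> (c ** t)) : I" .
  hence "(b ** u) \<ominus> (c ** t) : I" using I_prime[of s "(b ** u) \<ominus> (c ** t)"] that cl z by auto
  thus "z : fr b t" using z by (simp add: residue_fraction_def)
 qed
 assume m: "(a ** t) \<ominus> (b ** s) : I"
 have "(b ** s) \<ominus> (a ** t) = \<ominus> \<one> ** ((a ** t) \<ominus> (b ** s))"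
  using assms by (simp add: minus_eq l_minus minus_add a_comm)
 hence "(b ** s) \<ominus> (a ** t) : I" using I_l_closed[OF m, of "\<ominus> \<one>"] by simp
 thus "fr a s = fr b t" using *[OF assms m] *[OF assms(3,4,1,2)] by blast
qed

lemma fr_some:
 assumes "a <: R" "s : carrier R - I"
 obtains b t where "(SOME z. z : fr a s) = (b, t)" "b <: R" "t : carrier R - I" "(a ** t) \<ominus> (b ** s) : I"
proof -
 have "(a, s) : fr a s" using assms zero_closed by (simp add: residue_fraction_def minus_eq r_neg)
 hence "(SOME z. z : fr a s) : fr a s" by (rule someI)
 thus thesis using that by (auto simp: residue_fraction_def)
qed

lemma fr_mult:
 assumes "a <: R" "s : carrier R - I" "b <: R" "t : carrier R - I"
 shows "fr a s **.(residue_field R I) fr b t = fr (a ** b) (s ** t)"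
proof -
 obtain a' s' where a': "(SOME z. z : fr a s) = (a', s')" "a' <: R" "s' : carrier R - I" "(a ** s') \<ominus> (a' ** s) : I"
  using fr_some[OF assms(1,2)] .
 obtain b' t' where b': "(SOME z. z : fr b t) = (b', t')" "b' <: R" "t' : carrier R - I" "(b ** t') \<ominus> (b' ** t) : I"
  using fr_some[OF assms(3,4)] .
 have cl: "s <: R" "t <: R" "s' <: R" "t' <: R" using assms a' b' by auto
 have "(a' ** b') ** (s ** t) \<ominus> (a ** b) ** (s' ** t') =
  (\<ominus> (b ** t')) ** ((a ** s') \<ominus> (a' ** s)) \<oplus> (\<ominus> (a' ** s)) ** ((b ** t') \<ominus> (b' ** t))"
  using assms(1,3) a'(2) b'(2) cl by algebra
 also have "... : I" using assms a' b' cl by (intro I_add I_l_closed) auto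
 finally have "fr (a' ** b') (s' ** t') = fr (a ** b) (s ** t)"
  using assms a' b' p_mult by (subst fr_eq_iff) auto
 thus ?thesis using a'(1) b'(1) by (simp add: residue_field_def residue_mult_def residue_add_def)
qed

lemma fr_add:
 assumes "a <: R" "s : carrier R - I" "b <: R" "t : carrier R - I"
 shows "fr a s \<oplus>.(residue_field R I) fr b t = fr ((a ** t) \<oplus> (b ** s)) (s ** t)"
proof -
 obtain a' s' where a': "(SOME z. z : fr a s) = (a', s')" "a' <: R" "s' : carrier R - I" "(a ** s') \<ominus> (a' ** s) : I"
  using fr_some[OF assms(1,2)] .
 obtain b' t' where b': "(SOME z. z : fr b t) = (b', t')" "b' <: R" "t' : carrier R - I" "(b ** t') \<ominus> (b' ** t) : I"
  using fr_some[OF assms(3,4)] .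
 have cl: "s <: R" "t <: R" "s' <: R" "t' <: R" using assms a' b' by auto
 have "((a' ** t') \<oplus> (b' ** s')) ** (s ** t) \<ominus> ((a ** t) \<oplus> (b ** s)) ** (s' ** t') =
  (\<ominus> (t ** t')) ** ((a ** s') \<ominus> (a' ** s)) \<oplus> (\<ominus> (s ** s')) ** ((b ** t') \<ominus> (b' ** t))"
  using assms(1,3) a'(2) b'(2) cl by algebra
 also have "... : I" using assms a' b' cl by (intro I_add I_l_closed) auto
 finally have "fr ((a' ** t') \<oplus> (b' ** s')) (s' ** t') = fr ((a ** t) \<oplus> (b ** s)) (s ** t)"
  using assms a' b' p_mult by (subst fr_eq_iff) auto
 thus ?thesis using a'(1) b'(1) by (simp add: residue_field_def residue_mult_def residue_add_def)
qed

lemma fr_carrier: "a <: R ==> s : carrier R - I ==> fr a s : carrier (residue_field R I)"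
 by (auto simp: residue_field_def)

lemma fr_cases:
 assumes "x : carrier (residue_field R I)"
 obtains a s where "x = fr a s" "a <: R" "s : carrier R - I"
 using assms by (auto simp: residue_field_def)

lemma fr_eqI:
 assumes "a <: R" "s : carrier R - I" "b <: R" "t : carrier R - I" "a ** t = b ** s"
 shows "fr a s = fr b t"
 using assms zero_closed by (subst fr_eq_iff) (auto simp: minus_eq r_neg)

lemma residue_field_is_field: "field (residue_field R I)"
proof -
 let ?F = "residue_field R I"
 have z: "\<zero>.?F = fr \<zero> \<one>" and o: "\<one>.?F = fr \<one> \<one>" by (simp_all add: residue_field_def)
 have I1: "\<one> : carrier R - I" and [simp]: "\<one> ~: I" using one_notin by auto
 have fr1: "fr \<one> \<one> <: ?F" "fr \<zero> \<one> <: ?F" using I1 fr_carrier by auto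
 have "abelian_group ?F"
 proof (rule abelian_groupI)
  fix x y assume xy: "x <: ?F" "y <: ?F"
  obtain a s where x: "x = fr a s" "a <: R" "s : carrier R - I" using xy(1) fr_cases by blast
  obtain b t where y: "y = fr b t" "b <: R" "t : carrier R - I" using xy(2) fr_cases by blast
  show "x \<oplus>.?F y <: ?F" using x y p_mult by (auto simp: fr_add intro!: fr_carrier)
  show "x \<oplus>.?F y = y \<oplus>.?F x" using x y by (simp add: fr_add a_comm m_comm)
  show "\<zero>.?F \<oplus>.?F x = x" using fr_add[of \<zero> \<one> a s] x I1 by (simp add: z)
  have "fr (\<ominus> a) s \<oplus>.?F x = \<zero>.?F"
   unfolding z x fr_add[OF a_inv_closed[OF x(2)] x(3) x(2,3)]
   by (rule fr_eqI) (use x p_mult in "auto simp: l_minus l_neg")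
  thus "EX y:carrier ?F. y \<oplus>.?F x = \<zero>.?F" using fr_carrier[of "\<ominus> a" s] x by auto
  fix w assume "w <: ?F"
  then obtain c u where w: "w = fr c u" "c <: R" "u : carrier R - I" using fr_cases by blast
  have cl: "s <: R" "t <: R" "u <: R" using x y w by auto
  have "((a ** t) \<oplus> (b ** s)) ** u \<oplus> c ** (s ** t) = a ** (t ** u) \<oplus> ((b ** u) \<oplus> (c ** t)) ** s"
   using x(2) y(2) w(2) cl by algebra
  thus "x \<oplus>.?F y \<oplus>.?F w = x \<oplus>.?F (y \<oplus>.?F w)"
   using x y w p_mult[OF x(3) y(3)] p_mult[OF y(3) w(3)] cl
   by (simp add: fr_add m_assoc)
 qed (use fr1 z in auto)
 moreover have "comm_monoid ?F"
 proof (rule comm_monoidI)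
  fix x y assume xy: "x <: ?F" "y <: ?F"
  obtain a s where x: "x = fr a s" "a <: R" "s : carrier R - I" using xy(1) fr_cases by blast
  obtain b t where y: "y = fr b t" "b <: R" "t : carrier R - I" using xy(2) fr_cases by blast
  show "x **.?F y <: ?F" using x y p_mult by (auto simp: fr_mult intro!: fr_carrier)
  show "x **.?F y = y **.?F x" using x y by (simp add: fr_mult m_comm)
  show "\<one>.?F **.?F x = x" using fr_mult[of \<one> \<one> a s] x I1 by (simp add: o)
  fix w assume "w <: ?F"
  then obtain c u where w: "w = fr c u" "c <: R" "u : carrier R - I" using fr_cases by blast
  show "x **.?F y **.?F w = x **.?F (y **.?F w)"
   using x y w p_mult[OF x(3) y(3)] p_mult[OF y(3) w(3)] by (simp add: fr_mult m_assoc)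
 qed (use fr1 o in auto)
 moreover have "(x \<oplus>.?F y) **.?F w = x **.?F w \<oplus>.?F y **.?F w"
  if xyw: "x <: ?F" "y <: ?F" "w <: ?F" for x y w
 proof -
  obtain a s where x: "x = fr a s" "a <: R" "s : carrier R - I" using xyw(1) fr_cases by blast
  obtain b t where y: "y = fr b t" "b <: R" "t : carrier R - I" using xyw(2) fr_cases by blast
  obtain c u where w: "w = fr c u" "c <: R" "u : carrier R - I" using xyw(3) fr_cases by blast
  have cl: "s <: R" "t <: R" "u <: R" using x y w by auto
  have "(x \<oplus>.?F y) **.?F w = fr (((a ** t) \<oplus> (b ** s)) ** c) ((s ** t) ** u)"
   using x y w p_mult[OF x(3) y(3)] by (simp add: fr_add fr_mult)
  also have "... = fr ((a ** c) ** (t ** u) \<oplus> (b ** c) ** (s ** u)) ((s ** u) ** (t ** u))"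
  proof (rule fr_eqI)
   show "(((a ** t) \<oplus> (b ** s)) ** c) ** ((s ** u) ** (t ** u)) = ((a ** c) ** (t ** u) \<oplus> (b ** c) ** (s ** u)) ** ((s ** t) ** u)"
    using x(2) y(2) w(2) cl by algebra
   show "s ** t ** u : carrier R - I" "s ** u ** (t ** u) : carrier R - I" using p_mult x y w by simp_all
  qed (use x y w cl in auto)
  also have "... = x **.?F w \<oplus>.?F y **.?F w"
   using x y w p_mult[OF x(3) w(3)] p_mult[OF y(3) w(3)] by (simp add: fr_add fr_mult)
  finally show ?thesis .
 qed
 ultimately have "cring ?F" by (rule cringI)
 moreover have "\<zero>.?F ~= \<one>.?F"
 proof
  assume "\<zero>.?F = \<one>.?F"
  hence "\<zero> ** \<one> \<ominus> \<one> ** \<one> : I" unfolding z o by (subst (asm) fr_eq_iff) auto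
  hence "\<ominus> \<one> ** (\<ominus> \<one>) : I" using I_l_closed[of "\<ominus> \<one>" "\<ominus> \<one>"] by (simp add: minus_eq)
  thus False using I1 by (simp add: l_minus)
 qed
 moreover have "EX b:carrier ?F. x **.?F b = \<one>.?F" if xF: "x <: ?F" "x ~= \<zero>.?F" for x
 proof -
  obtain a s where x: "x = fr a s" "a <: R" "s : carrier R - I" using xF(1) fr_cases by blast
  have "a ~: I"
  proof
   assume "a : I"
   hence "x = \<zero>.?F" unfolding x z using x by (subst fr_eq_iff) (auto simp: minus_eq)
   thus False using xF by simp
  qed
  hence a: "a : carrier R - I" using x by simp
  have "x **.?F fr s a = \<one>.?F"
   unfolding o x(1) fr_mult[OF x(2,3) DiffD1[OF x(3)] a]
   by (rule fr_eqI) (use x a p_mult[OF x(3) a] I1 in "auto simp: m_comm")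
  thus ?thesis using fr_carrier[of s a] a x by auto
 qed
 ultimately show ?thesis by (rule cring.cring_fieldI2)
qed

lemma residue_hom:
 shows "(%a. fr a \<one>) : ring_hom R (residue_field R I)"
  and "a <: R ==> fr a \<one> = \<zero>.(residue_field R I) \<longleftrightarrow> a : I"
proof -
 have I1: "\<one> : carrier R - I" and [simp]: "\<one> ~: I" using one_notin by auto
 show "(%a. fr a \<one>) : ring_hom R (residue_field R I)"
 proof (rule ring_hom_memI)
  fix x y assume "x <: R" "y <: R"
  thus "fr (x ** y) \<one> = fr x \<one> **.(residue_field R I) fr y \<one>"
   "fr (x \<oplus> y) \<one> = fr x \<one> \<oplus>.(residue_field R I) fr y \<one>"
   using I1 by (simp_all only: fr_mult fr_add) simp_all
 next
  show "fr x \<one> : carrier (residue_field R I)" if "x <: R" for x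
   by (rule fr_carrier[OF that I1])
 qed (simp add: residue_field_def)
 show "fr a \<one> = \<zero>.(residue_field R I) \<longleftrightarrow> a : I" if "a <: R"
  using that I1 by (simp add: residue_field_def fr_eq_iff minus_eq del: Diff_iff)
qed

end

section \<open>Transcendence degree and Krull dimension\<close>

inductive_set (in ring) sub_span :: "'a set => 'a set => 'a set" for A S where
 zero: "\<zero> : sub_span A S"
| base: "m : S ==> m : sub_span A S"
| add: "v : sub_span A S ==> w : sub_span A S ==> v \<oplus> w : sub_span A S"
| smult: "a : A ==> v : sub_span A S ==> a ** v : sub_span A S"

context field
begin

lemma sub_span_carrier:
 assumes "v : sub_span A S" "A <= carrier R" "S <= carrier R"
 shows "v <: R"
 using assms by (induction rule: sub_span.induct) auto

lemma sub_span_mult: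
 assumes v: "v : sub_span A S" and AS: "A <= carrier R" "S <= carrier R" and b: "b <: R"
  and S: "!!m. m : S ==> b ** m : sub_span A S'"
 shows "b ** v : sub_span A S'"
 using v
proof (induction rule: sub_span.induct)
 case zero
 thus ?case using b by (simp add: sub_span.zero)
next
 case (add v w)
 hence "b ** (v \<oplus> w) = b ** v \<oplus> b ** w" using b sub_span_carrier[OF _ AS] by (simp add: r_distr)
 thus ?case using add sub_span.add by simp
next
 case (smult a v)
 hence "b ** (a ** v) = a ** (b ** v)" using b sub_span_carrier[OF _ AS] AS(1) by (simp add: m_lcomm subset_iff)
 thus ?case using smult sub_span.smult by simp
qed (use S in auto)

lemma sub_span_empty: "v : sub_span A {} ==> A <= carrier R ==> v = \<zero>"
 by (induction rule: sub_span.induct) auto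

lemma sub_span_split:
 assumes A: "subring A R" and S: "insert m S <= carrier R" and v: "v : sub_span A (insert m S)"
 shows "EX b:A. EX w:sub_span A S. v = b ** m \<oplus> w"
 using v
proof (induction rule: sub_span.induct)
 case zero
 thus ?case using S by (intro bexI[of _ \<zero>] bexI[OF _ sub_span.zero]) (auto simp: subringE(2)[OF A])
next
 case (base v)
 show ?case
 proof (cases "v = m")
  case True
  thus ?thesis using S by (intro bexI[of _ \<one>] bexI[OF _ sub_span.zero]) (auto simp: subringE(3)[OF A])
 next
  case False
  hence "v : sub_span A S" using base sub_span.base by blast
  thus ?thesis using S base by (intro bexI[of _ \<zero>] bexI[of _ v]) (auto simp: subringE(2)[OF A])
 qed
next
 case (add v v')
 then obtain b w b' w' where *: "b : A" "w : sub_span A S" "v = b ** m \<oplus> w" "b' : A" "w' : sub_span A S" "v' = b' ** m \<oplus> w'" by blast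
 have "b <: R" "b' <: R" "w <: R" "w' <: R" "m <: R"
  using * S subringE(1)[OF A] sub_span_carrier by auto
 hence "v \<oplus> v' = (b \<oplus> b') ** m \<oplus> (w \<oplus> w')" unfolding *(3,6) by algebra
 thus ?case using * sub_span.add subringE(7)[OF A] by blast
next
 case (smult a v)
 then obtain b w where *: "b : A" "w : sub_span A S" "v = b ** m \<oplus> w" by blast
 have "a <: R" "b <: R" "w <: R" "m <: R"
  using * smult S subringE(1)[OF A] sub_span_carrier by auto
 hence "a ** v = (a ** b) ** m \<oplus> a ** w" unfolding * by algebra
 thus ?case using * smult sub_span.smult subringE(6)[OF A] by blast
qed

text \<open>A relation is cut off after its last nonzero coefficient; degree zero is excluded
  because a nonzero constant is not zero.\<close>

lemma algebraic_lead:
 assumes A: "subring A R" and u: "u : alg_over A"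
 obtains n :: nat and c where "ALL i. c i : A" "c n ~= \<zero>" "0 < n" "(\<Oplus>i:{..n}. c i ** u [^] i) = \<zero>"
proof -
 have uc: "u <: R" using u by (simp add: alg_over_def)
 obtain k :: nat and c j where c: "!!i. c i : A" "j < k" "c j ~= \<zero>" "(\<Oplus>i:{..<k}. c i ** u [^] i) = \<zero>"
  using u algebraic_iff[OF A uc] by (auto simp: alg_over_def)
 note [simp] = uc subsetD[OF subringE(1)[OF A] c(1)]
 define n where "n = Max {j. j < k & c j ~= \<zero>}"
 have "n : {j. j < k & c j ~= \<zero>}" unfolding n_def by (rule Max_in) (use c(2,3) in auto)
 hence n: "n < k" "c n ~= \<zero>" by auto
 have z: "c i = \<zero>" if "i : {..<k} - {..n}" for i
  using Max_ge[of "{j. j < k & c j ~= \<zero>}" i] that unfolding n_def by fastforce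
 have "(\<Oplus>i:{..<k}. c i ** u [^] i) = (\<Oplus>i:{..n}. c i ** u [^] i)"
  by (rule finsum_neutral_subset) (use n z in auto)
 hence rel: "(\<Oplus>i:{..n}. c i ** u [^] i) = \<zero>" using c(4) by simp
 have "n ~= 0" using rel n(2) by (intro notI) simp
 thus thesis using that[of c n] c(1) n(2) rel by auto
qed

text \<open>Algebraic elements become integral once their leading coefficients are inverted.
  Adjoining the low powers of one element after another yields finitely many module generators, with
  one denominator \<open>g\<close> for all products.\<close>

lemma finite_module_after_localization:
 assumes A: "subring A R" and Z: "finite Z" "Z <= alg_over A"
 obtains G g where "finite G" "G <= carrier R" "\<one> : G" "g : A" "g ~= \<zero>"
  "!!z m. z : Z ==> m : G ==> g ** (z ** m) : sub_span A G"
proof -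
 note Ac = subringE(1)[OF A]
 have "EX G g. finite G & G <= carrier R & \<one> : G & g : A & g ~= \<zero> & (ALL z:Z. ALL m:G. g ** (z ** m) : sub_span A G)"
  using Z
 proof (induction Z rule: finite_induct)
  case empty
  thus ?case by (intro exI[of _ "{\<one>}"] exI[of _ \<one>]) (auto simp: subringE(3)[OF A])
 next
  case (insert z Z)
  then obtain G g where G: "finite G" "G <= carrier R" "\<one> : G" and g: "g : A" "g ~= \<zero>"
   and gG: "!!z m. z : Z ==> m : G ==> g ** (z ** m) : sub_span A G" by blast
  have zc: "z <: R" and Zc: "Z <= carrier R" using insert.prems by (auto simp: alg_over_def)
  have zA: "z : alg_over A" using insert.prems by simp
  obtain n :: nat and c where c0: "ALL i. c i : A" "c n ~= \<zero>" "0 < n" "(\<Oplus>i:{..n}. c i ** z [^] i) = \<zero>"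
   using algebraic_lead[OF A zA] by blast
  hence c: "!!i. c i : A" "c n ~= \<zero>" "0 < n" "(\<Oplus>i:{..n}. c i ** z [^] i) = \<zero>" by simp_all
  note [simp] = zc subsetD[OF Ac c(1)] subsetD[OF Ac g(1)]
  define G' where "G' = (%(i, m). z [^] i ** m) ` ({..<n} \<times> G)"
  have G'I: "z [^] i ** m : G'" if "i < n" "m : G" for i m using that by (auto simp: G'_def)
  have G'c: "G' <= carrier R" using G by (auto simp: G'_def)
  have pow: "b ** (z [^] i ** m) : sub_span A G'" if "b : A" "i < n" "m : G" for b i m
   using G'I that sub_span.smult sub_span.base by metis
  have sumspan: "(\<Oplus>i:I. b i ** (z [^] i ** m)) : sub_span A G'"
   if "finite I" "I <= {..<n}" "m : G" "!!i. b i : A" for I b m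
   using that(1,2)
  proof (induction I rule: finite_induct)
   case (insert i I)
   have "(\<Oplus>j:insert i I. b j ** (z [^] j ** m)) = b i ** (z [^] i ** m) \<oplus> (\<Oplus>j:I. b j ** (z [^] j ** m))"
    using insert that(3) G(2) subsetD[OF Ac that(4)] by (intro finsum_insert) auto
   thus ?case using insert sub_span.add pow[OF that(4) _ that(3)] by simp
  qed (simp add: sub_span.zero)
  \<comment> \<open>The factor \<open>g\<close> takes care of the earlier elements, the factor
    \<open>c n\<close> of rewriting the power \<open>z^n\<close>.\<close>
  let ?g = "g ** c n"
  have g': "?g : A" "?g ~= \<zero>" using g c subringE(6)[OF A] integral[of g "c n"] by auto
  have "?g ** (y ** w) : sub_span A G'" if y: "y : insert z Z" and w: "w : G'" for y w
  proof -
   obtain i m where im: "i < n" "m : G" "w = z [^] i ** m" using w by (auto simp: G'_def)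
   have mc[simp]: "m <: R" using im G by auto
   show ?thesis
   proof (cases "y = z")
    case False
    hence yZ: "y : Z" using y by simp
    hence [simp]: "y <: R" using Zc by auto
    have "(c n ** z [^] i) ** (g ** (y ** m)) : sub_span A G'"
    proof (rule sub_span_mult[OF gG[OF yZ im(2)] Ac G(2)])
     fix m' assume m': "m' : G"
     hence "(c n ** z [^] i) ** m' = c n ** (z [^] i ** m')" using G(2) by (auto simp: m_assoc)
     thus "(c n ** z [^] i) ** m' : sub_span A G'" using pow[OF c(1) im(1) m'] by simp
    qed simp
    moreover have "(c n ** z [^] i) ** (g ** (y ** m)) = ?g ** (y ** w)" unfolding im(3) by (simp add: m_ac)
    ultimately show ?thesis by simp
   next
    case True
    show ?thesis
    proof (cases "Suc i < n")
     case True
     have "?g ** (z ** w) = ?g ** (z [^] Suc i ** m)" unfolding im(3) by (simp add: m_ac)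
     thus ?thesis using pow[OF g'(1) True im(2)] \<open>y = z\<close> by simp
    next
     case False
     hence i: "Suc i = n" using im by simp
     have "(\<Oplus>i:{..n}. c i ** z [^] i) = c n ** z [^] n \<oplus> (\<Oplus>i:{..<n}. c i ** z [^] i)"
      using finsum_insert[of "{..<n}" n "%i. c i ** z [^] i"] by (simp add: lessThan_Suc_atMost[symmetric] lessThan_Suc Pi_iff)
     hence lead: "c n ** z [^] n = \<ominus> (\<Oplus>i:{..<n}. c i ** z [^] i)"
      using c(4) by (simp add: minus_equality finsum_closed Pi_iff)
     have "?g ** (z ** w) = g ** m ** (c n ** z [^] n)" unfolding im(3) i[symmetric] by (simp add: m_ac)
     also have "... = \<ominus> (g ** m) ** (\<Oplus>i:{..<n}. c i ** z [^] i)"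
      unfolding lead by (simp add: finsum_closed Pi_iff l_minus r_minus)
     also have "... = (\<Oplus>i:{..<n}. \<ominus> (g ** m) ** (c i ** z [^] i))"
      by (rule finsum_rdistr) auto
     also have "... = (\<Oplus>i:{..<n}. (\<ominus> g ** c i) ** (z [^] i ** m))"
      by (rule finsum_cong') (auto simp: l_minus r_minus m_ac)
     also have "... : sub_span A G'"
      by (rule sumspan[OF _ _ im(2)]) (use g c subringE(5,6)[OF A] in auto)
     finally show ?thesis using \<open>y = z\<close> by simp
    qed
   qed
  qed
  moreover have "\<one> : G'" using G'I[OF c(3) G(3)] by simp
  moreover have "finite G'" using G(1) by (simp add: G'_def)
  ultimately show ?case using G'c g' by blast
 qed
 thus thesis using that by blast
qed

text \<open>A form of Nakayama's lemma, for the multiplicative set \<open>T\<close> of elements not vanishing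
  at the specialization \<open>\<pi> = 0\<close>: if \<open>\<pi>\<close> divided an element of \<open>T\<close> in the algebra generated by
  \<open>Z\<close>, then no generators of a finite module containing \<open>1\<close> would be needed.\<close>

lemma specialization_nonunit:
 assumes A: "subring A R" and G: "finite G" "G <= carrier R" "\<one> : G" and Z: "Z <= carrier R"
  and T: "T <= A" "\<one> : T" "\<zero> ~: T" "!!s t. s : T ==> t : T ==> s ** t : T"
  and g: "g : T" "!!z m. z : Z ==> m : G ==> g ** (z ** m) : sub_span A G"
  and \<pi>: "\<pi> : A" "!!a b. a : T ==> b : A ==> a \<ominus> \<pi> ** b : T"
  and u: "u : generate_ring R (A Un Z)"
 shows "\<pi> ** u ~: T"
proof
 assume s: "\<pi> ** u : T"
 note Ac = subringE(1)[OF A]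
 note [simp] = subsetD[OF Ac] subsetD[OF subset_trans[OF T(1) Ac]]
 let ?N = "sub_span A G"
 have Nc: "v <: R" if "v : ?N" for v using sub_span_carrier[OF that Ac G(2)] .
 \<comment> \<open>Up to a denominator in \<open>T\<close>, every element of the algebra maps the
   module \<open>?N\<close> into itself.\<close>
 have "EX t:T. ALL w:?N. t ** (v ** w) : ?N" if "v : generate_ring R (A Un Z)" for v
  using that
 proof (induction rule: generate_ring.induct)
  case one
  thus ?case using T Nc by (intro bexI[of _ \<one>]) auto
 next
  case (incl v)
  show ?case
  proof (cases "v : A")
   case True
   thus ?thesis using T Nc sub_span.smult by (intro bexI[of _ \<one>]) auto
  next
   case False
   hence vZ: "v : Z" using incl by simp
   have "g ** (v ** w) : ?N" if w: "w : ?N" for w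
   proof -
    have "(g ** v) ** w : ?N"
     by (rule sub_span_mult[OF w Ac G(2)]) (use g vZ Z G(2) in "auto simp: m_assoc subset_iff")
    thus ?thesis using g(1) vZ Z Nc[OF w] by (auto simp: m_assoc)
   qed
   thus ?thesis using g(1) by blast
  qed
 next
  case (a_inv v)
  then obtain t where t: "t : T" "!!w. w : ?N ==> t ** (v ** w) : ?N" by blast
  have vc: "v <: R" using a_inv(1) generate_ring_in_carrier[of "A Un Z" v] Ac Z by auto
  have "t ** (\<ominus> v ** w) : ?N" if w: "w : ?N" for w
  proof -
   have "t ** (\<ominus> v ** w) = \<ominus> \<one> ** (t ** (v ** w))" using t(1) vc Nc[OF w] by (simp add: l_minus r_minus)
   thus ?thesis using t(2)[OF w] sub_span.smult subringE(3,5)[OF A] by simp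
  qed
  thus ?case using t(1) by blast
 next
  case (eng_add v v')
  then obtain t t' where t: "t : T" "!!w. w : ?N ==> t ** (v ** w) : ?N" and t': "t' : T" "!!w. w : ?N ==> t' ** (v' ** w) : ?N" by blast
  have vc: "v <: R" "v' <: R" using eng_add(1,2) generate_ring_in_carrier[of "A Un Z"] Ac Z by auto
  have "(t ** t') ** ((v \<oplus> v') ** w) : ?N" if w: "w : ?N" for w
  proof -
   have "(t ** t') ** ((v \<oplus> v') ** w) = t' ** (t ** (v ** w)) \<oplus> t ** (t' ** (v' ** w))"
    using t(1) t'(1) vc Nc[OF w] by (simp add: l_distr r_distr m_ac)
   moreover have "t : A" "t' : A" using t(1) t'(1) T(1) by auto
   ultimately show ?thesis using t(2)[OF w] t'(2)[OF w] sub_span.smult sub_span.add by metis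
  qed
  thus ?case using t(1) t'(1) T(4) by blast
 next
  case (eng_mult v v')
  then obtain t t' where t: "t : T" "!!w. w : ?N ==> t ** (v ** w) : ?N" and t': "t' : T" "!!w. w : ?N ==> t' ** (v' ** w) : ?N" by blast
  have vc: "v <: R" "v' <: R" using eng_mult(1,2) generate_ring_in_carrier[of "A Un Z"] Ac Z by auto
  have "(t ** t') ** ((v ** v') ** w) : ?N" if w: "w : ?N" for w
  proof -
   have "(t ** t') ** ((v ** v') ** w) = t ** (v ** (t' ** (v' ** w)))"
    using t(1) t'(1) vc Nc[OF w] by (simp add: m_ac)
   thus ?thesis using t(2)[OF t'(2)[OF w]] by simp
  qed
  thus ?case using t(1) t'(1) T(4) by blast
 qed
 then obtain t where t: "t : T" "!!w. w : ?N ==> t ** (u ** w) : ?N" using u by blast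
 have uc: "u <: R" using u generate_ring_in_carrier[of "A Un Z" u] Ac Z by auto
 \<comment> \<open>\<open>P H\<close> says that \<open>H\<close> still generates the module up to
   denominators in \<open>T\<close>.\<close>
 define P where "P H \<longleftrightarrow> H <= G & (EX f:T. ALL m:G. f ** m : sub_span A H)" for H
 have "P G" unfolding P_def using T(2) G(2) sub_span.base by (intro conjI bexI[of _ \<one>]) auto
 from ex_has_least_nat[of P, OF this, of card]
 obtain H where "P H & (ALL H'. P H' --> card H <= card H')" ..
 hence PH: "P H" and min: "!!H'. P H' ==> card H <= card H'" by simp_all
 obtain f where f: "f : T" "!!m. m : G ==> f ** m : sub_span A H" and HG: "H <= G" using PH by (auto simp: P_def)
 have Hc: "H <= carrier R" using HG G(2) by auto
 show False
 proof (cases "H = {}")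
  case True
  hence "f ** \<one> = \<zero>" using f(2)[OF G(3)] sub_span_empty Ac by blast
  thus False using f(1) T(3) by simp
 next
  case False
  then obtain m where m: "m : H" by blast
  hence mG: "m : G" and mc: "m <: R" using HG G by auto
  define H' where "H' = H - {m}"
  have H: "H = insert m H'" using m by (auto simp: H'_def)
  have tum: "t ** (u ** m) : ?N" using t(2) sub_span.base[OF mG] by blast
  have "f ** (t ** (u ** m)) : sub_span A H" by (rule sub_span_mult[OF tum Ac G(2)]) (use f in auto)
  then obtain b w where bw: "b : A" "w : sub_span A H'" "f ** (t ** (u ** m)) = b ** m \<oplus> w"
   using sub_span_split[OF A, of m H' "f ** (t ** (u ** m))"] H Hc by blast
  have wc: "w <: R" using sub_span_carrier[OF bw(2) Ac] Hc H by auto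
  \<comment> \<open>\<open>f'\<close> lies in \<open>T\<close> because \<open>\<pi> u\<close> does
    and subtracting multiples of \<open>\<pi>\<close> stays in \<open>T\<close>. It moves
    \<open>m\<close> into the span of the other generators, against minimality of
    \<open>H\<close>.\<close>
  define f' where "f' = (f ** t) ** (\<pi> ** u) \<ominus> \<pi> ** b"
  have f'T: "f' : T" unfolding f'_def using f(1) t(1) s bw(1) T(4) \<pi>(2) by blast
  have "f' ** m = \<pi> ** (f ** (t ** (u ** m))) \<ominus> \<pi> ** (b ** m)"
  proof -
   have cl: "f <: R" "t <: R" "\<pi> <: R" "b <: R" using f(1) t(1) \<pi>(1) bw(1) by auto
   show ?thesis unfolding f'_def using cl uc mc by algebra
  qed
  also have "... = \<pi> ** w"
  proof -
   have "\<pi> <: R" "b <: R" using \<pi>(1) bw(1) by auto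
   thus ?thesis unfolding bw(3) using wc mc by algebra
  qed
  finally have f'm: "f' ** m : sub_span A H'" using sub_span.smult[OF \<pi>(1) bw(2)] by simp
  have "(f' ** f) ** x : sub_span A H'" if x: "x : G" for x
  proof -
   have "f' ** (f ** x) : sub_span A H'"
   proof (rule sub_span_mult[OF f(2)[OF x] Ac Hc])
    fix y assume y: "y : H"
    show "f' ** y : sub_span A H'"
     using y f'm H sub_span.smult[OF subsetD[OF T(1) f'T] sub_span.base] by (cases "y = m") auto
   qed (use f'T in auto)
   thus ?thesis using f'T f(1) x G(2) by (auto simp: m_assoc subset_iff)
  qed
  moreover have "f' ** f : T" using f'T f(1) T(4) by blast
  ultimately have "P H'" unfolding P_def using HG H by auto
  hence "card H <= card H'" by (rule min)
  moreover have "card H' < card H" unfolding H'_def using m HG G(1) finite_subset by (intro card_Diff1_less) auto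
  ultimately show False by simp
 qed
qed

text \<open>The transcendental \<open>x\<close> is specialized to a scalar \<open>c\<close>. If the
  denominator of the finite module does not vanish at \<open>c\<close>, then \<open>x - c\<close>
  divides no nonzero element of \<open>A\<close>; a prime containing \<open>x - c\<close> can then
  be found that costs only one transcendental.\<close>

lemma exists_nonunit_specialization:
 assumes A: "subring A R" and k: "k <= A" "infinite k" and x: "x <: R" "x ~: alg_over A"
  and Z: "finite Z" "Z <= alg_over (simple_extension A x)"
 obtains c where "c : k" "ALL u:generate_ring R (simple_extension A x Un Z). (x \<ominus> c) ** u ~: A - {\<zero>}"
proof -
 define A' where "A' = simple_extension A x"
 note Ac = subringE(1)[OF A]
 have A': "subring A' R" unfolding A'_def by (rule simple_extension_is_subring[OF A x(1)])
 note A'c = subringE(1)[OF A']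
 have Zc: "Z <= carrier R" using Z by (auto simp: alg_over_def)
 obtain G g where G: "finite G" "G <= carrier R" "\<one> : G" and g: "g : A'" "g ~= \<zero>"
  and gz: "!!z m. z : Z ==> m : G ==> g ** (z ** m) : sub_span A' G"
  using finite_module_after_localization[OF A' Z(1)] Z(2) unfolding A'_def by blast
 have A'_eval: "A' = (%p. eval p x) ` carrier (A[X])"
  unfolding A'_def by (rule simple_extension_as_eval_img[OF Ac x(1)])
 obtain p where p: "p : carrier (A[X])" "g = eval p x" using g(1) A'_eval by blast
 have pne: "p ~= []" using p(2) g(2) by auto
 have trans: "q = []" if "q : carrier (A[X])" "eval q x = \<zero>" for q
  using that algebraicI[of q A x] x by (auto simp: alg_over_def)
 have big: "carrier (A[X]) <= carrier (poly_ring R)"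
  using Ac by (auto simp: univ_poly_def polynomial_def)
 have "finite {y. is_root p y}" using finite_number_of_roots p(1) big by blast
 \<comment> \<open>The denominator \<open>g\<close> is a nonzero polynomial in \<open>x\<close>, and
   infinitely many scalars are available to avoid its roots.\<close>
 then obtain c where c: "c : k" "~ is_root p c" using k(2) by (metis finite_subset mem_Collect_eq subsetI)
 have cA: "c : A" and cc: "c <: R" using c(1) k(1) Ac by auto
 have pc: "eval p c ~= \<zero>" using c(2) cc pne by (simp add: is_root_def)
 interpret ex: ring_hom_ring "A[X]" R "%p. eval p x" by (rule eval_ring_hom[OF A x(1)])
 interpret ec: ring_hom_ring "A[X]" R "%p. eval p c" by (rule eval_ring_hom[OF A cc])
 \<comment> \<open>Since \<open>x\<close> is transcendental over \<open>A\<close>, a polynomial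
   expression in \<open>x\<close> determines the polynomial, so not vanishing at \<open>c\<close>
   excludes zero from \<open>T\<close>.\<close>
 define T where "T = {eval q x | q. q : carrier (A[X]) & eval q c ~= \<zero>}"
 have TI: "eval q x : T" if "q : carrier (A[X])" "eval q c ~= \<zero>" for q using that by (auto simp: T_def)
 define l where "l = [\<one>, \<ominus> c]"
 have l: "l : carrier (A[X])" "eval l x = x \<ominus> c" "eval l c = \<zero>"
  using cA cc x(1) subringE(3,5)[OF A] by (auto simp: l_def univ_poly_def polynomial_def minus_eq r_neg)
 have const: "a : T" if a: "a : A - {\<zero>}" for a
 proof -
  have "[a] : carrier (A[X])" using a by (auto simp: univ_poly_def polynomial_def)
  moreover have "eval [a] x = a" "eval [a] c = a" using a Ac by auto
  ultimately show ?thesis using TI[of "[a]"] a by simp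
 qed
 have "(x \<ominus> c) ** u ~: T" if u: "u : generate_ring R (A' Un Z)" for u
 proof (rule specialization_nonunit[OF A' G Zc _ _ _ _ _ gz _ _ u])
  show "T <= A'" unfolding A'_eval T_def by blast
  show "\<one> : T" using const subringE(3)[OF A] by simp
  show "\<zero> ~: T"
  proof
   assume "\<zero> : T"
   then obtain q where "q : carrier (A[X])" "eval q x = \<zero>" "eval q c ~= \<zero>" by (auto simp: T_def)
   thus False using trans[of q] by simp
  qed
  show "s ** t : T" if "s : T" "t : T" for s t
  proof -
   obtain q q' where *: "s = eval q x" "t = eval q' x" "q : carrier (A[X])" "q' : carrier (A[X])" "eval q c ~= \<zero>" "eval q' c ~= \<zero>"
    using \<open>s : T\<close> \<open>t : T\<close> by (auto simp: T_def)
   have "eval (q **.(A[X]) q') c ~= \<zero>"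
    using * integral[of "eval q c" "eval q' c"] ec.hom_closed by auto
   thus ?thesis using TI[of "q **.(A[X]) q'"] * by simp
  qed
  show "g : T" unfolding p(2) by (rule TI[OF p(1) pc])
  show "x \<ominus> c : A'" unfolding A'_eval l(2)[symmetric] using l(1) by blast
  show "a \<ominus> (x \<ominus> c) ** b : T" if "a : T" "b : A'" for a b
  proof -
   obtain q q' where *: "a = eval q x" "b = eval q' x" "q : carrier (A[X])" "q' : carrier (A[X])" "eval q c ~= \<zero>"
    using \<open>a : T\<close> \<open>b : A'\<close> unfolding A'_eval by (auto simp: T_def)
   let ?r = "q \<ominus>.(A[X]) (l **.(A[X]) q')"
   have r: "?r : carrier (A[X])" using * l by simp
   have "eval ?r x = a \<ominus> (x \<ominus> c) ** b" using * l by (simp add: ex.R.minus_eq minus_eq)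
   moreover have "eval ?r c = eval q c" using * l ec.hom_closed by (simp add: ex.R.minus_eq)
   ultimately show ?thesis using TI[OF r] * by simp
  qed
 qed
 hence "(x \<ominus> c) ** u ~: A - {\<zero>}" if "u : generate_ring R (simple_extension A x Un Z)" for u
  using const that unfolding A'_def by blast
 thus thesis using that c(1) by blast
qed

end

text \<open>Algebraicity of \<open>b\<close> over \<open>A\<close> in the residue field of
  \<open>p\<close>, written with ring elements so that different primes can be compared.\<close>

definition (in ring) algebraic_mod :: "'a set => 'a set => 'a => bool" where
 "algebraic_mod p A b \<longleftrightarrow> (EX (n::nat) c. (ALL i. c i : A) & (EX i<n. c i ~: p) & (\<Oplus>i:{..<n}. c i ** b [^] i) : p)"

lemma (in ring_hom_cring) image_generate_ring:
 assumes "k <= carrier R" "Y <= carrier R"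
 shows "generate_ring S (h ` k Un h ` Y) = h ` generate_ring R (k Un Y)"
proof
 have sub: "k Un Y <= carrier R" using assms by auto
 have hsub: "h ` k Un h ` Y <= carrier S" using assms hom_closed by auto
 show "generate_ring S (h ` k Un h ` Y) <= h ` generate_ring R (k Un Y)"
 proof (rule S.generate_ring_min_subring1[OF hsub])
  show "subring (h ` generate_ring R (k Un Y)) S"
   by (rule ring.img_is_subring[OF R.generate_ring_is_subring[OF sub]])
  show "h ` k Un h ` Y <= h ` generate_ring R (k Un Y)"
   using generate_ring.incl[of _ "k Un Y" R] by blast
 qed
 have "h x : generate_ring S (h ` k Un h ` Y)" if "x : generate_ring R (k Un Y)" for x
  using that
 proof (induction rule: generate_ring.induct)
  case one
  thus ?case by (simp add: generate_ring.one)
 next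
  case (incl x)
  thus ?case by (intro generate_ring.incl) auto
 next
  case (a_inv x)
  thus ?case using R.generate_ring_in_carrier[OF sub] generate_ring.a_inv by fastforce
 next
  case (eng_add x y)
  thus ?case using R.generate_ring_in_carrier[OF sub] generate_ring.eng_add by fastforce
 next
  case (eng_mult x y)
  thus ?case using R.generate_ring_in_carrier[OF sub] generate_ring.eng_mult by fastforce
 qed
 thus "h ` generate_ring R (k Un Y) <= generate_ring S (h ` k Un h ` Y)" by blast
qed

lemma algebraic_mod_iff:
 assumes R: "cring R" and F: "field F" and h: "h : ring_hom R F"
  and p: "p = {x : carrier R. h x = \<zero>.F}" and A: "subring A R" and b: "b <: R"
 shows "ring.algebraic_mod R p A b \<longleftrightarrow> h b : ring.alg_over F (h ` A)"
proof -
 interpret R: cring R by fact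
 interpret F: field F by fact
 interpret h: ring_hom_cring R F h
  by (intro ring_hom_cring.intro ring_hom_cring_axioms.intro h) unfold_locales
 have hA: "subring (h ` A) F" by (rule h.ring.img_is_subring[OF A])
 note Ac = subsetD[OF subringE(1)[OF A]]
 have sum: "h (\<Oplus>.R i:{..<n}. c i **.R b [^].R i) = (\<Oplus>.F i:{..<n}. h (c i) **.F h b [^].F i)"
  if "ALL i. c i : A" for c and n :: nat
 proof -
  have "h (\<Oplus>.R i:{..<n}. c i **.R b [^].R i) = (\<Oplus>.F i:{..<n}. (h \<circ> (%i. c i **.R b [^].R i)) i)"
   using that Ac b by (subst h.hom_finsum) (auto simp: o_def)
  also have "... = (\<Oplus>.F i:{..<n}. h (c i) **.F h b [^].F i)"
   using that Ac b by (intro F.finsum_cong') (auto simp: h.ring.hom_nat_pow)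
  finally show ?thesis .
 qed
 have hb: "h b <: F" using b by simp
 show ?thesis
 proof
  assume "R.algebraic_mod p A b"
  then obtain n :: nat and c i where c: "ALL i. c i : A" "i < n" "c i ~: p" "(\<Oplus>.R i:{..<n}. c i **.R b [^].R i) : p"
   unfolding R.algebraic_mod_def by blast
  hence "(\<Oplus>.F i:{..<n}. h (c i) **.F h b [^].F i) = \<zero>.F" using sum[OF c(1), of n] p by simp
  moreover have "h (c i) ~= \<zero>.F" using c(1,3) Ac p by auto
  ultimately have "(F.algebraic over (h ` A)) (h b)"
   unfolding F.algebraic_iff[OF hA hb] using c(1,2) by (intro exI[of _ n] exI[of _ "%i. h (c i)"]) auto
  thus "h b : F.alg_over (h ` A)" using hb by (simp add: F.alg_over_def)
 next
  assume "h b : F.alg_over (h ` A)"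
  then obtain n :: nat and d i where d: "ALL i. d i : h ` A" "i < n" "d i ~= \<zero>.F" "(\<Oplus>.F i:{..<n}. d i **.F h b [^].F i) = \<zero>.F"
   using F.algebraic_iff[OF hA hb] by (auto simp: F.alg_over_def)
  have "ALL i. EX a. a : A & d i = h a" using d(1) by blast
  from choice[OF this] obtain c where "ALL i. c i : A & d i = h (c i)" ..
  hence c: "!!i. c i : A" "!!i. d i = h (c i)" by simp_all
  have "(\<Oplus>.R i:{..<n}. c i **.R b [^].R i) <: R" using c(1) Ac b by (intro R.finsum_closed) auto
  hence "(\<Oplus>.R i:{..<n}. c i **.R b [^].R i) : p" using sum[of c n] c d(4) p by simp
  moreover have "c i ~: p" using d(3) c p by simp
  ultimately show "R.algebraic_mod p A b" unfolding R.algebraic_mod_def using c(1) d(2) by blast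
 qed
qed

text \<open>\<open>k\<close> is the image of the base field inside the ring. Its nonzero elements
  are asked to be invertible in \<open>R\<close>, which lets it remain a mere subset.\<close>

locale affine_algebra = cring R for R (structure) +
 fixes k G
 assumes k_subring: "subring k R" and k_infinite: "infinite k"
  and k_unit: "!!a. a : k ==> a ~= \<zero> ==> EX b:carrier R. a ** b = \<one>"
  and G_finite: "finite G" and G_carrier: "G <= carrier R"
  and generated: "generate_ring R (k Un G) = carrier R"
begin

lemma k_carrier: "k <= carrier R" using subringE(1)[OF k_subring] .

text \<open>Differences of distinct elements of \<open>k\<close> are units, and a homomorphism to a
  field kills no unit.\<close>

lemma inj_on_k:
 assumes "field F" "h : ring_hom R F"
 shows "inj_on h k"
proof (rule inj_onI, rule ccontr)
 interpret F: field F by fact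
 interpret h: ring_hom_cring R F h
  by (intro ring_hom_cring.intro ring_hom_cring_axioms.intro assms) unfold_locales
 fix a b assume ab: "a : k" "b : k" "h a = h b" "a ~= b"
 have cl: "a <: R" "b <: R" using ab k_carrier by auto
 have "a \<ominus> b : k" using ab subringE(5,7)[OF k_subring] by (simp add: minus_eq)
 moreover have "a \<ominus> b ~= \<zero>" using ab cl by (simp add: r_right_minus_eq)
 ultimately obtain z where z: "z <: R" "(a \<ominus> b) ** z = \<one>" using k_unit by blast
 have "h (a \<ominus> b) = \<zero>.F" using ab cl by (simp add: minus_eq F.r_neg)
 hence "h ((a \<ominus> b) ** z) = \<zero>.F" using cl z(1) ab(3) by (simp add: F.minus_eq F.r_neg)
 thus False using z(2) by simp
qed

lemma image_in_acl:
 assumes "field F" "h : ring_hom R F" "h ` G <= field.acl F (h ` k) Y" "Y <= carrier F"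
 shows "h ` carrier R <= field.acl F (h ` k) Y"
proof -
 interpret F: field F by fact
 interpret h: ring_hom_cring R F h
  by (intro ring_hom_cring.intro ring_hom_cring_axioms.intro assms) unfold_locales
 have hk: "h ` k <= carrier F" using k_carrier by auto
 have "h ` carrier R = generate_ring F (h ` k Un h ` G)"
  using h.image_generate_ring[OF k_carrier G_carrier] generated by simp
 also have "... <= F.acl (h ` k) Y"
 proof (rule F.generate_ring_min_subring1)
  show "subring (F.acl (h ` k) Y) F" by (rule subfieldE(1)[OF F.acl_subfield[OF hk assms(4)]])
  show "h ` k Un h ` G <= F.acl (h ` k) Y" using assms(3) F.acl_incl[OF hk assms(4)] by auto
 qed (use hk G_carrier in auto)
 finally show ?thesis .
qed

abbreviation gr where "gr Y == generate_ring R (k Un Y)"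

lemma gr_subring: "Y <= carrier R ==> subring (gr Y) R"
 using k_carrier by (intro generate_ring_is_subring) auto

lemma gr_mono: "Y <= Y' ==> Y' <= carrier R ==> gr Y <= gr Y'"
 using k_carrier by (intro mono_generate_ring) auto

lemma algebraic_mod_acl:
 assumes "field F" "h : ring_hom R F" "p = {x : carrier R. h x = \<zero>.F}" "Y <= carrier R" "b <: R"
 shows "algebraic_mod p (gr Y) b \<longleftrightarrow> h b : field.acl F (h ` k) (h ` Y)"
proof -
 interpret F: field F by fact
 interpret h: ring_hom_cring R F h
  by (intro ring_hom_cring.intro ring_hom_cring_axioms.intro assms) unfold_locales
 show ?thesis
  unfolding F.acl_def h.image_generate_ring[OF k_carrier assms(4)]
  by (rule algebraic_mod_iff[OF cring_axioms assms(1-3) gr_subring[OF assms(4)] assms(5)])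
qed

text \<open>Each step specializes one member of a transcendence basis of the residue field of
  \<open>p\<close> and obtains a strictly larger prime that keeps the remaining members independent.
  The basis is taken among the ring generators instead of \<open>Bs\<close>, so that all of
  \<open>G\<close> is algebraic over it.\<close>

lemma prime_chain:
 assumes "primeideal p R" "finite Bs" "Bs <= carrier R" "card Bs = e"
  "!!b. b : Bs ==> ~ algebraic_mod p (gr (Bs - {b})) b"
 shows "EX P. P 0 = p & (ALL i<=e. primeideal (P i) R) & (ALL i<e. P i \<subset> P (Suc i))"
 using assms
proof (induction e arbitrary: p Bs)
 case 0
 thus ?case by (intro exI[of _ "%_. p"]) auto
next
 case (Suc e)
 interpret p: primeideal p R by (rule Suc.prems(1))
 define F where "F = residue_field R p"
 define h where "h a = residue_fraction R p a \<one>" for a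
 have F: "field F" unfolding F_def by (rule p.residue_field_is_field)
 have h: "h : ring_hom R F" using p.residue_hom(1) by (simp add: F_def h_def[abs_def])
 have ker: "p = {x : carrier R. h x = \<zero>.F}"
  using p.residue_hom(2) p.a_subset by (auto simp: F_def h_def)
 have kerD: "z : p \<longleftrightarrow> z <: R & h z = \<zero>.F" for z by (subst ker) simp
 interpret F: field F by fact
 interpret h: ring_hom_cring R F h
  by (intro ring_hom_cring.intro ring_hom_cring_axioms.intro h) unfold_locales
 have hk: "h ` k <= carrier F" and hG: "h ` G <= carrier F" using k_carrier G_carrier by auto
 obtain B0 where B0: "B0 <= h ` G" "h ` G <= F.acl (h ` k) B0" "ALL b:B0. b ~: F.acl (h ` k) (B0 - {b})"
  using F.acl_basis[OF hk hG finite_imageI[OF G_finite]] by blast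
 obtain B' where B': "B' <= G" "inj_on h B'" "B0 = h ` B'" using B0(1) subset_image_inj by metis
 have B'c: "B' <= carrier R" and fB': "finite B'" using B'(1) G_carrier G_finite finite_subset by auto
 have B0c: "B0 <= carrier F" using B'(3) B'c by auto
 obtain ts where ts: "set ts = Bs" "distinct ts" using finite_distinct_list[OF Suc.prems(2)] by blast
 \<comment> \<open>By exchange the basis is at least as large as the independent set
   \<open>Bs\<close>.\<close>
 have "length (map h ts) <= card B0"
 proof (rule F.acl_independent_bound[OF hk B0c])
  show "finite B0" using fB' B'(3) by simp
  show "set (map h ts) <= F.acl (h ` k) B0"
   using image_in_acl[OF F h B0(2) B0c] ts(1) Suc.prems(3) by auto
  fix i assume i: "i < length (map h ts)"
  let ?b = "ts ! i"
  have b: "?b : Bs" using i ts(1) by auto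
  have "set (take i ts) <= Bs - {?b}"
   using ts i by (auto simp: in_set_conv_nth nth_eq_iff_index_eq dest: in_set_takeD)
  hence "h ` set (take i ts) <= h ` (Bs - {?b})" by blast
  hence "F.acl (h ` k) (h ` set (take i ts)) <= F.acl (h ` k) (h ` (Bs - {?b}))"
   using Suc.prems(3) by (intro F.acl_mono[OF hk]) auto
  moreover have "h ?b ~: F.acl (h ` k) (h ` (Bs - {?b}))"
   using algebraic_mod_acl[OF F h ker, of "Bs - {?b}" ?b] Suc.prems(3,5) b by blast
  ultimately show "map h ts ! i ~: F.acl (h ` k) (set (take i (map h ts)))"
   using i by (auto simp: take_map)
 qed
 hence card: "Suc e <= card B'" using B'(2,3) card_image[of h B'] ts distinct_card[of ts] Suc.prems(4) by simp
 then obtain x where x: "x : B'" by fastforce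
 define Y where "Y = B' - {x}"
 have xc: "x <: R" and Yc: "Y <= carrier R" using x B'c by (auto simp: Y_def)
 have hxF: "h x <: F" using xc by simp
 have hY: "h ` Y = B0 - {h x}" using B'(2,3) x by (auto simp: Y_def inj_on_def)
 have hYc: "h ` Y <= carrier F" using Yc by auto
 define A where "A = generate_ring F (h ` k Un h ` Y)"
 have A_img: "A = h ` gr Y" unfolding A_def by (rule h.image_generate_ring[OF k_carrier Yc])
 have A: "subring A F" unfolding A_def by (rule F.gen_subring[OF hk hYc])
 have hx: "h x ~: F.alg_over A" using bspec[OF B0(3), of "h x"] x B'(3) by (auto simp: A_def F.acl_def hY)
 have "h ` G <= F.alg_over (F.simple_extension A (h x))"
 proof -
  have "B0 = insert (h x) (h ` Y)" using hY x B'(3) by auto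
  thus ?thesis
   using B0(2) F.generate_ring_insert[OF hk hYc hxF] by (simp add: F.acl_def A_def)
 qed
 note Gx = this
 have hkA: "h ` k <= A" unfolding A_def using generate_ring.incl[of _ "h ` k Un h ` Y" F] by blast
 have inf: "infinite (h ` k)" using inj_on_k[OF F h] k_infinite finite_imageD by blast
 obtain c where c: "c : h ` k"
  "ALL u:generate_ring F (F.simple_extension A (h x) Un h ` G). (h x \<ominus>.F c) **.F u ~: A - {\<zero>.F}"
  using F.exists_nonunit_specialization[OF A hkA inf hxF hx finite_imageI[OF G_finite] Gx] by blast
 have cF: "c <: F" using c(1) hk by auto
 obtain c0 where c0: "c0 : k" "c = h c0" using c(1) by blast
 have c0c: "c0 <: R" using c0 k_carrier by blast
 define y where "y = x \<ominus> c0"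
 have yc: "y <: R" using xc c0c by (simp add: y_def)
 have hy: "h y = h x \<ominus>.F c" using xc c0c c0(2) by (simp add: y_def minus_eq F.minus_eq)
 have all: "h r : generate_ring F (F.simple_extension A (h x) Un h ` G)" if "r <: R" for r
 proof -
  have Ax: "subring (F.simple_extension A (h x)) F" by (rule F.simple_extension_is_subring[OF A hxF])
  have "h r : generate_ring F (h ` k Un h ` G)"
   using h.image_generate_ring[OF k_carrier G_carrier] generated that by auto
  moreover have "h ` k <= F.simple_extension A (h x)"
   using \<open>h ` k <= A\<close> F.simple_extension_incl[OF subringE(1)[OF A] hxF] by blast
  moreover have "F.simple_extension A (h x) Un h ` G <= carrier F" using subringE(1)[OF Ax] hG by auto
  ultimately show ?thesis
   using F.mono_generate_ring[of "h ` k Un h ` G" "F.simple_extension A (h x) Un h ` G"] by blast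
 qed
 define I where "I = {z \<oplus> y ** r | z r. z : p & r <: R}"
 have I: "ideal I R" "p <= I" "y : I" using ideal_sum_principal[OF p.is_ideal yc] by (simp_all add: I_def)
 \<comment> \<open>An element of \<open>I\<close> lying in \<open>gr Y\<close> but not in
   \<open>p\<close> would map to a nonzero element of \<open>A\<close> divisible by
   \<open>x - c\<close>, which the choice of \<open>c\<close> excludes.\<close>
 have disj: "I Int (gr Y - p) = {}"
 proof (rule ccontr)
  assume "I Int (gr Y - p) ~= {}"
  then obtain z r where *: "z : p" "r <: R" "z \<oplus> y ** r : gr Y" "z \<oplus> y ** r ~: p" by (auto simp: I_def)
  have zc: "z <: R" "h z = \<zero>.F" using *(1) kerD by auto
  have "h (z \<oplus> y ** r) = (h x \<ominus>.F c) **.F h r" using zc * yc hy hxF cF by simp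
  moreover have "h (z \<oplus> y ** r) : A" using *(3) A_img by blast
  moreover have "h (z \<oplus> y ** r) ~= \<zero>.F"
   using *(4) kerD[of "z \<oplus> y ** r"] zc(1) *(2) yc by blast
  ultimately show False using bspec[OF c(2) all[OF *(2)]] by (metis DiffI singletonD)
 qed
 have "\<one> : gr Y - p" using p.one_notin generate_ring.one by auto
 moreover have "a ** b : gr Y - p" if "a : gr Y - p" "b : gr Y - p" for a b
 proof -
  have "a <: R" "b <: R" using that subringE(1)[OF gr_subring[OF Yc]] by auto
  thus ?thesis using that generate_ring.eng_mult[of a R "k Un Y" b] p.I_prime[of a b] by auto
 qed
 ultimately obtain q where q: "primeideal q R" "I <= q" "q Int (gr Y - p) = {}"
  using prime_avoiding[OF I(1) disj] by blast
 have pq: "p \<subset> q"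
 proof
  show "p <= q" using I q by blast
  have "h x ~= c" using hx c(1) \<open>h ` k <= A\<close> F.alg_over_incl[OF A] by auto
  hence "h y ~= \<zero>.F" using hy hxF c0 c0c F.r_right_minus_eq by simp
  thus "p ~= q" using I(3) q(2) kerD by auto
 qed
 \<comment> \<open>The value of a relation modulo \<open>q\<close> lies both in \<open>gr Y\<close>
   and in \<open>q\<close>, hence in \<open>p\<close>; its coefficients outside \<open>q\<close> are
   also outside \<open>p\<close>.\<close>
 have indep: "~ algebraic_mod q (gr (Y - {b})) b" if b: "b : Y" for b
 proof
  assume "algebraic_mod q (gr (Y - {b})) b"
  then obtain n :: nat and c i where c: "ALL i. c i : gr (Y - {b})" "i < n" "c i ~: q" "(\<Oplus>i:{..<n}. c i ** b [^] i) : q"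
   unfolding algebraic_mod_def by blast
  have YbY: "gr (Y - {b}) <= gr Y" by (rule gr_mono) (use Yc in auto)
  have bY: "b : gr Y" using b generate_ring.incl[of b "k Un Y" R] by blast
  have sgr: "subring (gr Y) R" by (rule gr_subring[OF Yc])
  have pw: "b [^] (i::nat) : gr Y" for i
   by (induction i) (auto simp: subringE(3)[OF sgr] intro: subringE(6)[OF sgr] bY)
  have "(\<Oplus>i:J. c i ** b [^] i) : gr Y" if "finite J" for J
   using that
  proof (induction J rule: finite_induct)
   case (insert j J)
   have "!!i. c i ** b [^] i : gr Y" using c(1) YbY pw subringE(6)[OF sgr] by blast
   thus ?case using insert subringE(1,7)[OF sgr] by (subst finsum_insert) auto
  qed (simp add: subringE(2)[OF sgr])
  hence "(\<Oplus>i:{..<n}. c i ** b [^] i) : p" using c(4) q(3) by blast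
  moreover have "c i ~: p" using c(3) pq by blast
  moreover have "gr (Y - {b}) <= gr (B' - {b})" by (rule gr_mono) (use B'c in "auto simp: Y_def")
  ultimately have "algebraic_mod p (gr (B' - {b})) b" unfolding algebraic_mod_def using c(1,2) by blast
  hence "h b : F.acl (h ` k) (h ` (B' - {b}))"
   using algebraic_mod_acl[OF F h ker, of "B' - {b}" b] B'c b by (auto simp: Y_def)
  moreover have "h ` (B' - {b}) = B0 - {h b}" using B'(2,3) b by (auto simp: Y_def inj_on_def)
  ultimately show False using bspec[OF B0(3), of "h b"] b B'(3) by (auto simp: Y_def)
 qed
 have "e <= card Y" using card x fB' by (simp add: Y_def)
 then obtain C where C: "C <= Y" "card C = e" by (metis obtain_subset_with_card_n)
 have fC: "finite C" and Cc: "C <= carrier R" using C(1) Yc fB' finite_subset[of C B'] by (auto simp: Y_def)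
 have "~ algebraic_mod q (gr (C - {b})) b" if "b : C" for b
 proof
  assume "algebraic_mod q (gr (C - {b})) b"
  moreover have "gr (C - {b}) <= gr (Y - {b})" by (rule gr_mono) (use C Yc in auto)
  ultimately have "algebraic_mod q (gr (Y - {b})) b" unfolding algebraic_mod_def by blast
  thus False using indep that C(1) by blast
 qed
 then obtain P where P: "P 0 = q" "ALL i<=e. primeideal (P i) R" "ALL i<e. P i \<subset> P (Suc i)"
  using Suc.IH[OF q(1) fC Cc C(2)] by blast
 define P' where "P' i = (case i of 0 => p | Suc j => P j)" for i
 have "P' 0 = p & (ALL i<=Suc e. primeideal (P' i) R) & (ALL i<Suc e. P' i \<subset> P' (Suc i))"
  using P Suc.prems(1) pq by (auto simp: P'_def split: nat.split)
 thus ?case by blast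
qed

text \<open>A transcendence basis of the image, chosen among the images of the generators, lifts to
  elements independent modulo the kernel of \<open>h\<close>. The primes above the kernel then form
  a chain of that length.\<close>

lemma transcendence_degree_le_krull_dim:
 assumes dim: "has_krull_dim R d" and F: "field F" and h: "h : ring_hom R F"
 obtains Y where "finite Y" "card Y <= d" "Y <= carrier F" "h ` carrier R <= field.acl F (h ` k) Y"
proof -
 interpret F: field F by fact
 interpret h: ring_hom_cring R F h
  by (intro ring_hom_cring.intro ring_hom_cring_axioms.intro h) unfold_locales
 have hk: "h ` k <= carrier F" and hG: "h ` G <= carrier F" using k_carrier G_carrier by auto
 obtain B0 where B0: "B0 <= h ` G" "h ` G <= F.acl (h ` k) B0" "ALL b:B0. b ~: F.acl (h ` k) (B0 - {b})"
  using F.acl_basis[OF hk hG finite_imageI[OF G_finite]] by blast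
 obtain B' where B': "B' <= G" "inj_on h B'" "B0 = h ` B'" using B0(1) subset_image_inj by metis
 have B'c: "B' <= carrier R" and fB': "finite B'" using B'(1) G_carrier G_finite finite_subset by auto
 have B0c: "B0 <= carrier F" using B'(3) B'c by auto
 define p where "p = {x : carrier R. h x = \<zero>.F}"
 have p: "primeideal p R"
 proof (rule primeidealI[OF _ cring_axioms])
  show "ideal p R" by (rule ideal_by_closure) (auto simp: p_def)
  have "\<one> ~: p" by (simp add: p_def)
  thus "carrier R ~= p" by blast
  show "a : p \<or> b : p" if "a <: R" "b <: R" "a ** b : p" for a b
   using that F.integral[of "h a" "h b"] by (auto simp: p_def)
 qed
 have "~ algebraic_mod p (gr (B' - {b})) b" if b: "b : B'" for b
 proof
  assume "algebraic_mod p (gr (B' - {b})) b"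
  hence "h b : F.acl (h ` k) (h ` (B' - {b}))"
   using algebraic_mod_acl[OF F h p_def, of "B' - {b}" b] B'c b by auto
  moreover have "h ` (B' - {b}) = B0 - {h b}" using B'(2,3) b by (auto simp: inj_on_def)
  ultimately show False using bspec[OF B0(3), of "h b"] b B'(3) by auto
 qed
 then obtain P where "(ALL i<=card B'. primeideal (P i) R) & (ALL i<card B'. P i \<subset> P (Suc i))"
  using prime_chain[OF p fB' B'c HOL.refl] by blast
 hence "card B' <= d" using dim unfolding has_krull_dim_def Let_def by blast
 hence "card B0 <= d" using card_image[OF B'(2)] B'(3) by simp
 thus thesis using that[of B0] image_in_acl[OF F h B0(2) B0c] fB' B'(3) B0c by simp
qed

end

section \<open>Semilinear functionals and local bases\<close>

context module
begin

lemma smult_finsum: "finite I ==> a <: R ==> (!!i. i : I ==> f i <: M) ==>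
  a \<odot>.M (\<Oplus>.M i:I. f i) = (\<Oplus>.M i:I. a \<odot>.M f i)"
 by (rule finsum_smult_ldistr) auto

lemma smult_swap:
 "a <: R ==> b <: R ==> x <: M ==> a \<odot>.M (b \<odot>.M x) = b \<odot>.M (a \<odot>.M x)"
 by (metis R.m_comm smult_assoc1)

end

lemma (in cring) module_regular: "module R (regular R)"
proof (rule moduleI[OF cring_axioms])
 have "abelian_group (regular R)"
  by (rule abelian_groupI) (auto simp: regular_def a_ac intro: bexI[OF _ a_inv_closed] l_neg)
 thus "abelian_group (regular R)" .
qed (auto simp: regular_def l_distr r_distr m_assoc)

section \<open>Localization of a module at a prime\<close>

locale module_prime = module R M + primeideal P R for R (structure) and M (structure) and P
begin

abbreviation fm where "fm == fraction R M P"

lemma compl_mult: "s : carrier R - P ==> t : carrier R - P ==> s ** t : carrier R - P"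
 using I_prime by auto

lemma compl_one: "\<one> : carrier R - P"
 using I_notcarr one_imp_carrier by auto

lemma fm_self: "x <: M ==> s : carrier R - P ==> (x, s) : fm x s"
 using compl_one by (auto simp: fraction_def)

lemma fm_eqI:
 assumes "x <: M" "y <: M" "s : carrier R - P" "t : carrier R - P" "u : carrier R - P"
  and eq: "u \<odot>.M (t \<odot>.M x) = u \<odot>.M (s \<odot>.M y)"
 shows "fm x s = fm y t"
proof -
 have *: "fm x s <= fm y t"
  if "x <: M" "y <: M" "s : carrier R - P" "t : carrier R - P" "u : carrier R - P"
   "u \<odot>.M (t \<odot>.M x) = u \<odot>.M (s \<odot>.M y)" for x y s t u
 proof
  fix z assume "z : fm x s"
  then obtain w v u' where z: "z = (w, v)" "w <: M" "v : carrier R - P" "u' : carrier R - P"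
   "u' \<odot>.M (v \<odot>.M x) = u' \<odot>.M (s \<odot>.M w)" by (auto simp: fraction_def)
  have cl[simp]: "s <: R" "t <: R" "u <: R" "v <: R" "u' <: R" "w <: M" "x <: M" "y <: M"
   using that z by auto
  have "(u' ** (u ** s)) \<odot>.M (v \<odot>.M y) = (u' ** v) \<odot>.M (u \<odot>.M (s \<odot>.M y))"
   by (simp add: smult_assoc1[symmetric] R.m_ac)
  also have "... = (u ** t) \<odot>.M (u' \<odot>.M (v \<odot>.M x))"
   unfolding that(6)[symmetric] by (simp add: smult_assoc1[symmetric] R.m_ac)
  also have "... = (u' ** (u ** s)) \<odot>.M (t \<odot>.M w)"
   unfolding z(5) by (simp add: smult_assoc1[symmetric] R.m_ac)
  finally show "z : fm y t"
   using z that compl_mult[OF z(4) compl_mult[OF that(5,3)]] by (auto simp: fraction_def)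
 qed
 show ?thesis using *[OF assms] *[OF assms(2,1,4,3,5) eq[symmetric]] by blast
qed

lemma fm_eqD:
 assumes "fm x s = fm y t" "y <: M" "t : carrier R - P"
 obtains u where "u : carrier R - P" "u \<odot>.M (t \<odot>.M x) = u \<odot>.M (s \<odot>.M y)"
proof -
 have "(y, t) : fm x s" using fm_self assms by simp
 thus thesis using that by (auto simp: fraction_def)
qed

lemma fm_eqI1:
 assumes "x <: M" "y <: M" "s : carrier R - P" "t : carrier R - P" "t \<odot>.M x = s \<odot>.M y"
 shows "fm x s = fm y t"
 using assms compl_one by (intro fm_eqI[of x y s t \<one>]) auto

lemma localize_add:
 assumes "x <: M" "y <: M" "s : carrier R - P" "t : carrier R - P"
 shows "fm x s \<oplus>.(localize R M P) fm y t = fm (t \<odot>.M x \<oplus>.M s \<odot>.M y) (s ** t)"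
proof -
 have *: "fm (t' \<odot>.M x' \<oplus>.M s' \<odot>.M y') (s' ** t') = fm (t \<odot>.M x \<oplus>.M s \<odot>.M y) (s ** t)"
  if xy: "(x', s') : fm x s" "(y', t') : fm y t" for x' s' y' t'
 proof -
  obtain u where u: "x' <: M" "s' : carrier R - P" "u : carrier R - P" "u \<odot>.M (s' \<odot>.M x) = u \<odot>.M (s \<odot>.M x')"
   using xy(1) by (auto simp: fraction_def)
  obtain v where v: "y' <: M" "t' : carrier R - P" "v : carrier R - P" "v \<odot>.M (t' \<odot>.M y) = v \<odot>.M (t \<odot>.M y')"
   using xy(2) by (auto simp: fraction_def)
  have cl[simp]: "s <: R" "t <: R" "s' <: R" "t' <: R" "u <: R" "v <: R" using assms u v by auto
  note [simp] = assms(1,2) u(1) v(1)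
  have 1: "(u ** v) \<odot>.M ((s ** t) \<odot>.M (t' \<odot>.M x')) = (u ** v) \<odot>.M ((s' ** t') \<odot>.M (t \<odot>.M x))"
  proof -
   have "(u ** v) \<odot>.M ((s ** t) \<odot>.M (t' \<odot>.M x')) = (v ** (t ** t')) \<odot>.M (u \<odot>.M (s \<odot>.M x'))"
    by (simp add: smult_assoc1[symmetric] R.m_ac)
   thus ?thesis unfolding u(4)[symmetric] by (simp add: smult_assoc1[symmetric] R.m_ac)
  qed
  have 2: "(u ** v) \<odot>.M ((s ** t) \<odot>.M (s' \<odot>.M y')) = (u ** v) \<odot>.M ((s' ** t') \<odot>.M (s \<odot>.M y))"
  proof -
   have "(u ** v) \<odot>.M ((s ** t) \<odot>.M (s' \<odot>.M y')) = (u ** (s ** s')) \<odot>.M (v \<odot>.M (t \<odot>.M y'))"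
    by (simp add: smult_assoc1[symmetric] R.m_ac)
   thus ?thesis unfolding v(4)[symmetric] by (simp add: smult_assoc1[symmetric] R.m_ac)
  qed
  show ?thesis
  proof (rule fm_eqI[where u = "u ** v"])
   show "(u ** v) \<odot>.M ((s ** t) \<odot>.M (t' \<odot>.M x' \<oplus>.M s' \<odot>.M y')) = (u ** v) \<odot>.M ((s' ** t') \<odot>.M (t \<odot>.M x \<oplus>.M s \<odot>.M y))"
    using 1 2 by (simp add: smult_r_distr)
  qed (use compl_mult assms u v in auto)
 qed
 have "fm x s \<oplus>.(localize R M P) fm y t =
  (\<Union>(x', s')\<in>fm x s. \<Union>(y', t')\<in>fm y t. fm (t' \<odot>.M x' \<oplus>.M s' \<odot>.M y') (s' ** t'))"
  by (simp add: localize_def)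
 also have "... = (\<Union>(x', s')\<in>fm x s. \<Union>(y', t')\<in>fm y t. fm (t \<odot>.M x \<oplus>.M s \<odot>.M y) (s ** t))"
  using * by fast
 also have "... = fm (t \<odot>.M x \<oplus>.M s \<odot>.M y) (s ** t)"
  using fm_self[OF assms(1,3)] fm_self[OF assms(2,4)] by fast
 finally show ?thesis .
qed

lemma localize_smult:
 assumes "r <: R" "s : carrier R - P" "x <: M" "t : carrier R - P"
 shows "fraction R (regular R) P r s \<odot>.(localize R M P) fm x t = fm (r \<odot>.M x) (s ** t)"
proof -
 have *: "fm (r' \<odot>.M x') (s' ** t') = fm (r \<odot>.M x) (s ** t)"
  if xy: "(r', s') : fraction R (regular R) P r s" "(x', t') : fm x t" for r' s' x' t'
 proof -
  obtain u where u: "r' <: R" "s' : carrier R - P" "u : carrier R - P" "u ** (s' ** r) = u ** (s ** r')"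
   using xy(1) by (auto simp: fraction_def regular_def)
  obtain v where v: "x' <: M" "t' : carrier R - P" "v : carrier R - P" "v \<odot>.M (t' \<odot>.M x) = v \<odot>.M (t \<odot>.M x')"
   using xy(2) by (auto simp: fraction_def)
  have cl[simp]: "s <: R" "t <: R" "s' <: R" "t' <: R" "u <: R" "v <: R" using assms u v by auto
  note [simp] = assms(1,3) u(1) v(1)
  show ?thesis
  proof (rule fm_eqI[where u = "u ** v"])
   have "(u ** v) \<odot>.M ((s ** t) \<odot>.M (r' \<odot>.M x')) = (u ** (s ** r')) \<odot>.M (v \<odot>.M (t \<odot>.M x'))"
    by (simp add: smult_assoc1[symmetric] R.m_ac)
   also have "... = (u ** (s' ** r)) \<odot>.M (v \<odot>.M (t' \<odot>.M x))" using u(4) v(4) by simp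
   also have "... = (u ** v) \<odot>.M ((s' ** t') \<odot>.M (r \<odot>.M x))"
    by (simp add: smult_assoc1[symmetric] R.m_ac)
   finally show "(u ** v) \<odot>.M ((s ** t) \<odot>.M (r' \<odot>.M x')) = (u ** v) \<odot>.M ((s' ** t') \<odot>.M (r \<odot>.M x))" .
  qed (use compl_mult assms u v in auto)
 qed
 have "fraction R (regular R) P r s \<odot>.(localize R M P) fm x t =
  (\<Union>(r', s')\<in>fraction R (regular R) P r s. \<Union>(x', t')\<in>fm x t. fm (r' \<odot>.M x') (s' ** t'))"
  by (simp add: localize_def)
 also have "... = (\<Union>(r', s')\<in>fraction R (regular R) P r s. \<Union>(x', t')\<in>fm x t. fm (r \<odot>.M x) (s ** t))"
  using * by fast
 also have "... = fm (r \<odot>.M x) (s ** t)"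
 proof -
  have "(r, s) : fraction R (regular R) P r s" using assms compl_one by (auto simp: fraction_def regular_def)
  thus ?thesis using fm_self[OF assms(3,4)] by fast
 qed
 finally show ?thesis .
qed

lemma common_denominator:
 fixes n :: nat
 assumes "!!j. j < n ==> y j <: M & s j : carrier R - P"
 shows "EX S:carrier R - P. EX z. (ALL j<n. z j <: M) & (ALL j<n. fm (y j) (s j) = fm (z j) S)"
 using assms
proof (induction n)
 case 0
 thus ?case using compl_one by auto
next
 case (Suc n)
 then obtain S z where S: "S : carrier R - P" "ALL j<n. z j <: M" "ALL j<n. fm (y j) (s j) = fm (z j) S" by auto
 have n: "y n <: M" "s n : carrier R - P" using Suc.prems by auto
 define z' where "z' j = (if j = n then S \<odot>.M y n else s n \<odot>.M z j)" for j
 have z': "z' j <: M" if "j < Suc n" for j using that S n by (auto simp: z'_def less_Suc_eq)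
 have "fm (y j) (s j) = fm (z' j) (S ** s n)" if "j < Suc n" for j
 proof (cases "j = n")
  case True
  have "fm (y n) (s n) = fm (z' n) (S ** s n)"
   by (rule fm_eqI1) (use n S z' compl_mult in "auto simp: z'_def smult_assoc1[symmetric] R.m_comm")
  thus ?thesis using True by simp
 next
  case False
  hence "j < n" using that by simp
  have "fm (z j) S = fm (z' j) (S ** s n)"
   by (rule fm_eqI1) (use n S z'[of j] compl_mult False \<open>j < n\<close> in "auto simp: z'_def smult_assoc1[symmetric]")
  thus ?thesis using S(3) \<open>j < n\<close> by simp
 qed
 thus ?case using z' compl_mult[OF S(1) n(2)] by blast
qed

lemma regular_prime: "module_prime R (regular R) P"
 by (intro module_prime.intro R.module_regular) (rule primeideal_axioms)

text \<open>Freeness of the localization with all denominators cleared, so that only elements of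
  \<open>M\<close> and \<open>R\<close> remain. Of linear independence the form
  \<open>a i : P\<close> is kept, which is what can be seen in a field where \<open>P\<close>
  becomes zero.\<close>

lemma local_basis:
 assumes rank: "has_rank R M k"
 obtains ys where "ALL i<k. ys i <: M"
  "ALL x:carrier M. EX t:carrier R - P. EX a. (ALL i. a i <: R) & t \<odot>.M x = (\<Oplus>.M i:{..<k}. a i \<odot>.M ys i)"
  "ALL a. (ALL i. a i <: R) --> (\<Oplus>.M i:{..<k}. a i \<odot>.M ys i) = \<zero>.M --> (ALL i<k. a i : P)"
proof -
 interpret r: module_prime R "regular R" P by (rule regular_prime)
 have reg[simp]: "carrier (regular R) = carrier R" "smult (regular R) = (**)" "\<zero>.(regular R) = \<zero>" "\<one>.(regular R) = \<one>" "add (regular R) = add R"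
  by (simp_all add: regular_def)
 let ?RP = "localize R (regular R) P" and ?MP = "localize R M P"
 let ?FM = "free_module ?RP k"
 obtain f where f: "f : linear_maps ?RP ?FM ?MP" "bij_betw f (carrier ?FM) (carrier ?MP)"
  using rank primeideal_axioms unfolding has_rank_def Let_def by blast
 have RPc: "r.fm a s <: ?RP" if "a <: R" "s : carrier R - P" for a s
  using that by (auto simp: localize_def)
 have one0: "\<one>.?RP = r.fm \<one> \<one>" "\<zero>.?RP = r.fm \<zero> \<one>" by (simp_all add: localize_def)
 have mulRP: "r.fm a s **.?RP r.fm b t = r.fm (a ** b) (s ** t)"
  if "a <: R" "s : carrier R - P" "b <: R" "t : carrier R - P" for a s b t
 proof -
  have "r.fm a s **.?RP r.fm b t = r.fm a s \<odot>.?RP r.fm b t" by (simp add: localize_def regular_def)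
  thus ?thesis using r.localize_smult[of a s b t] that by simp
 qed
 have addRP: "r.fm a s \<oplus>.?RP r.fm b t = r.fm (t ** a \<oplus> s ** b) (s ** t)"
  if "a <: R" "s : carrier R - P" "b <: R" "t : carrier R - P" for a s b t
  using r.localize_add[of a b s t] that by simp
 have FMI: "(\<lambda>i\<in>{..<k}. v i) <: ?FM" if "!!i. i < k ==> v i <: ?RP" for v
  using that by (auto simp: free_module_def)
 have f_add: "f (v \<oplus>.?FM w) = f v \<oplus>.?MP f w" if "v <: ?FM" "w <: ?FM" for v w
  using f(1) that by (simp add: linear_maps_def)
 have f_smult: "f (a \<odot>.?FM v) = a \<odot>.?MP f v" if "a <: ?RP" "v <: ?FM" for a v
  using f(1) that by (simp add: linear_maps_def)
 have f_closed: "EX x s. f v = fm x s & x <: M & s : carrier R - P" if "v <: ?FM" for v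
 proof -
  have "f v <: ?MP" using f(2) that bij_betwE by blast
  thus ?thesis by (auto simp: localize_def)
 qed
 define e where "e j = (\<lambda>i\<in>{..<k}. if i = j then r.fm \<one> \<one> else r.fm \<zero> \<one>)" for j
 have e: "e j <: ?FM" for j unfolding e_def by (rule FMI) (use RPc compl_one in auto)
 obtain y s where ys: "!!j. f (e j) = fm (y j) (s j)" "!!j. y j <: M" "!!j. s j : carrier R - P"
  using f_closed[OF e] by metis
 obtain S z where S: "S : carrier R - P" "!!j. j < k ==> z j <: M" "!!j. j < k ==> f (e j) = fm (z j) S"
  using common_denominator[of k y s] ys by auto
 have Sc[simp]: "S <: R" using S by simp
 \<comment> \<open>The vector with coordinates \<open>a i / t\<close>, cut off after
   \<open>m\<close> places. Its image is computed by induction on \<open>m\<close>, because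
   \<open>f\<close> is known only as an additive and homogeneous map.\<close>
 define vec where "vec a t m = (\<lambda>i\<in>{..<k}. if i < m then r.fm (a i) t else r.fm \<zero> \<one>)" for a t and m :: nat
 have val_eq: "f (vec a t m) = fm (\<Oplus>.M i:{..<m}. a i \<odot>.M z i) (t ** S)"
  if a: "!!i. i < k ==> a i <: R" and t: "t : carrier R - P" and m: "m <= k" for a t m
  using m
 proof (induction m)
  case 0
  have v0: "vec a t 0 <: ?FM" unfolding vec_def by (rule FMI) (use RPc compl_one in auto)
  obtain x u where xu: "f (vec a t 0) = fm x u" "x <: M" "u : carrier R - P" using f_closed[OF v0] by blast
  have "vec a t 0 = r.fm \<zero> \<one> \<odot>.?FM vec a t 0"
   using compl_one by (auto simp: vec_def free_module_def fun_eq_iff mulRP)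
  hence "f (vec a t 0) = r.fm \<zero> \<one> \<odot>.?MP fm x u"
   using f_smult[OF RPc v0, of \<zero> \<one>] compl_one xu(1) by simp
  also have "... = fm (\<zero> \<odot>.M x) (\<one> ** u)" by (rule localize_smult) (use compl_one xu in auto)
  also have "... = fm \<zero>.M (t ** S)"
   by (rule fm_eqI1) (use compl_mult t S xu in auto)
  finally show ?case by simp
 next
  case (Suc m)
  hence mk: "m < k" by simp
  let ?X = "\<Oplus>.M i:{..<m}. a i \<odot>.M z i"
  have X: "?X <: M" using a S(2) mk by (intro M.finsum_closed) auto
  have tS: "t ** S : carrier R - P" using compl_mult t S by blast
  have vm: "vec a t m <: ?FM" unfolding vec_def by (rule FMI) (use RPc compl_one a t in auto)
  have am: "r.fm (a m) t <: ?RP" using RPc a mk t by simp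
  have ae: "r.fm (a m) t \<odot>.?FM e m = (\<lambda>i\<in>{..<k}. if i = m then r.fm (a m) t else r.fm \<zero> t)"
   using compl_one a mk t by (auto simp: e_def free_module_def fun_eq_iff mulRP)
  have aeF: "r.fm (a m) t \<odot>.?FM e m <: ?FM"
   unfolding ae by (rule FMI) (use RPc a mk t in auto)
  have addz: "r.fm b u \<oplus>.?RP r.fm \<zero> w = r.fm b u" "r.fm \<zero> w \<oplus>.?RP r.fm b u = r.fm b u"
   if bu: "b <: R" "u : carrier R - P" "w : carrier R - P" for b u w
  proof -
   have "r.fm (w ** b) (w ** u) = r.fm b u"
    by (rule r.fm_eqI1) (use bu compl_mult[of w u] in "auto simp: R.m_ac")
   thus "r.fm b u \<oplus>.?RP r.fm \<zero> w = r.fm b u" "r.fm \<zero> w \<oplus>.?RP r.fm b u = r.fm b u"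
    using bu addRP[of b u \<zero> w] addRP[of \<zero> w b u] by (simp_all add: R.m_comm)
  qed
  have "vec a t (Suc m) = vec a t m \<oplus>.?FM (r.fm (a m) t \<odot>.?FM e m)"
  proof -
   have "vec a t (Suc m) i = (vec a t m \<oplus>.?FM (r.fm (a m) t \<odot>.?FM e m)) i" for i
   proof (cases "i < k")
    case True
    have z0: "r.fm \<zero> t = r.fm \<zero> \<one>" by (rule r.fm_eqI1) (use t compl_one in auto)
    have "(vec a t m \<oplus>.?FM (r.fm (a m) t \<odot>.?FM e m)) i =
     (if i < m then r.fm (a i) t else r.fm \<zero> \<one>) \<oplus>.?RP (if i = m then r.fm (a m) t else r.fm \<zero> t)"
     unfolding ae using True by (simp add: free_module_def vec_def)
    also have "... = vec a t (Suc m) i"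
     using True a[OF True] t compl_one addz[of "a i" t t] addz[of "a i" t \<one>] addz[of \<zero> \<one> t]
     by (auto simp: vec_def less_Suc_eq)
    finally show ?thesis by simp
   next
    case False
    thus ?thesis by (simp add: vec_def free_module_def)
   qed
   thus ?thesis by blast
  qed
  hence "f (vec a t (Suc m)) = f (vec a t m) \<oplus>.?MP (r.fm (a m) t \<odot>.?MP f (e m))"
   using f_add[OF vm aeF] f_smult[OF am e] by simp
  also have "... = fm ?X (t ** S) \<oplus>.?MP fm (a m \<odot>.M z m) (t ** S)"
   using Suc S(1,2,3) a mk t by (simp add: localize_smult)
  also have "... = fm ((t ** S) \<odot>.M ?X \<oplus>.M (t ** S) \<odot>.M (a m \<odot>.M z m)) ((t ** S) ** (t ** S))"
   by (rule localize_add) (use X a mk S tS in auto)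
  also have "... = fm (?X \<oplus>.M a m \<odot>.M z m) (t ** S)"
  proof (rule fm_eqI1)
   show "(t ** S) \<odot>.M ((t ** S) \<odot>.M ?X \<oplus>.M (t ** S) \<odot>.M (a m \<odot>.M z m)) = ((t ** S) ** (t ** S)) \<odot>.M (?X \<oplus>.M a m \<odot>.M z m)"
    using X a[OF mk] S(2)[OF mk] tS by (simp add: smult_r_distr smult_assoc1 del: R.m_closed)
  qed (use X a mk S tS compl_mult in auto)
  also have "?X \<oplus>.M a m \<odot>.M z m = (\<Oplus>.M i:{..<Suc m}. a i \<odot>.M z i)"
   unfolding lessThan_Suc using a S(2) mk X by (subst M.finsum_insert) (auto simp: M.a_comm)
  finally show ?case .
 qed
 have vec_closed: "vec a t k <: ?FM" if "!!i. i < k ==> a i <: R" "t : carrier R - P" for a t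
  unfolding vec_def by (rule FMI) (use RPc compl_one that in auto)
 show thesis
 proof (rule that[of z]; intro allI ballI impI)
  show "z i <: M" if "i < k" for i using S(2) that .
 next
  fix x assume x: "x <: M"
  have "fm x \<one> <: ?MP" using x compl_one by (auto simp: localize_def)
  hence "fm x \<one> : f ` carrier ?FM" unfolding bij_betw_imp_surj_on[OF f(2)] .
  then obtain v where v: "v <: ?FM" "f v = fm x \<one>" by (elim imageE) (rule that, assumption, rule HOL.sym)
  have "ALL i. EX a t. i < k --> v i = r.fm a t & a <: R & t : carrier R - P"
  proof
   fix i
   show "EX a t. i < k --> v i = r.fm a t & a <: R & t : carrier R - P"
   proof (cases "i < k")
    case True
    hence "v i <: ?RP" using v(1) by (auto simp: free_module_def)
    thus ?thesis by (auto simp: localize_def)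
   qed auto
  qed
  then obtain a0 t0 where "!!i. i < k ==> v i = r.fm (a0 i) (t0 i) & a0 i <: R & t0 i : carrier R - P" by metis
  then obtain t a where ta: "t : carrier R - P" "!!i. i < k ==> a i <: R" "!!i. i < k ==> v i = r.fm (a i) t"
   using r.common_denominator[of k a0 t0] by auto
  have "v = vec a t k"
  proof
   show "v i = vec a t k i" for i using ta(3)[of i] v(1) by (cases "i < k") (auto simp: vec_def free_module_def PiE_def extensional_def)
  qed
  hence eq: "fm x \<one> = fm (\<Oplus>.M i:{..<k}. a i \<odot>.M z i) (t ** S)" using val_eq[OF ta(2,1) order_refl] v(2) by simp
  have sum: "(\<Oplus>.M i:{..<k}. a i \<odot>.M z i) <: M" using ta(2) S(2) by (intro M.finsum_closed) auto
  have tS: "t ** S : carrier R - P" using compl_mult ta(1) S(1) by blast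
  obtain u where u: "u : carrier R - P" "u \<odot>.M ((t ** S) \<odot>.M x) = u \<odot>.M (\<one> \<odot>.M (\<Oplus>.M i:{..<k}. a i \<odot>.M z i))"
   using fm_eqD[OF eq sum tS] .
  define b where "b i = (if i < k then u ** a i else \<zero>)" for i
  have "(u ** (t ** S)) \<odot>.M x = u \<odot>.M (\<Oplus>.M i:{..<k}. a i \<odot>.M z i)"
   using u tS x sum by (simp add: smult_assoc1)
  also have "... = (\<Oplus>.M i:{..<k}. u \<odot>.M (a i \<odot>.M z i))" by (rule smult_finsum) (use u ta S in auto)
  also have "... = (\<Oplus>.M i:{..<k}. b i \<odot>.M z i)"
   by (rule M.finsum_cong') (use u ta S in "auto simp: b_def smult_assoc1")
  finally have "(u ** (t ** S)) \<odot>.M x = (\<Oplus>.M i:{..<k}. b i \<odot>.M z i)" .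
  moreover have "ALL i. b i <: R" using u ta by (simp add: b_def)
  ultimately show "EX t:carrier R - P. EX a. (ALL i. a i <: R) & t \<odot>.M x = (\<Oplus>.M i:{..<k}. a i \<odot>.M z i)"
   using compl_mult[OF u(1) tS] by blast
 next
  fix a i assume a: "ALL i. a i <: R" and 0: "(\<Oplus>.M i:{..<k}. a i \<odot>.M z i) = \<zero>.M" and i: "i < k"
  have "f (vec a \<one> k) = fm \<zero>.M (\<one> ** S)" using val_eq[of a \<one> k] a compl_one 0 by simp
  also have "... = f (vec (%_. \<zero>) \<one> k)"
  proof -
   have "(\<Oplus>.M i:{..<k}. \<zero> \<odot>.M z i) = \<zero>.M"
    using S(2) by (intro M.add.finprod_one_eqI) auto
   thus ?thesis using val_eq[of "%_. \<zero>" \<one> k] compl_one by simp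
  qed
  finally have "vec a \<one> k = vec (%_. \<zero>) \<one> k"
   using f(2) vec_closed[of a \<one>] vec_closed[of "%_. \<zero>" \<one>] a compl_one unfolding bij_betw_def inj_on_def by auto
  hence "r.fm (a i) \<one> = r.fm \<zero> \<one>" using i by (auto simp: vec_def dest: fun_cong[where x = i])
  then obtain u where u: "u : carrier R - P" "u ** (\<one> ** a i) = u ** (\<one> ** \<zero>)"
   using r.fm_eqD[of "a i" \<one> \<zero> \<one>] compl_one by auto
  hence "u ** a i : P" using a by (simp add: additive_subgroup.zero_closed[OF is_additive_subgroup])
  thus "a i : P" using I_prime[of u "a i"] u(1) a by auto
 qed
qed

end

text \<open>Functionals that are linear along a ring homomorphism \<open>h\<close> from the base ring to a field;
  they replace the base change of \<open>M\<close> to that field, being the dual of it.\<close>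

definition hom_along ::
 "('r, 'c) ring_scheme => ('r, 'a, 'm) module_scheme => ('f, 'n) ring_scheme => ('r => 'f) => ('a => 'f) set" where
 "hom_along R M F h = {phi. (ALL x : carrier M. phi x <: F) & (ALL x. x ~: carrier M --> phi x = \<zero>.F) &
   (ALL x : carrier M. ALL y : carrier M. phi (x \<oplus>.M y) = phi x \<oplus>.F phi y) &
   (ALL r : carrier R. ALL x : carrier M. phi (r \<odot>.M x) = h r **.F phi x)}"

locale module_to_field = module R M + F: field F for R (structure) and M (structure) and F +
 fixes h assumes h_hom: "h : ring_hom R F"
begin

sublocale h: ring_hom_cring R F h
 by (intro ring_hom_cring.intro ring_hom_cring_axioms.intro h_hom) unfold_locales

abbreviation "functionals == hom_along R M F h"

lemma functionals_closed: "phi : functionals ==> phi x <: F"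
 by (cases "x <: M") (auto simp: hom_along_def)

lemma functionals_add: "phi : functionals ==> x <: M ==> y <: M ==> phi (x \<oplus>.M y) = phi x \<oplus>.F phi y"
 and functionals_smult: "phi : functionals ==> r <: R ==> x <: M ==> phi (r \<odot>.M x) = h r **.F phi x"
 and functionals_outside: "phi : functionals ==> x ~: carrier M ==> phi x = \<zero>.F"
 by (auto simp: hom_along_def)

lemma functionals_zero: "phi : functionals ==> phi \<zero>.M = \<zero>.F"
 using functionals_smult[of phi \<zero> "\<zero>.M"] functionals_closed by simp

lemma functionals_finsum:
 assumes "phi : functionals" "finite I" "!!i. i : I ==> x i <: M"
 shows "phi (\<Oplus>.M i:I. x i) = (\<Oplus>.F i:I. phi (x i))"
 using assms(2,3)
proof (induction I rule: finite_induct)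
 case (insert i I)
 hence "(\<Oplus>.M j:insert i I. x j) = x i \<oplus>.M (\<Oplus>.M j:I. x j)" by (intro M.finsum_insert) auto
 moreover have "(\<Oplus>.M j:I. x j) <: M" using insert.prems by (intro M.finsum_closed) auto
 ultimately show ?case
  using insert functionals_add[OF assms(1)] functionals_closed[OF assms(1)]
  by (subst F.finsum_insert) auto
qed (simp add: functionals_zero[OF assms(1)])

lemma functionals_vanish:
 assumes phi: "phi : functionals" and E: "finite E" "E <= carrier M" and c: "ALL e. c e <: R" and 0: "ALL e:E. phi e = \<zero>.F"
 shows "phi (\<Oplus>.M e:E. c e \<odot>.M e) = \<zero>.F"
proof -
 have "phi (\<Oplus>.M e:E. c e \<odot>.M e) = (\<Oplus>.F e:E. phi (c e \<odot>.M e))"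
  by (rule functionals_finsum[OF phi E(1)]) (use c E(2) in auto)
 also have "... = \<zero>.F" by (rule F.finsum_all_zero) (use functionals_smult[OF phi] c E(2) 0 in auto)
 finally show ?thesis .
qed

lemma functionals_subspace: "F.fun_subspace functionals"
 unfolding F.fun_subspace_def
proof (intro conjI ballI)
 show "functionals <= UNIV \<rightarrow> carrier F" using functionals_closed by blast
 show "(%x. \<zero>.F) : functionals" by (simp add: hom_along_def)
next
 fix u v assume uv: "u : functionals" "v : functionals"
 show "(%x. u x \<oplus>.F v x) : functionals"
  using functionals_closed[OF uv(1)] functionals_closed[OF uv(2)] functionals_add[OF uv(1)] functionals_add[OF uv(2)]
   functionals_smult[OF uv(1)] functionals_smult[OF uv(2)] functionals_outside[OF uv(1)] functionals_outside[OF uv(2)]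
  unfolding hom_along_def[of R M F h] by (simp add: F.r_distr F.a_ac)
next
 fix c u assume uv: "c <: F" "u : functionals"
 show "(%x. c **.F u x) : functionals"
  using uv(1) functionals_closed[OF uv(2)] functionals_add[OF uv(2)] functionals_smult[OF uv(2)] functionals_outside[OF uv(2)]
  unfolding hom_along_def[of R M F h] by (simp add: F.r_distr F.m_lcomm)
qed

lemma kernel_prime: "primeideal {r : carrier R. h r = \<zero>.F} R"
proof (rule primeidealI[OF _ R.cring_axioms])
 show "ideal {r : carrier R. h r = \<zero>.F} R" by (rule R.ideal_by_closure) auto
 have "\<one> ~: {r : carrier R. h r = \<zero>.F}" by simp
 thus "carrier R ~= {r : carrier R. h r = \<zero>.F}" by blast
 show "a : {r : carrier R. h r = \<zero>.F} \<or> b : {r : carrier R. h r = \<zero>.F}"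
  if "a <: R" "b <: R" "a ** b : {r : carrier R. h r = \<zero>.F}" for a b
  using that F.integral[of "h a" "h b"] by auto
qed

text \<open>Coordinates in a local basis at the kernel of \<open>h\<close>: if \<open>t x\<close>
  has coordinates \<open>a\<close>, the functional takes the value \<open>h (a i) / h t\<close>. The
  denominator is invertible because \<open>t\<close> is outside the kernel.\<close>

lemma functionals_dual_basis:
 assumes rank: "has_rank R M k"
 obtains ys xi where "ALL i<k. ys i <: M" "ALL i<k. xi i : functionals"
  "ALL i<k. ALL j<k. xi i (ys j) = (if i = j then \<one>.F else \<zero>.F)"
  "ALL phi:functionals. (ALL i<k. phi (ys i) = \<zero>.F) --> phi = (%_. \<zero>.F)"
proof -
 define P where "P = {r : carrier R. h r = \<zero>.F}"
 have mpP: "module_prime R M P"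
  unfolding P_def by (rule module_prime.intro[OF module_axioms kernel_prime])
 note mp_compl = module_prime.compl_mult[OF mpP] module_prime.compl_one[OF mpP]
 obtain ys where *: "ALL i<k. ys i <: M"
  "ALL x:carrier M. EX t:carrier R - P. EX a. (ALL i. a i <: R) & t \<odot>.M x = (\<Oplus>.M i:{..<k}. a i \<odot>.M ys i)"
  "ALL a. (ALL i. a i <: R) --> (\<Oplus>.M i:{..<k}. a i \<odot>.M ys i) = \<zero>.M --> (ALL i<k. a i : P)"
  using module_prime.local_basis[OF mpP rank] by blast
 have ys: "!!i. i < k ==> ys i <: M" using *(1) by blast
 have span: "!!x. x <: M ==> EX t:carrier R - P. EX a. (ALL i. a i <: R) & t \<odot>.M x = (\<Oplus>.M i:{..<k}. a i \<odot>.M ys i)"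
  using *(2) by blast
 have indep: "!!a i. (!!i. a i <: R) ==> (\<Oplus>.M i:{..<k}. a i \<odot>.M ys i) = \<zero>.M ==> i < k ==> a i : P"
  using *(3) by blast
 let ?L = "%a. \<Oplus>.M i:{..<k}. a i \<odot>.M ys i"
 have Lc: "?L a <: M" if "!!i. a i <: R" for a
  using that ys by (intro M.finsum_closed) auto
 have L_add: "?L (%i. a i \<oplus> b i) = ?L a \<oplus>.M ?L b" if "!!i. a i <: R" "!!i. b i <: R" for a b
 proof -
  have "?L (%i. a i \<oplus> b i) = (\<Oplus>.M i:{..<k}. a i \<odot>.M ys i \<oplus>.M b i \<odot>.M ys i)"
   by (rule M.finsum_cong') (use that ys in "auto simp: smult_l_distr")
  thus ?thesis using that ys by (simp add: M.finsum_addf Pi_iff)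
 qed
 have L_smult: "?L (%i. c ** a i) = c \<odot>.M ?L a" if "!!i. a i <: R" "c <: R" for a c
 proof -
  have "?L (%i. c ** a i) = (\<Oplus>.M i:{..<k}. c \<odot>.M (a i \<odot>.M ys i))"
   by (rule M.finsum_cong') (use that ys in "auto simp: smult_assoc1")
  thus ?thesis using that ys smult_finsum[of "{..<k}" c "%i. a i \<odot>.M ys i"] by auto
 qed
 \<comment> \<open>Two coordinate vectors of the same element, multiplied crosswise and subtracted,
   form a relation, whose coefficients lie in the kernel.\<close>
 have unique: "h t' **.F h (a i) = h t **.F h (a' i)"
  if *: "t <: R" "t' <: R" "!!i. a i <: R" "!!i. a' i <: R" "x <: M"
   "t \<odot>.M x = ?L a" "t' \<odot>.M x = ?L a'" "i < k" for t t' a a' x i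
 proof -
  have "?L (%i. t' ** a i \<oplus> (\<ominus> t) ** a' i) = t' \<odot>.M (t \<odot>.M x) \<oplus>.M (\<ominus> t) \<odot>.M (t' \<odot>.M x)"
   using * by (simp add: L_add L_smult)
  also have "... = \<zero>.M" using * Lc[of a] Lc[of a'] unfolding smult_swap[OF *(2,1,5)] by (simp add: smult_l_minus smult_closed M.r_neg del: *(6,7))
  finally have "t' ** a i \<oplus> (\<ominus> t) ** a' i : P"
   using indep[of "%i. t' ** a i \<oplus> (\<ominus> t) ** a' i" i] * by auto
  hence "h t' **.F h (a i) \<ominus>.F h t **.F h (a' i) = \<zero>.F"
   using *(1-4) by (simp add: P_def F.minus_eq F.l_minus)
  thus ?thesis by (rule F.minus_eq_zeroD[rotated 2]) (use *(1-4) in auto)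
 qed
 define ok where "ok x t a \<longleftrightarrow> t : carrier R - P & (ALL i. a i <: R) & t \<odot>.M x = ?L a" for x t a
 define co where "co x = (SOME z. ok x (fst z) (snd z))" for x
 have co: "ok x (fst (co x)) (snd (co x))" if x: "x <: M" for x
 proof -
  obtain t a where "ok x t a" using span[OF x] unfolding ok_def by blast
  thus ?thesis unfolding co_def by (intro someI[of "%z. ok x (fst z) (snd z)" "(t, a)"]) simp
 qed
 have inv: "inv\<^bsub>F\<^esub> (h t) <: F" "h t **.F inv\<^bsub>F\<^esub> (h t) = \<one>.F" "h t ~= \<zero>.F" if "t : carrier R - P" for t
  using that F.inv_closed[of "h t"] F.inv_right[of "h t"] by (auto simp: P_def)
 define xi where "xi i x = (if x <: M then h (snd (co x) i) **.F inv\<^bsub>F\<^esub> (h (fst (co x))) else \<zero>.F)" for i x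
 have xi_eq: "h t **.F xi i x = h (a i)" if "x <: M" "ok x t a" "i < k" for x t a i
 proof -
  obtain t' a' where c: "co x = (t', a')" by fastforce
  have *: "ok x t' a'" using co[OF that(1)] c by simp
  have "h t' **.F h (a i) = h t **.F h (a' i)"
   by (rule unique[of t t' a a' x i]) (use that * in "auto simp: ok_def")
  moreover have cl: "h t <: F" "h t' <: F" "h (a i) <: F" "h (a' i) <: F" "t' : carrier R - P"
   using that(2) * by (auto simp: ok_def)
  moreover have "h t **.F xi i x = (h t **.F h (a' i)) **.F inv\<^bsub>F\<^esub> (h t')"
   using that(1) c cl inv[OF cl(5)] by (simp add: xi_def F.m_assoc)
  ultimately have "h t **.F xi i x = h (a i) **.F (h t' **.F inv\<^bsub>F\<^esub> (h t'))"
   using inv[OF cl(5)] by (metis F.m_assoc F.m_comm)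
  thus ?thesis using cl inv[OF cl(5)] by simp
 qed
 have xic: "xi i x <: F" for i x
  using co[of x] inv[of "fst (co x)"] by (auto simp: xi_def ok_def)
 have cancel: "a = b" if "t : carrier R - P" "a <: F" "b <: F" "h t **.F a = h t **.F b" for t a b
  using that inv(3)[OF that(1)] F.m_lcancel[of "h t" a b] by auto
 have xi: "xi i : functionals" if i: "i < k" for i
  unfolding hom_along_def
 proof (intro CollectI conjI ballI allI impI)
  show "xi i x <: F" for x by (rule xic)
  show "x ~: carrier M ==> xi i x = \<zero>.F" for x by (simp add: xi_def)
 next
  fix x y assume xy: "x <: M" "y <: M"
  obtain t a where a: "ok x t a" using co[OF xy(1)] by blast
  obtain u b where b: "ok y u b" using co[OF xy(2)] by blast
  have tu: "t ** u : carrier R - P" using a b mp_compl by (auto simp: ok_def)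
  have "ok (x \<oplus>.M y) (t ** u) (%i. u ** a i \<oplus> t ** b i)"
  proof -
   have cl: "t <: R" "u <: R" "!!i. a i <: R" "!!i. b i <: R" using a b by (auto simp: ok_def)
   have "?L (%i. u ** a i \<oplus> t ** b i) = u \<odot>.M (t \<odot>.M x) \<oplus>.M t \<odot>.M (u \<odot>.M y)"
    using cl a b by (simp add: L_add L_smult ok_def)
   also have "... = (t ** u) \<odot>.M (x \<oplus>.M y)"
    using cl xy by (simp add: smult_r_distr smult_assoc1[symmetric] R.m_comm)
   finally show ?thesis using tu cl by (simp add: ok_def)
  qed
  hence "h (t ** u) **.F xi i (x \<oplus>.M y) = h (u ** a i \<oplus> t ** b i)" using xi_eq i xy by blast
  also have "... = h u **.F (h t **.F xi i x) \<oplus>.F h t **.F (h u **.F xi i y)"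
   using a b unfolding xi_eq[OF xy(1) a i] xi_eq[OF xy(2) b i] by (simp add: ok_def)
  also have "... = h (t ** u) **.F (xi i x \<oplus>.F xi i y)"
   using a b xic by (simp add: ok_def F.r_distr F.m_ac)
  finally show "xi i (x \<oplus>.M y) = xi i x \<oplus>.F xi i y" using cancel[OF tu] xic by blast
 next
  fix r x assume rx: "r <: R" "x <: M"
  obtain t a where a: "ok x t a" using co[OF rx(2)] by blast
  have "ok (r \<odot>.M x) t (%i. r ** a i)"
   using a rx L_smult[of a r] by (auto simp: ok_def smult_swap[of t r x])
  hence "h t **.F xi i (r \<odot>.M x) = h (r ** a i)" using xi_eq[of "r \<odot>.M x"] i rx by simp
  also have "... = h r **.F (h t **.F xi i x)" using a rx unfolding xi_eq[OF rx(2) a i] by (simp add: ok_def)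
  also have "... = h t **.F (h r **.F xi i x)" using a rx xic by (simp add: ok_def F.m_lcomm)
  finally show "xi i (r \<odot>.M x) = h r **.F xi i x" using cancel[of t] a xic rx(1) by (auto simp: ok_def)
 qed
 show thesis
 proof (rule that[of ys xi]; intro allI ballI impI)
  show "i < k ==> ys i <: M" "i < k ==> xi i : functionals" for i using ys xi by auto
 next
  fix i j assume ij: "i < k" "j < k"
  have "(\<Oplus>.M l:{..<k}. (if l = j then \<one> else \<zero>) \<odot>.M ys l) = (\<Oplus>.M l:{..<k}. if j = l then ys l else \<zero>.M)"
   by (rule M.finsum_cong') (use ys in auto)
  also have "... = ys j" by (rule M.add.finprod_singleton) (use ij ys in auto)
  finally have "ok (ys j) \<one> (%l. if l = j then \<one> else \<zero>)"
   using mp_compl ys ij by (simp add: ok_def)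
  hence "h \<one> **.F xi i (ys j) = h (if i = j then \<one> else \<zero>)" using xi_eq ys ij by blast
  thus "xi i (ys j) = (if i = j then \<one>.F else \<zero>.F)" using xic by auto
 next
  fix phi assume phi: "phi : functionals" "ALL i<k. phi (ys i) = \<zero>.F"
  show "phi = (%_. \<zero>.F)"
  proof
   fix x
   show "phi x = \<zero>.F"
   proof (cases "x <: M")
    case True
    obtain t a where a: "ok x t a" using co[OF True] by blast
    have "h t **.F phi x = phi (?L a)" using a functionals_smult[OF phi(1) _ True] by (metis DiffE ok_def)
    also have "... = (\<Oplus>.F i:{..<k}. phi (a i \<odot>.M ys i))"
     by (rule functionals_finsum[OF phi(1)]) (use a ys in "auto simp: ok_def")
    also have "... = \<zero>.F"
     by (rule F.finsum_all_zero) (use a ys phi functionals_smult[OF phi(1)] in "auto simp: ok_def")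
    finally have "h t **.F phi x = h t **.F \<zero>.F" using a by (simp add: ok_def)
    thus ?thesis using cancel[of t] a functionals_closed[OF phi(1)] by (auto simp: ok_def)
   next
    case False
    thus ?thesis using functionals_outside[OF phi(1)] by simp
   qed
  qed
 qed
qed

end

section \<open>Dual bases, traces and separability\<close>

lemma linear_mapsD:
 assumes "f : linear_maps R M N"
 shows "x <: M ==> f x <: N"
  and "x <: M ==> y <: M ==> f (x \<oplus>.M y) = f x \<oplus>.N f y"
  and "r <: R ==> x <: M ==> f (r \<odot>.M x) = r \<odot>.N f x"
 using assms by (auto simp: linear_maps_def)

text \<open>The vector that occurs inside \<open>module_trace\<close>, named so that it can be
  folded there.\<close>

definition unit_vector :: "('r, 'c) ring_scheme => nat => nat => nat => 'r" where
 "unit_vector R k j = (\<lambda>i\<in>{..<k}. if i = j then \<one>.R else \<zero>.R)"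

text \<open>\<open>E\<close> is not assumed to be a ring because this is also applied to enveloping algebras.\<close>

lemma linear_map_on_free_module:
 assumes f: "f : linear_maps E (free_module E k) M" and v: "v : carrier (free_module E k)"
  and M: "abelian_monoid M"
  and E: "\<zero>.E <: E" "\<one>.E <: E"
   "ALL a:carrier E. a **.E \<one>.E = a & a **.E \<zero>.E = \<zero>.E & \<zero>.E \<oplus>.E a = a & a \<oplus>.E \<zero>.E = a"
  and zero: "ALL x:carrier M. \<zero>.E \<odot>.M x = \<zero>.M"
 shows "f v = (\<Oplus>.M j:{..<k}. v j \<odot>.M f (unit_vector E k j))"
proof -
 interpret M: abelian_monoid M by (rule M)
 let ?F = "free_module E k"
 note fl = linear_mapsD[OF f]
 have vc: "v j <: E" if "j < k" for j using v that by (auto simp: free_module_def)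
 have uv: "unit_vector E k j <: ?F" for j using E by (auto simp: free_module_def unit_vector_def)
 have sc: "v j \<odot>.?F unit_vector E k j <: ?F" if "j < k" for j
  using E vc[OF that] by (auto simp: free_module_def unit_vector_def)
 have fc: "v j \<odot>.M f (unit_vector E k j) <: M" if "j < k" for j
  using fl(1)[OF sc[OF that]] fl(3)[OF vc[OF that] uv] by simp
 define w where "w m = (\<lambda>i\<in>{..<k}. if i < m then v i else \<zero>.E)" for m
 have w: "w m <: ?F" for m using E vc by (auto simp: free_module_def w_def)
 have "f (w m) = (\<Oplus>.M j:{..<m}. v j \<odot>.M f (unit_vector E k j))" if "m <= k" for m
  using that
 proof (induction m)
  case 0
  have "w 0 = \<zero>.E \<odot>.?F w 0" using E by (auto simp: w_def free_module_def)
  hence "f (w 0) = \<zero>.E \<odot>.M f (w 0)" using fl(3)[OF E(1) w] by metis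
  thus ?case using zero fl(1)[OF w] by simp
 next
  case (Suc m)
  have "w (Suc m) i = (w m \<oplus>.?F (v m \<odot>.?F unit_vector E k m)) i" for i
   using E vc[of m] vc[of i] Suc.prems by (auto simp: w_def free_module_def unit_vector_def less_Suc_eq)
  hence "w (Suc m) = w m \<oplus>.?F (v m \<odot>.?F unit_vector E k m)" ..
  hence "f (w (Suc m)) = f (w m) \<oplus>.M v m \<odot>.M f (unit_vector E k m)"
   using fl(2)[OF w sc[of m]] fl(3)[OF vc uv, of m] Suc.prems by simp
  also have "... = (\<Oplus>.M j:insert m {..<m}. v j \<odot>.M f (unit_vector E k j))"
   using Suc fc by (subst M.finsum_insert) (auto simp: Pi_iff intro!: M.a_comm M.finsum_closed)
  finally show ?case by (simp add: lessThan_Suc)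
 qed
 moreover have "w k = v" using v by (auto simp: w_def free_module_def PiE_def extensional_def)
 ultimately show ?thesis by (metis order_refl)
qed

context module
begin

text \<open>The dual basis lemma: images of the unit vectors generate, and the components of
  \<open>iota\<close> are the coordinate functionals.\<close>

lemma summand_dual_basis:
 assumes "summand_of_free R M k iota \<pi>"
 shows "x <: M ==> x = (\<Oplus>.M j:{..<k}. iota x j \<odot>.M \<pi> (unit_vector R k j))"
  and "\<pi> (unit_vector R k j) <: M"
  and "x <: M ==> j < k ==> iota x j <: R"
  and "x <: M ==> y <: M ==> j < k ==> iota (x \<oplus>.M y) j = iota x j \<oplus> iota y j"
  and "r <: R ==> x <: M ==> j < k ==> iota (r \<odot>.M x) j = r ** iota x j"
proof -
 have iota: "iota : linear_maps R M (free_module R k)" and \<pi>: "\<pi> : linear_maps R (free_module R k) M"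
  and id: "ALL x:carrier M. \<pi> (iota x) = x" using assms by (auto simp: summand_of_free_def)
 show "x = (\<Oplus>.M j:{..<k}. iota x j \<odot>.M \<pi> (unit_vector R k j))" if "x <: M"
  using linear_map_on_free_module[OF \<pi> linear_mapsD(1)[OF iota that] M.abelian_monoid_axioms] id that by simp
 have "unit_vector R k j : carrier (free_module R k)" by (auto simp: free_module_def unit_vector_def)
 thus "\<pi> (unit_vector R k j) <: M" by (rule linear_mapsD(1)[OF \<pi>])
 show "iota x j <: R" if "x <: M" "j < k"
  using linear_mapsD(1)[OF iota that(1)] that(2) by (auto simp: free_module_def)
 show "iota (x \<oplus>.M y) j = iota x j \<oplus> iota y j" if "x <: M" "y <: M" "j < k"
  using linear_mapsD(2)[OF iota that(1,2)] that(3) by (auto simp: free_module_def)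
 show "iota (r \<odot>.M x) j = r ** iota x j" if "r <: R" "x <: M" "j < k"
  using linear_mapsD(3)[OF iota that(1,2)] that(3) by (auto simp: free_module_def)
qed

lemma linear_finsum:
 assumes "finite J" "!!j. j : J ==> x j <: M" "!!j. j : J ==> c j <: R"
  and f: "!!x. x <: M ==> f x <: N" "!!x y. x <: M ==> y <: M ==> f (x \<oplus>.M y) = f x \<oplus>.N f y"
   "!!r x. r <: R ==> x <: M ==> f (r \<odot>.M x) = r \<odot>.N f x" and N: "module R N"
 shows "f (\<Oplus>.M j:J. c j \<odot>.M x j) = (\<Oplus>.N j:J. c j \<odot>.N f (x j))"
 using assms(1-3)
proof (induction J rule: finite_induct)
 case empty
 interpret N: module R N by (rule N)
 have "f (\<zero> \<odot>.M \<zero>.M) = \<zero>.N" using f(1)[OF M.zero_closed] by (subst f(3)) auto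
 thus ?case by simp
next
 case (insert j J)
 interpret N: module R N by (rule N)
 have "f (\<Oplus>.M j:insert j J. c j \<odot>.M x j) = f (c j \<odot>.M x j \<oplus>.M (\<Oplus>.M j:J. c j \<odot>.M x j))"
  using insert by (subst M.finsum_insert) auto
 also have "... = c j \<odot>.N f (x j) \<oplus>.N (\<Oplus>.N j:J. c j \<odot>.N f (x j))"
  using insert by (subst f(2)) (auto simp: f(3) intro!: M.finsum_closed)
 also have "... = (\<Oplus>.N j:insert j J. c j \<odot>.N f (x j))"
  using insert f(1) by (subst N.finsum_insert) auto
 finally show ?case .
qed

lemma coordinate_finsum:
 assumes s: "summand_of_free R M k iota \<pi>" and "finite J" "!!j. j : J ==> x j <: M" "!!j. j : J ==> c j <: R" "i < k"
 shows "iota (\<Oplus>.M j:J. c j \<odot>.M x j) i = (\<Oplus>j:J. c j ** iota (x j) i)"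
proof -
 have reg: "(\<Oplus>.(regular R)j:J. g j) = (\<Oplus>j:J. g j)" for g
  by (simp add: finsum_def finprod_def regular_def)
 show ?thesis
  using linear_finsum[of J x c "%x. iota x i" "regular R"] assms summand_dual_basis[OF s] R.module_regular
  by (simp add: reg) (simp add: regular_def)
qed

text \<open>The trace is a definite description, so all presentations must give the same value.
  Expanding each dual basis in the other produces two double sums that differ only in the order of
  summation, as for the traces of \<open>X Y\<close> and \<open>Y X\<close>.\<close>

lemma module_trace_eq:
 assumes s: "summand_of_free R M k iota \<pi>" and phi: "!!x. x <: M ==> phi x <: M"
  "!!x y. x <: M ==> y <: M ==> phi (x \<oplus>.M y) = phi x \<oplus>.M phi y"
  "!!r x. r <: R ==> x <: M ==> phi (r \<odot>.M x) = r \<odot>.M phi x"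
 shows "module_trace R M phi = (\<Oplus>j:{..<k}. iota (phi (\<pi> (unit_vector R k j))) j)"
proof -
 have *: "(\<Oplus>j:{..<k}. iota (phi (\<pi> (unit_vector R k j))) j) = (\<Oplus>j:{..<k'}. iota' (phi (\<pi>' (unit_vector R k' j))) j)"
  if s: "summand_of_free R M k iota \<pi>" and s': "summand_of_free R M k' iota' \<pi>'" for k iota \<pi> k' iota' \<pi>'
 proof -
  note d = summand_dual_basis[OF s] and d' = summand_dual_basis[OF s']
  let ?g = "%j. \<pi> (unit_vector R k j)" and ?g' = "%j. \<pi>' (unit_vector R k' j)"
  have "(\<Oplus>j:{..<k}. iota (phi (?g j)) j) = (\<Oplus>j:{..<k}. \<Oplus>l:{..<k'}. iota' (phi (?g j)) l ** iota (?g' l) j)"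
  proof (rule R.finsum_cong')
   fix j assume "j : {..<k}"
   hence "iota (\<Oplus>.M l:{..<k'}. iota' (phi (?g j)) l \<odot>.M ?g' l) j = (\<Oplus>l:{..<k'}. iota' (phi (?g j)) l ** iota (?g' l) j)"
    by (intro coordinate_finsum[OF s]) (use phi(1) d(2) d' in auto)
   thus "iota (phi (?g j)) j = (\<Oplus>l:{..<k'}. iota' (phi (?g j)) l ** iota (?g' l) j)"
    using d'(1)[OF phi(1)[OF d(2)], of j] by simp
  qed (use phi d d' in auto)
  also have "... = (\<Oplus>l:{..<k'}. \<Oplus>j:{..<k}. iota (?g' l) j ** iota' (phi (?g j)) l)"
   by (subst R.finsum_swap) (use phi d d' in "auto simp: R.m_comm intro!: R.finsum_cong'")
  also have "... = (\<Oplus>l:{..<k'}. iota' (phi (?g' l)) l)"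
  proof (rule R.finsum_cong')
   fix l assume l: "l : {..<k'}"
   have "phi (\<Oplus>.M j:{..<k}. iota (?g' l) j \<odot>.M ?g j) = (\<Oplus>.M j:{..<k}. iota (?g' l) j \<odot>.M phi (?g j))"
    by (rule linear_finsum) (use phi d d' module_axioms in auto)
   hence "iota' (phi (?g' l)) l = iota' (\<Oplus>.M j:{..<k}. iota (?g' l) j \<odot>.M phi (?g j)) l"
    using d(1)[OF d'(2), of l] by simp
   also have "... = (\<Oplus>j:{..<k}. iota (?g' l) j ** iota' (phi (?g j)) l)"
    by (rule coordinate_finsum[OF s']) (use phi d d' l in auto)
   finally show "(\<Oplus>j:{..<k}. iota (?g' l) j ** iota' (phi (?g j)) l) = iota' (phi (?g' l)) l" ..
  qed (use phi d d' in auto)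
  finally show ?thesis .
 qed
 show ?thesis
  unfolding module_trace_def unit_vector_def[symmetric] by (rule the_equality) (use s * in blast)+
qed

end

text \<open>The universal property of the tensor product for a balanced biadditive \<open>H\<close>.
  Membership in the carriers is proved along with it because the case of concatenated lists uses
  it.\<close>

lemma (in abelian_group) tensor_eq_foldr:
 assumes eq: "tensor_eq S A C ps qs"
  and H: "ALL a:carrier A. ALL c:carrier C. H a c <: G"
  and add: "ALL a:carrier A. ALL a':carrier A. ALL c:carrier C. H (a \<oplus>.A a') c = H a c \<oplus> H a' c"
   "ALL a:carrier A. ALL c:carrier C. ALL c':carrier C. H a (c \<oplus>.C c') = H a c \<oplus> H a c'"
  and bal: "ALL r:carrier S. ALL a:carrier A. ALL c:carrier C. H (r \<odot>.A a) c = H a (r \<odot>.C c)"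
  and cl: "ALL c:carrier C. H \<zero>.A c = \<zero>"
   "ALL r:carrier S. ALL a:carrier A. r \<odot>.A a <: A" "ALL r:carrier S. ALL c:carrier C. r \<odot>.C c <: C"
   "ALL a:carrier A. ALL a':carrier A. a \<oplus>.A a' <: A" "ALL a:carrier C. ALL a':carrier C. a \<oplus>.C a' <: C"
   "\<zero>.A <: A"
 shows "set ps <= carrier A \<times> carrier C & set qs <= carrier A \<times> carrier C &
  foldr (%(a, c) y. H a c \<oplus> y) ps \<zero> = foldr (%(a, c) y. H a c \<oplus> y) qs \<zero>"
proof -
 let ?v = "%ps. foldr (%(a, c) y. H a c \<oplus> y) ps \<zero>"
 have v: "?v ps <: G" if "set ps <= carrier A \<times> carrier C" for ps
  using that H by (induction ps) auto
 have app: "?v (ps @ qs) = ?v ps \<oplus> ?v qs" if "set ps <= carrier A \<times> carrier C" "set qs <= carrier A \<times> carrier C" for ps qs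
  using that(1)
 proof (induction ps)
  case Nil
  thus ?case using v[OF that(2)] by simp
 next
  case (Cons p ps)
  thus ?case using v[OF that(2)] v[of ps] H by (cases p) (auto simp: a_assoc)
 qed
 show ?thesis
  using eq
 proof (induction rule: tensor_eq.induct)
  case (append ps ps' qs qs')
  thus ?case by (simp add: app del: foldr_append)
 next
  case (commute ps qs)
  thus ?case by (simp add: app a_comm v del: foldr_append)
 qed (use H add bal cl in auto)
qed

section \<open>The enveloping algebra of a commutative algebra and point derivations\<close>

context algebra
begin

abbreviation (input) teq where "teq == tensor_eq R M (opposite M)"
abbreviation (input) tcl where "tcl == tensor_class R M (opposite M)"
abbreviation (input) valid where "valid ps == set ps <= carrier M \<times> carrier M"

lemma opposite_simps [simp]:
 "carrier (opposite M) = carrier M" "add (opposite M) = add M" "smult (opposite M) = smult M"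
 "\<one>.(opposite M) = \<one>.M" "x **.(opposite M) y = y **.M x"
 by (simp_all add: opposite_def)

lemma smult_mult_swap: "r <: R ==> x <: M ==> y <: M ==> x **.M (r \<odot>.M y) = r \<odot>.M (x **.M y)"
 using smult_assoc2[of r y x] by (simp add: m_comm)

lemma smult_zero_right [simp]: "r <: R ==> r \<odot>.M \<zero>.M = \<zero>.M"
 by (rule smult_r_null)

lemma teq_foldr:
 assumes "teq ps qs" "abelian_group G"
  "ALL a:carrier M. ALL c:carrier M. H a c <: G"
  "ALL a:carrier M. ALL a':carrier M. ALL c:carrier M. H (a \<oplus>.M a') c = H a c \<oplus>.G H a' c"
  "ALL a:carrier M. ALL c:carrier M. ALL c':carrier M. H a (c \<oplus>.M c') = H a c \<oplus>.G H a c'"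
  "ALL r:carrier R. ALL a:carrier M. ALL c:carrier M. H (r \<odot>.M a) c = H a (r \<odot>.M c)"
  "ALL c:carrier M. H \<zero>.M c = \<zero>.G"
 shows "foldr (%(a, c) y. H a c \<oplus>.G y) ps \<zero>.G = foldr (%(a, c) y. H a c \<oplus>.G y) qs \<zero>.G"
 using abelian_group.tensor_eq_foldr[OF assms(2,1), of H] assms(3-) by simp

lemma teq_refl: "valid ps ==> teq ps ps"
 and teq_commute: "valid ps ==> valid qs ==> teq (ps @ qs) (qs @ ps)"
 using tensor_eq.refl[of ps M "opposite M" R] tensor_eq.commute[of ps M "opposite M" qs R] by simp_all

lemma teq_valid: "teq ps qs ==> valid ps & valid qs"
 by (induction rule: tensor_eq.induct) auto

lemma tcl_eq: "teq ps qs ==> tcl ps = tcl qs"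
 unfolding tensor_class_def by (blast intro: tensor_eq.sym tensor_eq.trans)

lemma tcl_nonempty: "valid ps ==> tcl ps ~= {}"
 using teq_refl[of ps] unfolding tensor_class_def by blast

lemma tcl_eqD: "tcl ps = tcl qs ==> valid qs ==> teq ps qs"
 unfolding tensor_class_def using tensor_eq.refl[of qs M "opposite M" R] by auto

definition tprod where
 "tprod ps qs = [(a **.M a', c **.(opposite M) c'). (a, c) \<leftarrow> ps, (a', c') \<leftarrow> qs]"

lemma tprod_simps [simp]: "tprod [] qs = []"
  "tprod (p # ps) qs = map (%q. (fst p **.M fst q, snd q **.M snd p)) qs @ tprod ps qs"
 by (cases p; simp add: tprod_def case_prod_beta)+

lemma teq_scale:
 assumes "teq qs qs'" "a <: M" "c <: M"
 shows "teq (map (%q. (a **.M fst q, snd q **.M c)) qs) (map (%q. (a **.M fst q, snd q **.M c)) qs')"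
 using assms(1)
proof (induction rule: tensor_eq.induct)
 case (balance r a' c')
 thus ?case using assms(2,3) tensor_eq.balance[of r R "a **.M a'" M "c' **.M c" "opposite M"]
  by (simp add: smult_assoc2 smult_mult_swap)
next
 case (sym ps qs)
 thus ?case by (blast intro: tensor_eq.sym)
next
 case (trans ps qs us)
 thus ?case by (blast intro: tensor_eq.trans)
next
 case (add_right a' c' c'')
 thus ?case using assms(2,3) tensor_eq.add_right[of "a **.M a'" M "c' **.M c" "opposite M" "c'' **.M c" R]
  by (simp add: l_distr)
next
 case (refl ps)
 thus ?case by (intro teq_refl) (use assms(2,3) in auto)
next
 case (commute ps qs)
 have "set (map (%q. (a **.M fst q, snd q **.M c)) ps) <= carrier M \<times> carrier M" if "valid ps" for ps
  using that assms(2,3) by auto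
 from teq_commute[OF this this] show ?case using commute by simp
qed (use assms(2,3) in "auto simp: r_distr l_distr intro: tensor_eq.intros")

lemma teq_perm: "mset ps = mset qs ==> valid ps ==> teq ps qs"
proof (induction ps arbitrary: qs)
 case Nil
 thus ?case by (auto intro: teq_refl)
next
 case (Cons p ps)
 then obtain us vs where qs: "qs = us @ p # vs" by (metis in_set_conv_decomp list.set_intros(1) mset_eq_setD)
 have ps: "mset ps = mset (us @ vs)" using Cons.prems qs by simp
 hence v: "valid us" "valid vs" using Cons.prems mset_eq_setD[OF ps] by auto
 have "teq ([p] @ ps) ([p] @ us @ vs)" by (rule tensor_eq.append) (use Cons ps in "auto intro: teq_refl")
 moreover have "teq (([p] @ us) @ vs) ((us @ [p]) @ vs)"
  by (rule tensor_eq.append[OF teq_commute teq_refl]) (use Cons.prems v in auto)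
 ultimately show ?case using qs by (auto intro: tensor_eq.trans)
qed

lemma tprod_valid: "valid ps ==> valid qs ==> valid (tprod ps qs)"
 by (induction ps) auto

lemma tprod_comm: "valid ps ==> valid qs ==> mset (tprod ps qs) = mset (tprod qs ps)"
proof (induction ps)
 case Nil
 show ?case by (induction qs) auto
next
 case (Cons p ps)
 have "mset (tprod qs (p # ps)) = mset (map (%q. (fst q **.M fst p, snd p **.M snd q)) qs) + mset (tprod qs ps)"
  by (induction qs) auto
 moreover have "map (%q. (fst q **.M fst p, snd p **.M snd q)) qs = map (%q. (fst p **.M fst q, snd q **.M snd p)) qs"
  using Cons.prems by (auto simp: m_comm)
 ultimately show ?case using Cons by simp
qed

text \<open>By commutativity \<open>tprod\<close> is symmetric up to the order of the list, so
  well-definedness in the second factor implies it in the first.\<close>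

lemma teq_tprod:
 assumes "teq ps ps'" "teq qs qs'"
 shows "teq (tprod ps qs) (tprod ps' qs')"
proof -
 have right: "teq (tprod ps qs) (tprod ps qs')" if "teq qs qs'" "valid ps" for ps qs qs'
  using that(2) by (induction ps) (auto intro!: tensor_eq.append teq_scale that teq_refl)
 have v: "valid ps" "valid ps'" "valid qs" "valid qs'" using assms teq_valid by auto
 have swap: "teq (tprod us ws) (tprod ws us)" if "valid us" "valid ws" for us ws
  by (rule teq_perm[OF tprod_comm[OF that] tprod_valid[OF that]])
 have "teq (tprod ps qs) (tprod qs ps')"
  by (rule tensor_eq.trans[OF swap[OF v(1,3)] right[OF assms(1) v(3)]])
 also have "teq (tprod qs ps') (tprod ps' qs)" by (rule swap[OF v(3,2)])
 finally (tensor_eq.trans) show ?thesis using right[OF assms(2) v(2)] by (rule tensor_eq.trans)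
qed

abbreviation (input) Env where "Env == enveloping R M"

lemma Env_carrier: "T <: Env \<longleftrightarrow> (EX ps. T = tcl ps & valid ps)"
 by (simp add: enveloping_def tensor_algebra_def)

lemma tcl_in_Env: "valid ps ==> tcl ps <: Env"
 unfolding Env_carrier by blast

lemma Env_add:
 assumes "valid ps" "valid qs"
 shows "tcl ps \<oplus>.Env tcl qs = tcl (ps @ qs)"
proof -
 have "tcl (ps' @ qs') = tcl (ps @ qs)" if "ps' : tcl ps" "qs' : tcl qs" for ps' qs'
  using tcl_eq[OF tensor_eq.append[OF that[unfolded tensor_class_def mem_Collect_eq]], symmetric] .
 hence "(\<Union>ps'\<in>tcl ps. \<Union>qs'\<in>tcl qs. tcl (ps' @ qs')) = (\<Union>ps'\<in>tcl ps. \<Union>qs'\<in>tcl qs. tcl (ps @ qs))"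
  by (intro SUP_cong HOL.refl)
 also have "... = tcl (ps @ qs)" using tcl_nonempty assms by simp
 finally show ?thesis unfolding enveloping_def tensor_algebra_def by simp
qed

lemma Env_mult:
 assumes "valid ps" "valid qs"
 shows "tcl ps **.Env tcl qs = tcl (tprod ps qs)"
proof -
 have "tcl (tprod ps' qs') = tcl (tprod ps qs)" if "ps' : tcl ps" "qs' : tcl qs" for ps' qs'
  using tcl_eq[OF teq_tprod[OF that[unfolded tensor_class_def mem_Collect_eq]], symmetric] .
 hence "(\<Union>ps'\<in>tcl ps. \<Union>qs'\<in>tcl qs. tcl (tprod ps' qs')) = (\<Union>ps'\<in>tcl ps. \<Union>qs'\<in>tcl qs. tcl (tprod ps qs))"
  by (intro SUP_cong HOL.refl)
 also have "... = tcl (tprod ps qs)" using tcl_nonempty assms by simp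
 finally show ?thesis unfolding enveloping_def tensor_algebra_def tprod_def[symmetric] by simp
qed

lemma Env_laws: "\<zero>.Env = tcl []" "\<one>.Env = tcl [(\<one>.M, \<one>.M)]"
  "T <: Env ==> T **.Env \<one>.Env = T" "T <: Env ==> T **.Env \<zero>.Env = \<zero>.Env"
  "T <: Env ==> \<zero>.Env \<oplus>.Env T = T" "T <: Env ==> T \<oplus>.Env \<zero>.Env = T"
proof -
 show 0: "\<zero>.Env = tcl []" and 1: "\<one>.Env = tcl [(\<one>.M, \<one>.M)]"
  by (simp_all add: enveloping_def tensor_algebra_def)
 have id: "tprod ps [(\<one>.M, \<one>.M)] = ps" "tprod ps [] = []" if "valid ps" for ps
  using that by (induction ps) auto
 assume "T <: Env"
 then obtain ps where T: "T = tcl ps" "valid ps" unfolding Env_carrier by blast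
 show "T **.Env \<one>.Env = T" "T **.Env \<zero>.Env = \<zero>.Env" "\<zero>.Env \<oplus>.Env T = T" "T \<oplus>.Env \<zero>.Env = T"
  unfolding 0 1 using T by (simp_all add: Env_mult Env_add id)
qed

lemma env_action_eq:
 assumes "valid ps" "x <: M"
 shows "env_action M (tcl ps) x = sandwich M ps x"
proof -
 have "sandwich M qs x = sandwich M ps x" if "teq ps qs" for qs
  unfolding sandwich_def
  by (rule teq_foldr[OF that abelian_group_axioms, symmetric])
   (use assms in "auto simp: l_distr r_distr smult_assoc2 smult_mult_swap")
 hence "(%ps. sandwich M ps x) ` tcl ps = (%_. sandwich M ps x) ` tcl ps"
  by (intro image_cong HOL.refl) (simp add: tensor_class_def)
 also have "... = {sandwich M ps x}" using tcl_nonempty[OF assms(1)] by (simp add: image_constant_conv)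
 finally show ?thesis by (simp add: env_action_def)
qed

lemma sandwich_closed: "valid ps ==> x <: M ==> sandwich M ps x <: M"
 by (induction ps) (auto simp: sandwich_def)

text \<open>Projectivity over the enveloping algebra embeds \<open>M\<close> in a free module, where
  \<open>1\<close> becomes a vector \<open>v\<close> with
  \<open>(s \<otimes> 1) v = (1 \<otimes> s) v\<close>. Applying
  \<open>a \<otimes> b \<mapsto> psi (a c) chi b\<close> to each coordinate leaves
  \<open>psi s\<close> times a factor equal to zero, and the factors add up to
  \<open>chi 1 = 1\<close>.\<close>

lemma separable_derivation_zero:
 assumes sep: "fg_projective Env (env_module M)" and F: "field F" and h: "h : ring_hom R F"
  and chi: "chi : hom_along R M F h" "chi \<one>.M = \<one>.F"
   "ALL x:carrier M. ALL y:carrier M. chi (x **.M y) = chi x **.F chi y"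
  and psi: "psi : hom_along R M F h"
   "ALL x:carrier M. ALL y:carrier M. psi (x **.M y) = psi x **.F chi y \<oplus>.F chi x **.F psi y"
  and s: "s <: M"
 shows "psi s = \<zero>.F"
proof -
 interpret m: module_to_field R M F h
  by (intro module_to_field.intro module_axioms F module_to_field_axioms.intro h)
 note m_chi = m.functionals_closed[OF chi(1)] m.functionals_add[OF chi(1)] m.functionals_smult[OF chi(1)] m.functionals_zero[OF chi(1)]
 note m_psi = m.functionals_closed[OF psi(1)] m.functionals_add[OF psi(1)] m.functionals_smult[OF psi(1)] m.functionals_zero[OF psi(1)]
 note [simp] = m_chi m_psi chi(2,3) psi(2) s
 have em[simp]: "carrier (env_module M) = carrier M" "T \<odot>.(env_module M) x = env_action M T x" for T x
  by (simp_all add: env_module_def)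
 obtain k iota \<pi> where iota: "iota : linear_maps Env (env_module M) (free_module Env k)"
  and \<pi>: "\<pi> : linear_maps Env (free_module Env k) (env_module M)" and id: "ALL x:carrier M. \<pi> (iota x) = x"
  using sep unfolding fg_projective_def summand_of_free_def by auto
 define v where "v = iota \<one>.M"
 have v: "v : carrier (free_module Env k)" using linear_mapsD(1)[OF iota] by (simp add: v_def)
 hence "ALL j:{..<k}. EX ps. v j = tcl ps & valid ps"
  by (auto simp: free_module_def Env_carrier[symmetric])
 then obtain ps where ps: "!!j. j < k ==> v j = tcl (ps j)" "!!j. j < k ==> valid (ps j)"
  by (metis lessThan_iff)
 define c where "c j = \<pi> (unit_vector Env k j)" for j
 have E01: "\<zero>.Env <: Env" "\<one>.Env <: Env" by (auto simp: Env_laws Env_carrier)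
 have c[simp]: "c j <: M" for j
  using linear_mapsD(1)[OF \<pi>, of "unit_vector Env k j"] E01 by (auto simp: c_def unit_vector_def free_module_def)
 have fs: "(\<Oplus>.(env_module M)j:A. f j) = (\<Oplus>.M j:A. f j)" for A :: "nat set" and f
  by (simp add: finsum_def finprod_def env_module_def)
 have am: "abelian_monoid (env_module M)"
  by (rule abelian_monoidI) (auto simp: env_module_def a_assoc intro: a_comm)
 have "\<pi> v = (\<Oplus>.M j:{..<k}. env_action M (v j) (c j))"
  using linear_map_on_free_module[OF \<pi> v am E01] Env_laws env_action_eq[of "[]"]
  by (simp add: fs c_def) (simp add: env_module_def sandwich_def)
 hence one: "\<one>.M = (\<Oplus>.M j:{..<k}. env_action M (v j) (c j))" using id by (simp add: v_def)
 have sw[simp]: "sandwich M (ps j) (c j) <: M" if "j < k" for j using that ps sandwich_closed by simp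
 have ea: "env_action M (v j) (c j) = sandwich M (ps j) (c j)" if "j < k" for j
  using that ps by (simp add: env_action_eq)
 have key: "psi s **.F chi (sandwich M (ps j) (c j)) = \<zero>.F" if j: "j < k" for j
 proof -
  \<comment> \<open>Both tensors send \<open>1\<close> to \<open>s\<close>, so both send
    \<open>v\<close> to \<open>iota s\<close>.\<close>
  have "tcl [(s, \<one>.M)] \<odot>.(free_module Env k) v = iota s" "tcl [(\<one>.M, s)] \<odot>.(free_module Env k) v = iota s"
   using linear_mapsD(3)[OF iota tcl_in_Env, of "[(s, \<one>.M)]" "\<one>.M"]
    linear_mapsD(3)[OF iota tcl_in_Env, of "[(\<one>.M, s)]" "\<one>.M"]
   by (simp_all add: v_def env_action_eq sandwich_def)
  hence "(tcl [(s, \<one>.M)] \<odot>.(free_module Env k) v) j = (tcl [(\<one>.M, s)] \<odot>.(free_module Env k) v) j" by simp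
  hence "tcl (tprod [(s, \<one>.M)] (ps j)) = tcl (tprod [(\<one>.M, s)] (ps j))"
   using j ps by (simp add: free_module_def Env_mult del: tprod_simps)
  hence "teq (tprod [(s, \<one>.M)] (ps j)) (tprod [(\<one>.M, s)] (ps j))"
   by (rule tcl_eqD) (use ps(2)[OF j] in "auto intro!: tprod_valid")
  note eq = teq_foldr[OF this, of F "%a b. psi (a **.M c j) **.F chi b"]
  let ?v = "%ps. foldr (%(a, b) y. psi (a **.M c j) **.F chi b \<oplus>.F y) ps \<zero>.F"
  have vc: "?v ps <: F" if "valid ps" for ps using that by (induction ps) auto
  have 1: "?v (tprod [(s, \<one>.M)] ps) = psi s **.F chi (sandwich M ps (c j)) \<oplus>.F chi s **.F ?v ps" if "valid ps" for ps
   using that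
  proof (induction ps)
   case Nil
   thus ?case by (simp add: sandwich_def)
  next
   case (Cons p ps)
   obtain a b where p: "p = (a, b)" by fastforce
   have ab[simp]: "a <: M" "b <: M" and vps: "valid ps" using Cons.prems p by auto
   have sc: "sandwich M ps (c j) <: M" by (rule sandwich_closed) (use vps in auto)
   have sp: "sandwich M (p # ps) (c j) = (a **.M c j **.M b) \<oplus>.M sandwich M ps (c j)" by (simp add: sandwich_def p)
   have "?v (tprod [(s, \<one>.M)] (p # ps)) = psi (s **.M a **.M c j) **.F chi b \<oplus>.F ?v (tprod [(s, \<one>.M)] ps)"
    by (simp add: p)
   also have "... = psi s **.F chi (sandwich M (p # ps) (c j)) \<oplus>.F chi s **.F ?v (p # ps)"
    unfolding Cons.IH[OF vps] sp using sc vc[OF vps]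
    by (simp add: p m_assoc m.F.l_distr m.F.r_distr m.F.m_ac m.F.a_ac)
   finally show ?case .
  qed
  have 2: "?v (tprod [(\<one>.M, s)] ps) = chi s **.F ?v ps" if "valid ps" for ps
   using that
  proof (induction ps)
   case (Cons p ps)
   obtain a b where p: "p = (a, b)" by fastforce
   have ab[simp]: "a <: M" "b <: M" and vps: "valid ps" using Cons.prems p by auto
   have "?v (tprod [(\<one>.M, s)] (p # ps)) = psi (a **.M c j) **.F (chi b **.F chi s) \<oplus>.F ?v (tprod [(\<one>.M, s)] ps)"
    by (simp add: p)
   thus ?case
    unfolding Cons.IH[OF vps] using vc[OF vps] by (simp add: p m.F.r_distr m.F.m_ac del: psi(2))
  qed simp
  have "psi s **.F chi (sandwich M (ps j) (c j)) \<oplus>.F chi s **.F ?v (ps j) = \<zero>.F \<oplus>.F chi s **.F ?v (ps j)"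
   using eq 1[OF ps(2)[OF j]] 2[OF ps(2)[OF j]] vc[OF ps(2)[OF j]] m.F.abelian_group_axioms
   by (simp add: l_distr smult_assoc2 smult_mult_swap m.F.l_distr m.F.r_distr m.F.m_ac del: tprod_simps psi(2))
  thus ?thesis by (rule m.F.add.r_cancel) (use vc[OF ps(2)[OF j]] sw[OF j] in auto)
 qed
 have "psi s = psi s **.F chi (\<Oplus>.M j:{..<k}. sandwich M (ps j) (c j))"
 proof -
  have "(\<Oplus>.M j:{..<k}. env_action M (v j) (c j)) = (\<Oplus>.M j:{..<k}. sandwich M (ps j) (c j))"
   by (rule finsum_cong') (auto simp: ea)
  thus ?thesis using one chi(2) by simp
 qed
 also have "... = (\<Oplus>.F j:{..<k}. psi s **.F chi (sandwich M (ps j) (c j)))"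
  by (subst m.functionals_finsum[OF chi(1)]) (auto simp: m.F.finsum_rdistr)
 also have "... = \<zero>.F" by (rule m.F.finsum_all_zero) (use key in auto)
 finally show ?thesis .
qed

end

lemma (in field) cancel_left: "a <: R ==> b <: R ==> c <: R ==> c ~= \<zero> ==> c ** a = c ** b ==> a = b"
 using m_lcancel by blast

text \<open>A two by two Vandermonde system with distinct nodes \<open>u\<close> and
  \<open>v\<close>, whose only solution is \<open>(1, 0)\<close>.\<close>

lemma (in field) affine_relations:
 assumes "a <: R" "b <: R" "u <: R" "v <: R" "u ~= v"
  and "a \<oplus> b = \<one>" "u ** a \<oplus> v ** b = u"
 shows "a = \<one>" "b = \<zero>"
proof -
 have "u ** a \<oplus> v ** b = u ** (a \<oplus> b)" using assms by simp
 hence "u ** a \<oplus> v ** b = u ** a \<oplus> u ** b" using assms(1-4) by (simp add: r_distr)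
 hence "v ** b = u ** b" using assms(1-4) by simp
 thus "b = \<zero>" using assms(1-5) m_rcancel[of b v u] by auto
 thus "a = \<one>" using assms by simp
qed

lemma (in cring) affine_identities:
 assumes "x <: R" "y <: R" "z <: R" "u <: R" "v <: R"
 shows "x = (x \<ominus> y \<ominus> z) \<oplus> (y \<oplus> z)"
  and "x ** u \<oplus> y ** v = (x \<oplus> y ** z) ** u \<oplus> y ** (v \<ominus> z ** u)"
  and "x \<ominus> (\<zero> \<ominus> y ** z) ** u ** v = x \<oplus> y ** (u ** z) ** v"
 using assms by algebra+

lemma (in cring) cross_difference:
 assumes "a <: R" "b <: R" "c <: R" "a' <: R" "b' <: R" "c' <: R"
  and eq: "c ** a' \<oplus> b ** c' = c' ** a \<oplus> b' ** c"
 shows "(a \<ominus> b) ** c' = (a' \<ominus> b') ** c"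
proof -
 have "(a \<ominus> b) ** c' = (c' ** a \<oplus> b' ** c) \<ominus> (b ** c' \<oplus> b' ** c)" using assms(1-6) by algebra
 moreover have "(a' \<ominus> b') ** c = (c ** a' \<oplus> b ** c') \<ominus> (b ** c' \<oplus> b' ** c)" using assms(1-6) by algebra
 ultimately show ?thesis using eq by simp
qed

section \<open>The two characters of a quadratic etale algebra\<close>

context quadratic_etale_algebra
begin

text \<open>The functionals form a two-dimensional translation-stable space, which contains a
  character \<open>chi\<close>. In a basis \<open>chi\<close>, \<open>psi\<close> with
  \<open>psi 1 = 0\<close> translations are triangular, and their second diagonal entry is again
  multiplicative. It differs from \<open>chi\<close>, since otherwise \<open>psi\<close> would be a
  point derivation, contrary to separability.\<close>

lemma characters:
 assumes F: "field F" and roots: "ring.has_roots F" and h: "h : ring_hom R F"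
 obtains chi beta s where "ALL theta:{chi, beta}. theta : hom_along R S F h & theta \<one>.S = \<one>.F &
   (ALL x:carrier S. ALL y:carrier S. theta (x **.S y) = theta x **.F theta y)"
  "s <: S" "chi s ~= beta s"
  "ALL phi:hom_along R S F h. EX a:carrier F. EX b:carrier F. ALL x. phi x = a **.F chi x \<oplus>.F b **.F beta x"
  "ALL x:carrier S. h (algebra_trace R S x) = chi x \<oplus>.F beta x"
proof -
 interpret m: module_to_field R S F h
  by (intro module_to_field.intro module_axioms F module_to_field_axioms.intro h)
 obtain ys xi where ys: "ALL i<(2::nat). ys i <: S" and xi: "ALL i<2. xi i : m.functionals"
  and dual: "ALL i<2. ALL j<2. xi i (ys j) = (if i = j then \<one>.F else \<zero>.F)"
  and det: "ALL phi:m.functionals. (ALL i<2. phi (ys i) = \<zero>.F) --> phi = (%_. \<zero>.F)"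
  using m.functionals_dual_basis[OF rank_two] by blast
 note fc = m.functionals_closed and fo = m.functionals_outside
 have translate: "(%x. if x <: S then u (x **.S a) else \<zero>.F) : m.functionals"
  if "a <: S" "u : m.functionals" for a u
  using that m.functionals_add[OF that(2)] m.functionals_smult[OF that(2)] m.functionals_closed[OF that(2)]
  unfolding hom_along_def[of R S F h] by (simp add: l_distr smult_assoc2)
 have det': "ALL u:m.functionals. (ALL y:{ys 0, ys 1}. u y = \<zero>.F) --> u = (%_. \<zero>.F)"
  using det by (auto simp: less_2_cases_iff)
 have nz: "EX u:m.functionals. u ~= (%_. \<zero>.F)"
 proof (rule bexI)
  have "xi 0 (ys 0) = \<one>.F" using dual by simp
  thus "xi 0 ~= (%_. \<zero>.F)" by auto
 qed (use xi in simp)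
 have fin: "finite {ys 0, ys 1}" "{ys 0, ys 1} <= carrier S" using ys by auto
 obtain chi0 u p where c0: "u : m.functionals" "p <: S" "!!a. a <: S ==> chi0 a = u (p **.S a)"
   "chi0 \<one>.S = \<one>.F" "!!a b. a <: S ==> b <: S ==> chi0 (a **.S b) = chi0 a **.F chi0 b"
  by (rule m.F.burnside_commutative[where W = "carrier S" and mul = "monoid.mult S" and e = "\<one>.S", OF roots])
   (assumption | rule m_closed one_closed m_assoc r_one m_comm m.functionals_subspace translate fin det' nz that)+
 define chi where "chi x = (if x <: S then chi0 x else \<zero>.F)" for x
 have "chi = (%x. if x <: S then u (x **.S p) else \<zero>.F)"
  using c0(2,3) by (auto simp: chi_def m_comm)
 hence chi: "chi : m.functionals" using translate[OF c0(2,1)] by simp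
 have chi1: "chi \<one>.S = \<one>.F" and chim: "!!x y. x <: S ==> y <: S ==> chi (x **.S y) = chi x **.F chi y"
  using c0(4,5) by (simp_all add: chi_def)
 note [simp] = fc[OF chi] chi1 chim
 have "chi ~= (%_. \<zero>.F)" using chi1 m.F.one_not_zero by metis
 then obtain i0 :: nat where i0: "i0 < 2" "chi (ys i0) ~= \<zero>.F" using det chi by blast
 define y y' xi' where "y = ys i0" "y' = ys (1 - i0)" "xi' = xi (1 - i0)"
 note y_def = this
 have i01: "i0 = 0 \<or> i0 = 1" using i0(1) by auto
 hence j: "1 - i0 < 2" "1 - i0 ~= i0" by auto
 have yy[simp]: "y <: S" "y' <: S" and xi': "xi' : m.functionals" "xi' y = \<zero>.F" "xi' y' = \<one>.F"
  using i0(1) j(1) ys xi dual[rule_format, OF j(1) i0(1)] dual[rule_format, OF j(1) j(1)] j(2) unfolding y_def by auto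
 have det2: "phi = (%_. \<zero>.F)" if "phi : m.functionals" "phi y = \<zero>.F" "phi y' = \<zero>.F" for phi
  using det' that i01 unfolding y_def by auto
 define c where "c = inv\<^bsub>F\<^esub> (chi y)"
 have c: "c <: F" "c **.F chi y = \<one>.F" using i0 m.F.inv_closed m.F.inv_left by (auto simp: c_def y_def)
 \<comment> \<open>The coefficient of \<open>phi\<close> at \<open>xi'\<close> once
   \<open>chi\<close> has matched the value at \<open>y\<close>; it is also the coefficient at
   \<open>psi\<close>.\<close>
 define D where "D phi = phi y' \<ominus>.F phi y **.F c **.F chi y'" for phi
 define psi where "psi = (%x. xi' x \<ominus>.F xi' \<one>.S **.F chi x)"
 note subsp = m.functionals_subspace and [simp] = fc[OF xi'(1)]
 have psi: "psi : m.functionals" unfolding psi_def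
  by (intro m.F.fun_subspace_minus[OF subsp] m.F.fun_subspace_smult[OF subsp] xi' chi) simp
 note [simp] = fc[OF psi]
 have Dc: "D phi <: F" if "phi : m.functionals" for phi using fc[OF that] c by (simp add: D_def)
 have expand: "phi x = phi \<one>.S **.F chi x \<oplus>.F D phi **.F psi x" if phi: "phi : m.functionals" for phi x
 proof -
  note [simp] = fc[OF phi] Dc[OF phi] c(1)
  define theta where "theta = (%x. (phi x \<ominus>.F (phi y **.F c) **.F chi x) \<ominus>.F D phi **.F xi' x)"
  have "theta : m.functionals" unfolding theta_def
   by (intro m.F.fun_subspace_minus[OF subsp] m.F.fun_subspace_smult[OF subsp] xi' chi phi) simp_all
  moreover have "theta y = \<zero>.F" "theta y' = \<zero>.F"
   using c(2) xi' by (auto simp: theta_def D_def m.F.m_assoc m.F.minus_eq m.F.r_neg)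
  ultimately have "theta = (%_. \<zero>.F)" by (rule det2)
  hence "theta x = \<zero>.F" for x by simp
  hence e: "phi x = phi y **.F c **.F chi x \<oplus>.F D phi **.F xi' x" for x
  proof -
   assume z: "!!x. theta x = \<zero>.F"
   have "phi x = theta x \<oplus>.F (phi y **.F c **.F chi x \<oplus>.F D phi **.F xi' x)"
    unfolding theta_def by (rule m.F.affine_identities(1)[of _ _ _ "\<zero>.F" "\<zero>.F"]) simp_all
   thus ?thesis using z by simp
  qed
  show ?thesis
   unfolding e[of "\<one>.S"] psi_def
   using e[of x] m.F.affine_identities(2)[of "phi y **.F c" "D phi" "xi' \<one>.S" "chi x" "xi' x"] by simp
 qed
 \<comment> \<open>The second diagonal entry of the translation by \<open>s\<close>.\<close>
 define beta0 where "beta0 s = D (%x. if x <: S then psi (x **.S s) else \<zero>.F)" for s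
 have psi1: "psi \<one>.S = \<zero>.F" by (simp add: psi_def m.F.r_neg m.F.minus_eq)
 have betac[simp]: "s <: S ==> beta0 s <: F" for s unfolding beta0_def by (rule Dc[OF translate[OF _ psi]])
 have prod: "psi (x **.S s) = psi s **.F chi x \<oplus>.F beta0 s **.F psi x" if "s <: S" "x <: S" for s x
  using expand[OF translate[OF that(1) psi], of x] that by (simp add: beta0_def)
 have Dpsi: "D psi = \<one>.F"
  using c xi'(2,3) m.F.affine_identities(3)[of "\<one>.F \<ominus>.F xi' \<one>.S **.F chi y'" "xi' \<one>.S" "chi y" c "chi y'"]
  by (simp add: D_def psi_def) (simp add: m.F.minus_eq m.F.a_assoc m.F.l_neg)
 have "psi ~= (%_. \<zero>.F)"
 proof
  assume "psi = (%_. \<zero>.F)"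
  hence "D psi = \<zero>.F" using c(1) by (simp add: D_def m.F.minus_eq)
  thus False using Dpsi by simp
 qed
 then obtain z where z: "psi z ~= \<zero>.F" "z <: S" using fo[OF psi] by (metis (no_types, lifting) ext)
 have betam: "beta0 (s **.S t) = beta0 s **.F beta0 t" if st[simp]: "s <: S" "t <: S" for s t
 proof (rule m.F.cancel_left[of _ _ "psi z"])
  note [simp] = z(2)
  have "psi (s **.S t) **.F chi z \<oplus>.F beta0 (s **.S t) **.F psi z = psi ((z **.S s) **.S t)"
   using prod[of "s **.S t" z] by (simp add: m_assoc)
  also have "... = psi t **.F (chi z **.F chi s) \<oplus>.F beta0 t **.F (psi s **.F chi z \<oplus>.F beta0 s **.F psi z)"
   by (subst prod) (simp_all add: prod)
  also have "... = psi (s **.S t) **.F chi z \<oplus>.F beta0 s **.F beta0 t **.F psi z"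
   by (simp add: prod m.F.l_distr m.F.r_distr m.F.m_ac m.F.a_ac)
  finally show "psi z **.F beta0 (s **.S t) = psi z **.F (beta0 s **.F beta0 t)"
   by (simp add: m.F.m_ac)
 qed (use z in auto)
 \<comment> \<open>If both diagonal entries were equal, the triangular form would be the Leibniz
   rule for \<open>psi\<close>.\<close>
 have "EX s:carrier S. beta0 s ~= chi s"
 proof (rule ccontr)
  assume "~ (EX s:carrier S. beta0 s ~= chi s)"
  hence d: "ALL x:carrier S. ALL y:carrier S. psi (x **.S y) = psi x **.F chi y \<oplus>.F chi x **.F psi y"
   by (simp add: prod m.F.m_ac m.F.a_ac)
  have chimm: "ALL x:carrier S. ALL y:carrier S. chi (x **.S y) = chi x **.F chi y" by simp
  show False using separable_derivation_zero[OF separable F h chi chi1 chimm psi d z(2)] z(1) by simp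
 qed
 then obtain s where s: "s <: S" "beta0 s ~= chi s" by blast
 define w where "w = inv\<^bsub>F\<^esub> (chi s \<ominus>.F beta0 s)"
 have dc: "chi s \<ominus>.F beta0 s <: F" using s(1) by simp
 have dn: "chi s \<ominus>.F beta0 s ~= \<zero>.F"
  using m.F.minus_eq_zeroD[OF fc[OF chi] betac[OF s(1)]] s(2) by metis
 have w: "w <: F" "w **.F (chi s \<ominus>.F beta0 s) = \<one>.F"
  unfolding w_def using m.F.inv_closed[OF dc dn] m.F.inv_left[OF dc dn] by blast+
 define e where "e = w **.F psi s"
 have ec[simp]: "e <: F" using w by (simp add: e_def)
 \<comment> \<open>Comparing \<open>psi (x s)\<close> with \<open>psi (s x)\<close> makes
   \<open>psi\<close> proportional to the difference of \<open>chi\<close> and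
   \<open>beta0\<close>.\<close>
 have psi_eq: "psi x = e **.F (chi x \<ominus>.F beta0 x)" if x[simp]: "x <: S" for x
 proof -
  have eq: "psi s **.F chi x \<oplus>.F beta0 s **.F psi x = psi x **.F chi s \<oplus>.F beta0 x **.F psi s"
   using prod[OF s(1) x] prod[OF x s(1)] by (simp add: m_comm s(1))
  have "(chi s \<ominus>.F beta0 s) **.F psi x = (chi x \<ominus>.F beta0 x) **.F psi s"
   by (rule m.F.cross_difference[OF _ _ _ _ _ _ eq]) (use s(1) in auto)
  hence "w **.F (chi s \<ominus>.F beta0 s) **.F psi x = w **.F psi s **.F (chi x \<ominus>.F beta0 x)"
   using s(1) w(1) by (simp add: m.F.m_assoc m.F.m_comm[of "psi s"])
  thus ?thesis using w by (simp add: e_def)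
 qed
 have e0: "e ~= \<zero>.F" using psi_eq[OF z(2)] z by auto
 \<comment> \<open>This agrees with \<open>beta0\<close> on the carrier and is visibly a
   functional.\<close>
 define beta where "beta x = chi x \<ominus>.F inv\<^bsub>F\<^esub> e **.F psi x" for x
 have ie: "inv\<^bsub>F\<^esub> e <: F" "inv\<^bsub>F\<^esub> e **.F e = \<one>.F" using m.F.inv_closed[OF ec e0] m.F.inv_left[OF ec e0] by auto
 have beta: "beta : m.functionals" unfolding beta_def
  by (intro m.F.fun_subspace_minus[OF subsp] m.F.fun_subspace_smult[OF subsp] psi chi ie)
 note [simp] = fc[OF beta]
 have beta_eq: "beta x = beta0 x" if x[simp]: "x <: S" for x
  unfolding beta_def psi_eq[OF x] using ie
  by (simp add: m.F.m_assoc[symmetric]) (simp add: m.F.minus_eq m.F.minus_add m.F.a_assoc[symmetric] m.F.r_neg)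
 have beta1: "beta \<one>.S = \<one>.F" using ie by (simp add: beta_def psi1 m.F.minus_eq)
 have span: "phi x = (phi \<one>.S \<oplus>.F D phi **.F e) **.F chi x \<oplus>.F (\<ominus>.F (D phi **.F e)) **.F beta x" if phi: "phi : m.functionals" for phi x
 proof (cases "x <: S")
  case True
  thus ?thesis unfolding expand[OF phi, of x] psi_eq[OF True] using fc[OF phi] Dc[OF phi] beta_eq[OF True]
   by (simp add: m.F.l_distr m.F.r_distr m.F.minus_eq m.F.l_minus m.F.r_minus m.F.m_assoc m.F.a_assoc)
 next
  case False
  thus ?thesis using fo[OF phi] fo[OF chi] fo[OF beta] fc[OF phi] Dc[OF phi] by simp
 qed
 have span': "EX a:carrier F. EX b:carrier F. ALL x. phi x = a **.F chi x \<oplus>.F b **.F beta x" if phi: "phi : m.functionals" for phi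
  by (rule bexI, rule bexI, rule allI, rule span[OF phi]) (use fc[OF phi] Dc[OF phi] in auto)
 have ne: "chi s ~= beta s" using s beta_eq by auto
 have chars: "ALL theta:{chi, beta}. theta : m.functionals & theta \<one>.S = \<one>.F &
   (ALL x:carrier S. ALL y:carrier S. theta (x **.S y) = theta x **.F theta y)"
  using chi beta beta1 betam beta_eq by simp
 obtain k iota \<pi> where sf: "summand_of_free R S k iota \<pi>" using fg_projective unfolding fg_projective_def by blast
 note db = summand_dual_basis[OF sf]
 define g where "g j = \<pi> (unit_vector R k j)" for j
 note db = db[folded g_def]
 note [simp] = db(2)
 have "ALL j:{..<k}. EX a b. a <: F & b <: F & (ALL x:carrier S. h (iota x j) = a **.F chi x \<oplus>.F b **.F beta x)"
 proof
  fix j assume "j : {..<k}"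
  hence "(%x. if x <: S then h (iota x j) else \<zero>.F) : m.functionals"
   using db by (simp add: hom_along_def)
  from span'[OF this] obtain a b where ab: "a <: F" "b <: F"
   "!!x. (if x <: S then h (iota x j) else \<zero>.F) = a **.F chi x \<oplus>.F b **.F beta x" by blast
  have "h (iota x j) = a **.F chi x \<oplus>.F b **.F beta x" if "x <: S" for x using ab(3)[of x] that by simp
  with ab(1,2) show "EX a b. a <: F & b <: F & (ALL x:carrier S. h (iota x j) = a **.F chi x \<oplus>.F b **.F beta x)" by blast
 qed
 then obtain a b where ab: "!!j. j < k ==> a j <: F" "!!j. j < k ==> b j <: F"
  and iota: "!!j x. j < k ==> x <: S ==> h (iota x j) = a j **.F chi x \<oplus>.F b j **.F beta x"
  by (metis lessThan_iff)
 \<comment> \<open>Expansion in the dual basis writes a character as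
   \<open>chi x A theta + beta x C theta\<close>. The values at \<open>1\<close> and
   \<open>s\<close> force \<open>A chi = 1\<close> and \<open>C beta = 1\<close>, and these are the
   coefficients of the characters in the trace.\<close>
 define A where "A theta = (\<Oplus>.F j:{..<k}. a j **.F theta (g j))" for theta
 define C where "C theta = (\<Oplus>.F j:{..<k}. b j **.F theta (g j))" for theta
 have AC[simp]: "A theta <: F" "C theta <: F" if "theta : {chi, beta}" for theta
  using that ab by (auto simp: A_def C_def intro!: m.F.finsum_closed)
 have split: "(\<Oplus>.F j:{..<k}. (a j **.F u \<oplus>.F b j **.F v) **.F theta (g j)) = u **.F A theta \<oplus>.F v **.F C theta"
  if "u <: F" "v <: F" "theta : {chi, beta}" for u v theta
 proof -
  have "(\<Oplus>.F j:{..<k}. (a j **.F u \<oplus>.F b j **.F v) **.F theta (g j)) =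
    (\<Oplus>.F j:{..<k}. u **.F (a j **.F theta (g j)) \<oplus>.F v **.F (b j **.F theta (g j)))"
   by (rule m.F.finsum_cong') (use that ab in "auto simp: m.F.l_distr m.F.r_distr m.F.m_ac")
  also have "... = u **.F A theta \<oplus>.F v **.F C theta" unfolding A_def C_def
   by (subst m.F.finsum_rdistr m.F.finsum_addf; use that ab in auto)+
  finally show ?thesis .
 qed
 have recover: "x <: S ==> theta x = chi x **.F A theta \<oplus>.F beta x **.F C theta" if theta: "theta : {chi, beta}" for theta x
 proof -
  assume x: "x <: S"
  have thetaf: "theta : m.functionals" using chars theta by blast
  have "theta x = theta (\<Oplus>.S j:{..<k}. iota x j \<odot>.S g j)" using db(1)[OF x] by simp
  also have "... = (\<Oplus>.F j:{..<k}. theta (iota x j \<odot>.S g j))"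
   by (rule m.functionals_finsum[OF thetaf]) (use x db in auto)
  also have "... = (\<Oplus>.F j:{..<k}. (a j **.F chi x \<oplus>.F b j **.F beta x) **.F theta (g j))"
   by (rule m.F.finsum_cong') (use x db ab fc[OF thetaf] in "auto simp: m.functionals_smult[OF thetaf] iota")
  finally show ?thesis using split[OF _ _ theta, of "chi x" "beta x"] by simp
 qed
 have r: "chi s **.F A chi \<oplus>.F beta s **.F C chi = chi s" "chi s **.F A beta \<oplus>.F beta s **.F C beta = beta s"
  by (rule recover[symmetric]; use s(1) in simp)+
 have r1: "A chi \<oplus>.F C chi = \<one>.F" "A beta \<oplus>.F C beta = \<one>.F"
  using recover[of chi "\<one>.S", symmetric] recover[of beta "\<one>.S", symmetric] beta1 by simp_all
 have AC1: "A chi = \<one>.F" by (rule m.F.affine_relations(1)[OF _ _ _ _ ne r1(1) r(1)]) auto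
 have "C beta = \<one>.F"
  by (rule m.F.affine_relations(1)[of _ "A beta" "beta s" "chi s"]) (use r r1 ne in "auto simp: m.F.a_comm")
 note AC1 = AC1 this
 have trace: "h (algebra_trace R S x) = chi x \<oplus>.F beta x" if x[simp]: "x <: S" for x
 proof -
  have "algebra_trace R S x = (\<Oplus>j:{..<k}. iota (x **.S g j) j)"
   unfolding algebra_trace_def g_def
   by (rule module_trace_eq[OF sf]) (auto simp: r_distr smult_mult_swap)
  hence "h (algebra_trace R S x) = (\<Oplus>.F j:{..<k}. h (iota (x **.S g j) j))"
   using m.h.hom_finsum[of "%j. iota (x **.S g j) j" "{..<k}"] db(3) by (simp add: comp_def Pi_iff)
  also have "... = (\<Oplus>.F j:{..<k}. chi x **.F (a j **.F chi (g j)) \<oplus>.F beta x **.F (b j **.F beta (g j)))"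
   by (rule m.F.finsum_cong') (use ab betam beta_eq db in "auto simp: iota m.F.m_ac")
  also have "... = chi x **.F A chi \<oplus>.F beta x **.F C beta" unfolding A_def C_def
   by (subst m.F.finsum_rdistr m.F.finsum_addf; use ab in auto)+
  finally show ?thesis using AC1 by simp
 qed
 show thesis by (rule that[OF chars s(1) ne]) (use span' trace in auto)
qed

end

section \<open>Linear spans and change of fields\<close>

context cring
begin

lemma finsum_product:
 assumes "finite I" "finite J" "!!i j. i : I ==> j : J ==> f (i, j) <: R"
 shows "(\<Oplus>s:I \<times> J. f s) = (\<Oplus>i:I. \<Oplus>j:J. f (i, j))"
 using assms(1,3)
proof (induction I rule: finite_induct)
 case (insert i I)
 have "(\<Oplus>s:insert i I \<times> J. f s) = (\<Oplus>s:Pair i ` J Un I \<times> J. f s)" by (rule arg_cong[of _ _ "finsum R f"]) auto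
 also have "... = (\<Oplus>s:Pair i ` J. f s) \<oplus> (\<Oplus>s:I \<times> J. f s)"
  by (rule finsum_Un_disjoint) (use insert assms(2) in auto)
 also have "(\<Oplus>s:Pair i ` J. f s) = (\<Oplus>j:J. f (i, j))"
  by (rule finsum_reindex) (use insert in "auto simp: inj_on_def")
 also have "... \<oplus> (\<Oplus>s:I \<times> J. f s) = (\<Oplus>i:insert i I. \<Oplus>j:J. f (i, j))"
  using insert assms(2) by (subst finsum_insert) (auto intro!: finsum_closed)
 finally show ?case .
qed simp

text \<open>Only values on \<open>W\<close> are compared, because the functions involved follow
  different conventions outside the carrier.\<close>

definition lin_span :: "'j set => ('j => 'x => 'a) => 'x set => ('x => 'a) => bool" where
 "lin_span J f W phi \<longleftrightarrow> (EX C. (ALL j. C j <: R) & (ALL x:W. phi x = (\<Oplus>j:J. C j ** f j x)))"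

lemma lin_span_base:
 assumes "finite J" "i : J" "ALL j:J. ALL x:W. f j x <: R"
 shows "lin_span J f W (f i)"
 unfolding lin_span_def
proof (intro exI conjI ballI allI)
 show "(if j = i then \<one> else \<zero>) <: R" for j by simp
 show "f i x = (\<Oplus>j:J. (if j = i then \<one> else \<zero>) ** f j x)" if "x : W" for x
  using finsum_delta_mult(1)[of J i "%j. f j x"] assms that by simp
qed

lemma lin_span_cong: "lin_span J f W phi ==> (ALL x:W. phi x = psi x) ==> lin_span J f W psi"
 unfolding lin_span_def by metis

lemma lin_span_sum:
 assumes J: "finite J" and K: "finite K" and f: "ALL j:J. ALL x:W. f j x <: R"
  and phi: "ALL k:K. c k <: R & lin_span J f W (phi k)"
 shows "lin_span J f W (%x. \<Oplus>k:K. c k ** phi k x)"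
proof -
 have "ALL k:K. EX C. (ALL j. C j <: R) & (ALL x:W. phi k x = (\<Oplus>j:J. C j ** f j x))"
  using phi unfolding lin_span_def by blast
 then obtain C where C: "!!k j. k : K ==> C k j <: R" "!!k x. k : K ==> x : W ==> phi k x = (\<Oplus>j:J. C k j ** f j x)"
  by metis
 show ?thesis
  unfolding lin_span_def
 proof (intro exI conjI ballI allI)
  show "(\<Oplus>k:K. c k ** C k j) <: R" for j using phi C by (auto intro!: finsum_closed)
  fix x assume x: "x : W"
  have "(\<Oplus>k:K. c k ** phi k x) = (\<Oplus>k:K. \<Oplus>j:J. c k ** C k j ** f j x)"
   by (rule finsum_cong') (use phi C f x J in "auto simp: finsum_rdistr m_assoc intro!: finsum_cong' finsum_closed")
  also have "... = (\<Oplus>j:J. \<Oplus>k:K. c k ** C k j ** f j x)"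
   by (rule finsum_swap) (use phi C f x J K in auto)
  also have "... = (\<Oplus>j:J. (\<Oplus>k:K. c k ** C k j) ** f j x)"
   by (rule finsum_cong') (use phi C f x K in "auto simp: finsum_ldistr intro!: finsum_closed")
  finally show "(\<Oplus>k:K. c k ** phi k x) = (\<Oplus>j:J. (\<Oplus>k:K. c k ** C k j) ** f j x)" .
 qed
qed

lemma lin_span_add:
 assumes J: "finite J" and f: "ALL j:J. ALL x:W. f j x <: R" and ab: "a <: R" "b <: R"
  and phi: "lin_span J f W phi" "lin_span J f W psi"
 shows "lin_span J f W (%x. a ** phi x \<oplus> b ** psi x)"
proof -
 have cl: "phi x <: R" if "x : W" "lin_span J f W phi" for phi x
  using that f unfolding lin_span_def by (auto intro!: finsum_closed)
 have "lin_span J f W (%x. \<Oplus>k:{True, False}. (if k then a else b) ** (if k then phi x else psi x))"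
  using lin_span_sum[of J "{True, False}" W f "%k. if k then a else b" "%k. if k then phi else psi"] assms
  by (simp add: if_distrib[of "%f. f _"] cong: if_cong)
 thus ?thesis
  by (rule lin_span_cong) (use cl[OF _ phi(1)] cl[OF _ phi(2)] ab in "auto simp: finsum_insert")
qed

end

context field
begin

lemma subfield_finsum:
 assumes A: "subfield A R" and f: "!!i. i : I ==> f i : A"
 shows "(\<Oplus>.(R\<lparr>carrier := A\<rparr>)i:I. f i) = (\<Oplus>i:I. f i)"
proof -
 interpret F0: field "R\<lparr>carrier := A\<rparr>" by (rule subfield_iff(2)[OF A])
 have AR: "A <= carrier R" by (rule subfieldE(3)[OF A])
 show ?thesis
 proof (cases "finite I")
  case True
  thus ?thesis using f
  proof (induction I rule: finite_induct)
   case (insert i I)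
   thus ?case using AR by (subst finsum_insert F0.finsum_insert; auto)+
  qed simp
 next
  case False
  thus ?thesis by (simp add: finsum_def finprod_def)
 qed
qed

text \<open>The coefficient vectors of independent functions over the small field span, so that a finite
  system of equations over the small field recovers every coefficient.\<close>

lemma independent_over_extension:
 assumes A: "subfield A R" and J: "finite J" and E: "finite E" and f: "!!j x. f j x : A"
  and indep: "ALL C. (ALL j. C j : A) --> (ALL x:E. (\<Oplus>j:J. C j ** f j x) = \<zero>) --> (ALL j:J. C j = \<zero>)"
  and C: "!!j. C j <: R" and zero: "!!x. x : E ==> (\<Oplus>j:J. C j ** f j x) = \<zero>" and "j : J"
 shows "C j = \<zero>"
proof -
 let ?F = "R\<lparr>carrier := A\<rparr>"
 interpret F0: field ?F by (rule subfield_iff(2)[OF A])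
 have AR: "a : A ==> a <: R" for a using subfieldE(3)[OF A] by blast
 note [simp] = AR[OF f] C
 note A_cl = subringE[OF subfieldE(1)[OF A]]
 \<comment> \<open>The span, over the small field, of the vectors with coordinates
   \<open>f j x\<close>, one for each point \<open>x\<close> of \<open>E\<close>.\<close>
 define U where "U = {%j. if j : J then \<Oplus>x:E. a x ** f j x else \<zero> | a. ALL x. a x : A}"
 have UA: "u j : A" if u: "u : U" for u j
 proof -
  obtain a where a: "ALL x. a x : A" "u = (%j. if j : J then \<Oplus>x:E. a x ** f j x else \<zero>)"
   using u unfolding U_def by blast
  have "(\<Oplus>x:E. a x ** f j x) : A" by (rule subring_finsum[OF subfieldE(1)[OF A]]) (use a f A_cl(6) in simp)
  thus ?thesis using a(2) A_cl(2) by simp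
 qed
 have UI: "u : U" if "u = (%j. if j : J then \<Oplus>x:E. a x ** f j x else \<zero>)" "ALL x. a x : A" for u a
  unfolding U_def using that by blast
 have subU: "F0.fun_subspace U"
  unfolding F0.fun_subspace_def
 proof (intro conjI ballI)
  show "U <= UNIV \<rightarrow> carrier ?F" using UA by auto
  have "(%j. \<zero>) = (%j. if j : J then \<Oplus>x:E. \<zero> ** f j x else \<zero>)" by (auto simp: finsum_all_zero)
  thus "(%x. \<zero>.?F) : U" using UI[of _ "%_. \<zero>"] A_cl(2) by simp
 next
  fix u v assume "u : U" "v : U"
  then obtain a b where a: "ALL x. a x : A" "ALL x. b x : A"
   and u: "u = (%j. if j : J then \<Oplus>x:E. a x ** f j x else \<zero>)" and v: "v = (%j. if j : J then \<Oplus>x:E. b x ** f j x else \<zero>)"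
   unfolding U_def by blast
  have "(\<Oplus>x:E. (a x \<oplus> b x) ** f j x) = (\<Oplus>x:E. a x ** f j x) \<oplus> (\<Oplus>x:E. b x ** f j x)" for j
  proof -
   have "(\<Oplus>x:E. (a x \<oplus> b x) ** f j x) = (\<Oplus>x:E. a x ** f j x \<oplus> b x ** f j x)"
    by (rule finsum_cong') (use a AR in "auto simp: l_distr")
   thus ?thesis using a AR by (simp add: finsum_addf Pi_iff)
  qed
  hence "(%j. u j \<oplus> v j) = (%j. if j : J then \<Oplus>x:E. (a x \<oplus> b x) ** f j x else \<zero>)" by (intro ext) (simp add: u v)
  moreover have "ALL x. a x \<oplus> b x : A" using a by (simp add: A_cl(7))
  ultimately show "(%x. u x \<oplus>.?F v x) : U" using UI[of "%j. u j \<oplus> v j" "%x. a x \<oplus> b x"] by simp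
 next
  fix c u assume "c <: ?F" "u : U"
  then obtain a where c: "c : A" and a: "ALL x. a x : A" and u: "u = (%j. if j : J then \<Oplus>x:E. a x ** f j x else \<zero>)"
   unfolding U_def by (simp add: Ball_def) blast
  have "(\<Oplus>x:E. c ** a x ** f j x) = c ** (\<Oplus>x:E. a x ** f j x)" for j
  proof -
   have "(\<Oplus>x:E. c ** a x ** f j x) = (\<Oplus>x:E. c ** (a x ** f j x))"
    by (rule finsum_cong') (use a c AR in "auto simp: m_assoc")
   thus ?thesis using a c AR E by (simp add: finsum_rdistr Pi_iff)
  qed
  hence "(%j. c ** u j) = (%j. if j : J then \<Oplus>x:E. c ** a x ** f j x else \<zero>)" using AR[OF c] by (intro ext) (simp add: u)
  moreover have "ALL x. c ** a x : A" using a c by (simp add: A_cl(6))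
  ultimately show "(%x. c **.?F u x) : U" using UI[of "%j. c ** u j" "%x. c ** a x"] by simp
 qed
 have det: "ALL u:U. (ALL y:J. u y = \<zero>.?F) --> u = (%_. \<zero>.?F)" by (auto simp: U_def)
 obtain I e where I: "I <= J" "!!i. i : I ==> e i : U"
  "!!i j. i : I ==> j : I ==> e i j = (if i = j then \<one>.?F else \<zero>.?F)"
  "!!u. u : U ==> u = (%x. \<Oplus>.?F i:I. u i **.?F e i x)"
  by (rule F0.dual_basis_of_evaluations[OF subU J det]) (rule that)
 have eA: "e i j : A" if "i : I" for i j using UA[OF I(2)[OF that]] .
 have fI: "finite I" using I(1) J finite_subset by blast
 have evU: "(%j. if j : J then f j x else \<zero>) : U" if x: "x : E" for x
 proof -
  have "(\<Oplus>y:E. (if y = x then \<one> else \<zero>) ** f j y) = f j x" for j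
   by (rule finsum_delta_mult(1)) (use E x in auto)
  thus ?thesis using A_cl by (intro UI[of _ "%y. if y = x then \<one> else \<zero>"]) auto
 qed
 have expand: "f j x = (\<Oplus>i:I. f i x ** e i j)" if "x : E" "j : J" for x j
 proof -
  have "f j x = (\<Oplus>.?F i:I. (if i : J then f i x else \<zero>) ** e i j)"
   using fun_cong[OF I(4)[OF evU[OF that(1)]], of j] that(2) by simp
  also have "... = (\<Oplus>.?F i:I. f i x ** e i j)" by (rule F0.finsum_cong') (use I(1) eA f A_cl in auto)
  also have "... = (\<Oplus>i:I. f i x ** e i j)" by (rule subfield_finsum[OF A]) (use eA f A_cl in auto)
  finally show ?thesis .
 qed
 \<comment> \<open>If a coordinate were determined on \<open>U\<close> by the others, this
   dependence would be a relation between the \<open>f j\<close> over the small field.\<close>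
 have "I = J"
 proof (rule ccontr)
  assume "I ~= J"
  then obtain j0 where j0: "j0 : J" "j0 ~: I" using I(1) by blast
  define c where "c j = (if j = j0 then \<one> else if j : I then \<ominus> e j j0 else \<zero>)" for j
  have cA: "c j : A" for j using eA A_cl by (simp add: c_def)
  have "(\<Oplus>j:J. c j ** f j x) = \<zero>" if x: "x : E" for x
  proof -
   have "(\<Oplus>j:J. c j ** f j x) = c j0 ** f j0 x \<oplus> (\<Oplus>j:J - {j0}. c j ** f j x)"
    by (rule finsum_remove) (use J j0 AR[OF cA] in auto)
   also have "(\<Oplus>j:J - {j0}. c j ** f j x) = (\<Oplus>j:I. c j ** f j x)"
    by (rule finsum_neutral_subset) (use I(1) J j0 AR[OF cA] in "auto simp: c_def")
   also have "... = (\<Oplus>j:I. \<ominus> (f j x ** e j j0))"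
    by (rule finsum_cong') (use j0 AR[OF eA] in "auto simp: c_def l_minus r_minus m_comm")
   also have "... = \<ominus> f j0 x"
    using AR[OF eA] by (subst finsum_ominus) (auto simp: expand[OF x j0(1)])
   finally show ?thesis by (simp add: c_def r_neg)
  qed
  hence "c j0 = \<zero>" using indep cA j0(1) by blast
  thus False by (simp add: c_def)
 qed
 hence jI: "j : I" using \<open>j : J\<close> by simp
 \<comment> \<open>The basis vector at \<open>j\<close> is a combination of evaluation vectors; the
   same combination of the given equations isolates \<open>C j\<close>.\<close>
 obtain a where a: "!!x. a x : A" "e j = (%j'. if j' : J then \<Oplus>x:E. a x ** f j' x else \<zero>)"
  using I(2)[OF jI] unfolding U_def by blast
 have eq: "(\<Oplus>x:E. a x ** f j' x) = (if j' = j then \<one> else \<zero>)" if "j' : J" for j'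
  using a(2) I(3)[OF jI, of j'] that \<open>I = J\<close> by auto
 have "C j = (\<Oplus>j':J. C j' ** (if j' = j then \<one> else \<zero>))"
  using finsum_delta_mult(3)[OF J \<open>j : J\<close>, of C] by simp
 also have "... = (\<Oplus>j':J. \<Oplus>x:E. a x ** (C j' ** f j' x))"
 proof (rule finsum_cong')
  show "C j' ** (if j' = j then \<one> else \<zero>) = (\<Oplus>x:E. a x ** (C j' ** f j' x))" if "j' : J" for j'
   unfolding eq[OF that, symmetric]
   by (subst finsum_rdistr) (use E AR[OF a(1)] in "auto intro!: finsum_cong' simp: m_lcomm")
 qed (use AR[OF a(1)] in auto)
 also have "... = (\<Oplus>x:E. \<Oplus>j':J. a x ** (C j' ** f j' x))"
  by (rule finsum_swap) (use E J AR[OF a(1)] in auto)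
 also have "... = \<zero>"
 proof (rule finsum_all_zero)
  fix x assume "x : E"
  thus "(\<Oplus>j':J. a x ** (C j' ** f j' x)) = \<zero>"
   using zero[of x] finsum_rdistr[OF J, of "a x" "%j'. C j' ** f j' x"] AR[OF a(1)] by simp
 qed
 finally show ?thesis .
qed

end

lemma (in assoc_algebra) env_action_eq_sandwich:
 assumes ps: "set ps <= carrier A \<times> carrier A" and x: "x <: A"
 shows "env_action A (tensor_class R A (opposite A) ps) x = sandwich A ps x"
proof -
 have [simp]: "carrier (opposite A) = carrier A" "add (opposite A) = add A" "smult (opposite A) = smult A"
  by (simp_all add: opposite_def)
 have "sandwich A qs x = sandwich A ps x" if "tensor_eq R A (opposite A) ps qs" for qs
  using tensor_eq_foldr[OF that, of "%a b. a **.A x **.A b"] x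
  unfolding sandwich_def by (simp add: l_distr r_distr smult_mult_left smult_mult_right)
 hence "(%ps. sandwich A ps x) ` tensor_class R A (opposite A) ps = (%_. sandwich A ps x) ` tensor_class R A (opposite A) ps"
  by (intro image_cong HOL.refl) (simp add: tensor_class_def)
 moreover have "ps : tensor_class R A (opposite A) ps"
  using ps tensor_eq.refl[of ps A "opposite A" R] by (simp add: tensor_class_def)
 ultimately show ?thesis unfolding env_action_def by (auto simp: image_constant_conv)
qed

lemma (in quadratic_etale_algebra) algebra_trace_closed:
 assumes "x <: S"
 shows "algebra_trace R S x <: R"
proof -
 obtain k iota \<pi> where sf: "summand_of_free R S k iota \<pi>" using fg_projective unfolding fg_projective_def by blast
 have "algebra_trace R S x = (\<Oplus>j:{..<k}. iota (x **.S \<pi> (unit_vector R k j)) j)"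
  unfolding algebra_trace_def
  by (rule module_trace_eq[OF sf]) (use assms in "auto simp: r_distr smult_mult_swap")
 thus ?thesis using summand_dual_basis[OF sf] assms by (auto intro!: R.finsum_closed)
qed

section \<open>Azumaya algebras with unitary involution over fields\<close>

lemma (in abelian_monoid) finsum_in_submonoid:
 assumes "finite J" "\<zero> : T" "!!a b. a : T ==> b : T ==> a \<oplus> b : T" "T <= carrier G" "!!j. j : J ==> f j : T"
 shows "(\<Oplus>j:J. f j) : T"
 using assms(1,5)
proof (induction J rule: finite_induct)
 case (insert j J)
 thus ?case using assms(2-4) by (subst finsum_insert) auto
qed (simp add: assms(2))

lemma regular_simps:
 "carrier (regular B) = carrier B" "monoid.mult (regular B) = monoid.mult B" "add (regular B) = add B"
 "\<zero>.(regular B) = \<zero>.B" "\<one>.(regular B) = \<one>.B" "smult (regular B) = monoid.mult B"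
 by (simp_all add: regular_def)

lemma finsum_regular: "finsum (regular B) f J = finsum B f J"
 by (simp add: finsum_def finprod_def regular_def)

context azumaya_unitary
begin

abbreviation (input) S where "S == B\<lparr>carrier := ring_center B\<rparr>"

lemma centerD: "s : ring_center B ==> s <: B" "s : ring_center B ==> x <: B ==> s **.B x = x **.B s"
 by (auto simp: ring_center_def)

lemma inv_one: "\<tau> \<one>.B = \<one>.B"
proof -
 have "\<tau> \<one>.B = \<tau> \<one>.B **.B \<tau> (\<tau> \<one>.B)" by (simp add: inv_inv inv_closed)
 also have "... = \<tau> (\<tau> \<one>.B **.B \<one>.B)" by (subst inv_mult) (auto simp: inv_closed)
 finally show ?thesis by (simp add: inv_inv inv_closed)
qed

lemma center_inv: "s : ring_center B ==> \<tau> s : ring_center B"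
proof -
 assume s: "s : ring_center B"
 have "\<tau> s **.B x = x **.B \<tau> s" if x: "x <: B" for x
 proof -
  have "\<tau> s **.B x = \<tau> (\<tau> x **.B s)" using x centerD(1)[OF s] by (simp add: inv_mult inv_inv inv_closed)
  also have "... = \<tau> (s **.B \<tau> x)" using centerD(2)[OF s] x by (simp add: inv_closed)
  also have "... = x **.B \<tau> s" using x centerD(1)[OF s] by (simp add: inv_mult inv_inv inv_closed)
  finally show ?thesis .
 qed
 thus ?thesis using centerD(1)[OF s] by (simp add: ring_center_def inv_closed)
qed

lemma quadratic_center: "quadratic_etale_algebra R S" and azumaya_center: "azumaya_algebra S (regular B)"
 by (rule quadratic_etale_center, rule azumaya_over_center)

lemma center_module: "module R S"
 using quadratic_center unfolding quadratic_etale_algebra_def algebra_def by blast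

lemma center_cring: "cring S"
 using quadratic_center unfolding quadratic_etale_algebra_def algebra_def by blast

lemma regular_module: "module S (regular B)"
 using azumaya_center unfolding azumaya_algebra_def assoc_algebra_def by blast

lemma center_closed:
 "s : ring_center B ==> t : ring_center B ==> s \<oplus>.B t : ring_center B"
 "s : ring_center B ==> t : ring_center B ==> s **.B t : ring_center B"
 "r <: R ==> s : ring_center B ==> r \<odot>.B s : ring_center B"
 "\<one>.B : ring_center B" "\<zero>.B : ring_center B"
proof -
 interpret S: module R S by (rule center_module)
 interpret Sc: cring S by (rule center_cring)
 show "s : ring_center B ==> t : ring_center B ==> s \<oplus>.B t : ring_center B" using S.M.a_closed[of s t] by simp
 show "s : ring_center B ==> t : ring_center B ==> s **.B t : ring_center B" using Sc.m_closed[of s t] by simp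
 show "r <: R ==> s : ring_center B ==> r \<odot>.B s : ring_center B" using S.smult_closed[of r s] by simp
 show "\<one>.B : ring_center B" "\<zero>.B : ring_center B" using Sc.one_closed S.M.zero_closed by simp_all
qed

text \<open>The standard involution is \<open>Tr s - s\<close>, and the trace is the sum of the two
  characters.\<close>

lemma character_inv:
 assumes F: "field F" and h: "h : ring_hom R F"
  and theta: "ALL theta:{chi, beta}. theta : hom_along R S F h & theta \<one>.B = \<one>.F"
  and trace: "ALL x:ring_center B. h (algebra_trace R S x) = chi x \<oplus>.F beta x"
  and s: "s : ring_center B"
 shows "chi (\<tau> s) = beta s"
proof -
 interpret F: field F by (rule F)
 have chi: "chi : hom_along R S F h" "chi \<one>.B = \<one>.F" and beta: "beta : hom_along R S F h" using theta by auto
 have tr: "algebra_trace R S s <: R"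
  by (rule quadratic_etale_algebra.algebra_trace_closed[OF quadratic_center]) (use s in simp)
 have \<tau>s: "\<tau> s : ring_center B" by (rule center_inv[OF s])
 have "\<tau> s \<oplus>.B s = algebra_trace R S s \<odot>.B \<one>.B"
  using standard_on_center[OF s] tr centerD(1)[OF s] by (simp add: M.minus_eq M.a_assoc M.l_neg)
 hence "chi (\<tau> s) \<oplus>.F chi s = h (algebra_trace R S s) **.F \<one>.F"
  using chi s \<tau>s tr center_closed(4) unfolding hom_along_def by simp metis
 moreover have "chi s <: F" "beta s <: F" "chi (\<tau> s) <: F"
  using chi beta s \<tau>s unfolding hom_along_def by auto
 ultimately show ?thesis using trace s by (simp add: F.a_comm[of "chi s"])
qed

text \<open>Every center-linear endomorphism of \<open>B\<close> comes from the enveloping algebra,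
  so each central-valued coordinate is a sum of maps \<open>x \<mapsto> a x b\<close>. In a matrix
  representation such maps only mix the entries of \<open>x\<close>.\<close>

lemma azumaya_coordinates:
 obtains k :: nat and g c where "ALL i<k. g i <: B" "ALL i<k. ALL x:carrier B. c i x : ring_center B"
  "ALL x:carrier B. x = (\<Oplus>.B i:{..<k}. c i x **.B g i)"
  "ALL i<k. ALL x:carrier B. ALL y:carrier B. c i (x \<oplus>.B y) = c i x \<oplus>.B c i y"
  "ALL i<k. ALL s:ring_center B. ALL x:carrier B. c i (s **.B x) = s **.B c i x"
  "ALL i<k. EX ps. set ps <= carrier B \<times> carrier B & (ALL x:carrier B. c i x = sandwich B ps x)"
proof -
 interpret rm: module S "regular B" by (rule regular_module)
 have aa: "assoc_algebra S (regular B)" using azumaya_center by (simp add: azumaya_algebra_def)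
 obtain k iota \<pi> where sf: "summand_of_free S (regular B) k iota \<pi>"
  using azumaya_algebra.fg_projective[OF azumaya_center] unfolding fg_projective_def by blast
 note db = rm.summand_dual_basis[OF sf, simplified regular_simps finsum_regular]
 have surj: "(%T. \<lambda>x\<in>carrier B. env_action (regular B) T x) ` carrier (enveloping S (regular B)) = carrier (endo_ring S (regular B))"
  using azumaya_algebra.canonical_iso[OF azumaya_center] by (simp add: ring_iso_def bij_betw_def regular_simps)
 have ps: "EX ps. set ps <= carrier B \<times> carrier B & (ALL x:carrier B. iota x i = sandwich B ps x)" if i: "i < k" for i
 proof -
  \<comment> \<open>Coordinates are central elements, hence elements of \<open>B\<close>, so a
    coordinate functional is an endomorphism of \<open>B\<close>.\<close>
  have "(\<lambda>x\<in>carrier B. iota x i) : carrier (endo_ring S (regular B))"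
   using i db centerD(1) by (simp add: endo_ring_def linear_maps_def regular_simps)
  then obtain T where T: "T : carrier (enveloping S (regular B))"
   "(\<lambda>x\<in>carrier B. env_action (regular B) T x) = (\<lambda>x\<in>carrier B. iota x i)"
   unfolding surj[symmetric] by (elim imageE) (rule that, assumption, rule HOL.sym)
  obtain ps where ps: "T = tensor_class S (regular B) (opposite (regular B)) ps" "set ps <= carrier (regular B) \<times> carrier (regular B)"
   using T(1) by (auto simp: enveloping_def tensor_algebra_def opposite_def)
  have "iota x i = sandwich B ps x" if x: "x <: B" for x
  proof -
   have "iota x i = env_action (regular B) T x" using fun_cong[OF T(2), of x] x by simp
   also have "... = sandwich (regular B) ps x"
    unfolding ps(1) by (rule assoc_algebra.env_action_eq_sandwich[OF aa ps(2)]) (simp add: regular_simps x)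
   finally show ?thesis by (simp add: sandwich_def regular_simps)
  qed
  thus ?thesis using ps(2) by (auto simp: regular_simps)
 qed
 show thesis
 proof (rule that[of k "%i. \<pi> (unit_vector S k i)" "%i x. iota x i"]; intro allI impI ballI)
  show "x = (\<Oplus>.B i:{..<k}. iota x i **.B \<pi> (unit_vector S k i))" if "x <: B" for x using db(1)[OF that] .
 qed (use db ps in auto)
qed

lemma center_coordinates:
 obtains k :: nat and g c where "ALL i<k. g i : ring_center B" "ALL i<k. ALL s:ring_center B. c i s <: R"
  "ALL s:ring_center B. s = (\<Oplus>.S i:{..<k}. c i s \<odot>.B g i)"
  "ALL i<k. ALL s:ring_center B. ALL t:ring_center B. c i (s \<oplus>.B t) = c i s \<oplus> c i t"
  "ALL i<k. ALL r:carrier R. ALL s:ring_center B. c i (r \<odot>.B s) = r ** c i s"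
proof -
 interpret sm: module R S by (rule center_module)
 obtain k iota \<pi> where sf: "summand_of_free R S k iota \<pi>"
  using quadratic_etale_algebra.fg_projective[OF quadratic_center] unfolding fg_projective_def by blast
 note db = sm.summand_dual_basis[OF sf]
 show thesis
 proof (rule that[of k "%i. \<pi> (unit_vector R k i)" "%i x. iota x i"]; intro allI impI ballI)
  show "x = (\<Oplus>.S i:{..<k}. iota x i \<odot>.B \<pi> (unit_vector R k i))" if "x : ring_center B" for x using db(1)[of x] that by simp
 qed (use db in auto)
qed

text \<open>Generators of \<open>B\<close> over its center are multiplied with generators of the
  center over \<open>R\<close>.\<close>

lemma finite_spanning_set:
 obtains E where "finite E" "E <= carrier B" "ALL x:carrier B. EX c. (ALL e. c e <: R) & x = (\<Oplus>.B e:E. c e \<odot>.B e)"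
proof -
 interpret Sc: cring S by (rule center_cring)
 obtain k :: nat and g c where g: "ALL i<k. g i <: B" "ALL i<k. ALL x:carrier B. c i x : ring_center B"
  "ALL x:carrier B. x = (\<Oplus>.B i:{..<k}. c i x **.B g i)" by (rule azumaya_coordinates)
 obtain k' :: nat and g' c' where g': "ALL i<k'. g' i : ring_center B" "ALL i<k'. ALL s:ring_center B. c' i s <: R"
  "ALL s:ring_center B. s = (\<Oplus>.S i:{..<k'}. c' i s \<odot>.B g' i)" by (rule center_coordinates)
 define E where "E = (%(i, j). g' j **.B g i) ` ({..<k} \<times> {..<k'})"
 have E: "finite E" "E <= carrier B" using g(1) g'(1) centerD(1) by (auto simp: E_def)
 define T where "T = {\<Oplus>.B e:E. a e \<odot>.B e | a. ALL e. a e <: R}"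
 have TI: "(\<Oplus>.B e:E. a e \<odot>.B e) : T" if "ALL e. a e <: R" for a using that unfolding T_def by blast
 have TE: "EX a. (ALL e. a e <: R) & x = (\<Oplus>.B e:E. a e \<odot>.B e)" if "x : T" for x using that unfolding T_def by blast
 have ec: "e : E ==> e <: B" for e using E by blast
 have T0: "\<zero>.B : T"
 proof -
  have "(\<Oplus>.B e:E. \<zero> \<odot>.B e) = (\<Oplus>.B e:E. \<zero>.B)" by (rule M.finsum_cong') (use ec in auto)
  thus ?thesis using TI[of "%_. \<zero>"] by simp
 qed
 have T_add: "x \<oplus>.B y : T" if xy: "x : T" "y : T" for x y
 proof -
  obtain a b where ab: "ALL e. a e <: R" "x = (\<Oplus>.B e:E. a e \<odot>.B e)" "ALL e. b e <: R" "y = (\<Oplus>.B e:E. b e \<odot>.B e)"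
   using TE[OF xy(1)] TE[OF xy(2)] by blast
  have "(\<Oplus>.B e:E. (a e \<oplus> b e) \<odot>.B e) = (\<Oplus>.B e:E. a e \<odot>.B e \<oplus>.B b e \<odot>.B e)"
   by (rule M.finsum_cong') (use ec ab in "auto simp: smult_l_distr")
  also have "... = x \<oplus>.B y" unfolding ab(2,4) by (rule M.finsum_addf) (use ec ab in auto)
  finally show ?thesis using TI[of "%e. a e \<oplus> b e"] ab by simp
 qed
 have T_smult: "r \<odot>.B e : T" if re: "r <: R" "e : E" for r e
 proof -
  have "(\<Oplus>.B e':E. (if e' = e then r else \<zero>) \<odot>.B e') = (\<Oplus>.B e':E. if e = e' then r \<odot>.B e' else \<zero>.B)"
   by (rule M.finsum_cong') (use ec re in auto)
  also have "... = r \<odot>.B e" by (rule M.add.finprod_singleton) (use ec re E in auto)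
  finally show ?thesis using TI[of "%e'. if e' = e then r else \<zero>"] re by simp
 qed
 have Tc: "T <= carrier B" unfolding T_def using ec by (auto intro!: M.finsum_closed)
 have sg: "s **.B g i : T" if s: "s : ring_center B" and i: "i < k" for s i
 proof -
  have "(\<Oplus>.S j:{..<k'}. c' j s \<odot>.B g' j) : {s : ring_center B. s **.B g i : T}"
  proof (rule Sc.finsum_in_submonoid)
   fix j assume j: "j : {..<k'}"
   have "(c' j s \<odot>.B g' j) **.B g i = c' j s \<odot>.B (g' j **.B g i)"
    using j s i g(1) g'(1,2) centerD(1) by (simp add: smult_mult_left)
   moreover have "g' j **.B g i : E" using i j by (auto simp: E_def)
   ultimately show "c' j s \<odot>.B g' j : {s : ring_center B. s **.B g i : T}"
    using T_smult j s g'(1,2) center_closed(3) by auto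
  qed (use T0 T_add g(1) i center_closed centerD(1) in "auto simp: l_distr")
  thus ?thesis using g'(3) s by auto
 qed
 have "x : T" if x: "x <: B" for x
 proof -
  have "(\<Oplus>.B i:{..<k}. c i x **.B g i) : T"
   by (rule M.finsum_in_submonoid) (use T0 T_add Tc sg g(2) x in auto)
  thus ?thesis using g(3) x by auto
 qed
 thus thesis using that[OF E] TE by blast
qed

end

section \<open>Matrix representations exchanged by the involution\<close>

context azumaya_unitary
begin

text \<open>Multiplicativity makes each entry of \<open>a x b\<close> a combination of entries of
  \<open>x\<close>, with coefficients taken from the matrices of \<open>a\<close> and
  \<open>b\<close>.\<close>

lemma sandwich_lin_span:
 assumes F: "field F" and I: "finite I" and q: "q : I"
  and f: "ALL p:I. ALL q:I. ALL x:carrier B. f p q x <: F"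
  and zero: "ALL p:I. ALL q:I. f p q \<zero>.B = \<zero>.F"
  and add: "ALL p:I. ALL q:I. ALL x:carrier B. ALL y:carrier B. f p q (x \<oplus>.B y) = f p q x \<oplus>.F f p q y"
  and mult: "ALL p:I. ALL q:I. ALL x:carrier B. ALL y:carrier B. f p q (x **.B y) = (\<Oplus>.F j:I. f p j x **.F f j q y)"
  and ps: "set ps <= carrier B \<times> carrier B"
 shows "cring.lin_span F (I \<times> I) (%s. f (fst s) (snd s)) (carrier B) (%x. f q q (sandwich B ps x))"
 using ps
proof (induction ps)
 interpret F: field F by (rule F)
 let ?sp = "F.lin_span (I \<times> I) (%s. f (fst s) (snd s)) (carrier B)"
 have fc: "ALL s:I \<times> I. ALL x:carrier B. f (fst s) (snd s) x <: F" using f by auto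
 have fin: "finite (I \<times> I)" using I by simp
 {
  case Nil
  have "?sp (%x. \<Oplus>.F k:{}. undefined k **.F undefined k x)" by (rule F.lin_span_sum[OF fin _ fc]) auto
  thus ?case by (rule F.lin_span_cong) (use zero q in "auto simp: sandwich_def")
 next
  case (Cons ab ps)
  obtain a b where ab: "ab = (a, b)" "a <: B" "b <: B" using Cons.prems by (cases ab) auto
  have base: "?sp (f p p')" if "p : I" "p' : I" for p p'
   using F.lin_span_base[OF fin _ fc, of "(p, p')"] that by simp
  have "?sp (%x. \<Oplus>.F p':I. f p' q b **.F (\<Oplus>.F p:I. f q p a **.F f p p' x))"
   by (intro F.lin_span_sum[OF fin I fc] ballI conjI) (use f ab q base in auto)
  hence 1: "?sp (%x. f q q (a **.B x **.B b))"
  proof (rule F.lin_span_cong, intro ballI)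
   fix x assume x: "x <: B"
   have cl: "(\<Oplus>.F p:I. f q p a **.F f p p' x) <: F" if "p' : I" for p'
    by (rule F.finsum_closed) (use f q ab x that in auto)
   have "f q q (a **.B x **.B b) = (\<Oplus>.F p':I. f q p' (a **.B x) **.F f p' q b)"
    using mult q ab x by simp
   also have "... = (\<Oplus>.F p':I. f p' q b **.F (\<Oplus>.F p:I. f q p a **.F f p p' x))"
    by (rule F.finsum_cong') (use mult q ab x f cl in "auto simp: F.m_comm")
   finally show "(\<Oplus>.F p':I. f p' q b **.F (\<Oplus>.F p:I. f q p a **.F f p p' x)) = f q q (a **.B x **.B b)" ..
  qed
  have sc: "sandwich B ps x <: B" if "x <: B" for x
   using Cons.prems that by (induction ps) (auto simp: sandwich_def)
  have "?sp (%x. \<one>.F **.F f q q (a **.B x **.B b) \<oplus>.F \<one>.F **.F f q q (sandwich B ps x))"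
   by (rule F.lin_span_add[OF fin fc _ _ 1 Cons.IH]) (use Cons.prems in auto)
  thus ?case
  proof (rule F.lin_span_cong, intro ballI)
   fix x assume x: "x <: B"
   have "sandwich B (ab # ps) x = (a **.B x **.B b) \<oplus>.B sandwich B ps x" by (simp add: sandwich_def ab)
   thus "\<one>.F **.F f q q (a **.B x **.B b) \<oplus>.F \<one>.F **.F f q q (sandwich B ps x) = f q q (sandwich B (ab # ps) x)"
    using x ab q sc[OF x] add f by simp
  qed
 }
qed

text \<open>Along a character \<open>chi\<close> of the center the functionals on \<open>B\<close>
  form a space of dimension \<open>n^2\<close>; a minimal translation-stable part of it gives
  \<open>rho0\<close>, and the coordinates by sandwiches show that the entries of
  \<open>rho0\<close> span the whole space, whence \<open>n <= card I\<close>. On the transpose of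
  \<open>rho0 (\<tau> x)\<close> the center acts by the other character, so both representations
  together span all functionals along \<open>h\<close>, and a central element separating the
  characters makes them independent. Two fields are kept apart: entries lie in \<open>A\<close>,
  whereas spanning and independence have coefficients in \<open>F\<close>.\<close>

theorem representation:
 assumes F: "field F" and A: "subfield A F" and roots: "ring.has_roots (F\<lparr>carrier := A\<rparr>)"
  and h: "h : ring_hom R F" and hA: "h ` carrier R <= A" and deg: "has_degree B n" "n > 0"
 obtains I :: "'c set" and rho where "finite I" "I ~= {}" "n <= card I" "ALL l x p q. rho l x p q : A"
  "ALL l. ALL p:I. ALL q:I. (%x. if x <: B then rho l x p q else \<zero>.F) : hom_along R B F h"
  "ALL l. ALL p:I. ALL q:I. ALL x:carrier B. ALL y:carrier B. rho l (x **.B y) p q = (\<Oplus>.F j:I. rho l x p j **.F rho l y j q)"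
  "ALL l. ALL p:I. ALL q:I. rho l \<one>.B p q = (if p = q then \<one>.F else \<zero>.F)"
  "ALL l p q. ALL x:carrier B. rho (~ l) x p q = rho l (\<tau> x) q p"
  "ALL Phi:hom_along R B F h. cring.lin_span F ((UNIV \<times> I) \<times> I) (%s x. rho (fst (fst s)) x (snd (fst s)) (snd s)) (carrier B) Phi"
  "ALL C. (ALL s. C s <: F) -->
   (ALL x:carrier B. (\<Oplus>.F s:(UNIV \<times> I) \<times> I. C s **.F rho (fst (fst s)) x (snd (fst s)) (snd s)) = \<zero>.F) -->
   (ALL s:(UNIV \<times> I) \<times> I. C s = \<zero>.F)"
proof -
 let ?F0 = "F\<lparr>carrier := A\<rparr>"
 interpret F: field F by (rule F)
 interpret F0: field ?F0 by (rule F.subfield_iff(2)[OF A])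
 have AF: "a : A ==> a <: F" for a using subfieldE(3)[OF A] by blast
 note A_cl = subringE[OF subfieldE(1)[OF A]]
 have h0: "h : ring_hom R ?F0" using h hA by (auto simp: ring_hom_def)
 obtain chi beta s0 where chars: "ALL theta:{chi, beta}. theta : hom_along R S ?F0 h & theta \<one>.S = \<one>.?F0 &
   (ALL x:carrier S. ALL y:carrier S. theta (x **.S y) = theta x **.?F0 theta y)"
  and s0: "s0 <: S" "chi s0 ~= beta s0"
  and span: "ALL phi:hom_along R S ?F0 h. EX a:carrier ?F0. EX b:carrier ?F0. ALL x. phi x = a **.?F0 chi x \<oplus>.?F0 b **.?F0 beta x"
  and trace: "ALL x:carrier S. h (algebra_trace R S x) = chi x \<oplus>.?F0 beta x"
  by (rule quadratic_etale_algebra.characters[OF quadratic_center F0.field_axioms roots h0]) (rule that)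
 have theta_hom: "theta : hom_along R S ?F0 h" if "theta : {chi, beta}" for theta using chars that by blast
 have thetaA: "theta x : A" if "theta : {chi, beta}" for theta x
  using theta_hom[OF that] A_cl(2) by (cases "x : ring_center B") (auto simp: hom_along_def)
 have chiA[simp]: "chi x : A" and betaA[simp]: "beta x : A" for x using thetaA by auto
 have chi_ring: "chi : ring_hom S F" "chi : ring_hom S ?F0"
  using chars AF by (auto simp: ring_hom_def hom_along_def)
 have chi_smult: "chi (r \<odot>.B s) = h r **.F chi s" if "r <: R" "s : ring_center B" for r s
  using theta_hom[of chi] that by (simp add: hom_along_def)
 have chi_one: "chi \<one>.B = \<one>.F" and chi_mult: "!!s t. s : ring_center B ==> t : ring_center B ==> chi (s **.B t) = chi s **.F chi t"
  and chi_add: "!!s t. s : ring_center B ==> t : ring_center B ==> chi (s \<oplus>.B t) = chi s \<oplus>.F chi t"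
  using chars by (auto simp: hom_along_def)
 have chi\<tau>: "chi (\<tau> s) = beta s" if "s : ring_center B" for s
  by (rule character_inv[OF F0.field_axioms h0 _ _ that]) (use chars trace in simp_all)
 interpret v0: module_to_field S "regular B" ?F0 chi
  by (intro module_to_field.intro regular_module F0.field_axioms module_to_field_axioms.intro chi_ring)
 interpret v: module_to_field S "regular B" F chi
  by (intro module_to_field.intro regular_module F module_to_field_axioms.intro chi_ring)
 have rank: "has_rank S (regular B) (n\<^sup>2)" using deg(1) by (simp add: has_degree_def)
 have V0D: "u x : A" "x <: B ==> y <: B ==> u (x \<oplus>.B y) = u x \<oplus>.F u y"
   "s : ring_center B ==> x <: B ==> u (s **.B x) = chi s **.F u x" "x ~: carrier B ==> u x = \<zero>.F" if "u : v0.functionals" for u x y s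
  using that v0.functionals_closed[OF that] by (auto simp: hom_along_def regular_simps)
 \<comment> \<open>The construction is carried out over \<open>A\<close>, which keeps the entries
   there.\<close>
 obtain I rho0 where I: "finite I" "I ~= {}" "I <= carrier B" and rhoA: "!!a p q. rho0 a p q : A"
  and rho_mult0: "!!a b p q. a <: B ==> b <: B ==> p : I ==> q : I ==> rho0 (a **.B b) p q = (\<Oplus>.?F0 j:I. rho0 a p j **.F rho0 b j q)"
  and rho_one: "!!p q. p : I ==> q : I ==> rho0 \<one>.B p q = (if p = q then \<one>.F else \<zero>.F)"
  and rho_col: "!!q. q : I ==> EX u:v0.functionals. ALL p:I. ALL a:carrier B. rho0 a p q = u (p **.B a)"
  and rho_ind0: "!!C p q. (!!p q. C p q : A) ==> (!!a. a <: B ==> (\<Oplus>.?F0 p:I. \<Oplus>.?F0 q:I. C p q **.F rho0 a p q) = \<zero>.F) ==>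
   p : I ==> q : I ==> C p q = \<zero>.F"
 proof -
  obtain ys :: "nat => 'c" and xi where ys: "ALL i<n\<^sup>2. ys i : carrier (regular B)" and xi: "ALL i<n\<^sup>2. xi i : v0.functionals"
   and dual: "ALL i<n\<^sup>2. ALL j<n\<^sup>2. xi i (ys j) = (if i = j then \<one>.?F0 else \<zero>.?F0)"
   and det: "ALL phi:v0.functionals. (ALL i<n\<^sup>2. phi (ys i) = \<zero>.?F0) --> phi = (%_. \<zero>.?F0)"
   by (rule v0.functionals_dual_basis[OF rank]) (rule that)
  have n2: "0 < n\<^sup>2" using deg(2) by simp
  have translate: "(%x. if x <: B then u (x **.B a) else \<zero>.?F0) : v0.functionals"
   if a: "a <: B" and u: "u : v0.functionals" for a u
   unfolding hom_along_def using a V0D[OF u] A_cl(2) centerD(1) by (simp add: regular_simps l_distr m_assoc)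
  have det': "ALL u:v0.functionals. (ALL y:ys ` {..<n\<^sup>2}. u y = \<zero>.?F0) --> u = (%_. \<zero>.?F0)" using det by blast
  have nz: "EX u:v0.functionals. u ~= (%_. \<zero>.?F0)"
  proof (rule bexI)
   have "xi 0 (ys 0) = \<one>.F" using dual n2 by simp
   thus "xi 0 ~= (%_. \<zero>.?F0)" using F.one_not_zero by auto
  qed (use xi n2 in blast)
  have fin: "finite (ys ` {..<n\<^sup>2})" "ys ` {..<n\<^sup>2} <= carrier B" using ys by (auto simp: regular_simps)
  show thesis
  proof (rule F0.burnside[where W = "carrier B" and mul = "monoid.mult B" and e = "\<one>.B", OF roots m_closed one_closed
    m_assoc r_one v0.functionals_subspace translate fin det' nz])
   fix I rho assume *: "finite I" "I ~= {}" "I <= carrier B" "!!a p q. rho a p q <: ?F0"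
    "!!a b p q. a <: B ==> b <: B ==> p : I ==> q : I ==> rho (a **.B b) p q = (\<Oplus>.?F0 j:I. rho a p j **.?F0 rho b j q)"
    "!!p q. p : I ==> q : I ==> rho \<one>.B p q = (if p = q then \<one>.?F0 else \<zero>.?F0)"
    "!!q. q : I ==> EX u:v0.functionals. ALL p:I. ALL a:carrier B. rho a p q = u (p **.B a)"
    "!!C p q. (!!p q. C p q <: ?F0) ==> (!!a. a <: B ==> (\<Oplus>.?F0 p:I. \<Oplus>.?F0 q:I. C p q **.?F0 rho a p q) = \<zero>.?F0) ==>
     p : I ==> q : I ==> C p q = \<zero>.?F0"
   show thesis by (rule that[of I rho]) (use * in simp_all)
  qed
 qed
 note [simp] = AF[OF rhoA] AF[OF chiA] AF[OF betaA]
 have rho_mult: "rho0 (a **.B b) p q = (\<Oplus>.F j:I. rho0 a p j **.F rho0 b j q)"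
  if "a <: B" "b <: B" "p : I" "q : I" for a b p q
  unfolding rho_mult0[OF that] by (rule F.subfield_finsum[OF A]) (use rhoA A_cl(6) in simp)
 have rho_add: "rho0 (x \<oplus>.B y) p q = rho0 x p q \<oplus>.F rho0 y p q"
  and rho_semi: "s : ring_center B ==> rho0 (s **.B x) p q = chi s **.F rho0 x p q"
  if x: "x <: B" and y: "y <: B" and p: "p : I" and q: "q : I" for x y p q s
 proof -
  obtain u where u: "u : v0.functionals" "ALL p:I. ALL a:carrier B. rho0 a p q = u (p **.B a)" using rho_col[OF q] by blast
  have pB: "p <: B" using p I by blast
  show "rho0 (x \<oplus>.B y) p q = rho0 x p q \<oplus>.F rho0 y p q"
   using u(2) p x y pB V0D(2)[OF u(1)] by (simp add: r_distr)
  assume s: "s : ring_center B"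
  have "p **.B (s **.B x) = s **.B (p **.B x)"
   using pB x s centerD(1)[OF s] centerD(2)[OF s pB] by (simp add: m_assoc[symmetric])
  thus "rho0 (s **.B x) p q = chi s **.F rho0 x p q"
   using u(2) p x pB s V0D(3)[OF u(1)] centerD(1)[OF s] by simp
 qed
 have rho_zero: "rho0 \<zero>.B p q = \<zero>.F" if "p : I" "q : I" for p q
  using rho_add[OF M.zero_closed M.zero_closed that] F.add.l_cancel_one'[of "rho0 \<zero>.B p q" "rho0 \<zero>.B p q"] by simp
 have rho_smult: "rho0 (r \<odot>.B x) p q = h r **.F rho0 x p q" if r: "r <: R" and x: "x <: B" and pq: "p : I" "q : I" for r x p q
 proof -
  have "r \<odot>.B x = (r \<odot>.B \<one>.B) **.B x" using r x by (simp add: smult_mult_left)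
  thus ?thesis
   using rho_semi[OF x x pq center_closed(3)[OF r center_closed(4)]] chi_smult[OF r center_closed(4)] chi_one h r
   by (simp add: ring_hom_closed[OF h r])
 qed
 obtain k :: nat and g c where g: "ALL i<k. g i <: B" and c: "ALL i<k. ALL x:carrier B. c i x : ring_center B"
  and gc: "ALL x:carrier B. x = (\<Oplus>.B i:{..<k}. c i x **.B g i)"
  and c_add: "ALL i<k. ALL x:carrier B. ALL y:carrier B. c i (x \<oplus>.B y) = c i x \<oplus>.B c i y"
  and c_semi: "ALL i<k. ALL s:ring_center B. ALL x:carrier B. c i (s **.B x) = s **.B c i x"
  and c_sw: "ALL i<k. EX ps. set ps <= carrier B \<times> carrier B & (ALL x:carrier B. c i x = sandwich B ps x)"
  by (rule azumaya_coordinates) (rule that)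
 let ?f = "%s x. rho0 x (fst s) (snd s)"
 let ?sp = "F.lin_span (I \<times> I) ?f (carrier B)"
 have fin: "finite (I \<times> I)" using I by simp
 have fc: "ALL s:I \<times> I. ALL x:carrier B. ?f s x <: F" by simp
 \<comment> \<open>A central element acts as the scalar given by \<open>chi\<close>, so a diagonal
   entry of \<open>rho0 (c i x)\<close> is \<open>chi (c i x)\<close>; since \<open>c i\<close> is a
   sandwich, this entry is a combination of the entries of \<open>rho0 x\<close>.\<close>
 have sp_c: "?sp (%x. chi (c i x))" if i: "i < k" for i
 proof -
  obtain q where q: "q : I" using I by blast
  obtain ps where ps: "set ps <= carrier B \<times> carrier B" "ALL x:carrier B. c i x = sandwich B ps x" using c_sw i by blast
  have "?sp (%x. rho0 (sandwich B ps x) q q)"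
   using sandwich_lin_span[OF F I(1) q, of "%p q x. rho0 x p q" ps] rho_zero rho_add rho_mult ps(1) by simp
  thus ?thesis
  proof (rule F.lin_span_cong, intro ballI)
   fix x assume x: "x <: B"
   have "c i x : ring_center B" using c i x by blast
   hence "rho0 (c i x) q q = chi (c i x)"
    using rho_semi[OF one_closed one_closed q q, of "c i x"] rho_one[OF q q] centerD(1) by simp
   thus "rho0 (sandwich B ps x) q q = chi (c i x)" using ps(2) x by simp
  qed
 qed
 have sp: "?sp psi" if psi: "psi : v.functionals" for psi
 proof -
  have "?sp (%x. \<Oplus>.F i:{..<k}. psi (g i) **.F chi (c i x))"
   by (rule F.lin_span_sum[OF fin _ fc]) (use v.functionals_closed[OF psi] sp_c in auto)
  thus ?thesis
  proof (rule F.lin_span_cong, intro ballI)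
   fix x assume x: "x <: B"
   have "psi x = psi (\<Oplus>.(regular B)i:{..<k}. c i x **.B g i)" using gc x by (simp add: finsum_regular)
   also have "... = (\<Oplus>.F i:{..<k}. psi (c i x **.B g i))"
    by (rule v.functionals_finsum[OF psi]) (use x c g centerD(1) in "auto simp: regular_simps")
   also have "... = (\<Oplus>.F i:{..<k}. psi (g i) **.F chi (c i x))"
    by (rule F.finsum_cong') (use v.functionals_smult[OF psi] v.functionals_closed[OF psi] c g x F.m_comm in "auto simp: regular_simps")
   finally show "(\<Oplus>.F i:{..<k}. psi (g i) **.F chi (c i x)) = psi x" ..
  qed
 qed
 \<comment> \<open>Otherwise \<open>n^2\<close> independent functionals would lie in the span of
   fewer matrix entries.\<close>
 have card: "n <= card I"
 proof (rule ccontr)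
  assume "~ n <= card I"
  hence "card I ^ 2 < n\<^sup>2" by (intro power_strict_mono) auto
  hence lt: "card (I \<times> I) < card {..<n\<^sup>2}" by (simp add: card_cartesian_product power2_eq_square)
  obtain ys :: "nat => 'c" and xi where ys: "ALL i<n\<^sup>2. ys i : carrier (regular B)" and xi: "ALL i<n\<^sup>2. xi i : v.functionals"
   and dual: "ALL i<n\<^sup>2. ALL j<n\<^sup>2. xi i (ys j) = (if i = j then \<one>.F else \<zero>.F)"
   by (rule v.functionals_dual_basis[OF rank]) (rule that)
  have "ALL i:{..<n\<^sup>2}. EX C. (ALL s. C s <: F) & (ALL x:carrier B. xi i x = (\<Oplus>.F s:I \<times> I. C s **.F ?f s x))"
   using sp xi unfolding F.lin_span_def by blast
  then obtain C where C: "!!i. i < n\<^sup>2 ==> (ALL s. C i s <: F) & (ALL x:carrier B. xi i x = (\<Oplus>.F s:I \<times> I. C i s **.F ?f s x))"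
   by (metis lessThan_iff)
  define D where "D s i = (if i < n\<^sup>2 then C i s else \<zero>.F)" for s i
  have Dc: "D s i <: F" for s i using C[of i] by (cases s) (auto simp: D_def)
  obtain d where d: "!!j. d j <: F" "EX j:{..<n\<^sup>2}. d j ~= \<zero>.F"
   "!!s. s : I \<times> I ==> (\<Oplus>.F j:{..<n\<^sup>2}. d j **.F D s j) = \<zero>.F"
   using F.nontrivial_solution[OF fin finite_lessThan lt, of D] Dc by blast
  have "d j = \<zero>.F" if j: "j < n\<^sup>2" for j
  proof -
   have yj: "ys j <: B" using ys j by (simp add: regular_simps)
   have "d j = (\<Oplus>.F i:{..<n\<^sup>2}. d i **.F (if i = j then \<one>.F else \<zero>.F))"
    using F.finsum_delta_mult(3)[of "{..<n\<^sup>2}" j d] d(1) j by simp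
   also have "... = (\<Oplus>.F i:{..<n\<^sup>2}. \<Oplus>.F s:I \<times> I. d i **.F D s i **.F ?f s (ys j))"
   proof (rule F.finsum_cong')
    fix i assume i: "i : {..<n\<^sup>2}"
    have "d i **.F (if i = j then \<one>.F else \<zero>.F) = d i **.F (\<Oplus>.F s:I \<times> I. C i s **.F ?f s (ys j))"
     using C[of i] dual i j yj by auto
    also have "... = (\<Oplus>.F s:I \<times> I. d i **.F (C i s **.F ?f s (ys j)))"
     by (rule F.finsum_rdistr) (use fin d(1) C[of i] i in auto)
    also have "... = (\<Oplus>.F s:I \<times> I. d i **.F D s i **.F ?f s (ys j))"
     by (rule F.finsum_cong') (use d(1) C[of i] i in "auto simp: D_def F.m_assoc")
    finally show "d i **.F (if i = j then \<one>.F else \<zero>.F) = (\<Oplus>.F s:I \<times> I. d i **.F D s i **.F ?f s (ys j))" .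
   qed (use d(1) Dc in auto)
   also have "... = (\<Oplus>.F s:I \<times> I. \<Oplus>.F i:{..<n\<^sup>2}. d i **.F D s i **.F ?f s (ys j))"
    by (rule F.finsum_swap) (use fin d(1) Dc in auto)
   also have "... = \<zero>.F"
   proof (rule F.finsum_all_zero)
    fix s assume s: "s : I \<times> I"
    have "(\<Oplus>.F i:{..<n\<^sup>2}. d i **.F D s i **.F ?f s (ys j)) = (\<Oplus>.F i:{..<n\<^sup>2}. d i **.F D s i) **.F ?f s (ys j)"
     by (rule F.finsum_ldistr[symmetric]) (use d(1) Dc in auto)
    thus "(\<Oplus>.F i:{..<n\<^sup>2}. d i **.F D s i **.F ?f s (ys j)) = \<zero>.F" using d(3)[OF s] by simp
   qed
   finally show ?thesis .
  qed
  thus False using d(2) by blast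
 qed
 \<comment> \<open>Transposition undoes the reversal of products by \<open>\<tau>\<close>, so the
   index \<open>True\<close> again gives a representation.\<close>
 define rho where "rho l x p q = (if l then rho0 (\<tau> x) q p else rho0 x p q)" for l x p q
 have rhoF[simp]: "rho l x p q <: F" for l x p q by (simp add: rho_def)
 let ?J = "((UNIV :: bool set) \<times> I) \<times> I"
 let ?g = "%s x. rho (fst (fst s)) x (snd (fst s)) (snd s)"
 let ?SP = "F.lin_span ?J ?g (carrier B)"
 have finJ: "finite ?J" using I by simp
 have gF: "ALL s:?J. ALL x:carrier B. ?g s x <: F" by simp
 have lift: "?SP psi" "?SP (%x. psi (\<tau> x))" if psi: "?sp psi" for psi
 proof -
  obtain C where C: "!!s. C s <: F" "!!x. x <: B ==> psi x = (\<Oplus>.F s:I \<times> I. C s **.F ?f s x)"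
   using psi unfolding F.lin_span_def by blast
  have base: "?SP (%x. rho l x p q)" if "p : I" "q : I" for l p q
   using F.lin_span_base[OF finJ _ gF, of "((l, p), q)"] that by simp
  have "?SP (%x. \<Oplus>.F s:I \<times> I. C s **.F rho False x (fst s) (snd s))"
   by (rule F.lin_span_sum[OF finJ fin gF]) (use C base in auto)
  thus "?SP psi" by (rule F.lin_span_cong) (simp add: C(2) rho_def)
  have "?SP (%x. \<Oplus>.F s:I \<times> I. C s **.F rho True x (snd s) (fst s))"
   by (rule F.lin_span_sum[OF finJ fin gF]) (use C base in auto)
  thus "?SP (%x. psi (\<tau> x))" by (rule F.lin_span_cong) (simp add: C(2) rho_def inv_closed)
 qed
 interpret m: module_to_field R B F h
  by (intro module_to_field.intro module_axioms F module_to_field_axioms.intro h)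
 have h_closed: "h r <: F" if "r <: R" for r using ring_hom_closed[OF h that] .
 have rho_hom: "(%x. if x <: B then rho l x p q else \<zero>.F) : m.functionals" if "p : I" "q : I" for l p q
  using that by (cases l) (auto simp: hom_along_def rho_def rho_add rho_smult inv_add inv_smult inv_closed)
 have spanning: "?SP Phi" if Phi: "Phi : m.functionals" for Phi
 proof -
  interpret ms: module_to_field R S F h
   by (intro module_to_field.intro center_module F module_to_field_axioms.intro h)
  obtain k' :: nat and g' c' where g': "ALL i<k'. g' i : ring_center B" and c': "ALL i<k'. ALL s:ring_center B. c' i s <: R"
   and gc': "ALL s:ring_center B. s = (\<Oplus>.S i:{..<k'}. c' i s \<odot>.B g' i)"
   and c'_add: "ALL i<k'. ALL s:ring_center B. ALL t:ring_center B. c' i (s \<oplus>.B t) = c' i s \<oplus> c' i t"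
   and c'_smult: "ALL i<k'. ALL r:carrier R. ALL s:ring_center B. c' i (r \<odot>.B s) = r ** c' i s"
   by (rule center_coordinates) (rule that)
  have "ALL j:{..<k'}. EX a b. a <: F & b <: F & (ALL s:ring_center B. h (c' j s) = a **.F chi s \<oplus>.F b **.F beta s)"
  proof
   fix j assume j: "j : {..<k'}"
   have "(%s. if s : ring_center B then h (c' j s) else \<zero>.?F0) : hom_along R S ?F0 h"
    using j c' c'_add c'_smult hA A_cl(2) center_closed by (auto simp: hom_along_def m.h.ring.hom_add)
   from bspec[OF span this] obtain a b where ab: "a <: ?F0" "b <: ?F0"
    "ALL s. (if s : ring_center B then h (c' j s) else \<zero>.?F0) = a **.?F0 chi s \<oplus>.?F0 b **.?F0 beta s" by blast
   have "h (c' j s) = a **.F chi s \<oplus>.F b **.F beta s" if "s : ring_center B" for s using spec[OF ab(3), of s] that by simp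
   moreover have "a <: F" "b <: F" using AF ab(1,2) by auto
   ultimately show "EX a b. a <: F & b <: F & (ALL s:ring_center B. h (c' j s) = a **.F chi s \<oplus>.F b **.F beta s)"
    by blast
  qed
  then obtain a b where ab: "!!j. j < k' ==> a j <: F" "!!j. j < k' ==> b j <: F"
   and hc: "!!j s. j < k' ==> s : ring_center B ==> h (c' j s) = a j **.F chi s \<oplus>.F b j **.F beta s"
   by (metis lessThan_iff)
  note Phic = m.functionals_closed[OF Phi]
  have inner: "Phi (s **.B g i) = (\<Oplus>.F j:{..<k'}. Phi (g' j **.B g i) **.F (a j **.F chi s \<oplus>.F b j **.F beta s))"
   if s: "s : ring_center B" and i: "i < k" for s i
  proof -
   define Psi where "Psi s = (if s : ring_center B then Phi (s **.B g i) else \<zero>.F)" for s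
   have gi: "g i <: B" using g i by blast
   have Psi: "Psi : ms.functionals"
    using gi Phic m.functionals_add[OF Phi] m.functionals_smult[OF Phi] center_closed centerD(1)
    by (auto simp: hom_along_def[of R S] Psi_def l_distr smult_mult_left)
   have "Psi s = Psi (\<Oplus>.S j:{..<k'}. c' j s \<odot>.B g' j)" using gc' s by simp
   also have "... = (\<Oplus>.F j:{..<k'}. Psi (c' j s \<odot>.B g' j))"
    by (rule ms.functionals_finsum[OF Psi]) (use c' g' s center_closed(3) in auto)
   also have "... = (\<Oplus>.F j:{..<k'}. Phi (g' j **.B g i) **.F (a j **.F chi s \<oplus>.F b j **.F beta s))"
   proof (rule F.finsum_cong')
    fix j assume "j : {..<k'}"
    hence j: "j < k'" by simp
    have "Psi (c' j s \<odot>.B g' j) = h (c' j s) **.F Psi (g' j)"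
     using ms.functionals_smult[OF Psi, of "c' j s" "g' j"] c' g' s j by simp
    moreover have "Psi (g' j) = Phi (g' j **.B g i)" using g' j by (simp add: Psi_def)
    ultimately show "Psi (c' j s \<odot>.B g' j) = Phi (g' j **.B g i) **.F (a j **.F chi s \<oplus>.F b j **.F beta s)"
     using ab[OF j] hc[OF j s] Phic by (simp add: F.m_comm)
   qed (use ab Phic in auto)
   finally show ?thesis using s by (simp add: Psi_def)
  qed
  \<comment> \<open>Conjugating \<open>c i\<close> by \<open>\<tau>\<close> gives a functional along
    \<open>chi\<close>, which the entries of \<open>rho0\<close> span; one more
    \<open>\<tau>\<close> turns it into \<open>beta (c i x)\<close>.\<close>
  have spbeta: "?SP (%x. beta (c i x))" if i: "i < k" for i
  proof -
   define theta where "theta x = (if x <: B then chi (\<tau> (c i (\<tau> x))) else \<zero>.F)" for x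
   have cc: "c i x : ring_center B" if "x <: B" for x using c i that by blast
   have "theta : v.functionals"
    unfolding hom_along_def
   proof (intro CollectI conjI ballI allI impI)
    show "theta x <: F" for x by (simp add: theta_def)
    show "x ~: carrier (regular B) ==> theta x = \<zero>.F" for x by (simp add: theta_def regular_simps)
    show "theta (x \<oplus>.(regular B) y) = theta x \<oplus>.F theta y" if "x : carrier (regular B)" "y : carrier (regular B)" for x y
     using that i cc c_add centerD(1) by (simp add: theta_def regular_simps inv_closed inv_add chi_add center_inv)
    show "theta (s \<odot>.(regular B) x) = chi s **.F theta x" if "s <: S" "x : carrier (regular B)" for s x
    proof -
     have s: "s : ring_center B" and x: "x <: B" using that by (simp_all add: regular_simps)
     have "\<tau> (s **.B x) = \<tau> s **.B \<tau> x"
      using s x centerD(1) centerD(2)[OF center_inv[OF s], of "\<tau> x"] by (simp add: inv_mult inv_closed)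
     hence "c i (\<tau> (s **.B x)) = \<tau> s **.B c i (\<tau> x)" using c_semi i center_inv[OF s] x by (simp add: inv_closed)
     moreover have "\<tau> (\<tau> s **.B c i (\<tau> x)) = s **.B \<tau> (c i (\<tau> x))"
      using s x cc[of "\<tau> x"] centerD center_inv by (simp add: inv_mult inv_closed inv_inv)
     ultimately show ?thesis
      using s x cc[of "\<tau> x"] centerD(1) center_inv by (simp add: theta_def regular_simps inv_closed chi_mult)
    qed
   qed
   hence "?SP (%x. theta (\<tau> x))" by (intro lift(2) sp)
   thus ?thesis by (rule F.lin_span_cong) (use cc chi\<tau> in "auto simp: theta_def inv_closed inv_inv")
  qed
  have in_sp: "?SP (%x. \<Oplus>.F j:{..<k'}. Phi (g' j **.B g i) **.F (a j **.F chi (c i x) \<oplus>.F b j **.F beta (c i x)))" if i: "i < k" for i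
   using lift(1)[OF sp_c[OF i]] spbeta[OF i]
   by (intro F.lin_span_sum[OF finJ finite_lessThan gF] ballI conjI F.lin_span_add[OF finJ gF] Phic) (use ab in auto)
  have "?SP (%x. \<Oplus>.F i:{..<k}. \<one>.F **.F (\<Oplus>.F j:{..<k'}. Phi (g' j **.B g i) **.F (a j **.F chi (c i x) \<oplus>.F b j **.F beta (c i x))))"
   by (rule F.lin_span_sum[OF finJ finite_lessThan gF]) (use in_sp in auto)
  thus ?thesis
  proof (rule F.lin_span_cong, intro ballI)
   fix x assume x: "x <: B"
   have "Phi x = Phi (\<Oplus>.B i:{..<k}. c i x **.B g i)" using gc x by simp
   also have "... = (\<Oplus>.F i:{..<k}. Phi (c i x **.B g i))"
    by (rule m.functionals_finsum[OF Phi]) (use c g x centerD(1) in auto)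
   also have "... = (\<Oplus>.F i:{..<k}. \<one>.F **.F (\<Oplus>.F j:{..<k'}. Phi (g' j **.B g i) **.F (a j **.F chi (c i x) \<oplus>.F b j **.F beta (c i x))))"
   proof (rule F.finsum_cong')
    fix i assume i: "i : {..<k}"
    have "(\<Oplus>.F j:{..<k'}. Phi (g' j **.B g i) **.F (a j **.F chi (c i x) \<oplus>.F b j **.F beta (c i x))) = Phi (c i x **.B g i)"
     using inner[of "c i x" i] i c x by simp
    thus "Phi (c i x **.B g i) = \<one>.F **.F (\<Oplus>.F j:{..<k'}. Phi (g' j **.B g i) **.F (a j **.F chi (c i x) \<oplus>.F b j **.F beta (c i x)))"
     using Phic by simp
   qed (use ab Phic in "auto intro!: F.finsum_closed")
   finally show "(\<Oplus>.F i:{..<k}. \<one>.F **.F (\<Oplus>.F j:{..<k'}. Phi (g' j **.B g i) **.F (a j **.F chi (c i x) \<oplus>.F b j **.F beta (c i x)))) = Phi x" ..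
  qed
 qed
 \<comment> \<open>Independence over \<open>A\<close> is known; it passes to \<open>F\<close>
   because it can be tested on the finite set \<open>E\<close>, where all values lie in
   \<open>A\<close>.\<close>
 have ind: "C s = \<zero>.F" if C: "!!s. C s <: F" and z: "!!x. x <: B ==> (\<Oplus>.F s:I \<times> I. C s **.F ?f s x) = \<zero>.F"
  and s: "s : I \<times> I" for C s
 proof -
  obtain E where E: "finite E" "E <= carrier B" "ALL x:carrier B. EX c. (ALL e. c e <: R) & x = (\<Oplus>.B e:E. c e \<odot>.B e)"
   by (rule finite_spanning_set) (rule that)
  have fA: "?f j x : A" for j x by (rule rhoA)
  have i0: "ALL C. (ALL j. C j : A) --> (ALL x:E. (\<Oplus>.F j:I \<times> I. C j **.F ?f j x) = \<zero>.F) --> (ALL j:I \<times> I. C j = \<zero>.F)"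
  proof (intro allI impI ballI)
   fix C j assume CA: "ALL j. C j : A" and zE: "ALL x:E. (\<Oplus>.F j:I \<times> I. C j **.F ?f j x) = \<zero>.F" and j: "j : I \<times> I"
   have CF: "C j <: F" for j using CA AF by blast
   define phi where "phi x = (\<Oplus>.F j:I \<times> I. C j **.F (if x <: B then ?f j x else \<zero>.F))" for x
   have f_hom: "(%x. if x <: B then ?f s x else \<zero>.F) : m.functionals" if "s : I \<times> I" for s
    using rho_hom[of "fst s" "snd s" False] that by (simp add: rho_def mem_Times_iff cong: if_cong)
   have "phi : m.functionals"
    unfolding phi_def by (rule F.fun_subspace_sum[OF m.functionals_subspace fin])
     (rule CF, rule f_hom)
   note phi = this
   have "phi x = \<zero>.F" if x: "x <: B" for x
   proof -
    obtain c where c: "ALL e. c e <: R" "x = (\<Oplus>.B e:E. c e \<odot>.B e)" using E(3) x by blast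
    show ?thesis unfolding c(2)
     by (rule m.functionals_vanish[OF phi E(1,2) c(1)]) (use zE E(2) in \<open>auto simp: phi_def subset_iff\<close>)
   qed
   hence z: "(\<Oplus>.F j:I \<times> I. C j **.F ?f j x) = \<zero>.F" if "x <: B" for x using that by (simp add: phi_def)
   have "(\<Oplus>.?F0 p:I. \<Oplus>.?F0 q:I. C (p, q) **.F rho0 x p q) = \<zero>.F" if x: "x <: B" for x
   proof -
    have tA: "C (p, q) **.F rho0 x p q : A" for p q using CA rhoA A_cl(6) by blast
    have "(\<Oplus>.?F0 p:I. \<Oplus>.?F0 q:I. C (p, q) **.F rho0 x p q) = (\<Oplus>.F p:I. \<Oplus>.F q:I. C (p, q) **.F rho0 x p q)"
     by (simp add: F.subfield_finsum[OF A] tA)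
      (rule F.subfield_finsum[OF A], rule F.subring_finsum[OF subfieldE(1)[OF A]], rule tA)
    also have "... = (\<Oplus>.F j:I \<times> I. C j **.F ?f j x)"
     by (subst F.finsum_product) (use I CF in auto)
    finally show ?thesis using z[OF x] by simp
   qed
   thus "C j = \<zero>.F" using rho_ind0[of "%p q. C (p, q)" "fst j" "snd j"] CA j by auto
  qed
  show ?thesis by (rule F.independent_over_extension[OF A fin E(1) fA i0 C _ s]) (use z E(2) in blast)
 qed
 have indep: "ALL s:?J. C s = \<zero>.F" if C: "ALL s. C s <: F" and z: "ALL x:carrier B. (\<Oplus>.F s:?J. C s **.F ?g s x) = \<zero>.F" for C
 proof -
  have Cc[simp]: "C s <: F" for s using C by (cases s) blast
  \<comment> \<open>A relation reads \<open>N x + T (\<tau> x) = 0\<close>. Replacing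
    \<open>x\<close> by \<open>s0 x\<close> multiplies the two terms by different scalars, so each
    term vanishes.\<close>
  define N where "N x = (\<Oplus>.F s:I \<times> I. C ((False, fst s), snd s) **.F ?f s x)" for x
  define T where "T x = (\<Oplus>.F s:I \<times> I. C ((True, snd s), fst s) **.F ?f s x)" for x
  have NT[simp]: "N x <: F" "T x <: F" for x by (auto simp: N_def T_def intro!: F.finsum_closed)
  have total: "N x \<oplus>.F T (\<tau> x) = \<zero>.F" if x: "x <: B" for x
  proof -
   have "(\<Oplus>.F s:?J. C s **.F ?g s x) = (\<Oplus>.F l:UNIV. \<Oplus>.F p:I. \<Oplus>.F q:I. C ((l, p), q) **.F rho l x p q)"
    using I(1) by (simp add: F.finsum_product)
   also have "... = (\<Oplus>.F p:I. \<Oplus>.F q:I. C ((False, p), q) **.F rho0 x p q) \<oplus>.F (\<Oplus>.F p:I. \<Oplus>.F q:I. C ((True, p), q) **.F rho0 (\<tau> x) q p)"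
    by (simp add: UNIV_bool F.finsum_insert rho_def)
   also have "(\<Oplus>.F p:I. \<Oplus>.F q:I. C ((True, p), q) **.F rho0 (\<tau> x) q p) = (\<Oplus>.F q:I. \<Oplus>.F p:I. C ((True, p), q) **.F rho0 (\<tau> x) q p)"
    by (rule F.finsum_swap) (use I in auto)
   finally show ?thesis using z x I(1) by (simp add: N_def T_def F.finsum_product)
  qed
  have scale: "(\<Oplus>.F s:I \<times> I. D s **.F ?f s (t **.B x)) = chi t **.F (\<Oplus>.F s:I \<times> I. D s **.F ?f s x)"
   if "t : ring_center B" "x <: B" "!!s. D s <: F" for D t x
  proof -
   have "(\<Oplus>.F s:I \<times> I. D s **.F ?f s (t **.B x)) = (\<Oplus>.F s:I \<times> I. chi t **.F (D s **.F ?f s x))"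
    by (rule F.finsum_cong') (use that rho_semi in "auto simp: F.m_lcomm")
   thus ?thesis using fin that(3) by (simp add: F.finsum_rdistr Pi_iff)
  qed
  have N0: "N x = \<zero>.F" if x: "x <: B" for x
  proof -
   have s: "s0 : ring_center B" using s0(1) by simp
   have "\<tau> (s0 **.B x) = \<tau> s0 **.B \<tau> x"
    using s x centerD(1) centerD(2)[OF center_inv[OF s], of "\<tau> x"] by (simp add: inv_mult inv_closed)
   hence "chi s0 **.F N x \<oplus>.F beta s0 **.F T (\<tau> x) = \<zero>.F"
    using total[of "s0 **.B x"] s x centerD(1)[OF s] center_inv[OF s]
    unfolding N_def T_def by (simp add: scale inv_closed chi\<tau>)
   moreover have T: "T (\<tau> x) = \<ominus>.F N x" using total[OF x] by (simp add: F.minus_equality[symmetric] F.a_comm)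
   ultimately have "(chi s0 \<ominus>.F beta s0) **.F N x = \<zero>.F" by (simp add: F.minus_eq F.l_distr F.r_minus F.l_minus)
   thus ?thesis using F.integral[of "chi s0 \<ominus>.F beta s0" "N x"] s0(2) F.minus_eq_zeroD[of "chi s0" "beta s0"] by force
  qed
  have T0: "T x = \<zero>.F" if x: "x <: B" for x
   using total[of "\<tau> x"] N0[of "\<tau> x"] x by (simp add: inv_closed inv_inv)
  show ?thesis
  proof
   fix s assume s: "s : ?J"
   obtain l p q where lpq: "s = ((l, p), q)" "p : I" "q : I" using s by auto
   show "C s = \<zero>.F"
   proof (cases l)
    case True
    thus ?thesis using ind[of "%s. C ((True, snd s), fst s)" "(q, p)"] T0 lpq by (simp add: T_def)
   next
    case False
    thus ?thesis using ind[of "%s. C ((False, fst s), snd s)" "(p, q)"] N0 lpq by (simp add: N_def)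
   qed
  qed
 qed
 show thesis
 proof (rule that[of I rho])
  show "ALL l x p q. rho l x p q : A" using rhoA by (simp add: rho_def)
  show "ALL l. ALL p:I. ALL q:I. (%x. if x <: B then rho l x p q else \<zero>.F) : m.functionals" using rho_hom by blast
  show "ALL l. ALL p:I. ALL q:I. ALL x:carrier B. ALL y:carrier B. rho l (x **.B y) p q = (\<Oplus>.F j:I. rho l x p j **.F rho l y j q)"
   by (auto simp: rho_def inv_mult rho_mult inv_closed F.m_comm intro!: F.finsum_cong')
  show "ALL l. ALL p:I. ALL q:I. rho l \<one>.B p q = (if p = q then \<one>.F else \<zero>.F)" using rho_one by (auto simp: rho_def inv_one)
  show "ALL l p q. ALL x:carrier B. rho (~ l) x p q = rho l (\<tau> x) q p" by (auto simp: rho_def inv_inv)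
  show "ALL Phi:m.functionals. ?SP Phi" using spanning by blast
  show "ALL C. (ALL s. C s <: F) --> (ALL x:carrier B. (\<Oplus>.F s:?J. C s **.F ?g s x) = \<zero>.F) --> (ALL s:?J. C s = \<zero>.F)"
   using indep by blast
 qed (use I card in auto)
qed

end

section \<open>Counting parameters\<close>

context field
begin

lemma pivot_identity:
 assumes "u <: R" "v <: R" "w <: R" "i <: R" "v ** i = \<one>"
  "a <: R" "b <: R" "v ** a \<oplus> b = \<zero>"
 shows "a = \<ominus> i ** b"
proof -
 have "a = (v ** i) ** a" using assms by simp
 also have "... = i ** (v ** a \<oplus> b) \<ominus> i ** b" using assms(1-4,6,7) by algebra
 finally show ?thesis using assms by (simp add: minus_eq l_minus)
qed

text \<open>Each of the independent equations removes one unknown. The remaining set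
  \<open>E'\<close> depends on the coefficients alone, so one choice serves all solutions
  \<open>z\<close> and all fields \<open>T\<close>.\<close>

lemma elimination:
 assumes J: "finite J" and E: "finite E" and c: "ALL j:J. ALL e:E. c j e <: R"
  and indep: "ALL a. (ALL j. a j <: R) --> (ALL e:E. (\<Oplus>j:J. a j ** c j e) = \<zero>) --> (ALL j:J. a j = \<zero>)"
 shows "EX E'<=E. card E' + card J <= card E & (ALL T z. subfield T R & (ALL j:J. ALL e:E. c j e : T) & (ALL e:E. z e <: R) &
  (ALL j:J. (\<Oplus>e:E. c j e ** z e) = \<zero>) & z ` E' <= T --> z ` E <= T)"
 using J E c indep
proof (induction J arbitrary: E c rule: finite_induct)
 case empty
 thus ?case by (intro exI[of _ E]) auto
next
 case (insert j0 J)
 have cc: "c j e <: R" if "j : insert j0 J" "e : E" for j e using insert.prems(2) that by blast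
 have "EX e0:E. c j0 e0 ~= \<zero>"
 proof (rule ccontr)
  assume *: "~ (EX e0:E. c j0 e0 ~= \<zero>)"
  define delta where "delta j = (if j = j0 then \<one> else \<zero>)" for j
  have "(\<Oplus>j:insert j0 J. delta j ** c j e) = \<zero>" if "e : E" for e
   unfolding delta_def using finsum_delta_mult(1)[of "insert j0 J" j0 "%j. c j e"] insert.hyps(1) cc that * by auto
  hence d2: "ALL e:E. (\<Oplus>j:insert j0 J. delta j ** c j e) = \<zero>" by blast
  have d1: "ALL j. delta j <: R" by (simp add: delta_def)
  have "delta j0 = \<zero>" using insert.prems(3)[THEN spec[of _ delta], THEN mp, THEN mp, OF d1 d2] by (rule bspec) simp
  thus False by (simp add: delta_def)
 qed
 then obtain e0 where e0: "e0 : E" "c j0 e0 ~= \<zero>" by blast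
 define v where "v = inv (c j0 e0)"
 have v: "v <: R" "c j0 e0 ** v = \<one>" using inv_closed[of "c j0 e0"] inv_right[of "c j0 e0"] cc e0 by (auto simp: v_def)
 have v': "v ** c j0 e0 = \<one>" using v cc e0 by (simp add: m_comm)
 define c' where "c' j e = c j e \<ominus> (c j e0 ** v) ** c j0 e" for j e
 have c'c: "c' j e <: R" if "j : insert j0 J" "e : E" for j e using that cc e0 v by (simp add: c'_def)
 have fE: "finite (E - {e0})" using insert.prems by simp
 have fJ: "finite J" by (rule insert.hyps)
 have ind': "ALL a. (ALL j. a j <: R) --> (ALL e:E - {e0}. (\<Oplus>j:J. a j ** c' j e) = \<zero>) --> (ALL j:J. a j = \<zero>)"
 proof (intro allI impI)
  fix a assume a: "ALL j. a j <: R" and z: "ALL e:E - {e0}. (\<Oplus>j:J. a j ** c' j e) = \<zero>"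
  define s where "s = (\<Oplus>j:J. a j ** c j e0)"
  have s: "s <: R" unfolding s_def using a cc e0 by (auto intro!: finsum_closed)
  define b where "b j = (if j = j0 then \<ominus> (s ** v) else a j)" for j
  have bc: "b j <: R" for j using a s v by (simp add: b_def)
  have split: "(\<Oplus>j:insert j0 J. b j ** c j e) = \<ominus> (s ** v) ** c j0 e \<oplus> (\<Oplus>j:J. a j ** c j e)" if e: "e : E" for e
  proof -
   have "(\<Oplus>j:J. b j ** c j e) = (\<Oplus>j:J. a j ** c j e)"
    by (rule finsum_cong') (use insert.hyps(2) a cc e in "auto simp: b_def")
   thus ?thesis using fJ insert.hyps(2) bc cc e s v by (subst finsum_insert) (auto simp: b_def)
  qed
  have "(\<Oplus>j:insert j0 J. b j ** c j e) = \<zero>" if e: "e : E" for e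
  proof (cases "e = e0")
   case True
   have "\<ominus> (s ** v) ** c j0 e0 = \<ominus> (s ** (c j0 e0 ** v))" using s v v' cc[of j0 e0] e0 by (simp add: l_minus m_assoc)
   thus ?thesis using split[OF e] s v True by (simp add: s_def[symmetric] l_neg)
  next
   case False
   have "(\<Oplus>j:J. a j ** c' j e) = (\<Oplus>j:J. a j ** c j e \<oplus> \<ominus> (a j ** c j e0 ** (v ** c j0 e)))"
    by (rule finsum_cong') (use a cc e e0 v in "auto simp: c'_def minus_eq r_distr r_minus m_assoc")
   also have "... = (\<Oplus>j:J. a j ** c j e) \<oplus> \<ominus> (\<Oplus>j:J. a j ** c j e0 ** (v ** c j0 e))"
    using a cc e e0 v by (subst finsum_addf) (auto simp: finsum_ominus)
   also have "(\<Oplus>j:J. a j ** c j e0 ** (v ** c j0 e)) = s ** (v ** c j0 e)"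
    unfolding s_def by (rule finsum_ldistr[symmetric]) (use fJ a cc e e0 v in auto)
   finally have "(\<Oplus>j:J. a j ** c j e) \<oplus> \<ominus> (s ** (v ** c j0 e)) = \<zero>" using z e False by simp
   moreover have "(\<Oplus>j:J. a j ** c j e) <: R" using a cc e by (auto intro!: finsum_closed)
   ultimately show ?thesis using split[OF e] s v cc[of j0 e] e by (simp add: l_minus m_assoc a_comm)
  qed
  hence d2: "ALL e:E. (\<Oplus>j:insert j0 J. b j ** c j e) = \<zero>" by blast
  have d1: "ALL j. b j <: R" using bc by blast
  have "ALL j:insert j0 J. b j = \<zero>" by (rule insert.prems(3)[THEN spec[of _ b], THEN mp, THEN mp, OF d1 d2])
  hence "b j = \<zero>" if "j : J" for j using that by blast
  moreover have "b j = a j" if "j : J" for j using that insert.hyps(2) by (auto simp: b_def)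
  ultimately show "ALL j:J. a j = \<zero>" by simp
 qed
 have c'c': "ALL j:J. ALL e:E - {e0}. c' j e <: R" using c'c by blast
 obtain E' where E': "E' <= E - {e0}" "card E' + card J <= card (E - {e0})"
  and fill: "ALL T z. subfield T R & (ALL j:J. ALL e:E - {e0}. c' j e : T) & (ALL e:E - {e0}. z e <: R) &
   (ALL j:J. (\<Oplus>e:E - {e0}. c' j e ** z e) = \<zero>) & z ` E' <= T --> z ` (E - {e0}) <= T"
  using insert.IH[OF fE c'c' ind'] by (elim exE conjE) (rule that)
 have cardE: "card (E - {e0}) = card E - 1" "card E > 0" using e0(1) insert.prems(1) by (auto simp: card_gt_0_iff)
 show ?case
 proof (intro exI[of _ E'] conjI allI impI)
  show "E' <= E" using E' by blast
  show "card E' + card (insert j0 J) <= card E" using E'(2) cardE insert.hyps by simp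
  fix T z assume *: "subfield T R & (ALL j:insert j0 J. ALL e:E. c j e : T) & (ALL e:E. z e <: R) &
   (ALL j:insert j0 J. (\<Oplus>e:E. c j e ** z e) = \<zero>) & z ` E' <= T"
  hence T: "subfield T R" and cT: "!!j e. j : insert j0 J ==> e : E ==> c j e : T" and z[simp]: "!!e. e : E ==> z e <: R"
   and rel: "!!j. j : insert j0 J ==> (\<Oplus>e:E. c j e ** z e) = \<zero>" and zE': "z ` E' <= T" by blast+
  note cl = subringE[OF subfieldE(1)[OF T]]
  have vT: "v : T" unfolding v_def using subfield_m_inv(1)[OF T] cT[of j0 e0] e0 by auto
  have c'T: "c' j e : T" if "j : insert j0 J" "e : E" for j e
   unfolding c'_def minus_eq using that cT e0 vT cl(5-7) by simp
  let ?R = "%j. \<Oplus>e:E - {e0}. c j e ** z e"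
  have Rc: "?R j <: R" if "j : insert j0 J" for j using that cc by (intro finsum_closed) auto
  have rel0: "c j e0 ** z e0 \<oplus> ?R j = \<zero>" if j: "j : insert j0 J" for j
   using rel[OF j] finsum_remove[OF insert.prems(1) e0(1), of "%e. c j e ** z e"] cc[OF j] by simp
  have z0: "z e0 = \<ominus> v ** ?R j0"
   by (rule pivot_identity[of \<one> "c j0 e0" \<one>]) (use v cc e0 Rc rel0 in auto)
  have rel': "(\<Oplus>e:E - {e0}. c' j e ** z e) = \<zero>" if j: "j : J" for j
  proof -
   have ji: "j : insert j0 J" using j by simp
   have "(\<Oplus>e:E - {e0}. c' j e ** z e) = (\<Oplus>e:E - {e0}. c j e ** z e \<oplus> \<ominus> ((c j e0 ** v) ** (c j0 e ** z e)))"
    by (rule finsum_cong') (use cc[OF ji] cc[of j0] e0 v in "auto simp: c'_def minus_eq l_distr l_minus m_assoc")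
   also have "... = ?R j \<oplus> \<ominus> (\<Oplus>e:E - {e0}. (c j e0 ** v) ** (c j0 e ** z e))"
    using cc[OF ji] cc[of j0] e0 v finsum_ominus[of "E - {e0}" "%e. (c j e0 ** v) ** (c j0 e ** z e)"]
    by (subst finsum_addf) auto
   also have "(\<Oplus>e:E - {e0}. (c j e0 ** v) ** (c j0 e ** z e)) = (c j e0 ** v) ** ?R j0"
    by (rule finsum_rdistr[symmetric]) (use fE cc[OF ji] cc[of j0] e0 v in auto)
   also have "\<ominus> ((c j e0 ** v) ** ?R j0) = c j e0 ** z e0"
    unfolding z0 using cc[OF ji e0(1)] v Rc[of j0] by (simp add: l_minus r_minus m_assoc)
   finally show ?thesis using rel0[OF ji] Rc[OF ji] cc[OF ji e0(1)] e0 by (simp add: a_comm)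
  qed
  have "z ` (E - {e0}) <= T"
   by (rule fill[THEN spec, THEN spec, THEN mp]) (use T c'T z rel' zE' in auto)
  moreover have "z e0 : T"
  proof -
   have "?R j0 : T" by (rule subring_finsum[OF subfieldE(1)[OF T]]) (use calculation cT cl(6) in auto)
   thus ?thesis unfolding z0 using vT cl(5,6) by simp
  qed
  ultimately show "z ` E <= T" by blast
 qed
qed

end

text \<open>\<open>sigma l e\<close> is the matrix of the module generator \<open>e\<close> in the
  representation \<open>l\<close>, with entries algebraic over at most \<open>d\<close> elements.
  The \<open>x i e\<close> are the parameters, and \<open>ts\<close> lists them in an order
  witnessing algebraic independence. This separates the counting from the algebra.\<close>

locale generic_matrices = field R for R (structure) +
 fixes I :: "'i set" and E :: "'e set" and sigma :: "bool => 'e => 'i => 'i => 'a" and x :: "nat => 'e => 'a"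
  and r d :: nat and k Y ts
 assumes roots: "has_roots" and finI: "finite I" and finE: "finite E"
  and k: "k <= carrier R" and Y: "Y <= carrier R" "finite Y" "card Y <= d"
  and sigma: "!!l e p q. sigma l e p q : acl k Y" and x: "!!i e. x i e <: R"
  and sigma_indep: "ALL C. (ALL s. C s <: R) -->
   (ALL e:E. (\<Oplus>s:(UNIV \<times> I) \<times> I. C s ** sigma (fst (fst s)) e (snd (fst s)) (snd s)) = \<zero>) --> (ALL s:(UNIV \<times> I) \<times> I. C s = \<zero>)"
  and ts: "set ts = (%(i, e). x i e) ` ({..<r} \<times> E)" "length ts = r * card E"
   "ALL i<length ts. ts ! i ~: acl k (set (take i ts))"
  and bound: "d < (2 * r - 1) * (card I - 1)"
begin

abbreviation "pairs == ((UNIV :: bool set) \<times> I) \<times> I"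

text \<open>The matrix of the \<open>i\<close>-th generic element in the representation
  \<open>l\<close>.\<close>

definition gm :: "bool => nat => 'i => 'i => 'a" where
 "gm l i p q = (\<Oplus>e:E. sigma l e p q ** x i e)"

lemma sigma_closed[simp]: "sigma l e p q <: R"
 using sigma subfieldE(3)[OF acl_subfield[OF k Y(1)]] by blast

lemma gm_closed[simp]: "gm l i p q <: R"
 using x by (auto simp: gm_def intro!: finsum_closed)

text \<open>As the generators have independent matrices, the relations become \<open>card J\<close>
  independent linear equations for each row of parameters. All parameters are then algebraic over
  \<open>Y\<close>, \<open>P\<close> and \<open>card E - card J\<close> of them per row, at
  most.\<close>

lemma parameter_count_total:
 assumes J: "finite J" and P: "finite P" "P <= carrier R"
  and K: "!!j s. K j s : acl k (Y Un P)"
  and indep: "!!a. (!!j. a j <: R) ==> (!!s. s : pairs ==> (\<Oplus>j:J. a j ** K j s) = \<zero>) ==> ALL j:J. a j = \<zero>"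
  and rel: "!!j i. j : J ==> i < r ==> (\<Oplus>s:pairs. K j s ** gm (fst (fst s)) i (snd (fst s)) (snd s)) = \<zero>"
 shows "r * card J <= d + card P"
proof -
 let ?S = "%s e. sigma (fst (fst s)) e (snd (fst s)) (snd s)"
 have YP: "Y Un P <= carrier R" using Y P by blast
 have fP: "finite pairs" using finI by simp
 have Kc[simp]: "K j s <: R" for j s using K subfieldE(3)[OF acl_subfield[OF k YP]] by blast
 define c where "c j e = (\<Oplus>s:pairs. K j s ** ?S s e)" for j e
 have c[simp]: "c j e <: R" for j e by (auto simp: c_def intro!: finsum_closed)
 have ind: "ALL a. (ALL j. a j <: R) --> (ALL e:E. (\<Oplus>j:J. a j ** c j e) = \<zero>) --> (ALL j:J. a j = \<zero>)"
 proof (intro allI impI)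
  fix a assume a: "ALL j. a j <: R" and z: "ALL e:E. (\<Oplus>j:J. a j ** c j e) = \<zero>"
  note [simp] = a[rule_format]
  have "(\<Oplus>s:pairs. (\<Oplus>j:J. a j ** K j s) ** ?S s e) = \<zero>" if e: "e : E" for e
  proof -
   have "(\<Oplus>s:pairs. (\<Oplus>j:J. a j ** K j s) ** ?S s e) = (\<Oplus>s:pairs. \<Oplus>j:J. a j ** (K j s ** ?S s e))"
    by (rule finsum_cong') (use J in "auto simp: finsum_ldistr m_assoc intro!: finsum_cong' finsum_closed")
   also have "... = (\<Oplus>j:J. \<Oplus>s:pairs. a j ** (K j s ** ?S s e))" by (rule finsum_swap) (use J fP in auto)
   also have "... = (\<Oplus>j:J. a j ** c j e)"
    unfolding c_def by (rule finsum_cong') (use fP in "auto simp: finsum_rdistr intro!: finsum_closed")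
   finally show ?thesis using z e by simp
  qed
  hence d2: "ALL e:E. (\<Oplus>s:pairs. (\<Oplus>j:J. a j ** K j s) ** ?S s e) = \<zero>" by blast
  have d1: "ALL s. (\<Oplus>j:J. a j ** K j s) <: R" by (auto intro!: finsum_closed)
  have q: "ALL s:pairs. (\<Oplus>j:J. a j ** K j s) = \<zero>"
   by (rule sigma_indep[THEN spec[of _ "%s. \<Oplus>j:J. a j ** K j s"], THEN mp, THEN mp, OF d1 d2])
  show "ALL j:J. a j = \<zero>" by (rule indep[OF spec[OF a] bspec[OF q]])
 qed
 have relc: "(\<Oplus>e:E. c j e ** x i e) = \<zero>" if j: "j : J" and i: "i < r" for j i
 proof -
  have "(\<Oplus>e:E. c j e ** x i e) = (\<Oplus>e:E. \<Oplus>s:pairs. K j s ** (?S s e ** x i e))"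
   unfolding c_def by (rule finsum_cong') (use fP x in "auto simp: finsum_ldistr m_assoc intro!: finsum_cong' finsum_closed")
  also have "... = (\<Oplus>s:pairs. \<Oplus>e:E. K j s ** (?S s e ** x i e))" by (rule finsum_swap) (use finE fP x in auto)
  also have "... = (\<Oplus>s:pairs. K j s ** gm (fst (fst s)) i (snd (fst s)) (snd s))"
   unfolding gm_def by (rule finsum_cong') (use finE x in "auto simp: finsum_rdistr intro!: finsum_closed")
  finally show ?thesis using rel[OF j i] by simp
 qed
 have cc: "ALL j:J. ALL e:E. c j e <: R" by simp
 obtain E' where E': "E' <= E" "card E' + card J <= card E"
  and fill: "ALL T z. subfield T R & (ALL j:J. ALL e:E. c j e : T) & (ALL e:E. z e <: R) &
   (ALL j:J. (\<Oplus>e:E. c j e ** z e) = \<zero>) & z ` E' <= T --> z ` E <= T"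
  using elimination[OF J finE cc ind] by (elim exE conjE) (rule that)
 define Z where "Z = (Y Un P) Un (%(i, e). x i e) ` ({..<r} \<times> E')"
 have fE': "finite E'" using E'(1) finE finite_subset by blast
 have Z: "Z <= carrier R" "finite Z" using YP Y P x fE' by (auto simp: Z_def)
 have sub: "subfield (acl k Z) R" by (rule acl_subfield[OF k Z(1)])
 note cl = subringE[OF subfieldE(1)[OF sub]]
 have up: "acl k (Y Un P) <= acl k Z" by (rule acl_mono[OF k _ Z(1)]) (auto simp: Z_def)
 have "acl k Y <= acl k (Y Un P)" by (rule acl_mono[OF k _ YP]) auto
 hence cT: "c j e : acl k Z" for j e
  unfolding c_def using up sigma K cl(6) by (intro subring_finsum[OF subfieldE(1)[OF sub]]) blast
 have "x i ` E <= acl k Z" if i: "i < r" for i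
 proof (rule fill[THEN spec, THEN spec, THEN mp])
  have "x i ` E' <= Z" using i by (auto simp: Z_def)
  thus "subfield (acl k Z) R & (ALL j:J. ALL e:E. c j e : acl k Z) & (ALL e:E. x i e <: R) &
   (ALL j:J. (\<Oplus>e:E. c j e ** x i e) = \<zero>) & x i ` E' <= acl k Z"
   using sub cT x relc[OF _ i] acl_incl[OF k Z(1)] by blast
 qed
 hence "set ts <= acl k Z" by (auto simp: ts(1))
 hence "r * card E <= card Z" using acl_independent_bound[OF k Z, of ts] ts by auto
 also have "... <= (card Y + card P) + r * card E'"
 proof -
  have "card ((%(i, e). x i e) ` ({..<r} \<times> E')) <= r * card E'"
   using card_image_le[of "{..<r} \<times> E'" "%(i, e). x i e"] fE' by (simp add: card_cartesian_product)
  thus ?thesis unfolding Z_def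
   by (intro order.trans[OF card_Un_le] add_mono card_Un_le)
 qed
 finally have "r * card E <= d + card P + r * card E'" using Y(3) by simp
 moreover have "r * card E' + r * card J <= r * card E" using E'(2) by (metis add_mult_distrib2 mult_le_mono2)
 ultimately show ?thesis by simp
qed

text \<open>The form used in applications, with conditions only on the indices that occur; other
  coefficients are set to zero.\<close>

lemma parameter_count:
 assumes J: "finite J" and P: "finite P" "P <= carrier R"
  and K: "!!j s. j : J ==> s : pairs ==> K j s : acl k (Y Un P)"
  and indep: "!!a j. (!!j. a j <: R) ==> (!!s. s : pairs ==> (\<Oplus>j:J. a j ** K j s) = \<zero>) ==> j : J ==> a j = \<zero>"
  and rel: "!!j i. j : J ==> i < r ==> (\<Oplus>s:pairs. K j s ** gm (fst (fst s)) i (snd (fst s)) (snd s)) = \<zero>"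
 shows "r * card J <= d + card P"
proof -
 have YP: "Y Un P <= carrier R" using Y P by blast
 note sub = acl_subfield[OF k YP]
 define K' where "K' j s = (if j : J & s : pairs then K j s else \<zero>)" for j s
 have K': "K' j s : acl k (Y Un P)" for j s using K subringE(2)[OF subfieldE(1)[OF sub]] by (simp add: K'_def)
 have Kc: "K j s <: R" if "j : J" "s : pairs" for j s using K[OF that] subfieldE(3)[OF sub] by blast
 show ?thesis
 proof (rule parameter_count_total[OF J P K'])
  fix a assume a: "!!j. a j <: R" and z: "!!s. s : pairs ==> (\<Oplus>j:J. a j ** K' j s) = \<zero>"
  have q: "(\<Oplus>j:J. a j ** K j s) = \<zero>" if s: "s : pairs" for s
  proof -
   have "(\<Oplus>j:J. a j ** K j s) = (\<Oplus>j:J. a j ** K' j s)" by (rule finsum_cong') (use s a Kc in "auto simp: K'_def")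
   thus ?thesis using z[OF s] by simp
  qed
  show "ALL j:J. a j = \<zero>" by (intro ballI) (rule indep[OF a q])
 next
  fix j i assume j: "j : J" and i: "i < r"
  have "(\<Oplus>s:pairs. K' j s ** gm (fst (fst s)) i (snd (fst s)) (snd s)) = (\<Oplus>s:pairs. K j s ** gm (fst (fst s)) i (snd (fst s)) (snd s))"
   by (rule finsum_cong') (use j Kc in "auto simp: K'_def")
  thus "(\<Oplus>s:pairs. K' j s ** gm (fst (fst s)) i (snd (fst s)) (snd s)) = \<zero>" using rel[OF j i] by simp
 qed
qed

end

text \<open>\<open>k\<close> is the dimension of an invariant subspace, with
  \<open>2 k (m - k)\<close> relations per generic element against \<open>k (m - k)\<close> free
  entries. The product \<open>k (m - k)\<close> is at least \<open>m - 1\<close>.\<close>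

lemma count_reducible:
 fixes d r m k :: nat
 assumes "d < (2 * r - 1) * (m - 1)" "0 < k" "k < m" "r * (2 * (k * (m - k))) <= d + k * (m - k)"
 shows False
proof -
 obtain a b where ab: "k = Suc a" "m - k = Suc b" using assms by (metis Suc_pred zero_less_diff)
 hence m: "m - 1 = a + b + 1" using assms by simp
 have "k * (m - k) = Suc a * Suc b" using ab by simp
 hence "m - 1 <= k * (m - k)" unfolding m by simp
 hence "(2 * r - 1) * (m - 1) <= (2 * r - 1) * (k * (m - k))" by simp
 also have "... = r * (2 * (k * (m - k))) - k * (m - k)" by (simp add: diff_mult_distrib)
 also have "... <= d" using assms(4) by simp
 finally show False using assms(1) by simp
qed

text \<open>\<open>c\<close> is the number of entries in a triangle with diagonal; one of them is
  normalized to \<open>1\<close>, whence \<open>c - 1\<close>.\<close>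

lemma count_intertwiner:
 fixes d r m c :: nat
 assumes "d < (2 * r - 1) * (m - 1)" "2 * c = m * m + m" "r * (m * m) <= d + (c - 1)"
 shows False
proof -
 have "r ~= 0" "m - 1 ~= 0" using assms(1) by (auto intro: ccontr)
 then obtain s u where s: "r = Suc s" and u: "m = Suc (Suc u)" by (metis diff_0_eq_0 diff_Suc_1 not0_implies_Suc)
 have "2 * d + 2 <= 2 * ((2 * s + 1) * (u + 1))" using assms(1) unfolding s u by simp
 moreover have "c ~= 0" using assms(2) u by auto
 hence "2 * (r * (m * m)) <= 2 * d + (m * m + m) - 2" using assms(2,3) by linarith
 ultimately show False unfolding s u by (simp add: algebra_simps)
qed

text \<open>The injection \<open>f\<close> serves to order the index set, so that one side of the
  diagonal makes sense.\<close>

lemma card_le_pairs: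
 fixes f :: "'i => nat"
 assumes "finite I" "inj_on f I"
 shows "2 * card {(p, q) : I \<times> I. f p <= f q} = card I * card I + card I"
proof -
 let ?L = "{(p, q) : I \<times> I. f p <= f q}" and ?G = "{(p, q) : I \<times> I. f q <= f p}"
 have fin: "finite ?L" "finite ?G" using assms(1) by (auto intro: finite_subset[of _ "I \<times> I"])
 have "card ?G = card ?L" by (rule bij_betw_same_card[of prod.swap]) (auto simp: bij_betw_def inj_on_def image_def)
 moreover have "?L Un ?G = I \<times> I" by auto
 moreover have "?L Int ?G = (%p. (p, p)) ` I" using assms(2) by (auto simp: inj_on_def)
 moreover have "card ((%p. (p, p)) ` I) = card I" by (rule card_image) (auto simp: inj_on_def)
 ultimately show ?thesis using card_Un_Int[OF fin] by (simp add: card_cartesian_product)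
qed

section \<open>Words in the generic matrices and their transposes\<close>

context generic_matrices
begin

text \<open>A letter is a generic element, or its image under the involution if the flag is set; the
  latter acts by the transpose of the matrix in the other representation.\<close>

definition letter :: "bool => nat \<times> bool => 'i => 'i => 'a" where
 "letter l a p q = (if snd a then gm (~ l) (fst a) q p else gm l (fst a) p q)"

primrec word :: "bool => (nat \<times> bool) list => 'i => 'i => 'a" where
 "word l [] p q = (if p = q then \<one> else \<zero>)"
| "word l (a # w) p q = (\<Oplus>j:I. letter l a p j ** word l w j q)"

abbreviation "letters == {..<r} \<times> (UNIV :: bool set)"

lemma letter_closed[simp]: "letter l a p q <: R"
 by (simp add: letter_def)

lemma word_closed[simp]: "word l w p q <: R"
 by (induction w arbitrary: p q) (auto intro!: finsum_closed)

lemma pairs_sum: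
 assumes "!!s. f s <: R"
 shows "(\<Oplus>s:pairs. f s) = (\<Oplus>p:I. \<Oplus>q:I. f ((l, p), q)) \<oplus> (\<Oplus>p:I. \<Oplus>q:I. f ((~ l, p), q))"
proof -
 have "(\<Oplus>s:pairs. f s) = (\<Oplus>b:UNIV. \<Oplus>p:I. \<Oplus>q:I. f ((b, p), q))"
  using finI assms by (simp add: finsum_product)
 thus ?thesis using assms by (cases l) (simp_all add: UNIV_bool finsum_insert a_comm)
qed

lemma sum_zero_left: "(!!p q. f p q <: R) ==> (\<Oplus>p:I. \<Oplus>q:I. \<zero> ** f p q) = \<zero>"
 by (simp add: finsum_all_zero)

text \<open>In echelon form, with the identity at the places \<open>I'\<close>, an invariant
  subspace is described by its remaining entries \<open>P\<close>. Invariance under both letters of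
  a generic element is linear in its matrices and yields twice as many relations as there are
  remaining places. Each relation has a matrix entry of its own, so they are independent.\<close>

lemma letters_irreducible: "irred_rep I (letter l) letters"
 unfolding irred_rep_def
proof (intro allI impI, rule ccontr)
 fix U assume *: "fun_subspace U & U <= vecs I & (ALL w:letters. ALL u:U. mat_app I (letter l w) u : U) & (EX u:U. u ~= (%_. \<zero>))"
  and proper: "~ vecs I <= U"
 hence U: "fun_subspace U" and UV: "U <= vecs I" and inv: "!!w u. w : letters ==> u : U ==> mat_app I (letter l w) u : U"
  and nz: "EX u:U. u ~= (%_. \<zero>)" by blast+
 have det: "ALL u:U. (ALL y:I. u y = \<zero>) --> u = (%_. \<zero>)" using UV vecs_nonzeroD by blast
 obtain I' e where I': "I' <= I" and eU: "!!i. i : I' ==> e i : U"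
  and dual: "!!i j. i : I' ==> j : I' ==> e i j = (if i = j then \<one> else \<zero>)"
  and expand: "!!u. u : U ==> u = (%x. \<Oplus>i:I'. u i ** e i x)"
  by (rule dual_basis_of_evaluations[OF U finI det]) (rule that)
 have fI': "finite I'" using I' finI finite_subset by blast
 have ec: "e i j <: R" if "i : I'" for i j using fun_subspace_closed[OF U eU[OF that]] .
 have uc: "u j <: R" if "u : U" for u j using fun_subspace_closed[OF U that] .
 have ne: "I' ~= {}"
 proof
  assume "I' = {}"
  hence "u = (%_. \<zero>)" if "u : U" for u using expand[OF that] by simp
  thus False using nz by blast
 qed
 have neI: "I' ~= I"
 proof
  assume eq: "I' = I"
  have "v : U" if v: "v : vecs I" for v
  proof -
   have "(%x. \<Oplus>i:I. v i ** e i x) : U" by (rule fun_subspace_sum[OF U finI]) (use vecsD(1)[OF v] eU eq in auto)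
   moreover have "(\<Oplus>i:I. v i ** e i x) = v x" for x
   proof (cases "x : I")
    case True
    have "(\<Oplus>i:I. v i ** e i x) = (\<Oplus>i:I. v i ** (if i = x then \<one> else \<zero>))"
     by (rule finsum_cong') (use dual eq True vecsD(1)[OF v] in auto)
    thus ?thesis using finsum_delta_mult(3)[OF finI True, of v] vecsD(1)[OF v] by simp
   next
    case False
    have "e i x = \<zero>" if "i : I" for i using vecsD(2)[of "e i" I x] eU[of i] UV that eq False by blast
    thus ?thesis using vecsD[OF v] False by (simp add: finsum_all_zero)
   qed
   ultimately show ?thesis by simp
  qed
  thus False using proper by blast
 qed
 define J where "J = (UNIV :: bool set) \<times> (I' \<times> (I - I'))"
 define P where "P = (%(a, p). e a p) ` (I' \<times> (I - I'))"
 \<comment> \<open>The linear form that compares the coordinate at \<open>p\<close> with its value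
   predicted from the coordinates in \<open>I'\<close>; it vanishes on the subspace.\<close>
 define g where "g p p' = (if p' = p then \<one> else if p' : I' then \<ominus> e p' p else \<zero>)" for p p'
 \<comment> \<open>Coefficients of the relation that \<open>g p\<close> kills the letter applied to
   \<open>e a\<close>. For the transposed letter, marked by \<open>epsilon\<close>, the indices are
   exchanged and the other representation is addressed.\<close>
 define K where "K j s = (case j of (epsilon, a, p) => if epsilon then (if fst (fst s) = l then \<zero> else g p (snd s) ** e a (snd (fst s)))
   else (if fst (fst s) = l then g p (snd (fst s)) ** e a (snd s) else \<zero>))" for j :: "bool \<times> 'i \<times> 'i" and s :: "(bool \<times> 'i) \<times> 'i"
 have gc: "g p p' <: R" for p p' using ec by (simp add: g_def)
 have annihilate: "(\<Oplus>p':I. g p p' ** u p') = \<zero>" if u: "u : U" and p: "p : I - I'" for u p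
 proof -
  have "(\<Oplus>p':I. g p p' ** u p') = g p p ** u p \<oplus> (\<Oplus>p':I - {p}. g p p' ** u p')"
   by (rule finsum_remove) (use finI p gc uc[OF u] in auto)
  also have "(\<Oplus>p':I - {p}. g p p' ** u p') = (\<Oplus>p':I'. g p p' ** u p')"
   by (rule finsum_neutral_subset) (use finI I' p gc uc[OF u] in "auto simp: g_def")
  also have "... = (\<Oplus>i:I'. \<ominus> (u i ** e i p))"
   by (rule finsum_cong') (use p ec uc[OF u] in "auto simp: g_def l_minus r_minus m_comm")
  also have "... = \<ominus> (\<Oplus>i:I'. u i ** e i p)" by (rule finsum_ominus) (use ec uc[OF u] in auto)
  also have "(\<Oplus>i:I'. u i ** e i p) = u p" using fun_cong[OF expand[OF u], of p] by simp
  finally show ?thesis using uc[OF u] by (simp add: g_def r_neg)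
 qed
 have "r * card J <= d + card P"
 proof (rule parameter_count)
  show "finite J" using finI fI' by (simp add: J_def)
  show "finite P" using finI fI' by (simp add: P_def)
  show PR: "P <= carrier R" using ec by (auto simp: P_def)
  hence YP: "Y Un P <= carrier R" using Y by blast
  note cl = subringE[OF subfieldE(1)[OF acl_subfield[OF k YP]]]
  have eT: "e a p : acl k (Y Un P)" if "a : I'" "p : I" for a p
  proof (cases "p : I'")
   case True
   thus ?thesis using dual that cl(2,3) by simp
  next
   case False
   hence "e a p : P" using that by (force simp: P_def)
   thus ?thesis using acl_incl[OF k YP] by blast
  qed
  show "K j s : acl k (Y Un P)" if js: "j : J" "s : pairs" for j s
  proof -
   obtain epsilon a p where j: "j = (epsilon, a, p)" "a : I'" "p : I - I'" using js(1) by (auto simp: J_def)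
   have gT: "g p p' : acl k (Y Un P)" for p' using eT[of p' p] j cl(2,3,5) by (auto simp: g_def)
   show ?thesis using js(2) gT eT[OF j(2)] cl(2,6) by (auto simp: K_def j(1))
  qed
 next
  fix alpha j assume alpha: "!!j. alpha j <: R" and z: "!!s. s : pairs ==> (\<Oplus>j:J. alpha j ** K j s) = \<zero>" and jJ: "j : J"
  obtain epsilon a p where j: "j = (epsilon, a, p)" "a : I'" "p : I" "p ~: I'" using jJ by (auto simp: J_def)
  \<comment> \<open>The matrix entry at which relation \<open>j\<close> has coefficient one and all
    other relations have coefficient zero.\<close>
  define s where "s = (if epsilon then ((~ l, a), p) else ((l, p), a))"
  have s: "s : pairs" using j I' by (auto simp: s_def)
  have K: "K j' s = (if j' = j then \<one> else \<zero>)" if "j' : J" for j'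
  proof -
   obtain epsilon' a' p' where j': "j' = (epsilon', a', p')" "a' : I'" "p' : I - I'" using \<open>j' : J\<close> by (auto simp: J_def)
   have "g p' p = (if p' = p then \<one> else \<zero>)" using j by (auto simp: g_def)
   thus ?thesis using dual[OF j'(2) j(2)] by (auto simp: K_def j(1) j'(1) s_def)
  qed
  have fJ: "finite J" using finI fI' by (simp add: J_def)
  have "alpha j = (\<Oplus>j':J. alpha j' ** (if j' = j then \<one> else \<zero>))" by (rule finsum_delta_mult(3)[symmetric]) (use fJ jJ alpha in auto)
  also have "... = (\<Oplus>j':J. alpha j' ** K j' s)" by (rule finsum_cong') (use K alpha in auto)
  finally show "alpha j = \<zero>" using z[OF s] by simp
 next
  fix j i assume jJ: "j : J" and i: "i < r"
  obtain epsilon a p where j: "j = (epsilon, a, p)" "a : I'" "p : I - I'" using jJ by (auto simp: J_def)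
  note [simp] = gc ec[OF j(2)]
  have "(\<Oplus>s:pairs. K j s ** gm (fst (fst s)) i (snd (fst s)) (snd s)) = (\<Oplus>q:I. \<Oplus>q':I. g p q ** (letter l (i, epsilon) q q' ** e a q'))"
  proof (cases epsilon)
   case True
   have "(\<Oplus>s:pairs. K j s ** gm (fst (fst s)) i (snd (fst s)) (snd s)) = (\<Oplus>q':I. \<Oplus>q:I. g p q ** (letter l (i, epsilon) q q' ** e a q'))"
    by (subst pairs_sum[of _ l]) (auto simp: K_def j(1) True letter_def sum_zero_left m_assoc m_comm[of "e a _"] intro!: finsum_closed finsum_finsum_cong)
   thus ?thesis by (subst finsum_swap) (use finI in auto)
  next
   case False
   thus ?thesis
    by (subst pairs_sum[of _ l]) (auto simp: K_def j(1) letter_def sum_zero_left m_assoc m_comm[of "e a _"] intro!: finsum_closed finsum_finsum_cong)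
  qed
  also have "... = (\<Oplus>q:I. g p q ** mat_app I (letter l (i, epsilon)) (e a) q)"
   by (rule finsum_cong') (use finI in "auto simp: mat_app_def finsum_rdistr intro!: finsum_closed")
  also have "... = \<zero>" by (rule annihilate[OF inv]) (use i eU j in auto)
  finally show "(\<Oplus>s:pairs. K j s ** gm (fst (fst s)) i (snd (fst s)) (snd s)) = \<zero>" .
 qed
 moreover have "card (I - I') = card I - card I'" using I' fI' by (simp add: card_Diff_subset)
 moreover have "card P <= card I' * card (I - I')"
  using card_image_le[of "I' \<times> (I - I')" "%(a, p). e a p"] finI fI' by (simp add: P_def card_cartesian_product)
 ultimately have "r * (2 * (card I' * (card I - card I'))) <= d + card I' * (card I - card I')"
  by (simp add: J_def card_cartesian_product)
 moreover have "0 < card I'" "card I' < card I"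
  using ne fI' I' neI finI by (auto simp: card_gt_0_iff intro: psubset_card_mono)
 ultimately show False using count_reducible[OF bound] by blast
qed

text \<open>Transposition exchanges the representations together with the letters, so the transpose
  of an intertwiner intertwines as well and a combination \<open>H\<close> with half the free
  entries can be formed. By irreducibility \<open>H\<close> is nonsingular, which makes all
  \<open>m^2\<close> intertwining equations independent as equations for the generic
  matrices.\<close>

lemma intertwiner_zero:
 assumes g: "!!p q. g p q <: R"
  and inter: "!!a p q. a : letters ==> p : I ==> q : I ==> (\<Oplus>j:I. g p j ** letter l a j q) = (\<Oplus>j:I. letter (~ l) a p j ** g j q)"
  and pq: "p : I" "q : I"
 shows "g p q = \<zero>"
proof (rule ccontr)
 assume nz: "g p q ~= \<zero>"
 \<comment> \<open>Only the plain letters are recorded; the transposed ones amount to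
   \<open>Rel\<close> of the transposed matrix.\<close>
 define Rel where "Rel G \<longleftrightarrow> (ALL i<r. ALL p:I. ALL q:I. (\<Oplus>j:I. G p j ** gm l i j q) = (\<Oplus>j:I. gm (~ l) i p j ** G j q))" for G
 have R1: "Rel g" using inter[of "(_, False)"] by (auto simp: Rel_def letter_def)
 have R2: "Rel (%p q. g q p)"
  unfolding Rel_def
 proof (intro allI impI ballI)
  fix i p q assume i: "i < r" "p : I" "q : I"
  have "(\<Oplus>j:I. g q j ** gm (~ l) i p j) = (\<Oplus>j:I. gm l i j q ** g j p)"
   using inter[of "(i, True)" q p] i by (simp add: letter_def)
  thus "(\<Oplus>j:I. g j p ** gm l i j q) = (\<Oplus>j:I. gm (~ l) i p j ** g q j)" using g by (simp add: m_comm)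
 qed
 have lin: "Rel (%p q. a ** G p q \<oplus> b ** G' p q)"
  if "Rel G" "Rel G'" and [simp]: "a <: R" "b <: R" "!!p q. G p q <: R" "!!p q. G' p q <: R" for G G' a b
  unfolding Rel_def
 proof (intro allI impI ballI)
  fix i p q assume i: "i < r" "p : I" "q : I"
  have "(\<Oplus>j:I. (a ** G p j \<oplus> b ** G' p j) ** gm l i j q) = (\<Oplus>j:I. a ** (G p j ** gm l i j q) \<oplus> b ** (G' p j ** gm l i j q))"
   by (rule finsum_cong') (auto simp: l_distr m_assoc)
  also have "... = a ** (\<Oplus>j:I. G p j ** gm l i j q) \<oplus> b ** (\<Oplus>j:I. G' p j ** gm l i j q)"
   using finI by (simp add: finsum_addf finsum_rdistr Pi_iff)
  also have "... = a ** (\<Oplus>j:I. gm (~ l) i p j ** G j q) \<oplus> b ** (\<Oplus>j:I. gm (~ l) i p j ** G' j q)"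
   using that(1,2) i unfolding Rel_def by simp
  also have "... = (\<Oplus>j:I. a ** (gm (~ l) i p j ** G j q) \<oplus> b ** (gm (~ l) i p j ** G' j q))"
   using finI by (simp add: finsum_addf finsum_rdistr Pi_iff)
  also have "... = (\<Oplus>j:I. gm (~ l) i p j ** (a ** G j q \<oplus> b ** G' j q))"
   by (rule finsum_cong') (auto simp: r_distr m_lcomm)
  finally show "(\<Oplus>j:I. (a ** G p j \<oplus> b ** G' p j) ** gm l i j q) = (\<Oplus>j:I. gm (~ l) i p j ** (a ** G j q \<oplus> b ** G' j q))" .
 qed
 obtain f :: "'i => nat" where f: "inj_on f I" using finite_imp_inj_to_nat_seg[OF finI] by blast
  \<comment> \<open>The symmetrization of the intertwiner is used unless it vanishes, when the intertwiner is
    antisymmetric; in both cases the entries on one side of the diagonal determine the matrix.\<close>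
 obtain y eta where y: "y : {\<zero>, \<one>}" and eta: "eta : {\<one>, \<ominus> \<one>}"
  and sym: "!!p q. p : I ==> q : I ==> g q p \<oplus> y ** g p q = eta ** (g p q \<oplus> y ** g q p)"
  and nz': "EX p:I. EX q:I. g p q \<oplus> y ** g q p ~= \<zero>"
 proof (cases "EX p:I. EX q:I. g p q \<oplus> g q p ~= \<zero>")
  case True
  thus thesis using g by (intro that[of \<one> \<one>]) (auto simp: a_comm)
 next
  case False
  have anti: "g q p = \<ominus> \<one> ** g p q" if "p : I" "q : I" for p q
   using False that g minus_equality[of "g q p" "g p q"] by (auto simp: l_minus)
  have e: "g a b \<oplus> \<zero> ** g b a = g a b" for a b using g by simp
  show thesis
  proof (rule that[of \<zero> "\<ominus> \<one>"], unfold e)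
   show "EX p:I. EX q:I. g p q ~= \<zero>" using nz pq by blast
  qed (auto intro: anti)
 qed
 have yc[simp]: "y <: R" "eta <: R" using y eta by auto
 define H0 where "H0 p q = g p q \<oplus> y ** g q p" for p q
 have H0c[simp]: "H0 p q <: R" for p q using g by (simp add: H0_def)
 have sym0: "H0 q p = eta ** H0 p q" if "p : I" "q : I" for p q using sym[OF that] by (simp add: H0_def)
 obtain p0 q0 where p0: "p0 : I" "q0 : I" "f p0 <= f q0" "H0 p0 q0 ~= \<zero>"
 proof -
  obtain p q where *: "p : I" "q : I" "H0 p q ~= \<zero>" using nz' by (auto simp: H0_def)
  show thesis
  proof (cases "f p <= f q")
   case False
   have "H0 q p ~= \<zero>" using sym0[OF *(2,1)] *(3) by auto
   thus thesis using that[of q p] * False by simp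
  qed (use that * in blast)
 qed
 \<comment> \<open>Scaling the entry at \<open>(p0, q0)\<close> to one removes it from the list of
   parameters.\<close>
 define c where "c = inv (H0 p0 q0)"
 have c[simp]: "c <: R" "c ** H0 p0 q0 = \<one>" using inv_closed inv_left p0(4) by (auto simp: c_def)
 define H where "H p q = c ** g p q \<oplus> (c ** y) ** g q p" for p q
 have H_eq: "H p q = c ** H0 p q" for p q using g by (simp add: H_def H0_def r_distr m_assoc)
 have Hc[simp]: "H p q <: R" for p q by (simp add: H_eq)
 have RH: "Rel H" unfolding H_def by (rule lin[OF R1 R2]) (use g in auto)
 have "Rel (%p q. c ** g q p \<oplus> (c ** y) ** g p q)" by (rule lin[OF R2 R1]) (use g in auto)
 hence RT: "Rel (%p q. H q p)" by (simp add: H_def)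
 \<comment> \<open>The kernel of the transpose of \<open>H\<close>. It is stable under the letters
   and not everything, hence zero.\<close>
 define U where "U = {v : vecs I. ALL p:I. (\<Oplus>j:I. H j p ** v j) = \<zero>}"
 have U0: "v = (%_. \<zero>)" if v: "v : U" for v
 proof (rule ccontr)
  assume "v ~= (%_. \<zero>)"
  have "fun_subspace U"
   unfolding fun_subspace_def
  proof (intro conjI ballI)
   show "U <= UNIV \<rightarrow> carrier R" by (auto simp: U_def vecs_def)
   show "(%x. \<zero>) : U" by (simp add: U_def vecs_def finsum_all_zero)
   show "(%x. u x \<oplus> v x) : U" if u: "u : U" and v: "v : U" for u v
   proof -
    have [simp]: "u j <: R" "v j <: R" for j using u v by (auto simp: U_def vecs_def)
    have "(\<Oplus>j:I. H j p ** (u j \<oplus> v j)) = (\<Oplus>j:I. H j p ** u j) \<oplus> (\<Oplus>j:I. H j p ** v j)" for p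
     by (simp add: r_distr finsum_addf Pi_iff)
    thus ?thesis using u v by (auto simp: U_def vecs_def)
   qed
   show "(%x. b ** u x) : U" if b: "b <: R" and u: "u : U" for b u
   proof -
    have [simp]: "u j <: R" for j using u by (auto simp: U_def vecs_def)
    have "(\<Oplus>j:I. H j p ** (b ** u j)) = b ** (\<Oplus>j:I. H j p ** u j)" for p
     using b finI by (simp add: m_lcomm finsum_rdistr Pi_iff)
    thus ?thesis using u b by (auto simp: U_def vecs_def)
   qed
  qed
  moreover have "U <= vecs I" by (auto simp: U_def)
  moreover have "mat_app I (letter l a) u : U" if a: "a : letters" and u: "u : U" for a u
  proof -
   have uv: "u : vecs I" and z: "!!p. p : I ==> (\<Oplus>j:I. H j p ** u j) = \<zero>" using u by (auto simp: U_def)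
   note [simp] = vecsD(1)[OF uv]
   have HM: "(\<Oplus>j:I. H j p ** letter l a j q) = (\<Oplus>j:I. letter (~ l) a p j ** H q j)" if pq: "p : I" "q : I" for p q
   proof (cases "snd a")
    case True
    have "(\<Oplus>j:I. H q j ** gm l (fst a) j p) = (\<Oplus>j:I. gm (~ l) (fst a) q j ** H j p)" using RH a pq by (auto simp: Rel_def)
    thus ?thesis using True by (simp add: letter_def m_comm)
   next
    case False
    thus ?thesis using RT a pq by (auto simp: Rel_def letter_def)
   qed
   have "(\<Oplus>j:I. H j p ** mat_app I (letter l a) u j) = \<zero>" if p: "p : I" for p
   proof -
    have "(\<Oplus>j:I. H j p ** mat_app I (letter l a) u j) = (\<Oplus>j:I. \<Oplus>q:I. H j p ** letter l a j q ** u q)"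
     by (rule finsum_cong') (use finI in "auto simp: mat_app_def finsum_rdistr m_assoc intro!: finsum_closed")
    also have "... = (\<Oplus>q:I. \<Oplus>j:I. H j p ** letter l a j q ** u q)" by (rule finsum_swap) (use finI in auto)
    also have "... = (\<Oplus>q:I. \<Oplus>j:I. letter (~ l) a p j ** (H q j ** u q))"
    proof (rule finsum_cong')
     fix q assume q: "q : I"
     have "(\<Oplus>j:I. H j p ** letter l a j q ** u q) = (\<Oplus>j:I. H j p ** letter l a j q) ** u q" using finI by (simp add: finsum_ldistr Pi_iff)
     also have "... = (\<Oplus>j:I. letter (~ l) a p j ** H q j ** u q)" unfolding HM[OF p q] using finI by (simp add: finsum_ldistr Pi_iff)
     finally show "(\<Oplus>j:I. H j p ** letter l a j q ** u q) = (\<Oplus>j:I. letter (~ l) a p j ** (H q j ** u q))" by (simp add: m_assoc)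
    qed (auto intro!: finsum_closed)
    also have "... = (\<Oplus>j:I. \<Oplus>q:I. letter (~ l) a p j ** (H q j ** u q))" by (rule finsum_swap) (use finI in auto)
    also have "... = (\<Oplus>j:I. letter (~ l) a p j ** (\<Oplus>q:I. H q j ** u q))"
     by (rule finsum_cong') (use finI in "auto simp: finsum_rdistr Pi_iff intro!: finsum_closed")
    also have "... = \<zero>" by (rule finsum_all_zero) (simp add: z)
    finally show ?thesis .
   qed
   thus ?thesis using mat_app_vecs[OF _ uv, of "letter l a"] by (simp add: U_def)
  qed
  ultimately have "vecs I <= U" using irred_repD[OF letters_irreducible] v \<open>v ~= (%_. \<zero>)\<close> by blast
  hence "(%j. if j = p0 then \<one> else \<zero>) : U" using unit_vec_in_vecs[OF p0(1)] by blast
  hence "(\<Oplus>j:I. H j q0 ** (if j = p0 then \<one> else \<zero>)) = \<zero>" using p0(2) by (auto simp: U_def)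
  hence "H p0 q0 = \<zero>" using finsum_delta_mult(3)[OF finI p0(1), of "%j. H j q0"] by simp
  thus False by (simp add: H_eq)
 qed
 define L where "L = {(p, q) : I \<times> I. f p <= f q}"
 define P where "P = (%(p, q). H p q) ` (L - {(p0, q0)})"
 have finL: "finite L" using finI by (auto simp: L_def intro: finite_subset[of _ "I \<times> I"])
 \<comment> \<open>Coefficients, as a linear form in the generic matrices, of entry \<open>j\<close>
   of the difference of the two sides of the intertwining equation.\<close>
 define K where "K j s = (if fst (fst s) = l then (if snd s = snd j then H (fst j) (snd (fst s)) else \<zero>)
   else (if snd (fst s) = fst j then \<ominus> H (snd s) (snd j) else \<zero>))" for j :: "'i \<times> 'i" and s :: "(bool \<times> 'i) \<times> 'i"
 have "r * card (I \<times> I) <= d + card P"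
 proof (rule parameter_count)
  show "finite (I \<times> I)" using finI by simp
  show "finite P" using finL by (simp add: P_def)
  show PR: "P <= carrier R" by (auto simp: P_def)
  hence YP: "Y Un P <= carrier R" using Y by blast
  note cl = subringE[OF subfieldE(1)[OF acl_subfield[OF k YP]]]
  have HL: "H p q : acl k (Y Un P)" if "(p, q) : L" for p q
  proof (cases "(p, q) = (p0, q0)")
   case True
   thus ?thesis using cl(3) by (simp add: H_eq)
  next
   case False
   hence "H p q : P" using that by (force simp: P_def)
   thus ?thesis using acl_incl[OF k YP] by blast
  qed
  have "H p q : acl k (Y Un P)" if "p : I" "q : I" for p q
  proof (cases "f p <= f q")
   case False
   have "eta : acl k (Y Un P)" using eta cl(3,5) by auto
   moreover have "H q p : acl k (Y Un P)" using HL that False by (simp add: L_def)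
   moreover have "H p q = eta ** H q p" using sym0[OF that(2,1)] by (simp add: H_eq m_lcomm)
   ultimately show ?thesis using cl(6) by simp
  qed (use HL that in "simp add: L_def")
  thus "K j s : acl k (Y Un P)" if "j : I \<times> I" "s : pairs" for j s using that cl(2,5) by (auto simp: K_def)
 next
  fix alpha j assume alpha: "!!j. alpha j <: R" and z: "!!s. s : pairs ==> (\<Oplus>j:I \<times> I. alpha j ** K j s) = \<zero>" and j: "j : I \<times> I"
  \<comment> \<open>One column of a dependence between the relations is a vector in the kernel
    \<open>U\<close>.\<close>
  define v where "v p = (if p : I then alpha (p, snd j) else \<zero>)" for p
  have "(\<Oplus>p:I. H p P' ** v p) = \<zero>" if P': "P' : I" for P'
  proof -
   have "(\<Oplus>p:I. H p P' ** v p) = (\<Oplus>p:I. \<Oplus>q:I. (if q = snd j then \<one> else \<zero>) ** (alpha (p, q) ** H p P'))"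
    by (rule finsum_cong') (use finI alpha j finsum_delta_mult(1)[OF finI, of "snd j" "%q. alpha (_, q) ** H _ P'"] in "auto simp: v_def m_comm")
   also have "... = (\<Oplus>p:I. \<Oplus>q:I. alpha (p, q) ** K (p, q) ((l, P'), snd j))"
    by (rule finsum_finsum_cong) (use alpha in "auto simp: K_def")
   also have "... = (\<Oplus>j':I \<times> I. alpha j' ** K j' ((l, P'), snd j))"
    by (rule finsum_product[symmetric]) (use finI alpha in "auto simp: K_def")
   finally show ?thesis using z[of "((l, P'), snd j)"] P' j by auto
  qed
  hence "v : U" using alpha by (simp add: U_def vecs_def v_def)
  hence "v (fst j) = \<zero>" using U0 by (metis (full_types))
  thus "alpha j = \<zero>" using j by (auto simp: v_def)
 next
  fix j i assume j: "j : I \<times> I" and i: "i < r"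
  obtain p q where pq: "j = (p, q)" "p : I" "q : I" using j by blast
  have 1: "(\<Oplus>Q:I. K j ((l, P'), Q) ** gm l i P' Q) = H p P' ** gm l i P' q" for P'
  proof -
   have "(\<Oplus>Q:I. K j ((l, P'), Q) ** gm l i P' Q) = (\<Oplus>Q:I. (if Q = q then \<one> else \<zero>) ** (H p P' ** gm l i P' Q))"
    by (rule finsum_cong') (auto simp: K_def pq)
   thus ?thesis using finsum_delta_mult(1)[OF finI pq(3), of "%Q. H p P' ** gm l i P' Q"] by simp
  qed
  have 2: "(\<Oplus>P':I. K j ((~ l, P'), Q) ** gm (~ l) i P' Q) = \<ominus> (gm (~ l) i p Q ** H Q q)" for Q
  proof -
   have "(\<Oplus>P':I. K j ((~ l, P'), Q) ** gm (~ l) i P' Q) = (\<Oplus>P':I. (if P' = p then \<one> else \<zero>) ** (\<ominus> (gm (~ l) i P' Q ** H Q q)))"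
    by (rule finsum_cong') (auto simp: K_def pq l_minus m_comm)
   thus ?thesis using finsum_delta_mult(1)[OF finI pq(2), of "%P'. \<ominus> (gm (~ l) i P' Q ** H Q q)"] by simp
  qed
  have Kc: "K j s <: R" for s by (simp add: K_def)
  have "(\<Oplus>s:pairs. K j s ** gm (fst (fst s)) i (snd (fst s)) (snd s)) =
    (\<Oplus>P':I. \<Oplus>Q:I. K j ((l, P'), Q) ** gm l i P' Q) \<oplus> (\<Oplus>P':I. \<Oplus>Q:I. K j ((~ l, P'), Q) ** gm (~ l) i P' Q)"
   using pairs_sum[of "%s. K j s ** gm (fst (fst s)) i (snd (fst s)) (snd s)" l] Kc by simp
  also have "(\<Oplus>P':I. \<Oplus>Q:I. K j ((~ l, P'), Q) ** gm (~ l) i P' Q) = (\<Oplus>Q:I. \<Oplus>P':I. K j ((~ l, P'), Q) ** gm (~ l) i P' Q)"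
   by (rule finsum_swap) (use finI Kc in auto)
  also have "(\<Oplus>P':I. \<Oplus>Q:I. K j ((l, P'), Q) ** gm l i P' Q) \<oplus> (\<Oplus>Q:I. \<Oplus>P':I. K j ((~ l, P'), Q) ** gm (~ l) i P' Q) =
    (\<Oplus>P':I. H p P' ** gm l i P' q) \<ominus> (\<Oplus>Q:I. gm (~ l) i p Q ** H Q q)"
   unfolding 1 2 by (simp add: finsum_ominus minus_eq)
  also have "... = \<zero>" using RH i pq by (auto simp: Rel_def r_neg minus_eq intro!: finsum_closed)
  finally show "(\<Oplus>s:pairs. K j s ** gm (fst (fst s)) i (snd (fst s)) (snd s)) = \<zero>" .
 qed
 moreover have "card P <= card L - 1"
  using card_image_le[of "L - {(p0, q0)}" "%(p, q). H p q"] finL p0 by (auto simp: P_def L_def card_Diff_singleton)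
 ultimately have "r * (card I * card I) <= d + (card L - 1)" by (simp add: card_cartesian_product)
 thus False using count_intertwiner[OF bound card_le_pairs[OF finI f]] by (simp add: L_def)
qed

lemma word_append: "p : I ==> q : I ==> word l (a @ b) p q = (\<Oplus>j:I. word l a p j ** word l b j q)"
proof (induction a arbitrary: p)
 case Nil
 thus ?case using finsum_delta_mult(2)[OF finI Nil(1), of "%j. word l b j q"] by simp
next
 case (Cons c a)
 have "word l ((c # a) @ b) p q = (\<Oplus>i:I. \<Oplus>j:I. letter l c p i ** word l a i j ** word l b j q)"
  unfolding append_Cons word.simps by (rule finsum_cong') (use Cons finI in "auto simp: finsum_rdistr m_assoc Pi_iff intro!: finsum_closed")
 also have "... = (\<Oplus>j:I. \<Oplus>i:I. letter l c p i ** word l a i j ** word l b j q)" by (rule finsum_swap) (use finI in auto)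
 also have "... = (\<Oplus>j:I. word l (c # a) p j ** word l b j q)"
  unfolding word.simps by (rule finsum_cong') (use finI in "auto simp: finsum_ldistr intro!: finsum_closed")
 finally show ?case .
qed

lemma word_single: "q : I ==> word l [a] p q = letter l a p q"
 using finsum_delta_mult(3)[OF finI, of q "%j. letter l a p j"] by simp

text \<open>Words under concatenation form the monoid of the Frobenius--Schur argument.
  Irreducibility and the absence of intertwiners follow from the same properties for the
  letters.\<close>

theorem words_independent:
 assumes C: "!!s q. C s q <: R"
  and rel: "!!w. set w <= letters ==> (\<Oplus>s:UNIV \<times> I. \<Oplus>q:I. C s q ** word (fst s) w (snd s) q) = \<zero>"
  and s: "s : UNIV \<times> I" "q : I"
 shows "C s q = \<zero>"
proof (rule frobenius_schur[where W = "{w. set w <= letters}" and mul = "(@)" and e = "[]" and rho = word, OF roots finI finite_UNIV])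
 show "irred_rep I (word l) {w. set w <= letters}" for l
  unfolding irred_rep_def
 proof (intro allI impI, elim conjE)
  fix U assume U: "fun_subspace U" "U <= vecs I" "ALL w:{w. set w <= letters}. ALL u:U. mat_app I (word l w) u : U" "EX u:U. u ~= (%_. \<zero>)"
  show "vecs I <= U"
  proof (rule irred_repD[OF letters_irreducible U(1,2) _ U(4)])
   fix a u assume "a : letters" "u : U"
   hence "mat_app I (word l [a]) u : U" using U(3) by simp
   moreover have "mat_app I (word l [a]) u = mat_app I (letter l a) u"
    unfolding mat_app_def by (intro ext if_cong HOL.refl finsum_cong') (use U(2) \<open>u : U\<close> vecsD(1)[of u I] in "auto simp del: word.simps simp: word_single")
   ultimately show "mat_app I (letter l a) u : U" by simp
  qed
 qed
next
 fix l l' g p q assume l: "l ~= (l' :: bool)" and g: "!!p q. g p q <: R" and pq: "p : I" "q : I"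
  and inter: "!!w p q. w : {w. set w <= letters} ==> p : I ==> q : I ==> (\<Oplus>j:I. g p j ** word l w j q) = (\<Oplus>j:I. word l' w p j ** g j q)"
 show "g p q = \<zero>"
 proof (rule intertwiner_zero[OF g _ pq, where l = l])
  fix a p q assume a: "a : letters" "p : I" "q : I"
  have l': "l' = (~ l)" using l by auto
  have "(\<Oplus>j:I. g p j ** letter l a j q) = (\<Oplus>j:I. g p j ** word l [a] j q)"
   by (rule finsum_cong') (use a g in "auto simp del: word.simps simp: word_single")
  also have "... = (\<Oplus>j:I. word l' [a] p j ** g j q)" by (rule inter) (use a in auto)
  also have "... = (\<Oplus>j:I. letter (~ l) a p j ** g j q)"
   unfolding l' by (rule finsum_cong') (use a g in "auto simp del: word.simps simp: word_single")
  finally show "(\<Oplus>j:I. g p j ** letter l a j q) = (\<Oplus>j:I. letter (~ l) a p j ** g j q)" .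
 qed
qed (use C rel s word_append in auto)

end

section \<open>Generic points\<close>

text \<open>The factors are different ring structures on one type of elements, as is the case for
  quotients of a fixed ring.\<close>

definition prod_ring :: "('u => ('x, 'm) ring_scheme) => ('u => 'x) ring" where
 "prod_ring Q = \<lparr>carrier = {x. ALL t. x t : carrier (Q t)}, monoid.mult = (%x y t. x t **.(Q t) y t),
   one = (%t. \<one>.(Q t)), zero = (%t. \<zero>.(Q t)), add = (%x y t. x t \<oplus>.(Q t) y t)\<rparr>"

lemma prod_ring_simps [simp]:
 "x : carrier (prod_ring Q) \<longleftrightarrow> (ALL t. x t : carrier (Q t))" "\<one>.(prod_ring Q) = (%t. \<one>.(Q t))" "\<zero>.(prod_ring Q) = (%t. \<zero>.(Q t))"
 "x **.(prod_ring Q) y = (%t. x t **.(Q t) y t)" "x \<oplus>.(prod_ring Q) y = (%t. x t \<oplus>.(Q t) y t)"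
 by (simp_all add: prod_ring_def)

lemma prod_ring_cring:
 assumes "!!t. cring (Q t)"
 shows "cring (prod_ring Q)"
proof (rule cringI)
 have q: "ring (Q t)" "abelian_group (Q t)" "comm_monoid (Q t)" for t
  using assms[of t] by (auto simp: cring_def ring_def)
 note r = ring.ring_simprules[OF q(1)]
 show "abelian_group (prod_ring Q)"
 proof (rule abelian_groupI)
  fix x assume x: "x : carrier (prod_ring Q)"
  show "EX y:carrier (prod_ring Q). y \<oplus>.(prod_ring Q) x = \<zero>.(prod_ring Q)"
   by (rule bexI[of _ "%t. \<ominus>.(Q t) x t"]) (use x in "auto simp: r")
 qed (auto simp: r intro!: ext)
 show "comm_monoid (prod_ring Q)"
  by (rule comm_monoidI) (auto simp: r monoid.m_assoc[OF comm_monoid.axioms(1)[OF q(3)]] intro!: ext comm_monoid.m_comm[OF q(3)])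
qed (auto simp: ring.ring_simprules[OF cring.axioms(1)[OF assms]] cring.cring_simprules(13)[OF assms] intro!: ext)

lemma prod_ring_eval: "(%x. x t) : ring_hom (prod_ring Q) (Q t)"
 by (auto simp: ring_hom_def)

context affine_algebra
begin

lemmas k_cl = subringE[OF k_subring]

lemma k_elem_carrier [simp]: "a : k ==> a <: R"
 using k_cl(1) by blast

lemma k_cancel: "a : k ==> a ~= \<zero> ==> b <: R ==> a ** b = \<zero> ==> b = \<zero>"
proof -
 assume *: "a : k" "a ~= \<zero>" "b <: R" "a ** b = \<zero>"
 obtain c where c: "c <: R" "a ** c = \<one>" using k_unit[OF *(1,2)] by blast
 have "(a ** c) ** b = c ** (a ** b)" using c(1) *(1,3) by (simp add: m_ac)
 thus ?thesis using c * by simp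
qed

text \<open>\<open>R\<close> may have zero divisors, but nonzero elements of \<open>k\<close> can be
  cancelled. Since differences of elements of \<open>k\<close> lie in \<open>k\<close>, a root in
  \<open>k\<close> splits off in the usual way.\<close>

lemma finite_roots:
 assumes "ALL i. c i <: R" "EX i<n. c i ~= \<zero>"
 shows "finite {l : k. (\<Oplus>i:{..<n}. c i ** l [^] (i::nat)) = \<zero>}"
 using assms
proof (induction n arbitrary: c)
 case (Suc n)
 let ?Z = "{l : k. (\<Oplus>i:{..<Suc n}. c i ** l [^] i) = \<zero>}"
 have last: "(\<Oplus>i:{..<Suc n}. c i ** l [^] i) = (\<Oplus>i:{..<n}. c i ** l [^] i) \<oplus> c n ** l [^] n" if "l : k" for l
  unfolding lessThan_Suc using Suc.prems(1) that by (subst finsum_insert) (auto simp: a_comm intro!: finsum_closed)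
 show ?case
 proof (cases "c n = \<zero>")
  case True
  hence "?Z = {l : k. (\<Oplus>i:{..<n}. c i ** l [^] i) = \<zero>}" using last Suc.prems(1) by (auto intro!: finsum_closed)
  thus ?thesis using Suc.IH[of c] Suc.prems True by (auto simp: less_Suc_eq)
 next
  case False
  show ?thesis
  proof (cases "EX l. l : ?Z")
   case False
   thus ?thesis by (metis (no_types, lifting) Collect_empty_eq finite.emptyI mem_Collect_eq)
  next
   case True
   then obtain l where l: "l : k" "(\<Oplus>i:{..<Suc n}. c i ** l [^] i) = \<zero>" by blast
   have "n ~= 0"
   proof
    assume "n = 0"
    thus False using l Suc.prems(1) False by (simp add: lessThan_Suc)
   qed
   then obtain m where m: "n = Suc m" by (metis not0_implies_Suc)
   obtain q where q: "ALL i. q i <: R" "q m = c (Suc m)"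
    "ALL y. (ALL i. y i <: R) --> (\<Oplus>i:{..Suc m}. c i ** y i) = (\<Oplus>k:{..m}. q k ** (y (Suc k) \<ominus> l ** y k))"
    using synthetic_division[of c l m] Suc.prems(1) l by (auto simp: m lessThan_Suc_atMost)
   have "?Z <= insert l {x : k. (\<Oplus>i:{..<n}. q i ** x [^] i) = \<zero>}"
   proof
    fix x assume x: "x : ?Z"
    hence xk: "x : k" by simp
    have "\<zero> = (\<Oplus>i:{..m}. q i ** (x [^] Suc i \<ominus> l ** x [^] i))"
     using q(3)[THEN spec[of _ "%i. x [^] i"]] x xk by (simp add: m lessThan_Suc_atMost)
    also have "... = (\<Oplus>i:{..m}. (x \<ominus> l) ** (q i ** x [^] i))"
    proof (rule finsum_cong')
     fix i
     have "x [^] i <: R" "q i <: R" "x <: R" "l <: R" using xk l q(1) by auto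
     thus "q i ** (x [^] Suc i \<ominus> l ** x [^] i) = (x \<ominus> l) ** (q i ** x [^] i)" unfolding nat_pow_Suc by algebra
    qed (use xk l q(1) in auto)
    also have "... = (x \<ominus> l) ** (\<Oplus>i:{..m}. q i ** x [^] i)"
     by (rule finsum_rdistr[symmetric]) (use xk l q(1) in auto)
    finally have "(x \<ominus> l) ** (\<Oplus>i:{..<n}. q i ** x [^] i) = \<zero>" by (simp add: m lessThan_Suc_atMost)
    moreover have "x \<ominus> l : k" using xk l k_cl(5,7) by (simp add: minus_eq)
    moreover have "(\<Oplus>i:{..<n}. q i ** x [^] i) <: R" using xk q(1) by (intro finsum_closed) auto
    ultimately have "x \<ominus> l = \<zero> \<or> (\<Oplus>i:{..<n}. q i ** x [^] i) = \<zero>" using k_cancel by blast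
    thus "x : insert l {x : k. (\<Oplus>i:{..<n}. q i ** x [^] i) = \<zero>}"
     using xk l(1) by auto
   qed
   moreover have "finite {x : k. (\<Oplus>i:{..<n}. q i ** x [^] i) = \<zero>}"
    by (rule Suc.IH) (use q m False in auto)
   ultimately show ?thesis by (meson finite_insert finite_subset)
  qed
 qed
qed simp

text \<open>Parameters range over all functions into the type of \<open>R\<close>, so that no side
  condition on \<open>t\<close> has to be carried along; \<open>clip\<close> moves their values into
  \<open>k\<close>, with default zero.\<close>

definition clip :: "'a => 'a" where
 "clip a = (if a : k then a else \<zero>)"

inductive_set poly_fun :: "'j set => (('j => 'a) => 'a) set" for A where
 const: "c : k ==> (%t. c) : poly_fun A"
| coord: "j : A ==> (%t. clip (t j)) : poly_fun A"
| add: "f : poly_fun A ==> g : poly_fun A ==> (%t. f t \<oplus> g t) : poly_fun A"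
| mult: "f : poly_fun A ==> g : poly_fun A ==> (%t. f t ** g t) : poly_fun A"

lemma clip_k [simp]: "clip a : k" "a : k ==> clip a = a"
 using k_cl(2) by (auto simp: clip_def)

lemma poly_fun_k: "f : poly_fun A ==> f t : k"
 by (induction rule: poly_fun.induct) (auto simp: k_cl(6,7))

lemma poly_fun_cong: "f : poly_fun A ==> (ALL j:A. t j = t' j) ==> f t = f t'"
 by (induction rule: poly_fun.induct) auto

lemma poly_fun_mono: "f : poly_fun A ==> A <= A' ==> f : poly_fun A'"
 by (induction rule: poly_fun.induct) (auto intro: poly_fun.intros)

text \<open>Restriction to a line reduces questions on polynomial functions to one variable.\<close>

lemma poly_fun_line:
 assumes "f : poly_fun A"
 shows "EX p. set p <= carrier R & (ALL l:k. f (%j. clip (t j) \<oplus> l ** (clip (t' j) \<ominus> clip (t j))) = eval p l)"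
 using assms
proof (induction rule: poly_fun.induct)
 case (const c)
 thus ?case by (intro exI[of _ "[c]"]) auto
next
 case (coord j)
 have "clip (t j) \<oplus> l ** (clip (t' j) \<ominus> clip (t j)) : k" if "l : k" for l
  using that by (simp add: minus_eq k_cl(5-7))
 thus ?case by (intro exI[of _ "[clip (t' j) \<ominus> clip (t j), clip (t j)]"]) (auto simp: m_comm a_comm)
next
 case (add f g)
 then obtain p q where "set p <= carrier R" "ALL l:k. f (%j. clip (t j) \<oplus> l ** (clip (t' j) \<ominus> clip (t j))) = eval p l"
  "set q <= carrier R" "ALL l:k. g (%j. clip (t j) \<oplus> l ** (clip (t' j) \<ominus> clip (t j))) = eval q l" by blast
 thus ?case using poly_add_in_carrier by (intro exI[of _ "poly_add p q"]) (simp add: eval_poly_add del: poly_add.simps)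
next
 case (mult f g)
 then obtain p q where "set p <= carrier R" "ALL l:k. f (%j. clip (t j) \<oplus> l ** (clip (t' j) \<ominus> clip (t j))) = eval p l"
  "set q <= carrier R" "ALL l:k. g (%j. clip (t j) \<oplus> l ** (clip (t' j) \<ominus> clip (t j))) = eval q l" by blast
 thus ?case using poly_mult_in_carrier by (intro exI[of _ "poly_mult p q"]) (simp add: eval_poly_mult del: poly_mult.simps)
qed

lemma finite_eval_zeros:
 assumes p: "set p <= carrier R" and l: "l : k" "eval p l ~= \<zero>"
 shows "finite {l : k. eval p l = \<zero>}"
proof -
 have ev: "eval p l = (\<Oplus>i:{..<length p}. coeff p i ** l [^] i)" if "l : k" for l using eval_eq_finsum[OF p] that by simp
 have c: "ALL i. coeff p i <: R" using coeff_in_carrier[OF p] by blast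
 have "EX i<length p. coeff p i ~= \<zero>"
 proof (rule ccontr)
  assume "~ (EX i<length p. coeff p i ~= \<zero>)"
  hence "(\<Oplus>i:{..<length p}. coeff p i ** l [^] i) = \<zero>" using l(1) by (intro finsum_all_zero) auto
  thus False using ev l by simp
 qed
 hence "finite {l : k. (\<Oplus>i:{..<length p}. coeff p i ** l [^] i) = \<zero>}" by (rule finite_roots[OF c])
 moreover have "{l : k. eval p l = \<zero>} = {l : k. (\<Oplus>i:{..<length p}. coeff p i ** l [^] i) = \<zero>}" using ev by auto
 ultimately show ?thesis by simp
qed

text \<open>On the line joining a point where \<open>f\<close> is nonzero to one where
  \<open>g\<close> is, both restrict to polynomials with finitely many zeros in the infinite
  \<open>k\<close>.\<close>

lemma poly_fun_product_nonzero:
 assumes f: "f : poly_fun A" "f t0 ~= \<zero>" and g: "g : poly_fun A" "g t1 ~= \<zero>"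
 shows "EX t. f t ** g t ~= \<zero>"
proof -
 define line where "line l = (%j. clip (t0 j) \<oplus> l ** (clip (t1 j) \<ominus> clip (t0 j)))" for l
 have clip: "h t = h (%j. clip (t j))" if "h : poly_fun A" for h t using that by (induction rule: poly_fun.induct) auto
 have l0: "line \<zero> = (%j. clip (t0 j))" and l1: "line \<one> = (%j. clip (t1 j))"
 proof -
  have "x \<oplus> \<one> ** (y \<ominus> x) = y" if "x <: R" "y <: R" for x y using that by algebra
  thus "line \<zero> = (%j. clip (t0 j))" "line \<one> = (%j. clip (t1 j))" by (auto simp: line_def)
 qed
 obtain p where p: "set p <= carrier R" "ALL l:k. f (line l) = eval p l" using poly_fun_line[OF f(1), of t0 t1] unfolding line_def by blast
 obtain q where q: "set q <= carrier R" "ALL l:k. g (line l) = eval q l" using poly_fun_line[OF g(1), of t0 t1] unfolding line_def by blast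
 have "finite {l : k. eval p l = \<zero>}"
  by (rule finite_eval_zeros[OF p(1) k_cl(2)]) (use p(2) k_cl(2) f clip[OF f(1), of t0] l0 in auto)
 moreover have "finite {l : k. eval q l = \<zero>}"
  by (rule finite_eval_zeros[OF q(1) k_cl(3)]) (use q(2) k_cl(3) g clip[OF g(1), of t1] l1 in auto)
 ultimately have "finite ({l : k. eval p l = \<zero>} Un {l : k. eval q l = \<zero>})" by blast
 hence "~ k <= {l : k. eval p l = \<zero>} Un {l : k. eval q l = \<zero>}" using k_infinite finite_subset by blast
 then obtain l where l: "l : k" "f (line l) ~= \<zero>" "g (line l) ~= \<zero>" using p(2) q(2) by auto
 hence "f (line l) ** g (line l) ~= \<zero>" using k_cancel[OF poly_fun_k[OF f(1)] l(2)] poly_fun_k[OF g(1)] by auto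
 thus ?thesis by blast
qed

text \<open>The ideal of functions vanishing off the zero set of a nonzero polynomial function is proper,
  and a maximal ideal above it turns every nonzero polynomial function into a unit.\<close>

lemma generic_field:
 fixes m :: "('j => 'a) => 'a set"
 assumes m: "ALL t. maximalideal (m t) R"
 obtains F :: "((((('j => 'a) => 'a set) set list \<times> nat) multiset) => (('j => 'a) => 'a set) set) ring" and cl
 where "field F" "ring.has_roots F" "cl : ring_hom (prod_ring (%t. R Quot m t)) F"
  "ALL f:poly_fun UNIV. (EX t. f t ~= \<zero>) --> cl (%t. m t +> f t) ~= \<zero>.F"
proof -
 let ?Q = "%t. R Quot m t" and ?P = "prod_ring (%t. R Quot m t)"
 have Q: "field (?Q t)" for t using maximalideal.quotient_is_field[OF m[rule_format] cring_axioms] .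
 have Qc: "cring (?Q t)" for t using Q field.is_ring fieldE(1) by blast
 have id: "ideal (m t) R" for t using m maximalideal.axioms(1) by blast
 have hom: "(+>) (m t) : ring_hom R (?Q t)" for t by (rule ideal.rcos_ring_hom[OF id])
 interpret P: cring ?P by (rule prod_ring_cring[OF Qc])
 have Q0[simp]: "\<zero>.(?Q t) : carrier (?Q t)" "\<one>.(?Q t) : carrier (?Q t)" for t
  using P.zero_closed P.one_closed by (simp_all add: all_conj_distrib)
 note qr = ring.ring_simprules[OF cring.axioms(1)[OF Qc]]
 define V where "V x f \<longleftrightarrow> f : poly_fun UNIV & (EX t. f t ~= \<zero>) & (ALL t. f t ~= \<zero> --> x t = \<zero>.(?Q t))" for x f
 define J where "J = {x : carrier ?P. EX f. V x f}"
 obtain a where a: "a : k" "a ~= \<zero>" using k_infinite by (metis finite.emptyI finite_insert insertCI infinite_super subsetI)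
 have J: "ideal J ?P"
 proof (rule P.ideal_by_closure)
  show "J <= carrier ?P" by (auto simp: J_def)
  have "V \<zero>.?P (%t. a)" using a by (auto simp: V_def intro: poly_fun.const)
  thus "\<zero>.?P : J" unfolding J_def using P.zero_closed by blast
  show "x \<oplus>.?P y : J" if xy: "x : J" "y : J" for x y
  proof -
   \<comment> \<open>The product of the two witnesses is a witness for the sum; its nonvanishing
     somewhere is the point at which \<open>k\<close> must be infinite.\<close>
   obtain f g where f: "V x f" and g: "V y g" using xy by (auto simp: J_def)
   obtain t0 t1 where t: "f t0 ~= \<zero>" "g t1 ~= \<zero>" using f g by (auto simp: V_def)
   have fg: "f : poly_fun UNIV" "g : poly_fun UNIV" using f g by (auto simp: V_def)
   obtain t2 where "f t2 ** g t2 ~= \<zero>" using poly_fun_product_nonzero[OF fg(1) t(1) fg(2) t(2)] by blast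
   moreover have "f t ~= \<zero> & g t ~= \<zero>" if "f t ** g t ~= \<zero>" for t
    using that poly_fun_k[OF fg(1), of t] poly_fun_k[OF fg(2), of t] by auto
   ultimately have "V (x \<oplus>.?P y) (%t. f t ** g t)"
    using f g poly_fun.mult[OF fg] by (auto simp: V_def qr)
   moreover have "x \<oplus>.?P y <: ?P" using xy P.add.m_closed by (simp only: J_def mem_Collect_eq)
   ultimately show ?thesis unfolding J_def by blast
  qed
  show "r **.?P x : J" if r: "r <: ?P" and x: "x : J" for r x
  proof -
   obtain f where f: "V x f" using x by (auto simp: J_def)
   have "V (r **.?P x) f" using f r by (auto simp: V_def qr)
   moreover have "r **.?P x <: ?P" using r x P.m_closed by (simp only: J_def mem_Collect_eq)
   ultimately show ?thesis unfolding J_def by blast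
  qed
 qed
 have one: "\<one>.?P ~: J"
 proof
  assume "\<one>.?P : J"
  then obtain t where "\<one>.(?Q t) = \<zero>.(?Q t)" by (auto simp: J_def V_def)
  thus False using domain.one_not_zero[OF field.axioms(1)[OF Q]] by blast
 qed
 obtain M where M: "maximalideal M ?P" "J <= M" using P.maximal_containing[OF J one] by blast
 have Mi: "ideal M ?P" by (rule maximalideal.axioms(1)[OF M(1)])
 interpret F1: field "?P Quot M" by (rule maximalideal.quotient_is_field[OF M(1) P.cring_axioms])
 obtain L :: "((((('j => 'a) => 'a set) set list \<times> nat) multiset) => (('j => 'a) => 'a set) set) ring" and ic
  where L: "algebraic_closure L (ic ` carrier (?P Quot M))" and ih: "ic : ring_hom (?P Quot M) L"
  by (rule F1.exists_closure) (rule that)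
 interpret ac: algebraic_closure L "ic ` carrier (?P Quot M)" by (rule L)
 define cl where "cl x = ic (M +>\<^bsub>?P\<^esub> x)" for x
 have cl: "cl : ring_hom ?P L"
  using ring_hom_trans[OF ideal.rcos_ring_hom[OF Mi] ih] by (simp add: cl_def[abs_def] comp_def)
 have cl_J: "cl z = \<zero>.L" if z: "z : J" for z
 proof -
  have "\<zero>.(?P Quot M) = M" by (simp add: FactRing_def)
  hence "M +>\<^bsub>?P\<^esub> z = \<zero>.(?P Quot M)" using P.a_rcos_zero[OF Mi, of z] z M(2) by blast
  thus ?thesis unfolding cl_def using ring_hom_zero[OF ih F1.is_ring ac.is_ring] by simp
 qed
 have "cl (%t. m t +> f t) ~= \<zero>.L" if f: "f : poly_fun UNIV" and ne: "EX t. f t ~= \<zero>" for f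
 proof
  assume z: "cl (%t. m t +> f t) = \<zero>.L"
  let ?x = "%t. m t +> f t"
  have "ALL t. EX u. f t ~= \<zero> --> u <: R & f t ** u = \<one>" using k_unit[OF poly_fun_k[OF f]] by blast
  then obtain u where u: "!!t. f t ~= \<zero> ==> u t <: R & f t ** u t = \<one>" by metis
  \<comment> \<open>\<open>y\<close> inverts \<open>f\<close> where \<open>f\<close> is nonzero, and
    the complement \<open>w\<close> of the product belongs to \<open>J\<close>. If the class of
    \<open>f\<close> were zero, the classes of the two summands of \<open>1\<close> would both
    vanish.\<close>
  define y where "y t = (if f t ~= \<zero> then m t +> u t else \<zero>.(?Q t))" for t
  define w where "w t = (if f t ~= \<zero> then \<zero>.(?Q t) else \<one>.(?Q t))" for t
  have fc: "f t <: R" for t using poly_fun_k[OF f] by simp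
  have x: "?x <: ?P" using ring_hom_closed[OF hom fc] by simp
  have y: "y <: ?P" using u ring_hom_closed[OF hom] by (auto simp: y_def)
  have w: "w <: ?P" by (auto simp: w_def)
  have "?x t **.(?Q t) y t \<oplus>.(?Q t) w t = \<one>.(?Q t)" for t
  proof (cases "f t = \<zero>")
   case True
   thus ?thesis using ring_hom_closed[OF hom fc[of t]] by (simp add: y_def w_def qr)
  next
   case False
   have "?x t **.(?Q t) (m t +> u t) = m t +> (f t ** u t)"
    using ring_hom_mult[OF hom fc[of t], of "u t"] u[OF False] by simp
   thus ?thesis using False u[OF False] ring_hom_one[OF hom] by (simp add: y_def w_def qr)
  qed
  hence "?x **.?P y \<oplus>.?P w = \<one>.?P" by simp
  hence "cl ?x **.L cl y \<oplus>.L cl w = \<one>.L"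
   using ring_hom_add[OF cl P.m_closed[OF x y] w] ring_hom_mult[OF cl x y] ring_hom_one[OF cl] by simp
  moreover have "w : J" using w f ne by (auto simp: J_def V_def w_def)
  ultimately show False using z cl_J ring_hom_closed[OF cl y] ac.one_not_zero by simp
 qed
 thus thesis
  using that[OF ac.field_axioms ac.algebraically_closed_has_roots[OF ac.algebraically_closed_axioms] cl] by blast
qed

end

section \<open>Independence of the parameters\<close>

context affine_algebra
begin

text \<open>An algebraic relation of the coordinate \<open>j\<close> over the coordinates in
  \<open>A\<close> lifts to a polynomial function of class zero. One of its coefficients is nonzero
  at some point, and varying the coordinate \<open>j\<close> alone finds a point where the function
  does not vanish, so its class is nonzero after all.\<close>

lemma coordinates_independent:
 fixes m :: "('j => 'a) => 'a set"
 assumes m: "ALL t. maximalideal (m t) R" and F: "field F" and cl: "cl : ring_hom (prod_ring (%t. R Quot m t)) F"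
  and nz: "ALL f:poly_fun UNIV. (EX t. f t ~= \<zero>) --> cl (%t. m t +> f t) ~= \<zero>.F"
  and j: "j ~: A"
 shows "cl (%t. m t +> clip (t j)) ~: field.acl F ((%r. cl (%t. m t +> r)) ` k) ((%j. cl (%t. m t +> clip (t j))) ` A)"
proof
 interpret F: field F by (rule F)
 let ?P = "prod_ring (%t :: 'j => 'a. R)"
 have Pc: "cring ?P" by (rule prod_ring_cring) (rule cring_axioms)
 interpret P: cring ?P by (rule Pc)
 have hom: "(+>) (m t) : ring_hom R (R Quot m t)" for t using m by (intro ideal.rcos_ring_hom maximalideal.axioms(1)) blast
 define Cl where "Cl f = cl (%t. m t +> f t)" for f
 have "(%f t. m t +> f t) : ring_hom ?P (prod_ring (%t. R Quot m t))"
  using ring_hom_closed[OF hom] ring_hom_mult[OF hom] ring_hom_add[OF hom] ring_hom_one[OF hom] by (intro ring_hom_memI) auto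
 from ring_hom_trans[OF this cl] have Clh: "Cl : ring_hom ?P F" by (simp add: Cl_def[abs_def] comp_def)
 interpret c: ring_hom_cring ?P F Cl by (intro ring_hom_cring.intro ring_hom_cring_axioms.intro Clh Pc F.cring_axioms)
 have pfP: "f <: ?P" if "f : poly_fun A" for f :: "('j => 'a) => 'a" and A using poly_fun_k[OF that] by simp
 let ?h = "%r. Cl (%t. r)" and ?x = "%j. Cl (%t. clip (t j))"
 have xc: "?x j <: F" for j using c.hom_closed[of "%t. clip (t j)"] by simp
 have hk: "?h ` k <= carrier F" "?x ` A <= carrier F" using xc c.hom_closed[of "%t. _"] by auto
 let ?A = "generate_ring F (?h ` k Un ?x ` A)"
 have sub: "subring ?A F" by (rule F.gen_subring[OF hk])
 have rep: "EX f:poly_fun A. a = Cl f" if "a : ?A" for a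
  using that
 proof (induction rule: generate_ring.induct)
  case one
  thus ?case using c.hom_one k_cl(3) by (intro bexI[of _ "%t. \<one>"]) (auto intro: poly_fun.const)
 next
  case (incl a)
  thus ?case by (auto intro: poly_fun.intros)
 next
  case (a_inv a)
  then obtain f where f: "f : poly_fun A" "a = Cl f" by blast
  have "(%t. \<ominus> \<one> ** f t) : poly_fun A" using f k_cl(3,5) by (intro poly_fun.intros) auto
  moreover have "\<ominus>.?P f = (%t. \<ominus> \<one> ** f t)"
   by (rule P.minus_equality) (use poly_fun_k[OF f(1)] in "auto simp: l_minus l_neg")
  ultimately show ?case using c.hom_a_inv[OF pfP[OF f(1)]] f by metis
 next
  case (eng_add a b)
  then obtain f g where f: "f : poly_fun A" "a = Cl f" "g : poly_fun A" "b = Cl g" by blast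
  thus ?case using c.hom_add[OF pfP pfP, of f A g A] poly_fun.add[OF f(1,3)] by (intro bexI[of _ "%t. f t \<oplus> g t"]) auto
 next
  case (eng_mult a b)
  then obtain f g where f: "f : poly_fun A" "a = Cl f" "g : poly_fun A" "b = Cl g" by blast
  thus ?case using c.hom_mult[OF pfP pfP, of f A g A] poly_fun.mult[OF f(1,3)] by (intro bexI[of _ "%t. f t ** g t"]) auto
 qed
 assume "cl (%t. m t +> clip (t j)) : F.acl ((%r. cl (%t. m t +> r)) ` k) ((%j. cl (%t. m t +> clip (t j))) ` A)"
 hence "(F.algebraic over ?A) (?x j)" by (simp add: F.acl_def F.alg_over_def Cl_def)
 then obtain n :: nat and c where c: "ALL i. c i : ?A" "EX i<n. c i ~= \<zero>.F" "(\<Oplus>.F i:{..<n}. c i **.F ?x j [^].F i) = \<zero>.F"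
  using F.algebraic_iff[OF sub xc] by blast
 have "ALL i. EX f. f : poly_fun A & c i = Cl f" using rep c(1) by blast
 then obtain f where f: "!!i. f i : poly_fun A" "!!i. c i = Cl (f i)" by metis
 obtain i0 where i0: "i0 < n" "c i0 ~= \<zero>.F" using c(2) by blast
 have "f i0 ~= \<zero>.?P" using i0(2) f(2) c.hom_zero by metis
 then obtain t0 where t0: "f i0 t0 ~= \<zero>" by auto
 let ?X = "%t :: 'j => 'a. clip (t j)"
 have X: "?X <: ?P" by simp
 define G where "G = (\<Oplus>.?P i:{..<n}. f i **.?P ?X [^].?P i)"
 have tc: "f i **.?P ?X [^].?P i <: ?P" for i :: nat by (intro P.m_closed P.nat_pow_closed pfP[OF f(1)] X)
 have cF: "c i <: F" for i using c(1) subringE(1)[OF sub] by blast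
 have e1: "Cl G = (\<Oplus>.F i:{..<n}. c i **.F ?x j [^].F i)"
 proof -
  have "Cl G = (\<Oplus>.F i:{..<n}. Cl (f i **.?P ?X [^].?P i))"
   unfolding G_def using c.hom_finsum[of "%i. f i **.?P ?X [^].?P i" "{..<n}"] tc by (simp only: Pi_I comp_def)
  also have "... = (\<Oplus>.F i:{..<n}. c i **.F ?x j [^].F i)"
  proof (rule F.finsum_cong')
   fix i :: nat
   show "Cl (f i **.?P ?X [^].?P i) = c i **.F ?x j [^].F i"
    using c.hom_mult[OF pfP[OF f(1)] P.nat_pow_closed[OF X]] c.ring.hom_nat_pow[OF X] f(2) by (simp only:)
  qed (use cF F.nat_pow_closed[OF xc] in "auto intro!: F.m_closed")
  finally show ?thesis .
 qed
 have CG: "Cl G = \<zero>.F" unfolding e1 by (rule c(3))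
 have Xpow: "?X [^].?P (i :: nat) : poly_fun UNIV" for i
 proof (induction i)
  case 0
  thus ?case using poly_fun.const[OF k_cl(3)] by simp
 next
  case (Suc i)
  thus ?case using poly_fun.mult[OF Suc poly_fun.coord[of j UNIV]] by simp
 qed
 have G: "G : poly_fun UNIV"
  unfolding G_def
 proof (rule P.finsum_in_submonoid)
  show "f i **.?P ?X [^].?P i : poly_fun UNIV" for i :: nat
   using poly_fun.mult[OF poly_fun_mono[OF f(1)[of i] subset_UNIV] Xpow[of i]] by simp
 qed (use poly_fun.const[OF k_cl(2)] poly_fun.add pfP in auto)
 have Gt: "G t = (\<Oplus>i:{..<n}. f i t ** clip (t j) [^] i)" for t
 proof -
  interpret e: ring_hom_cring ?P R "%x. x t"
   by (intro ring_hom_cring.intro ring_hom_cring_axioms.intro Pc cring_axioms prod_ring_eval)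
  have "G t = (\<Oplus>i:{..<n}. (f i **.?P ?X [^].?P i) t)"
   unfolding G_def using e.hom_finsum[of "%i. f i **.?P ?X [^].?P i" "{..<n}"] tc by (simp only: Pi_I comp_def)
  also have "... = (\<Oplus>i:{..<n}. f i t ** clip (t j) [^] i)"
  proof (rule finsum_cong')
   fix i :: nat
   show "(f i **.?P ?X [^].?P i) t = f i t ** clip (t j) [^] i" using e.ring.hom_nat_pow[OF X, of i] by simp
  qed (use poly_fun_k[OF f(1)] in auto)
  finally show ?thesis .
 qed
 have fin: "finite {l : k. (\<Oplus>i:{..<n}. f i t0 ** l [^] i) = \<zero>}"
  by (rule finite_roots[of "%i. f i t0"]) (use poly_fun_k[OF f(1)] i0 t0 in auto)
 have "~ k <= {l : k. (\<Oplus>i:{..<n}. f i t0 ** l [^] i) = \<zero>}" using fin k_infinite finite_subset by blast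
 then obtain l where l: "l : k" "(\<Oplus>i:{..<n}. f i t0 ** l [^] i) ~= \<zero>" by blast
 \<comment> \<open>The coefficients involve only coordinates in \<open>A\<close>, so moving the
   coordinate \<open>j\<close> leaves them unchanged.\<close>
 have "f i (t0(j := l)) = f i t0" for i by (rule poly_fun_cong[OF f(1)]) (use j in auto)
 hence "G (t0(j := l)) ~= \<zero>" using l by (simp add: Gt)
 hence "Cl G ~= \<zero>.F" using nz G unfolding Cl_def by blast
 thus False using CG by simp
qed

end

section \<open>Proper submodules of finitely generated modules\<close>

context module
begin

definition submod :: "'c set => bool" where
 "submod N \<longleftrightarrow> N <= carrier M & \<zero>.M : N & (ALL a:N. ALL b:N. a \<oplus>.M b : N) & (ALL r:carrier R. ALL a:N. r \<odot>.M a : N)"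

lemma submod_add_generator:
 assumes N: "submod N" and e: "e <: M"
 shows "submod {n \<oplus>.M r \<odot>.M e | n r. n : N & r <: R}" (is "submod ?N")
  and "N <= {n \<oplus>.M r \<odot>.M e | n r. n : N & r <: R}" and "e : {n \<oplus>.M r \<odot>.M e | n r. n : N & r <: R}"
proof -
 have N': "N <= carrier M" "\<zero>.M : N" "!!a b. a : N ==> b : N ==> a \<oplus>.M b : N" "!!r a. r <: R ==> a : N ==> r \<odot>.M a : N"
  using N by (auto simp: submod_def)
 have I: "n \<oplus>.M r \<odot>.M e : ?N" if "n : N" "r <: R" for n r using that by blast
 show sub: "N <= ?N"
 proof
  fix n assume n: "n : N"
  hence "n \<oplus>.M \<zero> \<odot>.M e = n" using N'(1) e by auto
  thus "n : ?N" using I[OF n, of \<zero>] by simp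
 qed
 show "e : ?N" using I[OF N'(2), of \<one>] e by simp
 show "submod ?N"
  unfolding submod_def
 proof (intro conjI ballI)
  show "?N <= carrier M" using N'(1) e by auto
  show "\<zero>.M : ?N" using sub N'(2) by blast
 next
  fix a b assume "a : ?N" "b : ?N"
  then obtain n r n' r' where *: "a = n \<oplus>.M r \<odot>.M e" "n : N" "r <: R" "b = n' \<oplus>.M r' \<odot>.M e" "n' : N" "r' <: R" by blast
  have "n <: M" "n' <: M" using * N'(1) by auto
  hence "a \<oplus>.M b = (n \<oplus>.M n') \<oplus>.M (r \<oplus> r') \<odot>.M e" using * e by (simp add: smult_l_distr M.a_ac)
  thus "a \<oplus>.M b : ?N" using I[OF N'(3)[OF *(2,5)], of "r \<oplus> r'"] * by simp
 next
  fix s a assume s: "s <: R" and "a : ?N"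
  then obtain n r where *: "a = n \<oplus>.M r \<odot>.M e" "n : N" "r <: R" by blast
  have "n <: M" using * N'(1) by auto
  hence "s \<odot>.M a = s \<odot>.M n \<oplus>.M (s ** r) \<odot>.M e" using * e s by (simp add: smult_r_distr smult_assoc1)
  thus "s \<odot>.M a : ?N" using I[OF N'(4)[OF s *(2)], of "s ** r"] * s by simp
 qed
qed

text \<open>Generators are added to \<open>N\<close> one at a time; just before everything is
  reached, a single further generator suffices.\<close>

lemma cyclic_quotient:
 assumes "finite E" "E <= carrier M" "submod N" "N ~= carrier M"
  and "!!N'. submod N' ==> N Un E <= N' ==> N' = carrier M"
 shows "EX N' g. submod N' & N <= N' & N' ~= carrier M & g <: M &
  carrier M = {n \<oplus>.M r \<odot>.M g | n r. n : N' & r <: R}"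
 using assms
proof (induction E arbitrary: N rule: finite_induct)
 case empty
 thus ?case by blast
next
 case (insert e E)
 let ?N = "{n \<oplus>.M r \<odot>.M e | n r. n : N & r <: R}"
 have e: "e <: M" using insert.prems(1) by blast
 note N1 = submod_add_generator[OF insert.prems(2) e]
 show ?case
 proof (cases "?N = carrier M")
  case True
  thus ?thesis using insert.prems(2,3) e by (intro exI[of _ N] exI[of _ e]) simp
 next
  case False
  have "EX N' g. submod N' & ?N <= N' & N' ~= carrier M & g <: M &
   carrier M = {n \<oplus>.M r \<odot>.M g | n r. n : N' & r <: R}"
  proof (rule insert.IH[OF _ N1(1) False])
   show "E <= carrier M" using insert.prems(1) by blast
   show "N' = carrier M" if "submod N'" "?N Un E <= N'" for N'
    by (rule insert.prems(4)[OF that(1)]) (use that(2) N1(2,3) in blast)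
  qed
  thus ?thesis using N1(2) by (meson order_trans)
 qed
qed

text \<open>A nonzero cyclic quotient is \<open>R/I\<close> for a proper ideal \<open>I\<close>, and
  a maximal ideal above \<open>I\<close> makes it map onto a residue field.\<close>

lemma residue_functional:
 assumes E: "finite E" "E <= carrier M" "ALL x:carrier M. EX c. (ALL e. c e <: R) & x = (\<Oplus>.M e:E. c e \<odot>.M e)"
  and N: "submod N" "N ~= carrier M"
 shows "EX m phi. maximalideal m R & (ALL x:carrier M. phi x : carrier (R Quot m)) &
  (ALL x:carrier M. ALL y:carrier M. phi (x \<oplus>.M y) = phi x \<oplus>.(R Quot m) phi y) &
  (ALL r:carrier R. ALL x:carrier M. phi (r \<odot>.M x) = (m +> r) **.(R Quot m) phi x) &
  (ALL x:N. phi x = \<zero>.(R Quot m)) & (EX x:carrier M. phi x = \<one>.(R Quot m))"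
proof -
 have all: "N' = carrier M" if N': "submod N'" "N Un E <= N'" for N'
 proof -
  have "x : N'" if x: "x <: M" for x
  proof -
   obtain c where c: "ALL e. c e <: R" "x = (\<Oplus>.M e:E. c e \<odot>.M e)" using E(3) x by blast
   show ?thesis unfolding c(2)
    by (rule M.finsum_in_submonoid[OF E(1)]) (use N' c(1) in "auto simp: submod_def")
  qed
  thus ?thesis using N'(1) by (auto simp: submod_def)
 qed
 have "EX N' g. submod N' & N <= N' & N' ~= carrier M & g <: M &
  carrier M = {n \<oplus>.M r \<odot>.M g | n r. n : N' & r <: R}"
  by (rule cyclic_quotient[OF E(1,2) N]) (rule all)
 then obtain N' g where N': "submod N'" "N <= N'" "N' ~= carrier M" and g: "g <: M"
  and gen: "carrier M = {n \<oplus>.M r \<odot>.M g | n r. n : N' & r <: R}" by (elim exE conjE) (rule that)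
 have cl: "N' <= carrier M" "\<zero>.M : N'" "!!a b. a : N' ==> b : N' ==> a \<oplus>.M b : N'" "!!r a. r <: R ==> a : N' ==> r \<odot>.M a : N'"
  using N'(1) by (auto simp: submod_def)
 define I where "I = {r : carrier R. r \<odot>.M g : N'}"
 have I: "ideal I R"
  by (rule R.ideal_by_closure) (use cl g in "auto simp: I_def smult_l_distr smult_assoc1")
 have "\<one> ~: I"
 proof
  assume "\<one> : I"
  hence "g : N'" using g by (simp add: I_def)
  hence "carrier M <= N'" using gen cl(3,4) by auto
  thus False using N'(3) cl(1) by blast
 qed
 then obtain m where m: "maximalideal m R" "I <= m" using R.maximal_containing[OF I] by blast
 have mi: "ideal m R" by (rule maximalideal.axioms(1)[OF m(1)])
 note hom = ideal.rcos_ring_hom[OF mi]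
 \<comment> \<open>The coefficient of \<open>g\<close> modulo \<open>m\<close>. It is determined up
   to elements of \<open>I\<close>, which lie in \<open>m\<close>.\<close>
 define phi where "phi x = m +> (SOME r. r <: R & (EX n:N'. x = n \<oplus>.M r \<odot>.M g))" for x
 have phi: "phi x = m +> r" if x: "x = n \<oplus>.M r \<odot>.M g" and n: "n : N'" and r: "r <: R" for x n r
 proof -
  let ?P = "%r. r <: R & (EX n:N'. x = n \<oplus>.M r \<odot>.M g)"
  define s where "s = (SOME r. ?P r)"
  have "?P s" unfolding s_def by (rule someI[of ?P r]) (use x n r in blast)
  then obtain n' where s: "s <: R" "n' : N'" "x = n' \<oplus>.M s \<odot>.M g" by blast
  have nc: "n <: M" "n' <: M" using n s cl(1) by auto
  have "(s \<ominus> r) \<odot>.M g = n \<oplus>.M \<ominus>.M n'"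
  proof -
   have "n' \<oplus>.M s \<odot>.M g = n \<oplus>.M r \<odot>.M g" using x s(3) by simp
   hence "\<ominus>.M n' \<oplus>.M (n' \<oplus>.M s \<odot>.M g) \<oplus>.M \<ominus>.M (r \<odot>.M g) = \<ominus>.M n' \<oplus>.M (n \<oplus>.M r \<odot>.M g) \<oplus>.M \<ominus>.M (r \<odot>.M g)"
    by simp
   thus ?thesis using nc g r s(1)
    by (simp add: R.minus_eq smult_l_distr smult_l_minus M.a_assoc M.r_neg M.r_neg1 M.r_neg2) (simp add: M.a_comm)
  qed
  also have "... : N'" using cl(3)[OF n cl(4)[OF _ s(2), of "\<ominus> \<one>"]] nc by (simp add: smult_l_minus)
  finally have "s \<ominus> r : m" using m(2) s(1) r by (auto simp: I_def)
  thus ?thesis unfolding phi_def s_def[symmetric] using R.quotient_eq_iff_same_a_r_cos[OF mi s(1) r] by simp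
 qed
 have dec: "EX n r. x = n \<oplus>.M r \<odot>.M g & n : N' & r <: R" if "x <: M" for x using that gen by blast
 show ?thesis
 proof (intro exI[of _ m] exI[of _ phi] conjI ballI)
  show "maximalideal m R" by (rule m)
 next
  fix x assume x: "x <: M"
  obtain n r where n: "x = n \<oplus>.M r \<odot>.M g" "n : N'" "r <: R" using dec[OF x] by blast
  show "phi x : carrier (R Quot m)" unfolding phi[OF n] by (rule ring_hom_closed[OF hom n(3)])
 next
  fix x y assume x: "x <: M" and y: "y <: M"
  obtain n r where n: "x = n \<oplus>.M r \<odot>.M g" "n : N'" "r <: R" using dec[OF x] by blast
  obtain n' r' where n': "y = n' \<oplus>.M r' \<odot>.M g" "n' : N'" "r' <: R" using dec[OF y] by blast
  have "n <: M" "n' <: M" using n n' cl(1) by auto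
  hence "x \<oplus>.M y = (n \<oplus>.M n') \<oplus>.M (r \<oplus> r') \<odot>.M g" using n n' g by (simp add: smult_l_distr M.a_ac)
  hence "phi (x \<oplus>.M y) = m +> (r \<oplus> r')" using phi cl(3) n n' R.add.m_closed by blast
  thus "phi (x \<oplus>.M y) = phi x \<oplus>.(R Quot m) phi y" using phi[OF n] phi[OF n'] ring_hom_add[OF hom n(3) n'(3)] by simp
 next
  fix s x assume s: "s <: R" and x: "x <: M"
  obtain n r where n: "x = n \<oplus>.M r \<odot>.M g" "n : N'" "r <: R" using dec[OF x] by blast
  have "n <: M" using n cl(1) by auto
  hence "s \<odot>.M x = s \<odot>.M n \<oplus>.M (s ** r) \<odot>.M g" using n g s by (simp add: smult_r_distr smult_assoc1)
  hence "phi (s \<odot>.M x) = m +> (s ** r)" using phi cl(4) n s R.m_closed by blast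
  thus "phi (s \<odot>.M x) = (m +> s) **.(R Quot m) phi x" using phi[OF n] ring_hom_mult[OF hom s n(3)] by simp
 next
  fix x assume x: "x : N"
  hence "x : N'" "x <: M" using N'(2) cl(1) by auto
  hence "phi x = m +> \<zero>" using g by (intro phi[of x x \<zero>]) auto
  thus "phi x = \<zero>.(R Quot m)" using ring_hom_zero[OF hom R.ring_axioms ideal.quotient_is_ring[OF mi]] by simp
 next
  have "phi g = m +> \<one>" using g cl(2) by (intro phi[of g "\<zero>.M" \<one>]) auto
  thus "EX x:carrier M. phi x = \<one>.(R Quot m)" using g ring_hom_one[OF hom] by auto
 qed
qed

end

text \<open>A root in the large field is algebraic over the relative closure and therefore belongs
  to it.\<close>

lemma (in field) acl_has_roots:
 assumes roots: "has_roots" and k: "k <= carrier R" and Y: "Y <= carrier R"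
 shows "ring.has_roots (R\<lparr>carrier := acl k Y\<rparr>)"
proof -
 let ?A = "acl k Y"
 have A: "subfield ?A R" by (rule acl_subfield[OF k Y])
 interpret A: field "R\<lparr>carrier := ?A\<rparr>" by (rule subfield_iff(2)[OF A])
 have sub: "subring ?A R" by (rule subfieldE(1)[OF A])
 have AR: "a <: R" if "a : ?A" for a using that subfieldE(3)[OF A] by blast
 show ?thesis
  unfolding A.has_roots_def
 proof (intro allI impI, elim conjE)
  fix n and c :: "nat => 'a"
  assume "ALL i. c i : carrier (R\<lparr>carrier := ?A\<rparr>)" and nz: "c (Suc n) ~= \<zero>.(R\<lparr>carrier := ?A\<rparr>)"
  hence c: "ALL i. c i : ?A" by simp
  obtain x where x: "x <: R" "(\<Oplus>i:{..Suc n}. c i ** x [^] i) = \<zero>"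
   using roots[unfolded has_roots_def, rule_format, of c n] c nz AR by auto
  have "(algebraic over ?A) x"
   unfolding algebraic_iff[OF sub x(1)]
   by (intro exI[of _ "Suc (Suc n)"] exI[of _ c]) (use c nz x(2) in "auto simp: lessThan_Suc_atMost")
  hence xA: "x : ?A" using acl_idem[OF k Y] x(1) by (auto simp: alg_over_def)
  have "(\<Oplus>.(R\<lparr>carrier := ?A\<rparr>)i:{..Suc n}. c i ** x [^] i) = (\<Oplus>i:{..Suc n}. c i ** x [^] i)"
  proof (rule subfield_finsum[OF A])
   have "x [^] i : ?A" for i :: nat using A.nat_pow_closed[of x i] xA by (simp add: nat_pow_consistent[symmetric])
   thus "c i ** x [^] i : ?A" for i :: nat using c subringE(6)[OF sub] by blast
  qed
  thus "EX x:carrier (R\<lparr>carrier := ?A\<rparr>). (\<Oplus>.(R\<lparr>carrier := ?A\<rparr>)i:{..Suc n}. c i **.(R\<lparr>carrier := ?A\<rparr>) x [^].(R\<lparr>carrier := ?A\<rparr>) i) = \<zero>.(R\<lparr>carrier := ?A\<rparr>)"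
   using xA x(2) by (intro bexI[of _ x]) (simp_all add: nat_pow_consistent[symmetric])
 qed
qed

section \<open>From words to functionals\<close>

context generic_matrices
begin

text \<open>\<open>G w y\<close> stands for a functional evaluated at \<open>y\<close> times the
  word \<open>w\<close>. Expanding letter by letter shows that it is the
  \<open>C\<close>-combination of the entries of \<open>sigma y\<close> times the matrix of
  \<open>w\<close>. At the unit, vanishing on all words becomes a relation between words, which
  forces \<open>C\<close> to vanish on all indices in \<open>pairs\<close>.\<close>

lemma words_separate:
 assumes T: "E <= T" "ALL y:T. ALL z:T. mul y z : T" "ALL y:T. tau y : T" "e1 : T"
  and mult: "ALL l. ALL p:I. ALL q:I. ALL y:T. ALL z:T. sigma l (mul y z) p q = (\<Oplus>j:I. sigma l y p j ** sigma l z j q)"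
  and one: "ALL l. ALL p:I. ALL q:I. sigma l e1 p q = (if p = q then \<one> else \<zero>)"
  and tau: "ALL l p q. ALL y:T. sigma (~ l) y p q = sigma l (tau y) q p"
  and C: "ALL s. C s <: R"
  and Nil: "ALL y:T. G [] y = (\<Oplus>s:pairs. C s ** sigma (fst (fst s)) y (snd (fst s)) (snd s))"
  and Cons: "ALL i b w. ALL y:T. G ((i, b) # w) y = (\<Oplus>e:E. x i e ** G w (mul y (if b then tau e else e)))"
  and vanish: "ALL w. set w <= letters --> G w e1 = \<zero>"
  and y: "y : T"
 shows "G [] y = \<zero>"
proof -
 have x': "x i e <: R" for i e by (rule x)
 note cl[simp] = x' C[rule_format]
 \<comment> \<open>The entry \<open>s\<close> of the product of \<open>sigma y\<close> with the
   matrix of the word \<open>w\<close>.\<close>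
 define H where "H s y w = (\<Oplus>j:I. sigma (fst (fst s)) y (snd (fst s)) j ** word (fst (fst s)) w j (snd s))" for s :: "(bool \<times> 'i) \<times> 'i" and y w
 have Hc[simp]: "H s y w <: R" for s y w by (auto simp: H_def intro!: finsum_closed)
 have fe: "(if b then tau e else e) : T" if "e : E" for b e using T that by auto
 have step: "(\<Oplus>e:E. x i e ** H ((l, p), q) (mul y (if b then tau e else e)) w) = H ((l, p), q) y ((i, b) # w)"
  if p: "p : I" "q : I" and y: "y : T" for l p q i b y w
 proof -
  let ?f = "%e. if b then tau e else e"
  let ?t = "%e j j'. sigma l y p j ** (sigma l (?f e) j j' ** x i e) ** word l w j' q"
  have letter_sum: "letter l (i, b) j j' = (\<Oplus>e:E. sigma l (?f e) j j' ** x i e)" for j j'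
   unfolding letter_def gm_def using tau T(1) by (auto intro!: finsum_cong' finsum_closed)
  have "(\<Oplus>e:E. x i e ** H ((l, p), q) (mul y (?f e)) w) = (\<Oplus>e:E. \<Oplus>j':I. \<Oplus>j:I. ?t e j j')"
  proof (rule finsum_cong')
   fix e assume e: "e : E"
   have m: "sigma l (mul y (?f e)) p j' = (\<Oplus>j:I. sigma l y p j ** sigma l (?f e) j j')" if "j' : I" for j'
    using mult p(1) that y fe[OF e] by blast
   have "x i e ** H ((l, p), q) (mul y (?f e)) w = (\<Oplus>j':I. x i e ** ((\<Oplus>j:I. sigma l y p j ** sigma l (?f e) j j') ** word l w j' q))"
   proof -
    obtain z where z: "z = ?f e" by simp
    show ?thesis unfolding H_def fst_conv snd_conv z[symmetric] using finI
     by (subst finsum_rdistr) (auto intro!: finsum_cong' finsum_closed simp: m[folded z])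
   qed
   also have "... = (\<Oplus>j':I. \<Oplus>j:I. ?t e j j')"
   proof (rule finsum_cong')
    fix j' assume "j' : I"
    have "x i e ** ((\<Oplus>j:I. sigma l y p j ** sigma l (?f e) j j') ** word l w j' q) = (\<Oplus>j:I. sigma l y p j ** sigma l (?f e) j j') ** (x i e ** word l w j' q)"
     by (rule m_lcomm) (auto intro!: finsum_closed)
    also have "... = (\<Oplus>j:I. sigma l y p j ** sigma l (?f e) j j' ** (x i e ** word l w j' q))"
     by (rule finsum_ldistr) (use finI in auto)
    also have "... = (\<Oplus>j:I. ?t e j j')" by (rule finsum_cong') (simp_all add: m_assoc)
    finally show "x i e ** ((\<Oplus>j:I. sigma l y p j ** sigma l (?f e) j j') ** word l w j' q) = (\<Oplus>j:I. ?t e j j')" .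
   qed (auto intro!: finsum_closed)
   finally show "x i e ** H ((l, p), q) (mul y (?f e)) w = (\<Oplus>j':I. \<Oplus>j:I. ?t e j j')" .
  qed (auto intro!: finsum_closed)
  also have "... = (\<Oplus>j':I. \<Oplus>e:E. \<Oplus>j:I. ?t e j j')" by (rule finsum_swap) (use finI finE in "auto intro!: finsum_closed")
  also have "... = (\<Oplus>j':I. \<Oplus>j:I. \<Oplus>e:E. ?t e j j')"
   by (intro finsum_cong' finsum_swap) (use finI finE in "auto intro!: finsum_closed")
  also have "... = (\<Oplus>j:I. \<Oplus>j':I. \<Oplus>e:E. ?t e j j')" by (rule finsum_swap) (use finI finE in "auto intro!: finsum_closed")
  also have "... = H ((l, p), q) y ((i, b) # w)"
   unfolding H_def fst_conv snd_conv word.simps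
  proof (rule finsum_cong')
   fix j assume "j : I"
   have "sigma l y p j ** (\<Oplus>j':I. letter l (i, b) j j' ** word l w j' q) = (\<Oplus>j':I. sigma l y p j ** (letter l (i, b) j j' ** word l w j' q))"
    by (rule finsum_rdistr) (use finI in auto)
   also have "... = (\<Oplus>j':I. \<Oplus>e:E. ?t e j j')"
   proof (rule finsum_cong')
    fix j' assume "j' : I"
    have "letter l (i, b) j j' ** word l w j' q = (\<Oplus>e:E. sigma l (?f e) j j' ** x i e ** word l w j' q)"
     unfolding letter_sum by (rule finsum_ldistr) (use finE in auto)
    hence "sigma l y p j ** (letter l (i, b) j j' ** word l w j' q) = sigma l y p j ** (\<Oplus>e:E. sigma l (?f e) j j' ** x i e ** word l w j' q)" by simp
    also have "... = (\<Oplus>e:E. sigma l y p j ** (sigma l (?f e) j j' ** x i e ** word l w j' q))" by (rule finsum_rdistr) (use finE in auto)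
    also have "... = (\<Oplus>e:E. ?t e j j')" by (rule finsum_cong') (simp_all add: m_assoc)
    finally show "sigma l y p j ** (letter l (i, b) j j' ** word l w j' q) = (\<Oplus>e:E. ?t e j j')" .
   qed (auto intro!: finsum_closed)
   finally show "(\<Oplus>j':I. \<Oplus>e:E. ?t e j j') = sigma l y p j ** (\<Oplus>j':I. letter l (i, b) j j' ** word l w j' q)" by (rule HOL.sym)
  qed (auto intro!: finsum_closed)
  finally show ?thesis .
 qed
 have G: "G w y = (\<Oplus>s:pairs. C s ** H s y w)" if "y : T" for w y
  using that
 proof (induction w arbitrary: y)
  case Nil
  have "H s y [] = sigma (fst (fst s)) y (snd (fst s)) (snd s)" if "s : pairs" for s
   unfolding H_def word.simps by (rule finsum_delta_mult(3)[OF finI]) (use that in auto)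
  thus ?case using assms(9)[rule_format, OF Nil] by (auto intro!: finsum_cong')
 next
  case (Cons a w)
  obtain i b where a: "a = (i, b)" by (cases a)
  let ?f = "%e. if b then tau e else e"
  have "G (a # w) y = (\<Oplus>e:E. x i e ** G w (mul y (?f e)))" unfolding a using assms(10) Cons.prems by blast
  also have "... = (\<Oplus>e:E. \<Oplus>s:pairs. C s ** (x i e ** H s (mul y (?f e)) w))"
  proof (rule finsum_cong')
   fix e assume e: "e : E"
   have "mul y (?f e) : T" using T(2) Cons.prems fe[OF e] by blast
   hence "x i e ** G w (mul y (?f e)) = x i e ** (\<Oplus>s:pairs. C s ** H s (mul y (?f e)) w)" by (simp only: Cons.IH)
   also have "... = (\<Oplus>s:pairs. x i e ** (C s ** H s (mul y (?f e)) w))" by (rule finsum_rdistr) (use finI in auto)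
   also have "... = (\<Oplus>s:pairs. C s ** (x i e ** H s (mul y (?f e)) w))" by (intro finsum_cong' m_lcomm) auto
   finally show "x i e ** G w (mul y (?f e)) = (\<Oplus>s:pairs. C s ** (x i e ** H s (mul y (?f e)) w))" .
  qed (auto intro!: finsum_closed)
  also have "... = (\<Oplus>s:pairs. \<Oplus>e:E. C s ** (x i e ** H s (mul y (?f e)) w))" by (rule finsum_swap) (use finI finE in auto)
  also have "... = (\<Oplus>s:pairs. C s ** H s y (a # w))"
  proof (rule finsum_cong')
   fix s assume s: "s : pairs"
   have "(\<Oplus>e:E. C s ** (x i e ** H s (mul y (?f e)) w)) = C s ** (\<Oplus>e:E. x i e ** H s (mul y (?f e)) w)"
    by (rule finsum_rdistr[symmetric]) (use finE in auto)
   also have "(\<Oplus>e:E. x i e ** H s (mul y (?f e)) w) = H s y (a # w)"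
    using step[of "snd (fst s)" "snd s" y i "fst (fst s)"] s Cons.prems a by auto
   finally show "(\<Oplus>e:E. C s ** (x i e ** H s (mul y (?f e)) w)) = C s ** H s y (a # w)" .
  qed auto
  finally show ?case .
 qed
 have rel: "(\<Oplus>s:UNIV \<times> I. \<Oplus>q:I. C (s, q) ** word (fst s) w (snd s) q) = \<zero>" if w: "set w <= letters" for w
 proof -
  have "H s e1 w = word (fst (fst s)) w (snd (fst s)) (snd s)" if s: "s : pairs" for s
  proof -
   have "H s e1 w = (\<Oplus>j:I. (if snd (fst s) = j then \<one> else \<zero>) ** word (fst (fst s)) w j (snd s))"
    unfolding H_def by (rule finsum_cong') (use one s in auto)
   also have "... = word (fst (fst s)) w (snd (fst s)) (snd s)" by (rule finsum_delta_mult(2)[OF finI]) (use s in auto)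
   finally show ?thesis .
  qed
  hence "(\<Oplus>s:pairs. C s ** word (fst (fst s)) w (snd (fst s)) (snd s)) = (\<Oplus>s:pairs. C s ** H s e1 w)" by (intro finsum_cong') auto
  also have "... = \<zero>" using G[OF T(4)] vanish w by simp
  finally show ?thesis using finI by (subst (asm) finsum_product) auto
 qed
 have "C (s, q) = \<zero>" if "s : UNIV \<times> I" "q : I" for s q by (rule words_independent[OF _ rel that]) simp
 hence "C s = \<zero>" if "s : pairs" for s using that by (cases s) blast
 thus ?thesis unfolding assms(9)[rule_format, OF y] by (intro finsum_all_zero) simp
qed

end

section \<open>Generation with an involution\<close>

context azumaya_unitary
begin

lemma inv_finsum:
 assumes "finite E" "ALL e:E. g e <: B"
 shows "\<tau> (\<Oplus>.B e:E. g e) = (\<Oplus>.B e:E. \<tau> (g e))"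
 using assms
proof (induction E rule: finite_induct)
 case empty
 have "\<tau> \<zero>.B \<oplus>.B \<tau> \<zero>.B = \<tau> \<zero>.B \<oplus>.B \<zero>.B" using inv_add[of "\<zero>.B" "\<zero>.B"] inv_closed[of "\<zero>.B"] by simp
 thus ?case using inv_closed[of "\<zero>.B"] by (simp add: M.add.l_cancel)
next
 case (insert e E)
 hence "(\<Oplus>.B e:E. g e) <: B" "g : E \<rightarrow> carrier B" "(%e. \<tau> (g e)) : E \<rightarrow> carrier B" by (auto intro!: M.finsum_closed inv_closed)
 thus ?case using insert by (simp add: M.finsum_insert inv_add inv_closed)
qed

text \<open>Failures at all parameters are combined into one map \<open>Psi\<close> on families
  indexed by \<open>t\<close>. Families are unavoidable because the generic elements depend on
  \<open>t\<close>; on constant families \<open>Psi\<close> is a functional along \<open>h\<close>.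
  It kills all words and therefore the constants, whereas some family has value one.\<close>

lemma generators_exist:
 assumes aff: "affine_algebra R k G" and dim: "has_krull_dim R d" and deg: "has_degree B n"
  and bound: "d < (2 * r - 1) * (n - 1)"
 shows "EX Z. finite Z & card Z <= r & generates_with_involution R B \<tau> Z"
proof (rule ccontr)
 assume no: "~ ?thesis"
 interpret A: affine_algebra R k G by (rule aff)
 obtain E where E: "finite E" "E <= carrier B" "ALL x:carrier B. EX c. (ALL e. c e <: R) & x = (\<Oplus>.B e:E. c e \<odot>.B e)"
  by (rule finite_spanning_set)
 have EB: "e <: B" if "e : E" for e using that E(2) by blast
 have clipR: "A.clip a <: R" for a using A.clip_k(1) A.k_carrier by blast
 define b where "b t i = (\<Oplus>.B e:E. A.clip (t (i, e)) \<odot>.B e)" for t :: "nat \<times> 'c => 'a" and i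
 have bc: "b t i <: B" for t i unfolding b_def using EB clipR by (intro M.finsum_closed) auto
 define D where "D t = {T. unital_subalgebra R B T & \<tau> ` T <= T & b t ` {..<r} <= T}" for t
 \<comment> \<open>The subalgebra with involution generated by the \<open>b t i\<close>, proper for
   every \<open>t\<close> by assumption.\<close>
 define T where "T t = \<Inter>(D t)" for t
 have BD: "carrier B : D t" for t
  unfolding D_def unital_subalgebra_def using bc inv_closed by (auto intro!: carrier_is_subring)
 have sub: "subring U B" "ALL r:carrier R. ALL x:U. r \<odot>.B x : U" "ALL x:U. \<tau> x : U" "ALL i<r. b t i : U" if "U : D t" for t U
  using that by (auto simp: D_def unital_subalgebra_def)
 have TB: "T t <= carrier B" for t using BD by (auto simp: T_def)
 have T1: "\<one>.B : T t" and T0: "\<zero>.B : T t" for t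
  using sub(1) subringE(3) subringE(2) by (fastforce simp: T_def)+
 have Tm: "x **.B y : T t" and Ta: "x \<oplus>.B y : T t" if "x : T t" "y : T t" for x y t
  using that sub(1) subringE(6) subringE(7) by (fastforce simp: T_def)+
 have Ts: "s \<odot>.B x : T t" if "x : T t" "s <: R" for s x t using that sub(2) by (fastforce simp: T_def)
 have Tt: "\<tau> x : T t" if "x : T t" for x t using that sub(3) by (fastforce simp: T_def)
 have Tb: "b t i : T t" if "i < r" for t i using that sub(4) by (fastforce simp: T_def)
 have "T t ~= carrier B" for t
 proof
  assume "T t = carrier B"
  hence "generates_with_involution R B \<tau> (b t ` {..<r})" using bc by (auto simp: generates_with_involution_def T_def D_def)
  moreover have "card (b t ` {..<r}) <= r" using card_image_le[of "{..<r}" "b t"] by simp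
  ultimately show False using no by blast
 qed
 moreover have "submod (T t)" for t using TB T0 Ta Ts by (auto simp: submod_def)
 ultimately have "ALL t. EX m phi. maximalideal m R & (ALL x:carrier B. phi x : carrier (R Quot m)) &
  (ALL x:carrier B. ALL y:carrier B. phi (x \<oplus>.B y) = phi x \<oplus>.(R Quot m) phi y) &
  (ALL r:carrier R. ALL x:carrier B. phi (r \<odot>.B x) = (m +> r) **.(R Quot m) phi x) &
  (ALL x:T t. phi x = \<zero>.(R Quot m)) & (EX x:carrier B. phi x = \<one>.(R Quot m))"
  by (intro allI residue_functional[OF E])
 then obtain m phi where m: "ALL t. maximalideal (m t) R" and phic: "ALL t. ALL x:carrier B. phi t x : carrier (R Quot m t)"
  and phia: "ALL t. ALL x:carrier B. ALL y:carrier B. phi t (x \<oplus>.B y) = phi t x \<oplus>.(R Quot m t) phi t y"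
  and phis: "ALL t. ALL r:carrier R. ALL x:carrier B. phi t (r \<odot>.B x) = (m t +> r) **.(R Quot m t) phi t x"
  and phi0: "ALL t. ALL x:T t. phi t x = \<zero>.(R Quot m t)" and phi1: "ALL t. EX x:carrier B. phi t x = \<one>.(R Quot m t)"
  unfolding choice_iff all_conj_distrib by (elim exE conjE) (rule that)
 have id: "ideal (m t) R" for t using m maximalideal.axioms(1) by blast
 have hom: "(+>) (m t) : ring_hom R (R Quot m t)" for t by (rule ideal.rcos_ring_hom[OF id])
 have Qc: "cring (R Quot m t)" for t
  using maximalideal.quotient_is_field[OF m[rule_format] R.cring_axioms] fieldE(1) by blast
 let ?P = "prod_ring (%t. R Quot m t)"
 show False
 proof (rule A.generic_field[OF m])
  fix F :: "((((((nat \<times> 'c => 'a) => 'a set) set list \<times> nat) multiset) => ((nat \<times> 'c => 'a) => 'a set) set) ring)" and cl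
  assume F: "field F" and roots: "ring.has_roots F" and clh: "cl : ring_hom ?P F"
   and nz: "ALL f:A.poly_fun UNIV. (EX t. f t ~= \<zero>) --> cl (%t. m t +> f t) ~= \<zero>.F"
  interpret F: field F by (rule F)
  interpret c: ring_hom_cring ?P F cl
   by (intro ring_hom_cring.intro ring_hom_cring_axioms.intro clh prod_ring_cring Qc F.cring_axioms)
  have Rc: "m t +> s : carrier (R Quot m t)" if "s <: R" for s t by (rule ring_hom_closed[OF hom that])
  define Psi where "Psi y = cl (%t. phi t (y t))" for y
  \<comment> \<open>Classes of constant families give the homomorphism from \<open>R\<close>, and
    classes of coordinates give the algebraically independent parameters \<open>Z\<close>.\<close>
  define h where "h s = cl (%t. m t +> s)" for s
  define Z where "Z j = cl (%t. m t +> A.clip (t j))" for j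
  have Psic: "Psi y <: F" if "ALL t. y t <: B" for y
   unfolding Psi_def by (rule c.hom_closed) (use phic that in simp)
  have Zc: "Z j <: F" for j unfolding Z_def by (rule c.hom_closed) (use Rc clipR in simp)
  have Psia: "Psi (%t. y t \<oplus>.B z t) = Psi y \<oplus>.F Psi z" if "ALL t. y t <: B" "ALL t. z t <: B" for y z
   unfolding Psi_def using c.hom_add[of "%t. phi t (y t)" "%t. phi t (z t)"] phic phia that by simp
  have Psis: "Psi (%t. s t \<odot>.B y t) = cl (%t. m t +> s t) **.F Psi y" if "ALL t. s t <: R" "ALL t. y t <: B" for s y
   unfolding Psi_def using c.hom_mult[of "%t. m t +> s t" "%t. phi t (y t)"] phic phis Rc that by simp
  have PsiT: "Psi y = \<zero>.F" if "ALL t. y t : T t" for y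
   unfolding Psi_def using c.hom_zero phi0 that by simp
  have Psisum: "Psi (%t. \<Oplus>.B e:U. g e t) = (\<Oplus>.F e:U. Psi (g e))"
   if "finite U" "ALL e:U. ALL t. g e t <: B" for U :: "'c set" and g
   using that
  proof (induction U rule: finite_induct)
   case empty
   show ?case using PsiT[of "%t. \<zero>.B"] T0 by simp
  next
   case (insert e U)
   have "(%t. \<Oplus>.B e:insert e U. g e t) = (%t. g e t \<oplus>.B (\<Oplus>.B e:U. g e t))"
    using insert by (intro ext M.finsum_insert) auto
   hence "Psi (%t. \<Oplus>.B e:insert e U. g e t) = Psi (g e) \<oplus>.F Psi (%t. \<Oplus>.B e:U. g e t)"
    using insert.prems by (simp add: Psia M.finsum_closed Pi_iff)
   also have "... = (\<Oplus>.F e:insert e U. Psi (g e))"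
    using insert by (subst F.finsum_insert) (auto intro!: Psic)
   finally show ?case .
  qed
  have h: "h : ring_hom R F"
  proof (rule ring_hom_memI)
   show "h x <: F" if "x <: R" for x unfolding h_def by (rule c.hom_closed) (use Rc that in simp)
   show "h (x ** y) = h x **.F h y" if "x <: R" "y <: R" for x y
    unfolding h_def using c.hom_mult[of "%t. m t +> x" "%t. m t +> y"] Rc ring_hom_mult[OF hom] that by simp
   show "h (x \<oplus> y) = h x \<oplus>.F h y" if "x <: R" "y <: R" for x y
    unfolding h_def using c.hom_add[of "%t. m t +> x" "%t. m t +> y"] Rc ring_hom_add[OF hom] that by simp
   show "h \<one> = \<one>.F" unfolding h_def using c.hom_one ring_hom_one[OF hom] by simp
  qed
  obtain Y where Y: "finite Y" "card Y <= d" "Y <= carrier F" "h ` carrier R <= F.acl (h ` k) Y"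
   by (rule A.transcendence_degree_le_krull_dim[OF dim F h])
  have hk: "h ` k <= carrier F" using A.k_carrier ring_hom_closed[OF h] by blast
  have n: "n > 0" using bound by (cases n) auto
  obtain I :: "'c set" and rho where I: "finite I" "I ~= {}" "n <= card I" and rhoA: "ALL l x p q. rho l x p q : F.acl (h ` k) Y"
   and rho_hom: "ALL l. ALL p:I. ALL q:I. (%x. if x <: B then rho l x p q else \<zero>.F) : hom_along R B F h"
   and rho_mult: "ALL l. ALL p:I. ALL q:I. ALL x:carrier B. ALL y:carrier B. rho l (x **.B y) p q = (\<Oplus>.F j:I. rho l x p j **.F rho l y j q)"
   and rho_one: "ALL l. ALL p:I. ALL q:I. rho l \<one>.B p q = (if p = q then \<one>.F else \<zero>.F)"
   and rho_inv: "ALL l p q. ALL x:carrier B. rho (~ l) x p q = rho l (\<tau> x) q p"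
   and span: "ALL Phi:hom_along R B F h. F.lin_span ((UNIV \<times> I) \<times> I) (%s x. rho (fst (fst s)) x (snd (fst s)) (snd s)) (carrier B) Phi"
   and indep: "ALL C. (ALL s. C s <: F) -->
    (ALL x:carrier B. (\<Oplus>.F s:(UNIV \<times> I) \<times> I. C s **.F rho (fst (fst s)) x (snd (fst s)) (snd s)) = \<zero>.F) -->
    (ALL s:(UNIV \<times> I) \<times> I. C s = \<zero>.F)"
   by (rule representation[OF F F.acl_subfield[OF hk Y(3)] F.acl_has_roots[OF roots hk Y(3)] h Y(4) deg n]) (rule that)
  have rhoF: "rho l x p q <: F" for l x p q using rhoA subfieldE(3)[OF F.acl_subfield[OF hk Y(3)]] by blast
  have mf: "module_to_field R B F h" by (intro module_to_field.intro module_axioms F module_to_field_axioms.intro h)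
  have indep_E: "ALL C. (ALL s. C s <: F) -->
    (ALL e:E. (\<Oplus>.F s:(UNIV \<times> I) \<times> I. C s **.F rho (fst (fst s)) e (snd (fst s)) (snd s)) = \<zero>.F) -->
    (ALL s:(UNIV \<times> I) \<times> I. C s = \<zero>.F)"
  proof (intro allI impI)
   fix C :: "(bool \<times> 'c) \<times> 'c => _"
   assume Cc: "ALL s. C s <: F"
    and CE: "ALL e:E. (\<Oplus>.F s:(UNIV \<times> I) \<times> I. C s **.F rho (fst (fst s)) e (snd (fst s)) (snd s)) = \<zero>.F"
   let ?u = "%s x. if x <: B then rho (fst (fst s)) x (snd (fst s)) (snd s) else \<zero>.F"
   define xi where "xi x = (\<Oplus>.F s:(UNIV \<times> I) \<times> I. C s **.F ?u s x)" for x
   have xi: "xi : hom_along R B F h"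
    unfolding xi_def
   proof (rule F.fun_subspace_sum[OF module_to_field.functionals_subspace[OF mf]])
    show "finite ((UNIV \<times> I) \<times> I :: ((bool \<times> 'c) \<times> 'c) set)" using I(1) by simp
     show "C s <: F" for s using Cc by (rule spec)
     show "?u s : hom_along R B F h" if "s : (UNIV \<times> I) \<times> I" for s
      by (rule rho_hom[THEN spec, THEN bspec, THEN bspec]) (use that in auto)
    qed
   have xiE: "xi e = \<zero>.F" if "e : E" for e
    unfolding xi_def if_P[OF EB[OF that]] by (rule CE[THEN bspec, OF that])
   have xi0: "xi x = \<zero>.F" if x: "x <: B" for x
   proof -
    obtain c where c: "ALL e. c e <: R" "x = (\<Oplus>.B e:E. c e \<odot>.B e)" using E(3) x by blast
    show ?thesis unfolding c(2)
     by (rule module_to_field.functionals_vanish[OF mf xi E(1,2) c(1)]) (use xiE in blast)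
   qed
   have "(\<Oplus>.F s:(UNIV \<times> I) \<times> I. C s **.F rho (fst (fst s)) x (snd (fst s)) (snd s)) = \<zero>.F" if "x <: B" for x
    using xi0[OF that] unfolding xi_def if_P[OF that] .
   thus "ALL s:(UNIV \<times> I) \<times> I. C s = \<zero>.F" using indep[THEN spec[of _ C], THEN mp, THEN mp, OF Cc] by blast
  qed
  \<comment> \<open>Any enumeration will do, since each parameter is transcendental over all the
    others.\<close>
  obtain js where js: "set js = {..<r} \<times> E" "distinct js" using finite_distinct_list[of "{..<r} \<times> E"] E(1) by auto
  interpret g: generic_matrices F I E rho "%i e. Z (i, e)" r d "h ` k" Y "map Z js"
  proof (intro generic_matrices.intro generic_matrices_axioms.intro F roots I(1) E(1) hk Y(1-3) indep_E)
   show "rho l e p q : F.acl (h ` k) Y" for l e p q using rhoA by blast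
   show "Z (i, e) <: F" for i e by (rule Zc)
   show "set (map Z js) = (%(i, e). Z (i, e)) ` ({..<r} \<times> E)" using js(1) by auto
   show "length (map Z js) = r * card E" using distinct_card[OF js(2)] js(1) by (simp add: card_cartesian_product)
   show "ALL i<length (map Z js). map Z js ! i ~: F.acl (h ` k) (set (take i (map Z js)))"
   proof (intro allI impI)
    fix i assume i: "i < length (map Z js)"
    have "js ! i ~: set (take i js)" using js(2) i by (auto simp: in_set_conv_nth nth_eq_iff_index_eq)
    from A.coordinates_independent[OF m F clh nz this] show "map Z js ! i ~: F.acl (h ` k) (set (take i (map Z js)))"
     using i by (simp add: take_map Z_def[abs_def] h_def[abs_def])
   qed
   \<comment> \<open>A representation larger than \<open>n\<close> only strengthens the
     inequality.\<close>
   have "(2 * r - 1) * (n - 1) <= (2 * r - 1) * (card I - 1)" using I(3) by (intro mult_le_mono2 diff_le_mono)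
   thus "d < (2 * r - 1) * (card I - 1)" using bound by linarith
  qed
  have Phi: "(%x. if x <: B then Psi (%t. x) else \<zero>.F) : hom_along R B F h"
   using Psic Psia[of "%t. _" "%t. _"] Psis[of "%t. _" "%t. _"] by (auto simp: hom_along_def h_def)
  obtain C where C: "ALL s. C s <: F" "ALL y:carrier B. Psi (%t. y) = (\<Oplus>.F s:g.pairs. C s **.F rho (fst (fst s)) y (snd (fst s)) (snd s))"
   using span Phi unfolding F.lin_span_def by force
  \<comment> \<open>The word evaluated in \<open>B\<close> at the parameter \<open>t\<close>. It
    lies in the subalgebra \<open>T t\<close>, which \<open>phi t\<close> kills.\<close>
  define W where "W t w = foldr (%(i, a) z. (if a then \<tau> (b t i) else b t i) **.B z) w \<one>.B" for t w
  have Wc: "W t w <: B" for t w by (induction w) (auto simp: W_def bc inv_closed)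
  have WT: "W t w : T t" if "set w <= g.letters" for t w
   using that by (induction w) (auto simp: W_def T1 intro!: Tm Tt Tb)
  have Psi0: "Psi (%t. y) = \<zero>.F" if y: "y <: B" for y
  proof -
   have "Psi (%t. y **.B W t []) = \<zero>.F"
   proof (rule g.words_separate[where mul = "(**.B)" and tau = \<tau> and ?e1.0 = "\<one>.B" and T = "carrier B" and C = C and G = "%w y. Psi (%t. y **.B W t w)", OF E(2) _ _ one_closed rho_mult rho_one rho_inv C(1) _ _ _ y])
    show "ALL y:carrier B. Psi (%t. y **.B W t []) = (\<Oplus>.F s:g.pairs. C s **.F rho (fst (fst s)) y (snd (fst s)) (snd s))"
     using C(2) by (simp add: W_def)
    show "ALL w. set w <= g.letters --> Psi (%t. \<one>.B **.B W t w) = \<zero>.F" using PsiT WT Wc by simp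
    show "ALL i a w. ALL y:carrier B. Psi (%t. y **.B W t ((i, a) # w)) = (\<Oplus>.F e:E. Z (i, e) **.F Psi (%t. y **.B (if a then \<tau> e else e) **.B W t w))"
    proof (intro allI ballI)
     fix i a w y assume y: "y <: B"
     obtain f where f: "f = (%e. if a then \<tau> e else e)" by simp
     have fB: "f e <: B" if "e : E" for e using EB[OF that] inv_closed by (simp add: f)
     have L: "(if a then \<tau> (b t i) else b t i) = (\<Oplus>.B e:E. A.clip (t (i, e)) \<odot>.B f e)" for t
     proof -
      have "\<tau> (b t i) = (\<Oplus>.B e:E. \<tau> (A.clip (t (i, e)) \<odot>.B e))"
       unfolding b_def by (rule inv_finsum[OF E(1)]) (use EB clipR in auto)
      also have "... = (\<Oplus>.B e:E. A.clip (t (i, e)) \<odot>.B \<tau> e)"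
       by (rule M.finsum_cong') (use EB clipR inv_closed in "auto simp: inv_smult")
      finally show ?thesis by (simp add: f b_def)
     qed
     have "y **.B W t ((i, a) # w) = (\<Oplus>.B e:E. A.clip (t (i, e)) \<odot>.B (y **.B f e **.B W t w))" for t
     proof -
      have fc: "(%e. A.clip (t (i, e)) \<odot>.B f e) : E \<rightarrow> carrier B" using fB clipR by auto
      have "y **.B W t ((i, a) # w) = y **.B ((\<Oplus>.B e:E. A.clip (t (i, e)) \<odot>.B f e) **.B W t w)"
       using L by (simp add: W_def)
      also have "... = (\<Oplus>.B e:E. y **.B (A.clip (t (i, e)) \<odot>.B f e **.B W t w))"
       using fc y Wc by (subst finsum_ldistr[OF E(1)], simp, simp, subst finsum_rdistr[OF E(1)], auto)
      also have "... = (\<Oplus>.B e:E. A.clip (t (i, e)) \<odot>.B (y **.B f e **.B W t w))"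
       by (rule M.finsum_cong') (use y fB Wc clipR in "auto simp: smult_mult_left smult_mult_right m_assoc")
      finally show ?thesis .
     qed
     hence "Psi (%t. y **.B W t ((i, a) # w)) = (\<Oplus>.F e:E. Psi (%t. A.clip (t (i, e)) \<odot>.B (y **.B f e **.B W t w)))"
      using y fB Wc clipR by (simp add: Psisum[OF E(1)])
     also have "... = (\<Oplus>.F e:E. Z (i, e) **.F Psi (%t. y **.B f e **.B W t w))"
      by (rule F.finsum_cong') (use y fB Wc clipR Zc in "auto simp: Psis Z_def[symmetric] intro!: F.m_closed Psic")
     finally show "Psi (%t. y **.B W t ((i, a) # w)) = (\<Oplus>.F e:E. Z (i, e) **.F Psi (%t. y **.B (if a then \<tau> e else e) **.B W t w))"
      by (simp only: f)
    qed
   qed (use inv_closed in auto)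
   thus ?thesis using y by (simp add: W_def)
  qed
  \<comment> \<open>The elements with value one vary with \<open>t\<close> but are combinations of
    the fixed finite set \<open>E\<close>; their coefficients pass through \<open>cl\<close>, so
    vanishing on constant families is enough for a contradiction.\<close>
  obtain x where x: "ALL t. x t <: B" "ALL t. phi t (x t) = \<one>.(R Quot m t)" using phi1 unfolding Bex_def choice_iff by blast
  obtain v where v: "ALL t e. v t e <: R" "ALL t. x t = (\<Oplus>.B e:E. v t e \<odot>.B e)"
  proof -
   have "ALL t. EX c. (ALL e. c e <: R) & x t = (\<Oplus>.B e:E. c e \<odot>.B e)" using E(3) x(1) by blast
   from this[unfolded choice_iff] show ?thesis using that by blast
  qed
  have "Psi x = (\<Oplus>.F e:E. Psi (%t. v t e \<odot>.B e))"
  proof -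
   have "x = (%t. \<Oplus>.B e:E. v t e \<odot>.B e)" using v(2) by (intro ext) blast
   hence "Psi x = Psi (%t. \<Oplus>.B e:E. v t e \<odot>.B e)" by (rule arg_cong)
   also have "... = (\<Oplus>.F e:E. Psi (%t. v t e \<odot>.B e))" by (rule Psisum[OF E(1)]) (use v EB in auto)
   finally show ?thesis .
  qed
  also have "... = \<zero>.F"
  proof (rule F.finsum_all_zero)
   fix e assume e: "e : E"
   have "cl (%t. m t +> v t e) <: F" by (rule c.hom_closed) (use Rc v in simp)
   thus "Psi (%t. v t e \<odot>.B e) = \<zero>.F" using Psis[of "%t. v t e" "%t. e"] v(1) EB[OF e] Psi0 by simp
  qed
  finally have "Psi x = \<zero>.F" .
  moreover have "Psi x = \<one>.F" unfolding Psi_def using x(2) c.hom_one by simp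
  ultimately show False by simp
 qed
qed

end

text \<open>As \<open>R\<close> is not zero, the base field embeds in it, and its image inherits
  infinitude and inverses.\<close>

lemma affine_algebra_over_field:
 fixes K :: "('k, 'p) ring_scheme" and R :: "('k, 'r, 'q) module_scheme"
 assumes "field K" "infinite (carrier K)" "algebra K R" "fg_algebra K R" and nz: "\<one>.R ~= \<zero>.R"
 obtains G where "affine_algebra R ((%c. c \<odot>.R \<one>.R) ` carrier K) G"
proof -
 interpret K: field K by (rule assms(1))
 interpret algebra K R by (rule assms(3))
 let ?f = "%c. c \<odot>.R \<one>.R"
 let ?k = "?f ` carrier K"
 obtain G where G: "finite G" "G <= carrier R" "\<Inter>{T. unital_subalgebra K R T & G <= T} = carrier R"
  using assms(4) by (auto simp: fg_algebra_def)
 have mult: "?f c **.R ?f d = ?f (c **.K d)" if "c <: K" "d <: K" for c d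
  using that by (simp add: smult_assoc2 smult_assoc1)
 have sub: "subring ?k R"
 proof (rule subringI)
  show "?k <= carrier R" by auto
  show "\<one>.R : ?k" by (rule image_eqI[of _ _ "\<one>.K"]) simp_all
  show "\<ominus>.R x : ?k" if "x : ?k" for x
   using that by (auto simp: smult_l_minus[symmetric])
  show "x **.R y : ?k" if "x : ?k" "y : ?k" for x y using that mult by auto
  show "x \<oplus>.R y : ?k" if "x : ?k" "y : ?k" for x y using that by (auto simp: smult_l_distr[symmetric])
 qed
 have unit: "?f c **.R ?f (inv\<^bsub>K\<^esub> c) = \<one>.R" "inv\<^bsub>K\<^esub> c <: K" if "c <: K" "c ~= \<zero>.K" for c
  using that mult[of c "inv\<^bsub>K\<^esub> c"] by (auto simp: K.field_Units)
 have zero: "c = \<zero>.K" if "c <: K" "?f c = \<zero>.R" for c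
 proof (rule ccontr)
  assume "c ~= \<zero>.K"
  from unit[OF that(1) this] that(2) show False using nz by simp
 qed
 have inj: "inj_on ?f (carrier K)"
 proof (rule inj_onI)
  fix c d assume cd: "c <: K" "d <: K" "?f c = ?f d"
  hence "?f (c \<ominus>.K d) = \<zero>.R" by (simp add: K.minus_eq smult_l_distr smult_l_minus M.r_neg)
  hence "c \<ominus>.K d = \<zero>.K" using zero cd by simp
  thus "c = d" using cd by simp
 qed
 have "affine_algebra R ?k G"
 proof (intro affine_algebra.intro affine_algebra_axioms.intro sub G(1,2))
  show "cring R" by unfold_locales
  show "infinite ?k" using finite_imageD[OF _ inj] assms(2) by blast
  show "EX b:carrier R. a **.R b = \<one>.R" if "a : ?k" "a ~= \<zero>.R" for a
  proof -
   from that obtain c where c: "c <: K" "a = ?f c" by blast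
   have "c ~= \<zero>.K" using c that(2) by auto
   from unit[OF c(1) this] show ?thesis using c(2) by (intro bexI[of _ "?f (inv\<^bsub>K\<^esub> c)"]) auto
  qed
  have kG: "?k Un G <= carrier R" using G(2) by auto
  have gs: "subring (generate_ring R (?k Un G)) R" by (rule generate_ring_is_subring[OF kG])
  have "unital_subalgebra K R (generate_ring R (?k Un G))"
   unfolding unital_subalgebra_def
  proof (intro conjI ballI gs)
   fix c x assume cx: "c <: K" "x : generate_ring R (?k Un G)"
   have "c \<odot>.R x = ?f c **.R x" using cx subringE(1)[OF gs] by (auto simp: smult_assoc2)
   thus "c \<odot>.R x : generate_ring R (?k Un G)"
    using subringE(6)[OF gs _ cx(2), of "?f c"] cx(1) by (auto intro: generate_ring.incl)
  qed
  moreover have "G <= generate_ring R (?k Un G)" by (auto intro: generate_ring.incl)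
  ultimately show "generate_ring R (?k Un G) = carrier R" using G(3) subringE(1)[OF gs] by blast
 qed
 thus ?thesis by (rule that)
qed

theorem corollary1p2:
  fixes K :: "('k, 'p) ring_scheme"
    and R :: "('k, 'r, 'q) module_scheme"
    and B :: "('r, 'b, 's) module_scheme"
    and \<tau> :: "'b \<Rightarrow> 'b"
    and d n :: nat
  assumes "field K" and "infinite (carrier K)"
    and "algebra K R" and "fg_algebra K R" and "has_krull_dim R d"
    and "n > 1"
    and "azumaya_unitary R B \<tau>" and "has_degree B n"
  shows "gen R B \<tau> \<le> enat (nat \<lfloor>real d / (2 * real n - 2) + 3 / 2\<rfloor>)"
proof -
 interpret algebra K R by (rule assms(3))
 \<comment> \<open>A chain of length \<open>d\<close> has a first member, so a prime exists and the
   ring is not zero.\<close>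
 obtain P where P: "primeideal P R"
  using assms(5) unfolding has_krull_dim_def Let_def by blast
 have "\<one>.R ~= \<zero>.R"
 proof
  assume one: "\<one>.R = \<zero>.R"
  interpret P: primeideal P R by (rule P)
  have "carrier R <= P" using one_zeroD[OF one] additive_subgroup.zero_closed[OF P.is_additive_subgroup] by simp
  thus False using P.I_notcarr P.a_subset by blast
 qed
 then obtain G where aff: "affine_algebra R ((%c. c \<odot>.R \<one>.R) ` carrier K) G"
  by (rule affine_algebra_over_field[OF assms(1-4)])
 \<comment> \<open>This is the least natural number with
   \<open>d < (2 r - 1) (n - 1)\<close>.\<close>
 define r where "r = nat \<lfloor>real d / (2 * real n - 2) + 3 / 2\<rfloor>"
 have n: "real n - 1 > 0" using assms(6) by simp
 have q: "real d / (2 * real n - 2) >= 0" using n by (intro divide_nonneg_nonneg) auto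
 have "real d / (2 * real n - 2) + 3 / 2 < real r + 1" unfolding r_def using q by linarith
 hence "real d / (2 * real n - 2) < real r - 1 / 2" by simp
 hence lt: "real d < (2 * real r - 1) * (real n - 1)" using n by (subst (asm) pos_divide_less_eq) (auto simp: algebra_simps)
 have "r >= 1" unfolding r_def using q by linarith
 hence "real ((2 * r - 1) * (n - 1)) = (2 * real r - 1) * (real n - 1)" using assms(6) by (simp add: of_nat_diff)
 hence "d < (2 * r - 1) * (n - 1)" using lt by linarith
 from azumaya_unitary.generators_exist[OF assms(7) aff assms(5,8) this]
 obtain Z where Z: "finite Z" "card Z <= r" "generates_with_involution R B \<tau> Z" by blast
 hence "gen R B \<tau> <= enat (card Z)" unfolding gen_def by (intro Inf_lower) blast
 also have "... <= enat r" using Z(2) by simp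
 finally show ?thesis unfolding r_def .
qed

end
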